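(* Let $F(x_1,x_2,x_3)=a_1x_1^3+a_2x_2^3+a_3x_3^3$ with $a_1,a_2,a_3$ positive integers. Then there is a constant $\kappa_F>0$ (depending on $F$) such that for all integers $N,K$ satisfying $N>e^e$, $K\geq 2$ and $K<\kappa_F\frac{\sqrt{\log N}}{(\log\log N)^2}$, there exists a sequence of $K$ consecutive nonnegative integers $n+1,\dots,n+K$, all less than $N$, none of which is a value of $F$.
   Context: A "value of $F$" is a natural number of the form $F(x_1,x_2,x_3)$ with $x_1,x_2,x_3$ nonnegative integers. A sequence of $K$ consecutive nonnegative integers none of which is a value of $F$ is called a gap of length $K$ between the values of $F$. *)

theory Defs
  imports Complex_Main
begin

definition diag_cubic :: "nat \<Rightarrow> nat \<Rightarrow> nat \<Rightarrow> nat \<Rightarrow> nat \<Rightarrow> nat \<Rightarrow> nat" where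
  "diag_cubic a1 a2 a3 x1 x2 x3 = a1 * x1 ^ 3 + a2 * x2 ^ 3 + a3 * x3 ^ 3"

definition is_value_of :: "nat \<Rightarrow> (nat \<Rightarrow> nat \<Rightarrow> nat \<Rightarrow> nat) \<Rightarrow> bool" where
  "is_value_of m F \<longleftrightarrow> (\<exists>x1 x2 x3. m = F x1 x2 x3)"

(* The gap of length K consists of the integers n + 1, ..., n + K; it starts after n. *)
definition is_gap :: "(nat \<Rightarrow> nat \<Rightarrow> nat \<Rightarrow> nat) \<Rightarrow> nat \<Rightarrow> nat \<Rightarrow> bool" where
  "is_gap F n K \<longleftrightarrow> (\<forall>i\<in>{1..K}. \<not> is_value_of (n + i) F)"

end

theory Submission
  imports Defs "HOL-Number_Theory.Number_Theory" "HOL-Analysis.Analysis" "HOL-Real_Asymp.Real_Asymp"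
begin

text \<open>For a prime \<open>p = 1\<close> mod 3 that does not divide \<open>a = a1 * a2 * a3\<close>, the number of solutions of
  \<open>F = 0\<close> modulo \<open>p\<close> is \<open>p^2 - 2 (p - 1) sqrt p Re \<psi>(q)\<close>, where \<open>q\<close> is a primary prime of
  \<open>\<int>[\<omega>]\<close> above \<open>p\<close>, minus a cubic Jacobi sum, and \<open>\<psi>(q)\<close> is \<open>q / |q|\<close> times the conjugate of
  the cubic residue symbol of \<open>a\<close> modulo \<open>q\<close>. By cubic reciprocity the symbol depends only on \<open>q\<close>
  modulo \<open>9 a\<close>, so \<open>\<psi>\<close> is a Hecke character. Mertens' theorem for \<open>\<psi>\<close> and for the sixth power of
  \<open>q / |q|\<close> then yields a window \<open>(y, C y]\<close> in which the sum of \<open>max 0 (Re \<psi>(q)) log p / p\<close> is bounded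
  below: the class 0 modulo these \<open>p\<close> is represented with density at most \<open>1 - \<delta> p\<close>, where the
  \<open>\<delta> p\<close> have sum at least of order \<open>sqrt y / log y\<close>.

  With \<open>y\<close> a small multiple of \<open>log N\<close>, split the window into \<open>K\<close> groups with \<open>\<delta>\<close>-sum at least
  \<open>log (M K)\<close>, and let \<open>r + i\<close> be 0 modulo the primes of the \<open>i\<close>-th group. Each class \<open>r + i\<close>
  modulo the product \<open>Q\<close> of all primes is then so rarely represented that, by counting lattice points,
  some translate of \<open>r + 1, \<dots>, r + K\<close> by a multiple of \<open>Q\<close> contains no value.\<close>

section \<open>The ring of Eisenstein integers\<close>

text \<open>Modulo one prime the bias has relative size \<open>1 / sqrt p\<close> and a sign that
  depends on \<open>q\<close>, so primes of favourable sign must be shown to be frequent. No prime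
  number theorem is used: Mertens sums with bounded error suffice, at the price of a window
  \<open>(y, C y]\<close> long enough to outweigh the errors. The nonvanishing at 1 behind these
  sums has a simple source: the direction \<open>q / |q|\<close> makes every power of the characters
  that occurs nontrivial, and a zero is excluded by \<open>3 + 4 cos t + cos 2t \<ge> 0\<close>. The
  cancellation in lattice sums is elementary too: multiplication by the two primes above 7 rotates a
  disc sum by different angles.

  The shape of the bound: counting lattice points requires \<open>Q ^ 3 \<le> N\<close>, hence
  \<open>y\<close> of order \<open>log N\<close> and a total of \<open>\<delta>\<close> of order
  \<open>sqrt (log N) / log log N\<close>. Each of the \<open>K\<close> classes must become rarer
  than average by a factor of order \<open>K\<close>, since the \<open>K\<close> counts are added;
  this uses up \<open>log (M K)\<close>, of order \<open>log log N\<close>, of the total.\<close>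

datatype eis = Eis (ec: int) (eo: int)

lemma eis_eq_iff: "x = y \<longleftrightarrow> ec x = ec y \<and> eo x = eo y"
  by (cases x; cases y) auto

text \<open>\<open>Eis a b\<close> stands for \<open>a + b * omega\<close> with
  \<open>omega ^ 2 = - 1 - omega\<close>; this relation produces the two terms with
  \<open>eo x * eo y\<close> in the product.\<close>

instantiation eis :: comm_ring_1
begin
definition "0 = Eis 0 0"
definition "1 = Eis 1 0"
definition "x + y = Eis (ec x + ec y) (eo x + eo y)"
definition "x - y = Eis (ec x - ec y) (eo x - eo y)"
definition "- x = Eis (- ec x) (- eo x)"
definition "x * y = Eis (ec x * ec y - eo x * eo y) (ec x * eo y + eo x * ec y - eo x * eo y)"
instance
  by standard (auto simp: zero_eis_def one_eis_def plus_eis_def minus_eis_def uminus_eis_def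
      times_eis_def algebra_simps)
end

lemma eis_sel [simp]:
  "ec 0 = 0" "eo 0 = 0" "ec 1 = 1" "eo 1 = 0"
  "ec (x + y) = ec x + ec y" "eo (x + y) = eo x + eo y"
  "ec (x - y) = ec x - ec y" "eo (x - y) = eo x - eo y"
  "ec (- x) = - ec x" "eo (- x) = - eo x"
  by (simp_all add: zero_eis_def one_eis_def plus_eis_def minus_eis_def uminus_eis_def)

lemma eis_sel_mult:
  "ec (x * y) = ec x * ec y - eo x * eo y"
  "eo (x * y) = ec x * eo y + eo x * ec y - eo x * eo y"
  by (simp_all add: times_eis_def)

lemma eis_sel_of_nat [simp]: "ec (of_nat n) = int n" "eo (of_nat n) = 0"
  by (induction n) auto

lemma eis_sel_of_int [simp]: "ec (of_int n) = n" "eo (of_int n) = 0"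
  by (cases n; simp)+

lemma eis_sel_numeral [simp]: "ec (numeral n) = numeral n" "eo (numeral n) = 0"
  using eis_sel_of_int[of "numeral n"] by (simp_all del: eis_sel_of_int)

lemma eis_sel_of_int_mult [simp]:
  "ec (of_int n * x) = n * ec x" "eo (of_int n * x) = n * eo x"
  "ec (of_nat m * x) = int m * ec x" "eo (of_nat m * x) = int m * eo x"
  "ec (numeral k * x) = numeral k * ec x" "eo (numeral k * x) = numeral k * eo x"
  by (simp_all add: eis_sel_mult)

section \<open>Conjugation and norm\<close>

definition econj :: "eis \<Rightarrow> eis" where "econj x = Eis (ec x - eo x) (- eo x)"
definition enorm :: "eis \<Rightarrow> int" where "enorm x = ec x ^ 2 - ec x * eo x + eo x ^ 2"
definition omega :: eis where "omega = Eis 0 1"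

lemma econj_sel [simp]: "ec (econj x) = ec x - eo x" "eo (econj x) = - eo x"
  by (simp_all add: econj_def)

lemma omega_sel [simp]: "ec omega = 0" "eo omega = 1"
  by (simp_all add: omega_def)

lemma econj_simps [simp]: "econj 0 = 0" "econj 1 = 1" "econj (x + y) = econj x + econj y"
  "econj (x - y) = econj x - econj y" "econj (- x) = - econj x" "econj (x * y) = econj x * econj y"
  "econj (econj x) = x" "econj (of_int n) = of_int n" "econj (of_nat m) = of_nat m"
  by (auto simp: eis_eq_iff eis_sel_mult algebra_simps)

lemma econj_power [simp]: "econj (x ^ n) = econj x ^ n"
  by (induction n) auto

lemma econj_sum: "econj (sum f A) = (\<Sum>x\<in>A. econj (f x))"
  by (induction A rule: infinite_finite_induct) auto

lemma mult_econj: "x * econj x = of_int (enorm x)"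
  by (auto simp: eis_eq_iff eis_sel_mult enorm_def power2_eq_square algebra_simps)

lemma omega_mult: "omega * omega = -1 - omega"
  by (auto simp: eis_eq_iff eis_sel_mult)

lemma omega_sq: "omega ^ 2 = -1 - omega"
  by (simp add: power2_eq_square omega_mult)

lemma omega_cube [simp]: "omega ^ 3 = 1"
  by (simp add: power3_eq_cube omega_mult algebra_simps)

lemma enorm_mult: "enorm (x * y) = enorm x * enorm y"
  by (simp add: enorm_def eis_sel_mult power2_eq_square algebra_simps)

text \<open>Completing the square; the positivity of the norm and the bounds on coordinates come
  from here.\<close>

lemma enorm_4: "4 * enorm x = (2 * ec x - eo x) ^ 2 + 3 * eo x ^ 2"
  by (simp add: enorm_def power2_eq_square algebra_simps)

lemma enorm_nonneg [simp]: "enorm x \<ge> 0"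
  using enorm_4[of x] zero_le_power2[of "2 * ec x - eo x"] zero_le_power2[of "eo x"] by linarith

lemma enorm_eq_0_iff [simp]: "enorm x = 0 \<longleftrightarrow> x = 0"
proof
  assume "enorm x = 0"
  then have *: "(2 * ec x - eo x) ^ 2 + 3 * eo x ^ 2 = 0"
    using enorm_4[of x] by simp
  then have "eo x ^ 2 = 0"
    using zero_le_power2[of "2 * ec x - eo x"] zero_le_power2[of "eo x"] by linarith
  with * show "x = 0" by (auto simp: eis_eq_iff)
qed (simp add: enorm_def)

lemma enorm_pos_iff: "enorm x > 0 \<longleftrightarrow> x \<noteq> 0"
  using enorm_nonneg[of x] enorm_eq_0_iff[of x] by linarith

lemma enorm_ge_1: "x \<noteq> 0 \<Longrightarrow> enorm x \<ge> 1"
  using enorm_pos_iff[of x] by linarith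

lemma enorm_simps [simp]: "enorm 0 = 0" "enorm 1 = 1" "enorm (-x) = enorm x" "enorm (econj x) = enorm x"
  "enorm (of_int n) = n ^ 2" "enorm (of_nat m) = int m ^ 2" "enorm omega = 1"
  by (simp_all add: enorm_def power2_eq_square algebra_simps)

lemma enorm_power: "enorm (x ^ n) = enorm x ^ n"
  by (induction n) (auto simp: enorm_mult)

instance eis :: "{idom, ring_char_0}"
proof
  fix x y :: eis assume "x \<noteq> 0" "y \<noteq> 0"
  then have "enorm (x * y) \<noteq> 0" by (simp add: enorm_mult)
  then show "x * y \<noteq> 0" by auto
next
  show "inj (of_nat :: nat \<Rightarrow> eis)"
    by (rule injI) (metis eis_sel_of_nat(1) of_nat_eq_iff)
qed

section \<open>Euclidean division\<close>

text \<open>The integer nearest to \<open>c / n\<close>, halves rounded up, so that each coordinate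
  of the error of an approximate quotient is at most 1/2.\<close>

definition ediv_coord :: "int \<Rightarrow> int \<Rightarrow> int" where "ediv_coord c n = (2 * c + n) div (2 * n)"

lemma ediv_coord_bound:
  assumes "n > 0"
  shows "\<bar>2 * (c - n * ediv_coord c n)\<bar> \<le> n"
proof -
  have "2 * c + n = (2 * n) * ediv_coord c n + (2 * c + n) mod (2 * n)"
    unfolding ediv_coord_def by simp
  moreover have "(2 * c + n) mod (2 * n) \<ge> 0" "(2 * c + n) mod (2 * n) < 2 * n"
    using assms by simp_all
  ultimately have "2 * (c - n * ediv_coord c n) \<ge> - n" "2 * (c - n * ediv_coord c n) < n"
    by (simp_all add: algebra_simps)
  then show ?thesis by linarith
qed

lemma ediv_coord_mult:
  assumes "n > 0"
  shows "ediv_coord (n * a) n = a"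
proof -
  have "2 * (n * a) + n = n + a * (2 * n)" by (simp add: algebra_simps)
  then have "ediv_coord (n * a) n = a + n div (2 * n)"
    unfolding ediv_coord_def using assms by (simp only: div_mult_self1 mult_eq_0_iff) simp
  then show ?thesis using assms by simp
qed

instantiation eis :: euclidean_ring
begin
definition divide_eis :: "eis \<Rightarrow> eis \<Rightarrow> eis" where
  "divide_eis x y = Eis (ediv_coord (ec (x * econj y)) (enorm y)) (ediv_coord (eo (x * econj y)) (enorm y))"
definition modulo_eis :: "eis \<Rightarrow> eis \<Rightarrow> eis" where
  "modulo_eis x y = x - (x div y) * y"
definition euclidean_size_eis :: "eis \<Rightarrow> nat" where "euclidean_size_eis x = nat (enorm x)"
instance
proof
  fix x y :: eis
  show "x div 0 = 0" by (simp add: eis_eq_iff divide_eis_def ediv_coord_def)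
  show "euclidean_size (0::eis) = 0" by (simp add: euclidean_size_eis_def)
  show "x div y * y + x mod y = x" by (simp add: modulo_eis_def)
  assume y: "y \<noteq> 0"
  then have n: "enorm y > 0" by (simp add: enorm_pos_iff)
  have "(x * y) * econj y = of_int (enorm y) * x"
    by (simp add: mult.assoc mult_econj mult.commute)
  then show "x * y div y = x"
    unfolding divide_eis_def by (simp only: eis_sel_of_int_mult ediv_coord_mult[OF n] eis.collapse)
  define q where "q = x div y"
  \<comment> \<open>\<open>z\<close> is the remainder times \<open>econj y\<close>. Its coordinates
    are at most \<open>enorm y / 2\<close> in absolute value, so
    \<open>enorm z = enorm (x mod y) * enorm y\<close> is at most
    \<open>3/4 * enorm y ^ 2\<close>.\<close>
  define z where "z = (x - q * y) * econj y"
  have "z = x * econj y - of_int (enorm y) * q"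
    by (simp add: z_def algebra_simps flip: mult_econj)
  then have z: "ec z = ec (x * econj y) - enorm y * ediv_coord (ec (x * econj y)) (enorm y)"
    "eo z = eo (x * econj y) - enorm y * ediv_coord (eo (x * econj y)) (enorm y)"
    by (simp_all add: q_def divide_eis_def)
  have b: "\<bar>2 * ec z\<bar> \<le> enorm y" "\<bar>2 * eo z\<bar> \<le> enorm y"
    unfolding z using ediv_coord_bound[OF n] by blast+
  have "4 * enorm z = (2 * ec z) ^ 2 - (2 * ec z) * (2 * eo z) + (2 * eo z) ^ 2"
    by (simp add: enorm_def power2_eq_square)
  also have "\<dots> \<le> \<bar>2 * ec z\<bar> ^ 2 + \<bar>2 * ec z\<bar> * \<bar>2 * eo z\<bar> + \<bar>2 * eo z\<bar> ^ 2"
    using abs_ge_minus_self[of "(2 * ec z) * (2 * eo z)"] unfolding abs_mult by simp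
  also have "\<dots> \<le> enorm y ^ 2 + enorm y * enorm y + enorm y ^ 2"
    using b by (intro add_mono power_mono mult_mono) auto
  finally have "4 * enorm z \<le> 3 * enorm y ^ 2" by (simp add: power2_eq_square)
  then have "4 * (enorm (x mod y) * enorm y) \<le> 3 * enorm y ^ 2"
    by (simp add: z_def q_def modulo_eis_def enorm_mult)
  then have "4 * enorm (x mod y) \<le> 3 * enorm y"
    using n by (simp add: power2_eq_square)
  then show "euclidean_size (x mod y) < euclidean_size y"
    using n by (simp add: euclidean_size_eis_def)
  have "enorm x * 1 \<le> enorm x * enorm y"
    using n by (intro mult_left_mono) auto
  then show "euclidean_size x \<le> euclidean_size (x * y)"
    by (simp add: euclidean_size_eis_def enorm_mult)
qed
end

lemma eis_unit_iff: "x dvd 1 \<longleftrightarrow> enorm x = 1"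
proof
  assume "x dvd 1"
  then obtain y where "1 = x * y" by (elim dvdE)
  then have "enorm x * enorm y = 1" by (metis enorm_mult enorm_simps(2))
  then show "enorm x = 1"
    using enorm_nonneg[of x] by (metis pos_zmult_eq_1_iff zmult_eq_1_iff not_less neg_0_le_iff_le zero_le_one dual_order.antisym zero_neq_one linorder_not_less neg_equal_0_iff_equal minus_one_mult_self uminus_int_code(2) le_minus_one_simps(3))
next
  assume "enorm x = 1"
  then have "1 = x * econj x" by (simp add: mult_econj)
  then show "x dvd 1" by (rule dvdI)
qed

section \<open>Primary elements and normalization\<close>

text \<open>The primary elements, congruent to 1 modulo 3. An element of norm prime to 3 has exactly
  one primary associate (\<open>ex_prim_assoc\<close>, \<open>prim_unit\<close>), so primary
  elements take the place of the ideals prime to 3.\<close>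

definition prim :: "eis \<Rightarrow> bool" where "prim x \<longleftrightarrow> ec x mod 3 = 1 \<and> eo x mod 3 = 0"

lemma prim_alt: "prim x \<longleftrightarrow> (\<exists>y. x = 1 + 3 * y)"
proof
  assume "prim x"
  then have "x = 1 + 3 * Eis (ec x div 3) (eo x div 3)"
    by (simp add: prim_def eis_eq_iff)
      (metis add.commute mult_div_mod_eq add.right_neutral)
  then show "\<exists>y. x = 1 + 3 * y" ..
next
  assume "\<exists>y. x = 1 + 3 * y"
  then show "prim x" by (auto simp: prim_def)
qed

lemma prim_1 [simp]: "prim 1" by (simp add: prim_def)

lemma prim_nonzero: "prim x \<Longrightarrow> x \<noteq> 0" by (auto simp: prim_def)

lemma prim_mult: assumes "prim x" "prim y" shows "prim (x * y)"
proof -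
  from assms obtain u v where "x = 1 + 3 * u" "y = 1 + 3 * v" by (auto simp: prim_alt)
  then have "x * y = 1 + 3 * (u + v + 3 * u * v)" by (simp add: algebra_simps)
  then show ?thesis unfolding prim_alt by blast
qed

lemma prim_cancel: assumes "prim x" "prim (x * y)" shows "prim y"
proof -
  from assms obtain u v where "x = 1 + 3 * u" "x * y = 1 + 3 * v" by (auto simp: prim_alt)
  then have "y = 1 + 3 * (v - u * y)" by (simp add: algebra_simps)
  then show ?thesis unfolding prim_alt by blast
qed

lemma prim_unit: assumes "prim x" "enorm x = 1" shows "x = 1"
proof -
  have "(2 * ec x - eo x) ^ 2 + 3 * eo x ^ 2 = 4"
    using enorm_4[of x] assms by simp
  then have "3 * eo x ^ 2 \<le> 4" using zero_le_power2[of "2 * ec x - eo x"] by linarith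
  then have "eo x ^ 2 < 4" by linarith
  then have "eo x ^ 2 < 2 ^ 2" by simp
  then have "\<bar>eo x\<bar> < 2" using abs_le_square_iff[of 2 "eo x"] by linarith
  moreover have "eo x mod 3 = 0" using assms by (simp add: prim_def)
  ultimately have o: "eo x = 0" by presburger
  then have "ec x ^ 2 = 1" using assms by (simp add: enorm_def)
  then have "ec x = 1 \<or> ec x = -1" by (simp add: power2_eq_1_iff)
  with o assms show ?thesis by (auto simp: prim_def eis_eq_iff)
qed

lemma enorm_mod_3: "enorm x mod 3 = ((ec x + eo x) ^ 2) mod 3"
proof -
  have "enorm x = (ec x + eo x) ^ 2 + 3 * (- (ec x * eo x))"
    by (simp add: enorm_def power2_eq_square algebra_simps)
  then show ?thesis by (metis mod_mult_self2)
qed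

lemma enorm_prim_mod_3: assumes "prim x" shows "enorm x mod 3 = 1"
proof -
  have "(ec x + eo x) mod 3 = 1" using assms unfolding prim_def by presburger
  then show ?thesis unfolding enorm_mod_3 by (metis power_mod power_one mod_mod_trivial mod_pos_pos_trivial one_less_numeral_iff power_one semiring_norm(77) zero_le_one)
qed

text \<open>The six units permute simply transitively the six classes modulo 3 of elements with norm
  prime to 3; each case names the unit that moves its class to 1.\<close>

lemma ex_prim_assoc:
  assumes "enorm x mod 3 \<noteq> 0"
  obtains u where "enorm u = 1" "prim (u * x)"
proof -
  have "(ec x + eo x) mod 3 \<noteq> 0"
    using assms unfolding enorm_mod_3 by (auto simp: power2_eq_square)
  moreover have "(ec x + eo x) mod 3 = (ec x mod 3 + eo x mod 3) mod 3"
    by (simp add: mod_add_eq)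
  moreover have "ec x mod 3 \<in> {0, 1, 2}" "eo x mod 3 \<in> {0, 1, 2}"
    by auto
  ultimately have "ec x mod 3 = 1 \<and> eo x mod 3 = 0 \<or> ec x mod 3 = 2 \<and> eo x mod 3 = 0
    \<or> ec x mod 3 = 0 \<and> eo x mod 3 = 1 \<or> ec x mod 3 = 0 \<and> eo x mod 3 = 2
    \<or> ec x mod 3 = 1 \<and> eo x mod 3 = 1 \<or> ec x mod 3 = 2 \<and> eo x mod 3 = 2"
    by auto
  then consider "ec x mod 3 = 1" "eo x mod 3 = 0" | "ec x mod 3 = 2" "eo x mod 3 = 0"
    | "ec x mod 3 = 0" "eo x mod 3 = 1" | "ec x mod 3 = 0" "eo x mod 3 = 2"
    | "ec x mod 3 = 1" "eo x mod 3 = 1" | "ec x mod 3 = 2" "eo x mod 3 = 2"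
    by blast
  then show ?thesis
  proof cases
    case 1 then show ?thesis by (intro that[of 1]) (auto simp: prim_def)
  next
    case 2 then show ?thesis by (intro that[of "-1"]) (auto simp: prim_def, presburger+)
  next
    case 3 then show ?thesis by (intro that[of "Eis (-1) (-1)"]) (auto simp: prim_def enorm_def eis_sel_mult, presburger+)
  next
    case 4 then show ?thesis by (intro that[of "Eis 1 1"]) (auto simp: prim_def enorm_def eis_sel_mult, presburger+)
  next
    case 5 then show ?thesis by (intro that[of "Eis 0 (-1)"]) (auto simp: prim_def enorm_def eis_sel_mult, presburger+)
  next
    case 6 then show ?thesis by (intro that[of "Eis 0 1"]) (auto simp: prim_def enorm_def eis_sel_mult, presburger+)
  qed
qed

text \<open>A primary associate is chosen whenever there is one, otherwise an arbitrary associate;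
  the choice depends on the class of associates only. Thus every normalized prime that divides a
  primary element is itself primary (\<open>prim_of_dvd\<close>).\<close>

instantiation eis :: normalization_euclidean_semiring
begin
definition normalize_eis :: "eis \<Rightarrow> eis" where
  "normalize_eis x = (SOME y. x dvd y \<and> y dvd x \<and> ((\<exists>z. x dvd z \<and> z dvd x \<and> prim z) \<longrightarrow> prim y))"
definition unit_factor_eis :: "eis \<Rightarrow> eis" where
  "unit_factor_eis x = x div normalize x"
lemma normalize_eis_props:
  fixes x :: eis
  shows "x dvd normalize x" "normalize x dvd x"
    "x dvd z \<Longrightarrow> z dvd x \<Longrightarrow> prim z \<Longrightarrow> prim (normalize x)"
proof -
  have "\<exists>y. x dvd y \<and> y dvd x \<and> ((\<exists>z. x dvd z \<and> z dvd x \<and> prim z) \<longrightarrow> prim y)"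
  proof (cases "\<exists>z. x dvd z \<and> z dvd x \<and> prim z")
    case True then show ?thesis by blast
  next
    case False then show ?thesis by (intro exI[of _ x]) auto
  qed
  from someI_ex[OF this, folded normalize_eis_def]
  show "x dvd normalize x" "normalize x dvd x"
    "x dvd z \<Longrightarrow> z dvd x \<Longrightarrow> prim z \<Longrightarrow> prim (normalize x)" by blast+
qed
lemma normalize_eis_unit_mult:
  fixes x u :: eis assumes "u dvd 1" shows "normalize (u * x) = normalize x"
proof -
  have "u * x dvd y \<longleftrightarrow> x dvd y" "y dvd u * x \<longleftrightarrow> y dvd x" for y
    using assms by (simp_all add: mult_unit_dvd_iff' dvd_mult_unit_iff')
  then show ?thesis by (simp add: normalize_eis_def)
qed
lemma unit_factor_eis_mult_normalize:
  fixes x :: eis shows "unit_factor x * normalize x = x"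
  unfolding unit_factor_eis_def by (simp add: normalize_eis_props)
lemma normalize_eis_unit: fixes x :: eis assumes "x dvd 1" shows "normalize x = 1"
proof -
  have "prim (normalize x)"
    using assms by (intro normalize_eis_props(3)[of x 1]) auto
  moreover have "enorm (normalize x) = 1"
    using assms normalize_eis_props(2)[of x] eis_unit_iff dvd_trans by blast
  ultimately show ?thesis by (rule prim_unit)
qed
instance
proof
  fix a b :: eis
  show "unit_factor (0::eis) = 0" by (simp add: unit_factor_eis_def)
  show "normalize (0::eis) = 0" using normalize_eis_props(1)[of 0] by simp
  show "unit_factor a * normalize a = a" by (rule unit_factor_eis_mult_normalize)
  show "unit_factor a = a" if "a dvd 1" using that by (simp add: unit_factor_eis_def normalize_eis_unit)
  show "unit_factor a dvd 1" if "a \<noteq> 0"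
  proof -
    have "unit_factor a * normalize a dvd normalize a"
      using normalize_eis_props(1)[of a] unit_factor_eis_mult_normalize[of a] by simp
    then show ?thesis
      using that by (metis dvd_times_right_cancel_iff mult_1 mult_zero_right unit_factor_eis_mult_normalize)
  qed
  show "unit_factor (a * b) = a * unit_factor b" if "a dvd 1"
    unfolding unit_factor_eis_def normalize_eis_unit_mult[OF that]
    by (simp add: div_mult_swap normalize_eis_props)
qed
end

lemma normalize_prim: assumes "prim x" shows "normalize x = x"
proof -
  have "prim (normalize x)" using assms by (intro normalize_eis_props(3)[of x x]) auto
  moreover have "unit_factor x * normalize x = x" by simp
  note * = this
  ultimately have "prim (unit_factor x)" using assms by (metis mult.commute prim_cancel)
  moreover have "enorm (unit_factor x) = 1"
    using prim_nonzero[OF assms] by (simp flip: eis_unit_iff)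
  ultimately have "unit_factor x = 1" by (rule prim_unit)
  then show ?thesis using * by (metis mult_1)
qed

lemma enorm_dvd: "x dvd y \<Longrightarrow> enorm x dvd enorm y"
  by (auto simp: dvd_def enorm_mult)

lemma prim_of_dvd:
  assumes "prim x" "y dvd x" "normalize y = y"
  shows "prim y"
proof -
  have "enorm y mod 3 \<noteq> 0"
  proof
    assume "enorm y mod 3 = 0"
    then have "3 dvd enorm x" using enorm_dvd[OF assms(2)] by (metis dvd_trans dvd_eq_mod_eq_0)
    then show False using enorm_prim_mod_3[OF assms(1)] by auto
  qed
  then obtain u where "enorm u = 1" "prim (u * y)" by (rule ex_prim_assoc)
  then show ?thesis
    using normalize_prim[of "u * y"] normalize_eis_unit_mult[of u y] assms(3) eis_unit_iff by metis
qed

section \<open>Embedding into the complex numbers\<close>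

text \<open>\<open>omega\<close> goes to \<open>exp (2 \<pi> i / 3)\<close>.\<close>

definition toc :: "eis \<Rightarrow> complex" where
  "toc x = Complex (ec x - eo x / 2) (eo x * sqrt 3 / 2)"

lemma toc_simps [simp]: "toc 0 = 0" "toc 1 = 1" "toc (x + y) = toc x + toc y"
  "toc (x - y) = toc x - toc y" "toc (-x) = - toc x" "toc (x * y) = toc x * toc y"
  "toc (of_int n) = of_int n" "toc (of_nat m) = of_nat m" "toc (numeral k) = numeral k"
  by (simp_all add: toc_def complex_eq_iff eis_sel_mult field_simps)

lemma toc_power [simp]: "toc (x ^ n) = toc x ^ n"
  by (induction n) auto

lemma toc_econj [simp]: "toc (econj x) = cnj (toc x)"
  by (simp add: toc_def complex_eq_iff field_simps)

lemma toc_inj [simp]: "toc x = toc y \<longleftrightarrow> x = y"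
  by (auto simp: toc_def complex_eq_iff eis_eq_iff)

lemma toc_eq_0_iff [simp]: "toc x = 0 \<longleftrightarrow> x = 0"
  using toc_inj[of x 0] by (simp del: toc_inj)

lemma norm_toc_sq: "norm (toc x) ^ 2 = of_int (enorm x)"
proof -
  have "complex_of_real (norm (toc x) ^ 2) = toc x * cnj (toc x)"
    by (rule complex_norm_square)
  also have "\<dots> = toc (of_int (enorm x))" unfolding toc_econj[symmetric] toc_simps(6)[symmetric] mult_econj ..
  finally have "complex_of_real (norm (toc x) ^ 2) = complex_of_real (of_int (enorm x))" by simp
  then show ?thesis unfolding of_real_eq_iff .
qed

lemma norm_toc: "norm (toc x) = sqrt (of_int (enorm x))"
  by (metis norm_toc_sq norm_ge_zero real_sqrt_abs abs_of_nonneg)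

section \<open>Cubic characters modulo a prime and Jacobi sums\<close>

lemma eis_cube_root_unity:
  assumes "(z::eis) ^ 3 = 1"
  shows "z = 1 \<or> z = omega \<or> z = omega ^ 2"
proof -
  have "(z - omega) * (z - omega ^ 2) = z * z + z + 1"
    unfolding omega_sq by (simp add: algebra_simps omega_mult)
  then have "(z - 1) * ((z - omega) * (z - omega ^ 2)) = z ^ 3 - 1"
    by (simp only: power3_eq_cube) (simp add: algebra_simps)
  with assms show ?thesis by simp
qed

lemma omega_neq [simp]: "omega \<noteq> 1" "omega ^ 2 \<noteq> 1" "omega ^ 2 \<noteq> omega" "omega \<noteq> 0"
  by (simp_all add: eis_eq_iff omega_sq)

lemma econj_omega [simp]: "econj omega = omega ^ 2"
  by (simp add: eis_eq_iff omega_sq)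

lemma omega_power_mod: "omega ^ n = omega ^ (n mod 3)"
proof -
  have "omega ^ n = omega ^ (3 * (n div 3) + n mod 3)" by simp
  also have "\<dots> = (omega ^ 3) ^ (n div 3) * omega ^ (n mod 3)"
    unfolding power_add power_mult ..
  finally show ?thesis by simp
qed

lemma omega_power_eq_iff: "omega ^ m = omega ^ n \<longleftrightarrow> m mod 3 = n mod 3"
proof
  assume *: "omega ^ m = omega ^ n"
  define a b where "a = m mod 3" and "b = n mod 3"
  have "a < 3" "b < 3" by (simp_all add: a_def b_def)
  then have "a = 0 \<or> a = 1 \<or> a = 2" "b = 0 \<or> b = 1 \<or> b = 2" by linarith+
  moreover have "omega ^ a = omega ^ b"
    using * unfolding a_def b_def by (metis omega_power_mod)
  ultimately have "a = b" using omega_neq omega_neq[symmetric] by (elim disjE) simp_all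
  then show "m mod 3 = n mod 3" by (simp add: a_def b_def)
qed (metis omega_power_mod)

section \<open>Convolutions of a cubic character and its Jacobi sum\<close>

text \<open>The character is extended by 0 and takes its values in the ring itself, so that
  congruences between character values make sense. By \<open>chi_1_imp\<close> its kernel consists
  of cubes, which is what lets \<open>chi\<close> count cube roots.\<close>

locale cubic_char =
  fixes p :: int and chi :: "int \<Rightarrow> eis"
  assumes prime_p: "prime p"
    and chi_mod: "chi (x mod p) = chi x"
    and chi_mult: "chi (x * y) = chi x * chi y"
    and chi_0: "p dvd x \<Longrightarrow> chi x = 0"
    and chi_cube: "\<not> p dvd x \<Longrightarrow> chi x ^ 3 = 1"
    and chi_1_imp: "chi x = 1 \<Longrightarrow> \<exists>y. [y ^ 3 = x] (mod p)"
    and chi_nontrivial: "\<exists>x. \<not> p dvd x \<and> chi x \<noteq> 1"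
begin

abbreviation R :: "int set" where "R \<equiv> {0..<p}"
definition bar :: "int \<Rightarrow> eis" where "bar x = econj (chi x)"
definition J :: eis where "J = (\<Sum>u\<in>R. chi u * chi (1 - u))"

lemma p_gt_1: "p > 1" using prime_p prime_gt_1_int by blast

lemma chi_cong: "[x = y] (mod p) \<Longrightarrow> chi x = chi y"
  unfolding unique_euclidean_semiring_class.cong_def by (metis chi_mod)

lemma bar_cong: "[x = y] (mod p) \<Longrightarrow> bar x = bar y"
  by (metis chi_cong bar_def)

lemma chi_values: "\<not> p dvd x \<Longrightarrow> chi x = 1 \<or> chi x = omega \<or> chi x = omega ^ 2"
  using chi_cube eis_cube_root_unity by blast

lemma chi_eq_0_iff: "chi x = 0 \<longleftrightarrow> p dvd x"
  using chi_0 chi_cube[of x] by fastforce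

lemma chi_bar: "\<not> p dvd x \<Longrightarrow> chi x * bar x = 1"
  using chi_values[of x] omega_cube unfolding bar_def
  by (auto simp: power3_eq_cube power2_eq_square mult.assoc)

lemma bar_eq_sq: "bar x = chi x * chi x"
proof (cases "p dvd x")
  case False
  then show ?thesis using chi_bar[of x] chi_cube[of x]
    by (metis (no_types, lifting) mult.assoc mult.commute mult_1 power3_eq_cube)
qed (simp add: bar_def chi_0)

lemma bar_mult: "bar (x * y) = bar x * bar y" by (simp add: bar_def chi_mult)
lemma bar_0: "p dvd x \<Longrightarrow> bar x = 0" by (simp add: bar_def chi_0)

lemma chi_1 [simp]: "chi 1 = 1"
proof -
  have "chi 1 * chi 1 = chi 1" using chi_mult[of 1 1] by simp
  moreover have "chi 1 \<noteq> 0" using chi_eq_0_iff p_gt_1 by auto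
  ultimately show ?thesis by simp
qed

lemma chi_minus_1: "chi (- 1) = 1"
proof -
  have "chi (-1) * chi (-1) = 1" using chi_mult[of "-1" "-1"] by simp
  moreover have "chi (-1) ^ 3 = 1" using p_gt_1 by (intro chi_cube) auto
  ultimately show ?thesis by (simp add: power3_eq_cube)
qed

lemma chi_minus [simp]: "chi (- x) = chi x"
  using chi_mult[of "-1" x] by (simp add: chi_minus_1)
lemma bar_minus [simp]: "bar (- x) = bar x" by (simp add: bar_def)
lemma chi_diff_commute: "chi (x - y) = chi (y - x)" using chi_minus[of "x - y"] by simp
lemma bar_diff_commute: "bar (x - y) = bar (y - x)" using bar_minus[of "x - y"] by simp

lemma bij_affine:
  assumes "\<not> p dvd c"
  shows "bij_betw (\<lambda>x. (c * x + d) mod p) R R"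
proof -
  have "inj_on (\<lambda>x. (c * x + d) mod p) R"
  proof (rule inj_onI)
    fix x y assume xy: "x \<in> R" "y \<in> R" "(c * x + d) mod p = (c * y + d) mod p"
    then have "p dvd (c * x + d) - (c * y + d)" by (simp add: mod_eq_dvd_iff)
    then have "p dvd c * (x - y)" by (simp add: algebra_simps)
    then have "p dvd x - y" using assms prime_p prime_dvd_mult_iff by blast
    then have "x mod p = y mod p" by (simp add: mod_eq_dvd_iff)
    then show "x = y" using xy by simp
  qed
  moreover have "(\<lambda>x. (c * x + d) mod p) ` R \<subseteq> R" using p_gt_1 by auto
  ultimately show ?thesis
    by (metis bij_betw_def endo_inj_surj finite_atLeastLessThan_int)
qed

lemma sum_affine:
  assumes "\<not> p dvd c" "\<And>x. f (x mod p) = f x"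
  shows "(\<Sum>x\<in>R. f (c * x + d)) = sum f R"
  using sum.reindex_bij_betw[OF bij_affine[OF assms(1), of d], of f] by (simp add: assms(2))

lemma not_dvd_1: "\<not> p dvd 1" "\<not> p dvd -1"
  using p_gt_1 by auto

lemma sum_shift: "(\<And>x. f (x mod p) = f x) \<Longrightarrow> (\<Sum>x\<in>R. f (x + d)) = sum f R"
  using sum_affine[of 1 f d] not_dvd_1 by simp

lemma sum_reflect: "(\<And>x. f (x mod p) = f x) \<Longrightarrow> (\<Sum>x\<in>R. f (d - x)) = sum f R"
  using sum_affine[of "-1" f d] not_dvd_1 by simp

lemma bar_mod: "bar (x mod p) = bar x" by (simp add: bar_def chi_mod)

lemma sum_chi: "(\<Sum>x\<in>R. chi x) = 0"
proof -
  obtain c where c: "\<not> p dvd c" "chi c \<noteq> 1" using chi_nontrivial by blast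
  have "(\<Sum>x\<in>R. chi x) = (\<Sum>x\<in>R. chi (c * x + 0))"
    using c by (subst sum_affine) (auto simp: chi_mod)
  also have "\<dots> = chi c * (\<Sum>x\<in>R. chi x)" by (simp add: chi_mult sum_distrib_left)
  finally show ?thesis using c by simp
qed

lemma sum_bar: "(\<Sum>x\<in>R. bar x) = 0"
  using arg_cong[OF sum_chi, of econj] by (simp add: econj_sum bar_def)

lemma R_0: "R = insert 0 {1..<p}" using p_gt_1 by auto

lemma R_dvd_iff: "x \<in> R \<Longrightarrow> p dvd x \<longleftrightarrow> x = 0"
  by (metis atLeastLessThan_iff dvd_0_right mod_pos_pos_trivial dvd_imp_mod_0)

lemma sum_chi_bar: "(\<Sum>x\<in>R. chi x * bar x) = of_int p - 1"
proof -
  have "(\<Sum>x\<in>R. chi x * bar x) = (\<Sum>x\<in>{1..<p}. chi x * bar x)"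
    unfolding R_0 by (subst sum.insert) (auto simp: chi_0)
  also have "\<dots> = (\<Sum>x\<in>{1..<p}. 1)"
    using R_dvd_iff by (intro sum.cong refl chi_bar) auto
  also have "\<dots> = of_int p - 1" using p_gt_1 by (simp add: of_nat_diff)
  finally show ?thesis .
qed

text \<open>The Ramanujan sum modulo \<open>p\<close>; it is the convolution of \<open>chi\<close>
  with its conjugate.\<close>

definition B :: "int \<Rightarrow> eis" where "B n = (if p dvd n then of_int p else 0) - 1"

lemma B_mod: "B (n mod p) = B n" by (simp add: B_def dvd_mod_iff)

lemma chi_diff_mod: "chi (c - x mod p) = chi (c - x)"
  by (rule chi_cong) (simp add: unique_euclidean_semiring_class.cong_def mod_diff_right_eq)

lemma bar_diff_mod: "bar (c - x mod p) = bar (c - x)"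
  by (simp add: bar_def chi_diff_mod)

text \<open>The substitution of \<open>n * u\<close> for \<open>u\<close> pulls the factor
  \<open>n\<close> out of both characters.\<close>

lemma conv_scale:
  assumes "\<not> p dvd n" "\<And>x. f (x mod p) = f x" "\<And>x. g (x mod p) = g x"
    "\<And>x y. f (x * y) = f x * f y" "\<And>x y. g (x * y) = g x * g y"
  shows "(\<Sum>u\<in>R. f u * g (n - u)) = f n * g n * (\<Sum>u\<in>R. f u * g (1 - u) :: eis)"
proof -
  have m: "f (x mod p) * g (n - x mod p) = f x * g (n - x)" for x
    by (metis assms(2,3) mod_diff_right_eq)
  have "(\<Sum>u\<in>R. f u * g (n - u)) = (\<Sum>u\<in>R. f (n * u + 0) * g (n - (n * u + 0)))"
    using assms(1) m by (subst sum_affine[where f = "\<lambda>u. f u * g (n - u)"]) auto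
  also have "\<dots> = (\<Sum>u\<in>R. f n * g n * (f u * g (1 - u)))"
  proof (rule sum.cong)
    fix u
    have "n - (n * u + 0) = n * (1 - u)" by (simp add: algebra_simps)
    then show "f (n * u + 0) * g (n - (n * u + 0)) = f n * g n * (f u * g (1 - u))"
      by (simp only: assms(4,5) add_0_right) (simp add: algebra_simps)
  qed simp
  finally show ?thesis by (simp add: sum_distrib_left)
qed

lemma conv_chi_chi: "(\<Sum>u\<in>R. chi u * chi (n - u)) = J * bar n"
proof (cases "p dvd n")
  case False
  have "(\<Sum>u\<in>R. chi u * chi (n - u)) = chi n * chi n * (\<Sum>u\<in>R. chi u * chi (1 - u))"
    using False by (intro conv_scale) (auto simp: chi_mod chi_mult)
  then show ?thesis by (simp add: J_def bar_eq_sq)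
next
  case True
  have "(\<Sum>u\<in>R. chi u * chi (n - u)) = (\<Sum>u\<in>R. bar u)"
  proof (rule sum.cong)
    fix u
    have "chi (n - u) = chi (-u)" using True by (intro chi_cong) (simp add: cong_iff_dvd_diff)
    then show "chi u * chi (n - u) = bar u" by (simp add: bar_eq_sq)
  qed simp
  then show ?thesis using True by (simp add: sum_bar bar_0)
qed

lemma conv_bar_bar: "(\<Sum>u\<in>R. bar u * bar (n - u)) = econj J * chi n"
  using arg_cong[OF conv_chi_chi[of n], of econj] by (simp add: econj_sum bar_def)

text \<open>At multiples of \<open>p\<close> this is a sum of ones. Elsewhere the convolution is
  constant by \<open>conv_scale\<close>, and the constant is determined by the vanishing of the sum
  over all \<open>n\<close>.\<close>

lemma conv_chi_bar: "(\<Sum>u\<in>R. chi u * bar (n - u)) = B n"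
proof -
  define b where "b n = (\<Sum>u\<in>R. chi u * bar (n - u))" for n
  have b0: "b n = of_int p - 1" if "p dvd n" for n
  proof -
    have "bar (n - u) = bar (-u)" for u using that by (intro bar_cong) (simp add: cong_iff_dvd_diff)
    then show ?thesis by (simp add: b_def sum_chi_bar)
  qed
  have b1: "b n = b 1" if "\<not> p dvd n" for n
  proof -
    have "b n = chi n * bar n * b 1"
      unfolding b_def using that by (intro conv_scale) (auto simp: chi_mod chi_mult bar_mod bar_mult)
    then show ?thesis using that chi_bar by simp
  qed
  have "(\<Sum>n\<in>R. b n) = (\<Sum>u\<in>R. \<Sum>n\<in>R. chi u * bar (n - u))"
    unfolding b_def by (rule sum.swap)
  also have "\<dots> = (\<Sum>u\<in>R. chi u * (\<Sum>n\<in>R. bar (n + (- u))))"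
    by (simp add: sum_distrib_left)
  also have "\<dots> = 0" by (subst sum_shift) (auto simp: bar_mod sum_bar)
  finally have "b 0 + (\<Sum>n\<in>{1..<p}. b n) = 0" unfolding R_0 by simp
  also have "(\<Sum>n\<in>{1..<p}. b n) = (\<Sum>n\<in>{1..<p}. b 1)"
    using R_dvd_iff by (intro sum.cong refl b1) auto
  also have "\<dots> = (of_int p - 1) * b 1" using p_gt_1 by (simp add: of_nat_diff)
  finally have "(of_int p - 1) * (1 + b 1) = 0" using b0[of 0] by (simp add: algebra_simps)
  moreover have "of_int p - 1 \<noteq> (0::eis)" using p_gt_1 by (simp add: eis_eq_iff)
  ultimately have "b 1 = -1" by (simp add: eq_neg_iff_add_eq_0 add.commute)
  then show ?thesis using b0[of n] b1[of n] unfolding B_def b_def by auto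
qed

lemma conv_bar_chi: "(\<Sum>u\<in>R. bar u * chi (n - u)) = B n"
  using arg_cong[OF conv_chi_bar[of n], of econj] by (simp add: econj_sum bar_def B_def)

lemma sum_B_conv: 
  assumes "\<And>x. f (x mod p) = f x"
  shows "(\<Sum>n\<in>R. B n * f (m - n)) = of_int p * f m - sum f R"
proof -
  have "(\<Sum>n\<in>R. B n * f (m - n)) = (\<Sum>n\<in>R. (if n = 0 then of_int p * f m else 0) - f (m - n))"
    by (intro sum.cong refl) (auto simp: B_def R_dvd_iff algebra_simps)
  also have "\<dots> = of_int p * f m - (\<Sum>n\<in>R. f (m - n))"
    using p_gt_1 by (simp add: sum_subtractf)
  also have "(\<Sum>n\<in>R. f (m - n)) = sum f R" using assms by (rule sum_reflect)
  finally show ?thesis .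
qed

text \<open>The squared absolute value of the convolution of \<open>chi\<close> with itself, summed
  over \<open>n\<close>, is computed twice: by \<open>conv_chi_chi\<close> it is
  \<open>J * econj J * (p - 1)\<close>, and after opening both convolutions and summing over
  \<open>n\<close> first it is \<open>p * (p - 1)\<close>.\<close>

lemma J_norm: "J * econj J = of_int p"
proof -
  have "(\<Sum>n\<in>R. (J * bar n) * (econj J * chi n)) = J * econj J * (\<Sum>n\<in>R. chi n * bar n)"
    by (simp add: sum_distrib_left algebra_simps)
  also have "\<dots> = J * econj J * (of_int p - 1)" by (simp add: sum_chi_bar)
  finally have 1: "(\<Sum>n\<in>R. (J * bar n) * (econj J * chi n)) = J * econj J * (of_int p - 1)" .
  have "(\<Sum>n\<in>R. (J * bar n) * (econj J * chi n))
      = (\<Sum>n\<in>R. \<Sum>u\<in>R. \<Sum>v\<in>R. (chi u * chi (n - u)) * (bar v * bar (n - v)))"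
    by (simp add: conv_chi_chi[symmetric] conv_bar_bar[symmetric] sum_product)
  also have "\<dots> = (\<Sum>u\<in>R. \<Sum>v\<in>R. \<Sum>n\<in>R. (chi u * chi (n - u)) * (bar v * bar (n - v)))"
    by (subst sum.swap, rule sum.cong[OF refl], rule sum.swap)
  also have "\<dots> = (\<Sum>u\<in>R. chi u * (\<Sum>v\<in>R. B (u - v) * bar v))"
  proof (rule sum.cong)
    fix u
    have "(\<Sum>n\<in>R. (chi u * chi (n - u)) * (bar v * bar (n - v))) = chi u * (B (u - v) * bar v)" for v
    proof -
      have "(\<Sum>n\<in>R. chi (n - u) * bar (n - v)) = (\<Sum>n\<in>R. chi (n + (-u)) * bar (v - u - (n + (-u))))"
        by (intro sum.cong refl) (simp add: bar_diff_commute[of v])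
      also have "\<dots> = (\<Sum>n\<in>R. chi n * bar (v - u - n))"
        by (subst sum_shift[where f = "\<lambda>n. chi n * bar (v - u - n)"])
           (simp_all add: chi_mod bar_diff_mod)
      also have "\<dots> = B (v - u)" by (rule conv_chi_bar)
      also have "\<dots> = B (u - v)" by (simp add: B_def dvd_diff_commute)
      finally show ?thesis
        by (simp add: algebra_simps sum_distrib_left[symmetric])
    qed
    then show "(\<Sum>v\<in>R. \<Sum>n\<in>R. (chi u * chi (n - u)) * (bar v * bar (n - v))) = chi u * (\<Sum>v\<in>R. B (u - v) * bar v)"
      by (simp add: sum_distrib_left)
  qed simp
  also have "\<dots> = (\<Sum>u\<in>R. chi u * (of_int p * bar u))"
  proof (rule sum.cong)
    fix u
    have "(\<Sum>v\<in>R. B (u - v) * bar v) = (\<Sum>v\<in>R. B (u - v) * bar (u - (u - v)))" by simp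
    also have "\<dots> = (\<Sum>v\<in>R. B v * bar (u - v))"
      by (subst sum_reflect[where f = "\<lambda>v. B v * bar (u - v)"])
         (simp_all add: B_mod bar_diff_mod)
    also have "\<dots> = of_int p * bar u"
      by (subst sum_B_conv) (auto simp: bar_mod sum_bar)
    finally show "chi u * (\<Sum>v\<in>R. B (u - v) * bar v) = chi u * (of_int p * bar u)" by simp
  qed simp
  also have "\<dots> = of_int p * (of_int p - 1)"
    by (simp add: sum_chi_bar[symmetric] sum_distrib_left algebra_simps)
  finally have "J * econj J * (of_int p - 1) = of_int p * (of_int p - 1)" using 1 by simp
  moreover have "of_int p - 1 \<noteq> (0::eis)" using p_gt_1 by (simp add: eis_eq_iff)
  ultimately show ?thesis by simp
qed

lemma enorm_J: "enorm J = p"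
  using J_norm by (simp add: mult_econj eis_eq_iff)

section \<open>Cube roots and the number of solutions modulo p\<close>

definition cubes :: "int set" where "cubes = {v \<in> R. chi v = 1}"
definition nroots :: "int \<Rightarrow> nat" where "nroots u = card {x \<in> R. [x ^ 3 = u] (mod p)}"

lemma chi_power: "chi (x ^ n) = chi x ^ n"
  by (induction n) (auto simp: chi_mult)

lemma p_dvd_power_iff: "p dvd x ^ 3 \<longleftrightarrow> p dvd x"
  using prime_p by (metis prime_dvd_power dvd_power_same dvd_power dvd_trans zero_less_numeral)

lemma sum_cube_nroots:
  assumes "\<And>x. f (x mod p) = f x"
  shows "(\<Sum>x\<in>R. f (x ^ 3)) = (\<Sum>u\<in>R. of_nat (nroots u) * (f u :: eis))"
proof -
  have "(\<Sum>x\<in>R. f (x ^ 3)) = (\<Sum>x\<in>R. \<Sum>u\<in>R. if x ^ 3 mod p = u then f u else 0)"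
    using p_gt_1 assms by (intro sum.cong refl) simp
  also have "\<dots> = (\<Sum>u\<in>R. \<Sum>x\<in>R. if x ^ 3 mod p = u then f u else 0)" by (rule sum.swap)
  also have "\<dots> = (\<Sum>u\<in>R. of_nat (nroots u) * f u)"
  proof (rule sum.cong)
    fix u assume u: "u \<in> R"
    have "{x \<in> R. x ^ 3 mod p = u} = {x \<in> R. [x ^ 3 = u] (mod p)}"
      using u by (auto simp: unique_euclidean_semiring_class.cong_def)
    then show "(\<Sum>x\<in>R. if x ^ 3 mod p = u then f u else 0) = of_nat (nroots u) * f u"
      by (simp add: nroots_def sum.If_cases Int_def)
  qed simp
  finally show ?thesis .
qed

lemma weight_cases: "1 + chi u + bar u = (if p dvd u then 1 else if chi u = 1 then 3 else 0)"
proof (cases "p dvd u")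
  case False
  from chi_values[OF False] show ?thesis
  proof (elim disjE)
    assume c: "chi u = omega ^ 2"
    have "1 + chi u + bar u = 0"
      unfolding bar_eq_sq c omega_sq by (simp add: omega_mult algebra_simps)
    then show ?thesis using False c by simp
  qed (use False in \<open>simp_all add: bar_eq_sq omega_mult\<close>)
qed (simp add: chi_0 bar_0)

lemma finite_cubes: "finite cubes"
  by (rule finite_subset[of _ R]) (auto simp: cubes_def)

lemma card_cubes: "p = 1 + 3 * int (card cubes)"
proof -
  have "(\<Sum>u\<in>R. 1 + chi u + bar u) = of_int p"
    using p_gt_1 by (simp add: sum.distrib sum_chi sum_bar)
  moreover have "(\<Sum>u\<in>R. 1 + chi u + bar u) = (\<Sum>u\<in>R. (if u = 0 then 1 else 0) + (if chi u = 1 then 3 else 0))"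
    unfolding weight_cases by (intro sum.cong refl) (auto simp: R_dvd_iff chi_0)
  moreover have "\<dots> = 1 + 3 * of_nat (card cubes)"
    using p_gt_1 by (simp add: sum.distrib sum.If_cases cubes_def Int_def algebra_simps)
  ultimately have "(of_int p :: eis) = 1 + 3 * of_nat (card cubes)" by simp
  then show ?thesis by (simp add: eis_eq_iff)
qed

text \<open>All \<open>u\<close> with \<open>chi u = 1\<close> have equally many cube roots, because
  multiplication by one root of \<open>u\<close> carries the roots of 1 to those of
  \<open>u\<close>. Since all residues together supply \<open>p\<close> roots,
  \<open>card_cubes\<close> forces this number to be 3.\<close>

lemma nroots_eq: "(of_nat (nroots u) :: eis) = 1 + chi u + bar u"
proof -
  have 0: "nroots u = 1" if "p dvd u" for u
  proof -
    have "{x \<in> R. [x ^ 3 = u] (mod p)} = {0}"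
      using that R_dvd_iff p_dvd_power_iff p_gt_1
      by (auto simp: cong_iff_dvd_diff dvd_diff_left_iff) 
    then show ?thesis by (simp add: nroots_def)
  qed
  have 1: "nroots u = 0" if "\<not> p dvd u" "chi u \<noteq> 1" for u
  proof -
    have "\<not> [x ^ 3 = u] (mod p)" for x
    proof
      assume *: "[x ^ 3 = u] (mod p)"
      then have "chi u = chi x ^ 3" using chi_cong chi_power by metis
      moreover have "\<not> p dvd x" using * that p_dvd_power_iff cong_dvd_iff by blast
      ultimately show False using that chi_cube by simp
    qed
    then show ?thesis by (simp add: nroots_def)
  qed
  have 2: "nroots u = nroots 1" if "chi u = 1" for u
  proof -
    obtain y where y: "[y ^ 3 = u] (mod p)" using chi_1_imp[OF \<open>chi u = 1\<close>] by blast
    have "\<not> p dvd u" using that chi_0 by force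
    then have ny: "\<not> p dvd y" using y p_dvd_power_iff cong_dvd_iff by blast
    have "nroots u = (\<Sum>x\<in>R. if [x ^ 3 = u] (mod p) then 1 else 0)"
      by (simp add: nroots_def sum.If_cases Int_def)
    also have "\<dots> = (\<Sum>x\<in>R. if [(y * x + 0) ^ 3 = u] (mod p) then 1 else 0)"
    proof (rule sum_affine[OF ny, symmetric])
      fix x show "(if [(x mod p) ^ 3 = u] (mod p) then 1 else 0) = (if [x ^ 3 = u] (mod p) then 1 else (0::nat))"
        by (simp add: unique_euclidean_semiring_class.cong_def power_mod)
    qed
    also have "\<dots> = (\<Sum>x\<in>R. if [x ^ 3 = 1] (mod p) then 1 else 0)"
    proof (intro sum.cong refl if_cong)
      fix x
      have "[(y * x + 0) ^ 3 = u] (mod p) \<longleftrightarrow> [y ^ 3 * x ^ 3 = y ^ 3 * 1] (mod p)"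
        using y by (simp add: power_mult_distrib) (metis cong_sym cong_trans)
      also have "\<dots> \<longleftrightarrow> p dvd y ^ 3 * (x ^ 3 - 1)" by (simp add: cong_iff_dvd_diff algebra_simps)
      also have "\<dots> \<longleftrightarrow> p dvd x ^ 3 - 1" using ny prime_p p_dvd_power_iff prime_dvd_mult_iff by blast
      finally show "[(y * x + 0) ^ 3 = u] (mod p) \<longleftrightarrow> [x ^ 3 = 1] (mod p)" by (simp add: cong_iff_dvd_diff)
    qed
    also have "\<dots> = nroots 1" by (simp add: nroots_def sum.If_cases Int_def)
    finally show ?thesis .
  qed
  have c1: "1 \<in> cubes" using p_gt_1 by (simp add: cubes_def)
  have cn: "card cubes > 0" using c1 finite_cubes by (auto simp: card_gt_0_iff)
  have "(of_int p :: eis) = (\<Sum>u\<in>R. of_nat (nroots u) * 1)"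
    using p_gt_1 sum_cube_nroots[of "\<lambda>_. 1"] by simp
  also have "\<dots> = (\<Sum>u\<in>R. (if u = 0 then 1 else 0) + (if chi u = 1 then of_nat (nroots 1) else 0))"
  proof (rule sum.cong)
    fix u assume u: "u \<in> R"
    show "of_nat (nroots u) * 1 = (if u = 0 then 1 else 0) + (if chi u = 1 then of_nat (nroots 1) else (0::eis))"
    proof (cases "p dvd u")
      case True
      then show ?thesis using u 0[of u] by (simp add: R_dvd_iff chi_0)
    next
      case False
      then have "u \<noteq> 0" by auto
      then show ?thesis using 1[OF False] 2[of u] by (cases "chi u = 1") simp_all
    qed
  qed simp
  also have "\<dots> = 1 + of_nat (card cubes) * of_nat (nroots 1)"
    using p_gt_1 by (simp add: sum.distrib sum.If_cases cubes_def Int_def algebra_simps)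
  finally have "p = 1 + int (card cubes) * int (nroots 1)" by (simp add: eis_eq_iff eis_sel_mult)
  then have "int (card cubes) * int (nroots 1) = int (card cubes) * 3" using card_cubes by linarith
  then have "nroots 1 = 3" using cn by simp
  then show ?thesis unfolding weight_cases using 0[of u] 1[of u] 2[of u]
    by (cases "p dvd u"; cases "chi u = 1") simp_all
qed

text \<open>For \<open>a\<close> prime to \<open>p\<close> this is the number of \<open>x\<close>
  modulo \<open>p\<close> with \<open>a * x ^ 3 = t\<close>, expanded in characters of
  \<open>t\<close>.\<close>

definition h :: "int \<Rightarrow> int \<Rightarrow> eis" where "h a t = 1 + bar a * chi t + chi a * bar t"

lemma h_mod: "h a (t mod p) = h a t" by (simp add: h_def chi_mod bar_mod)
lemma h_diff_mod: "h a (c - t mod p) = h a (c - t)" by (simp add: h_def chi_diff_mod bar_diff_mod)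

lemma sum_scaled_cubes:
  assumes "\<And>x. f (x mod p) = (f x :: eis)" "\<not> p dvd a"
  shows "(\<Sum>x\<in>R. f (a * x ^ 3)) = (\<Sum>t\<in>R. h a t * f t)"
proof -
  have "(\<Sum>x\<in>R. f (a * x ^ 3)) = (\<Sum>u\<in>R. of_nat (nroots u) * f (a * u))"
  proof (rule sum_cube_nroots)
    fix x show "f (a * (x mod p)) = f (a * x)"
      by (metis assms(1) mod_mult_right_eq)
  qed
  also have "\<dots> = (\<Sum>u\<in>R. h a (a * u + 0) * f (a * u + 0))"
  proof (intro sum.cong refl arg_cong2[where f = "(*)"])
    fix u
    have "h a (a * u + 0) = 1 + (chi a * bar a) * chi u + (chi a * bar a) * bar u"
      by (simp add: h_def chi_mult bar_mult mult_ac)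
    then show "of_nat (nroots u) = h a (a * u + 0)"
      by (simp add: nroots_eq chi_bar[OF assms(2)])
  qed simp
  also have "\<dots> = (\<Sum>t\<in>R. h a t * f t)"
    using assms by (intro sum_affine[where f = "\<lambda>t. h a t * f t"]) (auto simp: h_mod)
  finally show ?thesis .
qed

definition ind :: "int \<Rightarrow> eis" where "ind t = (if p dvd t then 1 else 0)"

lemma ind_mod: "ind (t mod p) = ind t" by (simp add: ind_def dvd_mod_iff)
lemma ind_diff_mod: "ind (c - t mod p) = ind (c - t)"
  by (metis ind_mod mod_diff_right_eq)

lemma sum_ind:
  assumes "\<And>x. f (x mod p) = (f x :: eis)"
  shows "(\<Sum>t\<in>R. f t * ind (s - t)) = f s"
proof -
  have "ind (s - t) = (if t = s mod p then 1 else 0)" if "t \<in> R" for t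
    using that mod_pos_pos_trivial[of t p] mod_eq_dvd_iff[of s p t] by (auto simp: ind_def)
  then have "(\<Sum>t\<in>R. f t * ind (s - t)) = (\<Sum>t\<in>R. if t = s mod p then f t else 0)"
    by (intro sum.cong) auto
  also have "\<dots> = f s" using p_gt_1 assms by simp
  finally show ?thesis .
qed

definition nsol :: "int \<Rightarrow> int \<Rightarrow> int \<Rightarrow> int \<Rightarrow> nat" where
  "nsol a1 a2 a3 m = card {(x, y, z). x \<in> R \<and> y \<in> R \<and> z \<in> R \<and> [a1 * x ^ 3 + a2 * y ^ 3 + a3 * z ^ 3 = m] (mod p)}"

lemma conv_h_h:
  "(\<Sum>t\<in>R. h a t * h b (n - t)) =
     of_int p + bar a * bar b * J * bar n + chi a * chi b * econj J * chi n + (bar a * chi b + chi a * bar b) * B n"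
proof -
  have s: "(\<Sum>t\<in>R. chi (n - t)) = 0" "(\<Sum>t\<in>R. bar (n - t)) = 0"
    using sum_reflect[of chi n] sum_reflect[of bar n] by (simp_all add: chi_mod bar_mod sum_chi sum_bar)
  have "(\<Sum>t\<in>R. h a t * h b (n - t)) = (\<Sum>t\<in>R. 1 + bar b * chi (n - t) + chi b * bar (n - t) + bar a * chi t + chi a * bar t
     + bar a * bar b * (chi t * chi (n - t)) + chi a * chi b * (bar t * bar (n - t))
     + bar a * chi b * (chi t * bar (n - t)) + chi a * bar b * (bar t * chi (n - t)))"
    unfolding h_def by (intro sum.cong refl) (simp add: algebra_simps)
  also have "\<dots> = of_int p + bar a * bar b * (J * bar n) + chi a * chi b * (econj J * chi n) + bar a * chi b * B n + chi a * bar b * B n"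
    using p_gt_1 by (simp add: sum.distrib sum_distrib_left[symmetric] s sum_chi sum_bar conv_chi_chi conv_bar_bar conv_chi_bar conv_bar_chi)
  finally show ?thesis by (simp add: algebra_simps)
qed

lemma sum_h: "(\<Sum>t\<in>R. h a t) = of_int p"
  using p_gt_1 by (simp add: h_def sum.distrib sum_distrib_left[symmetric] sum_chi sum_bar)

text \<open>The solution count is the convolution of the distributions \<open>h a1\<close>,
  \<open>h a2\<close> and \<open>h a3\<close> of the three terms.\<close>

lemma nsol_sum:
  assumes "\<not> p dvd a1" "\<not> p dvd a2" "\<not> p dvd a3"
  shows "(of_nat (nsol a1 a2 a3 m) :: eis) = (\<Sum>n\<in>R. (\<Sum>t\<in>R. h a1 t * h a2 (n - t)) * h a3 (m - n))"
proof -
  have set: "{(x, y, z). x \<in> R \<and> y \<in> R \<and> z \<in> R \<and> [a1 * x ^ 3 + a2 * y ^ 3 + a3 * z ^ 3 = m] (mod p)} =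
     {w \<in> R \<times> R \<times> R. p dvd (m - a1 * fst w ^ 3 - a2 * fst (snd w) ^ 3) - a3 * snd (snd w) ^ 3}"
    by (auto simp: cong_iff_dvd_diff dvd_diff_commute algebra_simps)
  have "(of_nat (nsol a1 a2 a3 m) :: eis) = (\<Sum>w\<in>R \<times> R \<times> R. ind ((m - a1 * fst w ^ 3 - a2 * fst (snd w) ^ 3) - a3 * snd (snd w) ^ 3))"
    unfolding nsol_def set ind_def by (simp add: sum.If_cases Int_def)
  also have "\<dots> = (\<Sum>x\<in>R. \<Sum>y\<in>R. \<Sum>z\<in>R. ind ((m - a1 * x ^ 3 - a2 * y ^ 3) - a3 * z ^ 3))"
    by (simp add: sum.cartesian_product')
  also have "\<dots> = (\<Sum>x\<in>R. \<Sum>y\<in>R. h a3 (m - a1 * x ^ 3 - a2 * y ^ 3))"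
  proof (intro sum.cong refl)
    fix x y
    have "(\<Sum>z\<in>R. ind ((m - a1 * x ^ 3 - a2 * y ^ 3) - a3 * z ^ 3)) = (\<Sum>t\<in>R. h a3 t * ind ((m - a1 * x ^ 3 - a2 * y ^ 3) - t))"
      using assms(3) by (intro sum_scaled_cubes[where f = "\<lambda>t. ind ((m - a1 * x ^ 3 - a2 * y ^ 3) - t)"]) (simp_all add: ind_diff_mod)
    also have "\<dots> = h a3 (m - a1 * x ^ 3 - a2 * y ^ 3)" by (rule sum_ind) (simp add: h_mod)
    finally show "(\<Sum>z\<in>R. ind ((m - a1 * x ^ 3 - a2 * y ^ 3) - a3 * z ^ 3)) = h a3 (m - a1 * x ^ 3 - a2 * y ^ 3)" .
  qed
  also have "\<dots> = (\<Sum>x\<in>R. \<Sum>t\<in>R. h a2 t * h a3 (m - a1 * x ^ 3 - t))"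
  proof (rule sum.cong)
    fix x
    show "(\<Sum>y\<in>R. h a3 (m - a1 * x ^ 3 - a2 * y ^ 3)) = (\<Sum>t\<in>R. h a2 t * h a3 (m - a1 * x ^ 3 - t))"
      using assms(2) by (intro sum_scaled_cubes[where f = "\<lambda>t. h a3 (m - a1 * x ^ 3 - t)"]) (simp_all add: h_diff_mod)
  qed simp
  also have "\<dots> = (\<Sum>x\<in>R. \<Sum>n\<in>R. h a2 (n - a1 * x ^ 3) * h a3 (m - n))"
  proof (rule sum.cong)
    fix x
    have "(\<Sum>t\<in>R. h a2 t * h a3 (m - a1 * x ^ 3 - t)) = (\<Sum>t\<in>R. h a2 (t + (- a1 * x ^ 3)) * h a3 (m - a1 * x ^ 3 - (t + (- a1 * x ^ 3))))"
      by (rule sum_shift[where f = "\<lambda>t. h a2 t * h a3 (m - a1 * x ^ 3 - t)", symmetric]) (simp add: h_mod h_diff_mod)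
    then show "(\<Sum>t\<in>R. h a2 t * h a3 (m - a1 * x ^ 3 - t)) = (\<Sum>n\<in>R. h a2 (n - a1 * x ^ 3) * h a3 (m - n))"
      by simp
  qed simp
  also have "\<dots> = (\<Sum>n\<in>R. \<Sum>x\<in>R. h a2 (n - a1 * x ^ 3) * h a3 (m - n))" by (rule sum.swap)
  also have "\<dots> = (\<Sum>n\<in>R. (\<Sum>x\<in>R. h a2 (n - a1 * x ^ 3)) * h a3 (m - n))"
    by (simp add: sum_distrib_right)
  also have "\<dots> = (\<Sum>n\<in>R. (\<Sum>t\<in>R. h a1 t * h a2 (n - t)) * h a3 (m - n))"
  proof (rule sum.cong)
    fix n
    have "(\<Sum>x\<in>R. h a2 (n - a1 * x ^ 3)) = (\<Sum>t\<in>R. h a1 t * h a2 (n - t))"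
      using assms(1) by (intro sum_scaled_cubes[where f = "\<lambda>t. h a2 (n - t)"]) (simp_all add: h_diff_mod)
    then show "(\<Sum>x\<in>R. h a2 (n - a1 * x ^ 3)) * h a3 (m - n) = (\<Sum>t\<in>R. h a1 t * h a2 (n - t)) * h a3 (m - n)"
      by simp
  qed simp
  finally show ?thesis .
qed

lemma sum_bar_h: "(\<Sum>n\<in>R. bar n * h a (m - n)) = bar a * B m + chi a * econj J * chi m"
proof -
  have "(\<Sum>n\<in>R. bar n * h a (m - n)) = (\<Sum>n\<in>R. bar n + bar a * (bar n * chi (m - n)) + chi a * (bar n * bar (m - n)))"
    unfolding h_def by (intro sum.cong refl) (simp add: algebra_simps)
  then show ?thesis
    by (simp add: sum.distrib sum_distrib_left[symmetric] sum_bar conv_bar_chi conv_bar_bar)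
qed

lemma sum_chi_h: "(\<Sum>n\<in>R. chi n * h a (m - n)) = chi a * B m + bar a * J * bar m"
proof -
  have "(\<Sum>n\<in>R. chi n * h a (m - n)) = (\<Sum>n\<in>R. chi n + chi a * (chi n * bar (m - n)) + bar a * (chi n * chi (m - n)))"
    unfolding h_def by (intro sum.cong refl) (simp add: algebra_simps)
  then show ?thesis
    by (simp add: sum.distrib sum_distrib_left[symmetric] sum_chi conv_chi_bar conv_chi_chi)
qed

lemma nsol_formula:
  assumes "\<not> p dvd a1" "\<not> p dvd a2" "\<not> p dvd a3"
  shows "(of_nat (nsol a1 a2 a3 m) :: eis) = of_int p * of_int p
     + bar a1 * bar a2 * J * (bar a3 * B m + chi a3 * econj J * chi m)
     + chi a1 * chi a2 * econj J * (chi a3 * B m + bar a3 * J * bar m)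
     + (bar a1 * chi a2 + chi a1 * bar a2) * (of_int p * (bar a3 * chi m + chi a3 * bar m))"
proof -
  have r: "(\<Sum>n\<in>R. h a3 (m - n)) = of_int p"
    using sum_reflect[of "h a3" m] by (simp add: h_mod sum_h)
  have "(of_nat (nsol a1 a2 a3 m) :: eis) = (\<Sum>n\<in>R. of_int p * h a3 (m - n) + bar a1 * bar a2 * J * (bar n * h a3 (m - n))
     + chi a1 * chi a2 * econj J * (chi n * h a3 (m - n)) + (bar a1 * chi a2 + chi a1 * bar a2) * (B n * h a3 (m - n)))"
    unfolding nsol_sum[OF assms] conv_h_h by (intro sum.cong refl) (simp add: algebra_simps)
  also have "\<dots> = of_int p * of_int p + bar a1 * bar a2 * J * (bar a3 * B m + chi a3 * econj J * chi m)
     + chi a1 * chi a2 * econj J * (chi a3 * B m + bar a3 * J * bar m)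
     + (bar a1 * chi a2 + chi a1 * bar a2) * (of_int p * h a3 m - of_int p)"
    by (simp add: sum.distrib sum_distrib_left[symmetric] r sum_bar_h sum_chi_h sum_B_conv h_mod sum_h)
  finally show ?thesis by (simp add: h_def algebra_simps)
qed

lemma norm_toc_chi: "norm (toc (chi x)) \<le> 1" "norm (toc (bar x)) \<le> 1"
proof -
  have "norm (toc (chi x)) = (if p dvd x then 0 else 1)"
  proof (cases "p dvd x")
    case False
    have "norm (toc (chi x)) ^ 3 = 1" unfolding norm_power[symmetric] toc_power[symmetric] chi_cube[OF False] by simp
    then show ?thesis using False power_eq_imp_eq_base[of "norm (toc (chi x))" 3 1] by simp
  qed (simp add: chi_0)
  then show "norm (toc (chi x)) \<le> 1" "norm (toc (bar x)) \<le> 1" by (simp_all add: bar_def)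
qed

lemma norm_toc_J: "norm (toc J) = sqrt (of_int p)"
  by (simp add: norm_toc enorm_J)

text \<open>For \<open>m\<close> divisible by \<open>p\<close> only the two conjugate terms with
  \<open>B m = p - 1\<close> survive. They can reach the order \<open>p * sqrt p\<close>, while the
  excess in all other classes is at most of order \<open>p\<close> by
  \<open>nsol_le\<close>.\<close>

lemma nsol_0:
  assumes "\<not> p dvd a1" "\<not> p dvd a2" "\<not> p dvd a3" "p dvd m"
  shows "real (nsol a1 a2 a3 m) = of_int p ^ 2 + (of_int p - 1) * (2 * Re (toc (bar (a1 * a2 * a3) * J)))"
proof -
  define w where "w = bar (a1 * a2 * a3) * J"
  have "(of_nat (nsol a1 a2 a3 m) :: eis) = of_int p * of_int p + (of_int p - 1) * (w + econj w)"
    unfolding nsol_formula[OF assms(1-3)] using assms(4)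
    by (simp add: chi_0 bar_0 B_def w_def bar_mult chi_mult bar_def algebra_simps)
  then have "toc (of_nat (nsol a1 a2 a3 m)) = toc (of_int p * of_int p + (of_int p - 1) * (w + econj w))"
    by simp
  then have "complex_of_real (real (nsol a1 a2 a3 m)) = of_int p * of_int p + (of_int p - 1) * (toc w + cnj (toc w))"
    by simp
  then have "Re (complex_of_real (real (nsol a1 a2 a3 m))) = Re (of_int p * of_int p + (of_int p - 1) * (toc w + cnj (toc w)))"
    by (rule arg_cong)
  then show ?thesis by (simp add: w_def[symmetric] power2_eq_square)
qed

text \<open>Now \<open>J\<close> occurs either with the factor \<open>B m = - 1\<close> or in the
  product \<open>J * econj J = p\<close>. There are two terms of the first kind, bounded crudely by
  \<open>p\<close>, and six of the second: together \<open>8 * p\<close>.\<close>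

lemma nsol_le:
  assumes "\<not> p dvd a1" "\<not> p dvd a2" "\<not> p dvd a3" "\<not> p dvd m"
  shows "real (nsol a1 a2 a3 m) \<le> of_int p ^ 2 + 8 * of_int p"
proof -
  let ?p = "real_of_int p"
  have p1: "?p \<ge> 1" using p_gt_1 by simp
  have le: "norm (x * y) \<le> a * b" if "norm x \<le> a" "norm y \<le> b" for x y :: complex and a b
    using that by (metis norm_mult mult_mono' norm_ge_zero)
  have J: "norm (toc J) \<le> ?p"
    unfolding norm_toc_J using p1 real_sqrt_le_mono[of ?p "?p * ?p"] by simp
  have Jb: "norm (toc (econj J)) \<le> ?p" using J by simp
  note n = norm_toc_chi
  have Bm: "B m = -1" using assms by (simp add: B_def)
  have e: "(of_nat (nsol a1 a2 a3 m) :: eis) = of_int p * of_int p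
     - bar a1 * bar a2 * bar a3 * J - chi a1 * chi a2 * chi a3 * econj J
     + of_int p * (bar a1 * bar a2 * chi a3 * chi m + chi a1 * chi a2 * bar a3 * bar m
     + (bar a1 * chi a2 + chi a1 * bar a2) * (bar a3 * chi m + chi a3 * bar m))"
    unfolding nsol_formula[OF assms(1-3)] Bm J_norm[symmetric] by (simp add: algebra_simps)
  have t: "norm (toc (x * y * z * w)) \<le> 1" if "norm (toc x) \<le> 1" "norm (toc y) \<le> 1" "norm (toc z) \<le> 1" "norm (toc w) \<le> 1" for x y z w
    using that by (simp add: norm_mult mult_le_one)
  have t3: "norm (toc (x * y * z * w)) \<le> ?p" if "norm (toc x) \<le> 1" "norm (toc y) \<le> 1" "norm (toc z) \<le> 1" "norm (toc w) \<le> ?p" for x y z w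
  proof -
    have "norm (toc (x * y * z)) \<le> 1" using that by (simp add: norm_mult mult_le_one)
    from le[OF this that(4)] show ?thesis by simp
  qed
  define X1 X2 where "X1 = bar a1 * bar a2 * bar a3 * J" and "X2 = chi a1 * chi a2 * chi a3 * econj J"
  define Y1 Y2 Y3 Y4 Y5 Y6 where "Y1 = bar a1 * bar a2 * chi a3 * chi m" and "Y2 = chi a1 * chi a2 * bar a3 * bar m"
    and "Y3 = bar a1 * chi a2 * bar a3 * chi m" and "Y4 = bar a1 * chi a2 * chi a3 * bar m"
    and "Y5 = chi a1 * bar a2 * bar a3 * chi m" and "Y6 = chi a1 * bar a2 * chi a3 * bar m"
  have X: "norm (toc X1) \<le> ?p" "norm (toc X2) \<le> ?p"
    unfolding X1_def X2_def by (rule t3 n J Jb)+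
  have Y: "norm (toc Y1) \<le> 1" "norm (toc Y2) \<le> 1" "norm (toc Y3) \<le> 1" "norm (toc Y4) \<le> 1" "norm (toc Y5) \<le> 1" "norm (toc Y6) \<le> 1"
    unfolding Y1_def Y2_def Y3_def Y4_def Y5_def Y6_def by (rule t n)+
  have e2: "(of_nat (nsol a1 a2 a3 m) :: eis) = of_int p * of_int p - X1 - X2 + of_int p * (Y1 + Y2 + Y3 + Y4 + Y5 + Y6)"
    unfolding e X1_def X2_def Y1_def Y2_def Y3_def Y4_def Y5_def Y6_def by (simp add: algebra_simps)
  have "toc (of_nat (nsol a1 a2 a3 m)) = of_int p * of_int p - toc X1 - toc X2 + of_int p * (toc Y1 + toc Y2 + toc Y3 + toc Y4 + toc Y5 + toc Y6)"
    unfolding e2 by simp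
  then have eR: "real (nsol a1 a2 a3 m) = Re (of_int p * of_int p - toc X1 - toc X2 + of_int p * (toc Y1 + toc Y2 + toc Y3 + toc Y4 + toc Y5 + toc Y6))"
    by (metis toc_simps(8) Re_complex_of_real of_real_of_nat_eq)
  have r: "\<bar>Re z\<bar> \<le> c" if "norm z \<le> c" for z c using abs_Re_le_cmod[of z] that by linarith
  have "real (nsol a1 a2 a3 m) = ?p * ?p - Re (toc X1) - Re (toc X2) + ?p * (Re (toc Y1) + Re (toc Y2) + Re (toc Y3) + Re (toc Y4) + Re (toc Y5) + Re (toc Y6))"
    unfolding eR by simp
  also have "\<dots> \<le> ?p * ?p + ?p + ?p + ?p * 6"
    using r[OF X(1)] r[OF X(2)] r[OF Y(1)] r[OF Y(2)] r[OF Y(3)] r[OF Y(4)] r[OF Y(5)] r[OF Y(6)] p1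
    by (intro add_mono mult_left_mono) linarith+
  finally show ?thesis by (simp add: power2_eq_square)
qed

section \<open>The Jacobi sum modulo 9 and the supplementary law\<close>

text \<open>Summing \<open>chi (1 - v)\<close> against the weight of \<open>weight_cases\<close>,
  which is 3 times the indicator of the cubes apart from \<open>v = 0\<close>. The identity shows
  that \<open>- J\<close> is 1 modulo 3 and, read modulo 9, yields \<open>chi 3\<close>.\<close>

lemma J_cubes: "J = 2 + 3 * (\<Sum>v\<in>cubes. chi (v - 1))"
proof -
  have "(\<Sum>v\<in>R. (1 + chi v + bar v) * chi (1 - v)) = (\<Sum>v\<in>R. chi (1 - v)) + (\<Sum>v\<in>R. chi v * chi (1 - v)) + (\<Sum>v\<in>R. bar v * chi (1 - v))"
    by (simp add: sum.distrib algebra_simps)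
  also have "\<dots> = J - 1"
    using sum_reflect[of chi 1] p_gt_1 by (simp add: chi_mod sum_chi J_def conv_bar_chi B_def)
  also have "(\<Sum>v\<in>R. (1 + chi v + bar v) * chi (1 - v)) = (\<Sum>v\<in>R. (if v = 0 then 1 else 0) + (if chi v = 1 then 3 * chi (v - 1) else 0))"
    unfolding weight_cases by (intro sum.cong refl) (auto simp: R_dvd_iff chi_0 chi_diff_commute)
  also have "\<dots> = 1 + 3 * (\<Sum>v\<in>cubes. chi (v - 1))"
    using p_gt_1 by (simp add: sum.distrib sum.If_cases cubes_def Int_def sum_distrib_left)
  finally show ?thesis by (simp add: algebra_simps)
qed

lemma prim_minus_J: "prim (- J)"
  unfolding prim_alt by (rule exI[of _ "-1 - (\<Sum>v\<in>cubes. chi (v - 1))"]) (simp add: J_cubes algebra_simps)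

lemma cubic_char_bar: "cubic_char p bar"
proof
  fix x y
  show "prime p" by (rule prime_p)
  show "bar (x mod p) = bar x" "bar (x * y) = bar x * bar y" by (simp_all add: bar_mod bar_mult)
  show "p dvd x \<Longrightarrow> bar x = 0" by (rule bar_0)
  show "\<not> p dvd x \<Longrightarrow> bar x ^ 3 = 1" by (simp add: bar_def econj_power[symmetric] chi_cube del: econj_power)
  show "\<exists>y. [y ^ 3 = x] (mod p)" if "bar x = 1"
    using that chi_1_imp[of x] unfolding bar_def by (metis econj_simps(2,7))
  show "\<exists>x. \<not> p dvd x \<and> bar x \<noteq> 1"
    using chi_nontrivial unfolding bar_def by (metis econj_simps(2,7))
qed

lemma J_bar: "cubic_char.J p bar = econj J"
  unfolding cubic_char.J_def[OF cubic_char_bar] J_def by (simp add: econj_sum bar_def)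

end

text \<open>Induction by synthetic division: a root splits off a linear factor modulo
  \<open>p\<close>, and primality keeps the remaining roots roots of the quotient.\<close>

lemma poly_roots_mod_prime:
  fixes p :: int and f :: "int poly"
  assumes "prime p" "finite S" "S \<subseteq> {0..<p}" "\<And>r. r \<in> S \<Longrightarrow> p dvd poly f r" "degree f \<le> card S"
  shows "[poly f x = coeff f (card S) * (\<Prod>r\<in>S. x - r)] (mod p)"
  using assms(2-)
proof (induction S arbitrary: f rule: finite_induct)
  case empty
  then have "degree f = 0" by simp
  then obtain c where "f = [:c:]" using degree_eq_zeroE by blast
  then show ?case by simp
next
  case (insert r S)
  define q where "q = synthetic_div f r"
  have f: "f = [:- r, 1:] * q + [:poly f r:]" unfolding q_def by (metis synthetic_div_correct')
  have pf: "poly f y = (y - r) * poly q y + poly f r" for y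
    by (subst f) (simp add: algebra_simps)
  have r: "p dvd poly f r" using insert.prems by simp
  have dq: "degree q \<le> card S"
    using insert.prems insert.hyps by (simp add: q_def degree_synthetic_div)
  have "p dvd poly q s" if s: "s \<in> S" for s
  proof -
    have "p dvd poly f s" using insert.prems s by simp
    then have "p dvd (s - r) * poly q s" using pf[of s] r by (simp add: dvd_add_left_iff)
    moreover have "\<not> p dvd s - r"
    proof
      assume "p dvd s - r"
      then have "s mod p = r mod p" by (simp add: mod_eq_dvd_iff)
      then have "s = r" using s insert.prems by (auto simp: subset_iff)
      then show False using s insert.hyps by simp
    qed
    ultimately show ?thesis using assms(1) prime_dvd_mult_iff by blast
  qed
  then have IH: "[poly q x = coeff q (card S) * (\<Prod>r\<in>S. x - r)] (mod p)"
    using insert.prems dq by (intro insert.IH) auto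
  have c: "coeff f (card (insert r S)) = coeff q (card S)"
  proof -
    have "coeff q (Suc (card S)) = 0" using dq by (simp add: coeff_eq_0)
    then show ?thesis using insert.hyps by (subst f) (simp add: coeff_pCons)
  qed
  have "[poly f x = (x - r) * poly q x] (mod p)"
    unfolding pf[of x] using r by (simp add: cong_iff_dvd_diff)
  also have "[(x - r) * poly q x = (x - r) * (coeff q (card S) * (\<Prod>r\<in>S. x - r))] (mod p)"
    by (intro cong_mult IH cong_refl)
  also have "(x - r) * (coeff q (card S) * (\<Prod>r\<in>S. x - r)) = coeff f (card (insert r S)) * (\<Prod>r\<in>insert r S. x - r)"
    unfolding c using insert.hyps by (simp add: algebra_simps)
  finally show ?case .
qed

context cubic_char
begin

lemma fermat_int: assumes "\<not> p dvd y" shows "[y ^ nat (p - 1) = 1] (mod p)"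
proof -
  have "prime (nat p)" using prime_p prime_int_nat_transfer by blast
  moreover have yy: "int (nat (y mod p)) = y mod p" using p_gt_1 by simp
  have "\<not> nat p dvd nat (y mod p)"
  proof
    assume "nat p dvd nat (y mod p)"
    then have "int (nat p) dvd int (nat (y mod p))" by (simp only: of_nat_dvd_iff)
    then show False using assms p_gt_1 by (simp add: dvd_mod_iff)
  qed
  ultimately have "[nat (y mod p) ^ (nat p - 1) = 1] (mod nat p)" by (rule fermat_theorem)
  then have "[int (nat (y mod p)) ^ (nat p - 1) = int 1] (mod int (nat p))"
    by (metis cong_int_iff of_nat_power)
  then have "[(y mod p) ^ nat (p - 1) = 1] (mod p)"
    using p_gt_1 by (simp add: nat_diff_distrib)
  then show ?thesis by (simp add: unique_euclidean_semiring_class.cong_def power_mod)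
qed

text \<open>With \<open>m = (p - 1) / 3\<close> the cubes are roots of \<open>X^m - 1\<close> modulo
  \<open>p\<close>, so those other than 1 are the roots of \<open>1 + X + ... + X^(m - 1)\<close>,
  whose value at 1 is \<open>m\<close>.\<close>

lemma prod_cubes: "[(\<Prod>v\<in>cubes - {1}. 1 - v) = int (card cubes)] (mod p)"
proof -
  define m where "m = card cubes"
  note fin = finite_cubes
  have c1: "1 \<in> cubes" using p_gt_1 by (simp add: cubes_def)
  have m0: "m > 0" using c1 fin by (auto simp: m_def card_gt_0_iff)
  have pm: "nat (p - 1) = 3 * m" using card_cubes by (simp add: m_def)
  define f :: "int poly" where "f = (\<Sum>i<m. monom 1 i)"
  have pf: "poly f x = (\<Sum>i<m. x ^ i)" for x by (simp add: f_def poly_sum poly_monom)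
  have cf: "coeff f i = (if i < m then 1 else 0)" for i by (simp add: f_def coeff_sum)
  have card: "card (cubes - {1}) = m - 1" using c1 fin by (simp add: m_def)
  have df: "degree f \<le> m - 1" by (rule degree_le) (use m0 in \<open>auto simp: cf\<close>)
  have "[poly f 1 = coeff f (card (cubes - {1})) * (\<Prod>r\<in>cubes - {1}. 1 - r)] (mod p)"
  proof (rule poly_roots_mod_prime[OF prime_p])
    show "finite (cubes - {1})" "cubes - {1} \<subseteq> {0..<p}" using fin by (auto simp: cubes_def)
    show "degree f \<le> card (cubes - {1})" using df card by simp
    fix v assume v: "v \<in> cubes - {1}"
    then obtain y where y: "[y ^ 3 = v] (mod p)" using chi_1_imp[of v] by (auto simp: cubes_def)
    have "\<not> p dvd v" using v chi_0[of v] by (auto simp: cubes_def)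
    then have "\<not> p dvd y" using y p_dvd_power_iff cong_dvd_iff by blast
    then have "[y ^ (3 * m) = 1] (mod p)" using fermat_int pm by metis
    moreover have "[(y ^ 3) ^ m = v ^ m] (mod p)" using y by (rule cong_pow)
    ultimately have "[v ^ m = 1] (mod p)" by (metis cong_sym cong_trans power_mult)
    then have "p dvd v ^ m - 1" by (simp add: cong_iff_dvd_diff)
    also have "v ^ m - 1 = (v - 1) * poly f v" unfolding pf by (rule power_diff_1_eq)
    finally have "p dvd (v - 1) * poly f v" .
    moreover have "\<not> p dvd v - 1"
    proof
      assume "p dvd v - 1"
      then have "v mod p = 1 mod p" by (simp add: mod_eq_dvd_iff)
      then show False using v p_gt_1 by (auto simp: cubes_def)
    qed
    ultimately show "p dvd poly f v" using prime_p prime_dvd_mult_iff by blast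
  qed
  moreover have "poly f 1 = int m" "coeff f (card (cubes - {1})) = 1"
    using card m0 by (simp_all add: pf cf)
  ultimately show ?thesis by (simp add: m_def cong_sym_eq)
qed

text \<open>The supplementary law for 3, via \<open>omega ^ k = 1 + k (omega - 1)\<close> modulo 3.\<close>

lemma chi_3: "chi 3 = omega ^ nat ((eo (- J) div 3) mod 3)"
proof -
  define D where "D = cubes - {1}"
  note fin = finite_cubes
  have c1: "1 \<in> cubes" using p_gt_1 by (simp add: cubes_def)
  have nd: "\<not> p dvd v - 1" if "v \<in> D" for v
  proof
    assume "p dvd v - 1"
    then have "v mod p = 1 mod p" by (simp add: mod_eq_dvd_iff)
    then show False using that p_gt_1 by (auto simp: cubes_def D_def)
  qed
  have "\<exists>k::nat. chi (v - 1) = omega ^ k" if "v \<in> D" for v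
    using chi_values[OF nd[OF that]] by (metis power_0 power_one_right)
  then obtain k :: "int \<Rightarrow> nat" where k: "\<And>v. v \<in> D \<Longrightarrow> chi (v - 1) = omega ^ k v" by metis
  have w: "\<exists>z. omega ^ j = 1 + of_nat j * (omega - 1) + 3 * z" for j :: nat
  proof (induction j)
    case (Suc j)
    then obtain z where z: "omega ^ j = 1 + of_nat j * (omega - 1) + 3 * z" by blast
    have "omega ^ Suc j = omega * (1 + of_nat j * (omega - 1) + 3 * z)" by (simp add: z)
    also have "\<dots> = 1 + of_nat (Suc j) * (omega - 1) + 3 * (omega * z - of_nat j * omega)"
      using omega_mult by (simp add: eis_eq_iff eis_sel_mult algebra_simps)
    finally show ?case by blast
  qed (rule exI[of _ 0], simp)
  then obtain z where z: "\<And>j. omega ^ j = 1 + of_nat j * (omega - 1) + 3 * z j" by metis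
  define K where "K = (\<Sum>v\<in>D. k v)"
  have "(\<Sum>v\<in>cubes. chi (v - 1)) = (\<Sum>v\<in>D. chi (v - 1))"
    unfolding D_def using fin c1 by (subst sum.remove[of _ 1]) (auto simp: chi_0)
  also have "\<dots> = (\<Sum>v\<in>D. 1 + of_nat (k v) * (omega - 1) + 3 * z (k v))"
    by (intro sum.cong refl) (simp add: k z)
  also have "\<dots> = of_nat (card D) + of_nat K * (omega - 1) + 3 * (\<Sum>v\<in>D. z (k v))"
    by (simp add: sum.distrib K_def sum_distrib_left[symmetric] sum_distrib_right[symmetric])
  finally have S: "(\<Sum>v\<in>cubes. chi (v - 1)) = of_nat (card D) + of_nat K * (omega - 1) + 3 * (\<Sum>v\<in>D. z (k v))" .
  have "eo (- J) = 3 * (- int K - 3 * eo (\<Sum>v\<in>D. z (k v)))"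
    unfolding J_cubes S by (simp add: eis_sel_mult)
  then have "eo (- J) div 3 = - int K - 3 * eo (\<Sum>v\<in>D. z (k v))" by simp
  then have "(eo (- J) div 3) mod 3 = (- int K) mod 3"
    by (metis mod_diff_eq mod_mult_self1_is_0 diff_zero mod_mod_trivial)
  \<comment> \<open>\<open>- K\<close> and \<open>2 * K\<close> agree modulo 3; the second can serve
    as a natural exponent.\<close>
  also have "\<dots> = (2 * int K) mod 3" by presburger
  finally have t: "nat ((eo (- J) div 3) mod 3) = (2 * K) mod 3" by (simp add: nat_mod_distrib nat_mult_distrib)
  have "chi (\<Prod>v\<in>D. 1 - v) = chi (int (card cubes))"
    unfolding D_def by (rule chi_cong[OF prod_cubes])
  moreover have "chi (\<Prod>v\<in>D. 1 - v) = omega ^ K"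
  proof -
    have "chi (\<Prod>v\<in>A. g v) = (\<Prod>v\<in>A. chi (g v))" for A and g :: "int \<Rightarrow> int"
      by (induction A rule: infinite_finite_induct) (auto simp: chi_mult)
    then have "chi (\<Prod>v\<in>D. 1 - v) = (\<Prod>v\<in>D. omega ^ k v)"
      by (simp add: k chi_diff_commute[of 1])
    then show ?thesis by (simp add: power_sum K_def)
  qed
  \<comment> \<open>\<open>3 * card cubes\<close> is \<open>p - 1\<close>, hence \<open>- 1\<close>
    modulo \<open>p\<close>, and \<open>chi (- 1) = 1\<close>.\<close>
  moreover have "chi 3 * chi (int (card cubes)) = 1"
  proof -
    have "p - 1 = 3 * int (card cubes)" using card_cubes by linarith
    then have "chi 3 * chi (int (card cubes)) = chi (p - 1)" by (simp only: chi_mult)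
    also have "\<dots> = chi (- 1)" by (rule chi_cong) (simp add: cong_iff_dvd_diff)
    finally show ?thesis by simp
  qed
  ultimately have "chi 3 * omega ^ K = 1" by simp
  then have "chi 3 * (omega ^ K * omega ^ (2 * K)) = omega ^ (2 * K)" by (simp add: mult.assoc[symmetric])
  moreover have "omega ^ K * omega ^ (2 * K) = 1"
    by (simp add: power_add[symmetric]) (metis omega_cube power_mult power_one mult.commute mult_2 numeral_3_eq_3 mult_Suc)
  ultimately show ?thesis unfolding t by (simp add: omega_power_mod[symmetric])
qed

end

section \<open>Existence of cubic characters\<close>

text \<open>For a primitive root \<open>g\<close> put \<open>chi (g ^ i) = omega ^ i\<close>. The
  discrete logarithm is determined modulo \<open>p - 1\<close>, which 3 divides, so its arbitrary
  choice by \<open>SOME\<close> has no influence on \<open>omega ^ lg x\<close>.\<close>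

lemma ex_cubic_char:
  fixes p :: int
  assumes "prime p" "p mod 3 = 1"
  obtains chi where "cubic_char p chi"
proof -
  define q where "q = nat p"
  have "prime q" using assms(1) prime_int_nat_transfer unfolding q_def by blast
  moreover have "int q = p" using prime_gt_0_int[OF assms(1)] by (simp add: q_def)
  ultimately have q: "prime q" "int q = p" .
  have q1: "q > 1" using q prime_gt_1_nat by blast
  obtain g where "residue_primroot q g" using prime_primitive_root_exists[of q] q q1 by blast
  then have bij: "bij_betw (\<lambda>i. g ^ i mod q) {..<q - 1} (totatives q)"
    using residue_primroot_is_generator[of q g] q q1 by (simp add: totient_prime)
  have copg: "coprime q g" using \<open>residue_primroot q g\<close> by (simp add: residue_primroot_def)
  have ordg: "ord q g = q - 1" using \<open>residue_primroot q g\<close> q by (simp add: residue_primroot_def totient_prime)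
  have pd: "3 dvd q - 1"
  proof -
    have "int q mod 3 = 1" using assms q by simp
    then have "q mod 3 = 1" by presburger
    then show ?thesis using mod_eq_dvd_iff_nat[of 1 q 3] q1 by (simp add: mod_eq_dvd_iff_nat)
  qed
  have ex: "\<exists>i. [int g ^ i = x] (mod p)" if "\<not> p dvd x" for x
  proof -
    have "x mod p \<noteq> 0" using that by (simp add: dvd_eq_mod_eq_0)
    moreover have "x mod p \<ge> 0" "x mod p < p" using q q1 by simp_all
    ultimately have "nat (x mod p) > 0" "nat (x mod p) < q" using q by (auto simp: nat_less_iff)
    then have "nat (x mod p) \<in> totatives q"
      using q by (auto simp: totatives_prime)
    then obtain i where "nat (x mod p) = g ^ i mod q" using bij_betw_imp_surj_on[OF bij] by blast
    then have "g ^ i mod q = nat (x mod p)" by simp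
    then have "int (g ^ i mod q) = x mod p" using q1 q by (simp add: q_def)
    then have "int g ^ i mod p = x mod p" using q by (simp add: zmod_int)
    then show ?thesis by (auto simp: unique_euclidean_semiring_class.cong_def)
  qed
  have uniq: "i mod 3 = j mod 3" if "[int g ^ i = int g ^ j] (mod p)" for i j
  proof -
    have "[g ^ i = g ^ j] (mod q)" using that q by (metis cong_int_iff of_nat_power)
    then have "[i = j] (mod (q - 1))" using copg ordg order_divides_expdiff[of q g i j] by simp
    then have "[i = j] (mod 3)" using pd cong_dvd_modulus_nat by blast
    then show ?thesis by (simp add: unique_euclidean_semiring_class.cong_def)
  qed
  define lg where "lg x = (SOME i. [int g ^ i = x] (mod p))" for x
  have lg: "[int g ^ lg x = x] (mod p)" if "\<not> p dvd x" for x
    unfolding lg_def using someI_ex[OF ex[OF that]] .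
  define chi where "chi x = (if p dvd x then 0 else omega ^ lg x)" for x
  have chi_g: "chi x = omega ^ i" if "[int g ^ i = x] (mod p)" "\<not> p dvd x" for x i
  proof -
    have "[int g ^ lg x = int g ^ i] (mod p)" using lg[OF that(2)] that(1) by (metis cong_sym cong_trans)
    then show ?thesis using that uniq by (simp add: chi_def omega_power_eq_iff)
  qed
  have ng: "\<not> p dvd int g"
  proof
    assume "p dvd int g"
    then have "q dvd g" using q by (metis of_nat_dvd_iff)
    then show False using copg q1 by (auto simp: coprime_absorb_left)
  qed
  have "cubic_char p chi"
  proof
    fix x y
    show "prime p" by fact
    show "p dvd x \<Longrightarrow> chi x = 0" by (simp add: chi_def)
    show "chi (x mod p) = chi x"
    proof (cases "p dvd x")
      case False
      then have "[int g ^ lg x = x mod p] (mod p)" using lg[OF False] by (simp add: unique_euclidean_semiring_class.cong_def)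
      from chi_g[OF this] chi_g[OF lg[OF False] False] False show ?thesis by (simp add: dvd_mod_iff)
    qed (simp add: chi_def dvd_mod_iff)
    show "chi (x * y) = chi x * chi y"
    proof (cases "p dvd x \<or> p dvd y")
      case True then show ?thesis by (auto simp: chi_def)
    next
      case False
      then have n: "\<not> p dvd x * y" using assms prime_dvd_mult_iff by blast
      have "[int g ^ (lg x + lg y) = x * y] (mod p)"
        unfolding power_add using False by (intro cong_mult lg) auto
      from chi_g[OF this n] False show ?thesis by (simp add: chi_def power_add)
    qed
    show "chi x ^ 3 = 1" if "\<not> p dvd x"
      using that by (simp add: chi_def power_mult[symmetric] mult.commute[of _ 3]) (simp add: power_mult)
    show "\<exists>y. [y ^ 3 = x] (mod p)" if "chi x = 1"
    proof -
      have n: "\<not> p dvd x" using that by (auto simp: chi_def)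
      then have "omega ^ lg x = omega ^ 0" using that by (simp add: chi_def)
      then have "lg x mod 3 = 0" unfolding omega_power_eq_iff by simp
      then have "lg x = lg x div 3 * 3" by auto
      then have "int g ^ lg x = (int g ^ (lg x div 3)) ^ 3" by (metis power_mult)
      then show ?thesis using lg[OF n] by metis
    qed
    have "chi (int g) = omega ^ 1" by (rule chi_g) (use ng in auto)
    then show "\<exists>x. \<not> p dvd x \<and> chi x \<noteq> 1" using ng by (intro exI[of _ "int g"]) simp
  qed
  then show thesis by (rule that)
qed

section \<open>The cubic residue symbol and cubic reciprocity\<close>

lemma of_nat_dvd_mono: "m dvd n \<Longrightarrow> (of_nat m :: 'a :: comm_semiring_1) dvd of_nat n"
  by (auto simp: dvd_def)

lemma frobenius_add:
  fixes a b :: "'a :: comm_ring_1"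
  assumes "prime l"
  shows "\<exists>c. (a + b) ^ l = a ^ l + b ^ l + of_nat l * c"
proof -
  have l: "l > 1" using assms prime_gt_1_nat by blast
  have "of_nat l dvd (of_nat (l choose k) * a ^ k * b ^ (l - k) :: 'a)" if "k \<in> {1..<l}" for k
  proof -
    have "l dvd (l choose k)" using that assms by (intro dvd_choose_prime) auto
    then have "(of_nat l :: 'a) dvd of_nat (l choose k)" by (rule of_nat_dvd_mono)
    then show ?thesis by (simp add: mult.assoc)
  qed
  then have "of_nat l dvd (\<Sum>k\<in>{1..<l}. of_nat (l choose k) * a ^ k * b ^ (l - k) :: 'a)"
    by (rule dvd_sum)
  then obtain c where c: "(\<Sum>k\<in>{1..<l}. of_nat (l choose k) * a ^ k * b ^ (l - k) :: 'a) = of_nat l * c" unfolding dvd_def by blast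
  have "{..l} = insert 0 (insert l {1..<l})" using l by auto
  then have "(a + b) ^ l = a ^ l + b ^ l + (\<Sum>k\<in>{1..<l}. of_nat (l choose k) * a ^ k * b ^ (l - k))"
    unfolding binomial_ring using l by simp
  with c show ?thesis by auto
qed

lemma frobenius_sum:
  fixes f :: "'b \<Rightarrow> 'a :: comm_ring_1"
  assumes "prime l" "finite A"
  shows "\<exists>c. (\<Sum>x\<in>A. f x) ^ l = (\<Sum>x\<in>A. f x ^ l) + of_nat l * c"
  using assms(2)
proof (induction A rule: finite_induct)
  case empty
  have "l > 0" using assms prime_gt_0_nat by blast
  then show ?case by (intro exI[of _ 0]) (simp add: power_0_left)
next
  case (insert x A)
  obtain c where c: "(\<Sum>x\<in>A. f x) ^ l = (\<Sum>x\<in>A. f x ^ l) + of_nat l * c" using insert.IH by blast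
  obtain d where d: "(f x + (\<Sum>x\<in>A. f x)) ^ l = f x ^ l + (\<Sum>x\<in>A. f x) ^ l + of_nat l * d"
    using frobenius_add[OF assms(1)] by blast
  show ?case
    using insert.hyps c d by (intro exI[of _ "c + d"]) (simp add: algebra_simps)
qed

text \<open>The exponent \<open>l ^ 2\<close> is 1 modulo 3 for every prime \<open>l\<close> other
  than 3, so it fixes \<open>omega\<close> and all character values whether \<open>l\<close> splits
  or not.\<close>

lemma frobenius_sum_sq:
  fixes f :: "'b \<Rightarrow> 'a :: comm_ring_1"
  assumes "prime l" "finite A"
  shows "\<exists>c. (\<Sum>x\<in>A. f x) ^ (l ^ 2) = (\<Sum>x\<in>A. f x ^ (l ^ 2)) + of_nat l * c"
proof -
  obtain c where c: "(\<Sum>x\<in>A. f x) ^ l = (\<Sum>x\<in>A. f x ^ l) + of_nat l * c"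
    using frobenius_sum[OF assms] by blast
  obtain d where d: "((\<Sum>x\<in>A. f x ^ l) + of_nat l * c) ^ l = (\<Sum>x\<in>A. f x ^ l) ^ l + (of_nat l * c) ^ l + of_nat l * d"
    using frobenius_add[OF assms(1)] by blast
  obtain e where e: "(\<Sum>x\<in>A. f x ^ l) ^ l = (\<Sum>x\<in>A. (f x ^ l) ^ l) + of_nat l * e"
    using frobenius_sum[OF assms] by blast
  have "l > 0" using assms prime_gt_0_nat by blast
  then have "of_nat l dvd (of_nat l * c) ^ l" by (intro dvd_trans[OF _ dvd_power]) auto
  then obtain g where g: "(of_nat l * c) ^ l = of_nat l * g" unfolding dvd_def by blast
  have "(\<Sum>x\<in>A. f x) ^ (l ^ 2) = ((\<Sum>x\<in>A. f x) ^ l) ^ l"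
    by (simp add: power2_eq_square power_mult)
  also have "\<dots> = (\<Sum>x\<in>A. (f x ^ l) ^ l) + of_nat l * (e + g + d)"
    unfolding c d e g by (simp add: algebra_simps)
  finally show ?thesis by (auto simp: power2_eq_square power_mult)
qed

lemma sq_mod_3:
  assumes "prime (l::nat)" "l \<noteq> 3"
  shows "l ^ 2 = 1 + 3 * ((l ^ 2 - 1) div 3)" "(l ^ 2) mod 3 = 1"
proof -
  have "\<not> 3 dvd l" using assms primes_dvd_imp_eq[of 3 l] by auto
  then have "l mod 3 = 1 \<or> l mod 3 = 2" by presburger
  then have "(l mod 3) ^ 2 mod 3 = 1" by auto
  then show *: "(l ^ 2) mod 3 = 1" by (simp add: power_mod)
  then show "l ^ 2 = 1 + 3 * ((l ^ 2 - 1) div 3)"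
    by (metis add_diff_cancel_left' div_mult_mod_eq mult.commute add.commute mult_div_mod_eq nonzero_mult_div_cancel_left zero_neq_numeral)
qed

section \<open>Gauss sums\<close>

context cubic_char
begin

text \<open>The Gauss sum is treated as an element of \<open>\<int>[\<omega>][X]\<close> modulo \<open>X^p - 1\<close>, so that no root of
  unity of order \<open>p\<close> has to be adjoined.\<close>

definition chipoly :: "(int \<Rightarrow> eis) \<Rightarrow> eis poly" where
  "chipoly f = (\<Sum>x\<in>R. monom (f x) (nat x))"

definition xp :: "eis poly" where "xp = monom 1 (nat p) - 1"

definition peq :: "eis poly \<Rightarrow> eis poly \<Rightarrow> bool" (infix "\<approxeq>" 50) where "A \<approxeq> C \<longleftrightarrow> xp dvd A - C"

lemma peq_refl: "A \<approxeq> A" by (simp add: peq_def)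
lemma peq_trans [trans]: "A \<approxeq> C \<Longrightarrow> C \<approxeq> D \<Longrightarrow> A \<approxeq> D"
  using dvd_add[of xp "A - C" "C - D"] by (simp add: peq_def)
lemma peq_eq_trans [trans]: "A = C \<Longrightarrow> C \<approxeq> D \<Longrightarrow> A \<approxeq> D" "A \<approxeq> C \<Longrightarrow> C = D \<Longrightarrow> A \<approxeq> D" by auto
lemma peq_mult: assumes "A \<approxeq> C" shows "A * D \<approxeq> C * D"
  using assms unfolding peq_def left_diff_distrib[symmetric] by simp
lemma peq_mult_left: assumes "A \<approxeq> C" shows "D * A \<approxeq> D * C"
  using peq_mult[OF assms, of D] by (simp add: mult.commute)
lemma peq_sum: assumes "\<And>i. i \<in> I \<Longrightarrow> f i \<approxeq> g i" shows "(\<Sum>i\<in>I. f i) \<approxeq> (\<Sum>i\<in>I. g i)"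
  using assms unfolding peq_def sum_subtractf[symmetric] by (intro dvd_sum) auto

lemma peq_monom: assumes "x \<ge> 0" shows "monom c (nat x) \<approxeq> monom c (nat (x mod p))"
proof -
  have "monom 1 (nat p * k) - 1 = xp * (\<Sum>i<k. monom 1 (nat p) ^ i)" for k
    unfolding xp_def using power_diff_1_eq[of "monom (1::eis) (nat p)" k] by (simp add: monom_power)
  then have d: "xp dvd monom 1 (nat p * k) - 1" for k by simp
  have "x = p * (x div p) + x mod p" by simp
  then have "nat x = nat p * nat (x div p) + nat (x mod p)"
    using assms p_gt_1 by (metis nat_add_distrib nat_mult_distrib pos_imp_zdiv_nonneg_iff pos_mod_sign mult_nonneg_nonneg order_less_imp_le less_trans zero_less_one)
  then have "monom c (nat x) - monom c (nat (x mod p)) = monom c (nat (x mod p)) * (monom 1 (nat p * nat (x div p)) - 1)"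
    by (simp add: algebra_simps mult_monom)
  then show ?thesis using d by (simp add: peq_def)
qed

lemma chipoly_mult:
  assumes "\<And>x. f (x mod p) = f x" "\<And>x. g (x mod p) = g x"
  shows "chipoly f * chipoly g \<approxeq> chipoly (\<lambda>n. \<Sum>u\<in>R. f u * g (n - u))"
proof -
  have "chipoly f * chipoly g = (\<Sum>u\<in>R. \<Sum>v\<in>R. monom (f u * g v) (nat (u + v)))"
    unfolding chipoly_def sum_product by (intro sum.cong refl) (simp add: mult_monom nat_add_distrib)
  also have "\<dots> \<approxeq> (\<Sum>u\<in>R. \<Sum>v\<in>R. monom (f u * g v) (nat ((u + v) mod p)))"
    by (intro peq_sum peq_monom) auto
  also have "\<dots> = (\<Sum>u\<in>R. \<Sum>n\<in>R. monom (f u * g (n - u)) (nat n))"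
  proof (rule sum.cong)
    fix u
    have gd: "g (n mod p - u) = g (n - u)" for n by (metis assms(2) mod_diff_left_eq)
    have "(\<Sum>n\<in>R. monom (f u * g (n - u)) (nat n)) = (\<Sum>n\<in>R. monom (f u * g (n - u)) (nat (n mod p)))"
      by (intro sum.cong refl) simp
    also have "\<dots> = (\<Sum>v\<in>R. monom (f u * g ((v + u) - u)) (nat ((v + u) mod p)))"
      by (rule sum_shift[symmetric]) (simp add: gd)
    finally show "(\<Sum>v\<in>R. monom (f u * g v) (nat ((u + v) mod p))) = (\<Sum>n\<in>R. monom (f u * g (n - u)) (nat n))"
      by (simp add: add.commute)
  qed simp
  also have "\<dots> = (\<Sum>n\<in>R. \<Sum>u\<in>R. monom (f u * g (n - u)) (nat n))" by (rule sum.swap)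
  also have "\<dots> = chipoly (\<lambda>n. \<Sum>u\<in>R. f u * g (n - u))"
    by (simp add: chipoly_def monom_sum)
  finally show ?thesis .
qed

lemma chipoly_smult: "chipoly (\<lambda>n. c * f n) = [:c:] * chipoly f"
  unfolding chipoly_def sum_distrib_left by (intro sum.cong refl) (simp add: smult_monom)

text \<open>The classical \<open>g ^ 3 = p * J\<close> fails modulo \<open>X^p - 1\<close>, where
  the sum \<open>S\<close> of all powers of \<open>X\<close> is not 0. But \<open>S\<close>
  annihilates \<open>chipoly chi\<close>, so the identity holds after multiplication by one more
  \<open>g\<close>.\<close>

lemma gauss_sum_4: "chipoly chi ^ 4 \<approxeq> [:of_int p * J:] * chipoly chi"
proof -
  define S where "S = chipoly (\<lambda>_. 1)"
  have 1: "chipoly chi * chipoly chi \<approxeq> [:J:] * chipoly bar"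
  proof -
    have "chipoly chi * chipoly chi \<approxeq> chipoly (\<lambda>n. \<Sum>u\<in>R. chi u * chi (n - u))"
      by (rule chipoly_mult) (simp_all add: chi_mod)
    also have "\<dots> = [:J:] * chipoly bar" by (simp only: conv_chi_chi chipoly_smult)
    finally show ?thesis .
  qed
  have B: "chipoly B = [:of_int p:] - S"
  proof -
    have "chipoly B = (\<Sum>x\<in>R. (if x = 0 then monom (of_int p) 0 else 0) - monom 1 (nat x))"
      unfolding chipoly_def by (intro sum.cong refl) (auto simp: B_def R_dvd_iff diff_monom[symmetric])
    then show ?thesis using p_gt_1 by (simp add: sum_subtractf S_def chipoly_def monom_0)
  qed
  have 2: "chipoly chi * chipoly bar \<approxeq> [:of_int p:] - S"
  proof -
    have "chipoly chi * chipoly bar \<approxeq> chipoly (\<lambda>n. \<Sum>u\<in>R. chi u * bar (n - u))"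
      by (rule chipoly_mult) (simp_all add: chi_mod bar_mod)
    also have "\<dots> = [:of_int p:] - S" by (simp only: conv_chi_bar B)
    finally show ?thesis .
  qed
  have 3: "S * chipoly chi \<approxeq> 0"
  proof -
    have "chipoly chi * S \<approxeq> chipoly (\<lambda>n. \<Sum>u\<in>R. chi u * 1)"
      unfolding S_def by (rule chipoly_mult) (simp_all add: chi_mod)
    also have "\<dots> = 0" by (simp add: sum_chi chipoly_def)
    finally show ?thesis by (simp add: mult.commute)
  qed
  have "chipoly chi ^ 4 = (chipoly chi * chipoly chi) * chipoly chi * chipoly chi"
    by (simp add: power4_eq_xxxx)
  also have "\<dots> \<approxeq> [:J:] * chipoly bar * chipoly chi * chipoly chi" by (intro peq_mult 1)
  also have "\<dots> = [:J:] * ((chipoly chi * chipoly bar) * chipoly chi)" by (simp add: algebra_simps)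
  also have "\<dots> \<approxeq> [:J:] * (([:of_int p:] - S) * chipoly chi)" by (intro peq_mult_left peq_mult 2)
  also have "\<dots> = [:of_int p * J:] * chipoly chi - [:J:] * (S * chipoly chi)" by (simp add: algebra_simps)
  also have "\<dots> \<approxeq> [:of_int p * J:] * chipoly chi - [:J:] * 0"
    using peq_mult_left[OF 3, of "[:- J:]"] by (simp add: peq_def)
  finally show ?thesis by simp
qed

lemma gauss_sum_power: "chipoly chi ^ (1 + 3 * k) \<approxeq> [:(of_int p * J) ^ k:] * chipoly chi"
proof (induction k)
  case 0
  then show ?case by (simp add: peq_refl)
next
  case (Suc k)
  have "chipoly chi ^ (1 + 3 * Suc k) = chipoly chi ^ (1 + 3 * k) * chipoly chi ^ 3"
    by (subst power_add[symmetric]) (simp add: algebra_simps)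
  also have "\<dots> \<approxeq> [:(of_int p * J) ^ k:] * chipoly chi * chipoly chi ^ 3" by (intro peq_mult Suc.IH)
  also have "\<dots> = [:(of_int p * J) ^ k:] * chipoly chi ^ 4" by (simp add: eval_nat_numeral)
  also have "\<dots> \<approxeq> [:(of_int p * J) ^ k:] * ([:of_int p * J:] * chipoly chi)" by (intro peq_mult_left gauss_sum_4)
  also have "\<dots> = [:(of_int p * J) ^ Suc k:] * chipoly chi" by (simp add: algebra_simps)
  finally show ?case .
qed

text \<open>Weighting coefficients by \<open>wt\<close> extracts the coefficient of \<open>X\<close> after reduction modulo \<open>X^p - 1\<close>.\<close>

definition wt :: "nat \<Rightarrow> eis" where "wt i = (if i mod nat p = 1 then 1 else 0)"

lemma wt_sum_xp:
  assumes "degree U + nat p \<le> N"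
  shows "(\<Sum>i\<le>N. coeff (xp * U) i * wt i) = 0"
proof -
  let ?p = "nat p"
  have "(\<Sum>i\<le>N. coeff (monom 1 ?p * U) i * wt i) = (\<Sum>i\<in>{?p..N}. coeff U (i - ?p) * wt i)"
    by (intro sum.mono_neutral_cong_right) (auto simp: coeff_monom_mult)
  also have "\<dots> = (\<Sum>j\<le>N - ?p. coeff U j * wt j)"
    using assms by (intro sum.reindex_bij_witness[of _ "\<lambda>j. j + ?p" "\<lambda>i. i - ?p"]) (auto simp: wt_def le_mod_geq)
  also have "\<dots> = (\<Sum>j\<le>N. coeff U j * wt j)"
    using assms by (intro sum.mono_neutral_left) (auto intro!: coeff_eq_0)
  finally show ?thesis by (simp add: xp_def left_diff_distrib sum_subtractf)
qed

lemma wt_sum_chipoly: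
  assumes "nat p \<le> N"
  shows "(\<Sum>i\<le>N. coeff ([:c:] * chipoly chi) i * wt i) = c"
proof -
  have co: "coeff (chipoly chi) i = (if i < nat p then chi (int i) else 0)" for i
  proof -
    have "coeff (chipoly chi) i = (\<Sum>x\<in>R. if x = int i then chi x else 0)"
      unfolding chipoly_def coeff_sum by (intro sum.cong refl) auto
    then show ?thesis using p_gt_1 by auto
  qed
  have "(\<Sum>i\<le>N. coeff ([:c:] * chipoly chi) i * wt i) = (\<Sum>i\<in>{1}. coeff ([:c:] * chipoly chi) i * wt i)"
    using assms p_gt_1 by (intro sum.mono_neutral_right) (auto simp: co wt_def)
  then show ?thesis using p_gt_1 by (simp add: co wt_def)
qed

text \<open>Two evaluations of \<open>chipoly chi ^ (l ^ 2)\<close>: as a power of the Gauss sum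
  modulo \<open>X^p - 1\<close>, and modulo \<open>l\<close> by Frobenius, which turns
  \<open>X^x\<close> into \<open>X^(l^2 x)\<close> and so produces the inverse of
  \<open>chi (l ^ 2)\<close>, that is, \<open>chi l\<close>. The coefficients of \<open>X\<close>
  are compared.\<close>

lemma reciprocity:
  assumes l: "prime (l::nat)" "l \<noteq> 3" "\<not> p dvd int l"
  shows "of_nat l dvd (of_int p * J) ^ ((l ^ 2 - 1) div 3) - chi (int l)"
proof -
  define e where "e = (l ^ 2 - 1) div 3"
  have le: "l ^ 2 = 1 + 3 * e" unfolding e_def using sq_mod_3[OF l(1,2)] by simp
  obtain V where V: "chipoly chi ^ (l ^ 2) = (\<Sum>x\<in>R. monom (chi x) (nat x) ^ (l ^ 2)) + of_nat l * V"
    unfolding chipoly_def using frobenius_sum_sq[OF l(1), of R] by auto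
  have cl: "chi (int l) * chi (int l) * chi (int l) = 1"
    using chi_cube[OF l(3)] by (simp add: power3_eq_cube)
  have cc: "chi x ^ (l ^ 2) = chi x" for x
    unfolding le by (cases "p dvd x") (simp_all add: chi_0 power_mult chi_cube)
  have "(\<Sum>x\<in>R. monom (chi x) (nat x) ^ (l ^ 2)) = (\<Sum>x\<in>R. monom (chi x) (nat (int l ^ 2 * x)))"
    by (intro sum.cong refl) (auto simp: monom_power cc nat_mult_distrib nat_power_eq mult.commute)
  also have "\<dots> \<approxeq> (\<Sum>x\<in>R. monom (chi x) (nat ((int l ^ 2 * x) mod p)))"
    by (intro peq_sum peq_monom) auto
  also have "\<dots> = (\<Sum>x\<in>R. monom (chi (int l) * chi (int l ^ 2 * x + 0)) (nat ((int l ^ 2 * x + 0) mod p)))"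
  proof (intro sum.cong refl arg_cong2[where f = monom])
    fix x
    have "chi (int l) * chi (int l ^ 2 * x + 0) = (chi (int l) * chi (int l) * chi (int l)) * chi x"
      by (simp add: chi_mult power2_eq_square algebra_simps)
    then show "chi x = chi (int l) * chi (int l ^ 2 * x + 0)" by (simp add: cl)
  qed simp
  also have "\<dots> = (\<Sum>y\<in>R. monom (chi (int l) * chi y) (nat (y mod p)))"
  proof (rule sum_affine)
    show "\<not> p dvd int l ^ 2" using l(3) prime_p prime_dvd_power by blast
  qed (simp add: chi_mod)
  also have "\<dots> = [:chi (int l):] * chipoly chi"
    unfolding chipoly_smult[symmetric] by (simp add: chipoly_def)
  finally have "(\<Sum>x\<in>R. monom (chi x) (nat x) ^ (l ^ 2)) \<approxeq> [:chi (int l):] * chipoly chi" .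
  then have "chipoly chi ^ (l ^ 2) - of_nat l * V \<approxeq> [:chi (int l):] * chipoly chi"
    unfolding V by simp
  then obtain U1 where U1: "chipoly chi ^ (l ^ 2) - of_nat l * V - [:chi (int l):] * chipoly chi = xp * U1"
    unfolding peq_def unfolding dvd_def by blast
  have "chipoly chi ^ (l ^ 2) \<approxeq> [:(of_int p * J) ^ e:] * chipoly chi"
    unfolding le by (rule gauss_sum_power)
  then obtain U2 where U2: "chipoly chi ^ (l ^ 2) - [:(of_int p * J) ^ e:] * chipoly chi = xp * U2"
    unfolding peq_def unfolding dvd_def by blast
  define U where "U = U1 - U2"
  define c where "c = (of_int p * J) ^ e - chi (int l)"
  have "[:c:] = [:(of_int p * J) ^ e:] - [:chi (int l):]" by (simp add: c_def)
  then have "[:c:] * chipoly chi = [:(of_int p * J) ^ e:] * chipoly chi - [:chi (int l):] * chipoly chi"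
    by (simp only: left_diff_distrib)
  also have "\<dots> = xp * U + of_nat l * V"
    by (simp only: U_def right_diff_distrib U1[symmetric] U2[symmetric]) simp
  finally have "[:c:] * chipoly chi = xp * U + of_nat l * V" .
  then have eq: "[:c:] * chipoly chi = xp * U + smult (of_nat l) V"
    by (simp add: of_nat_poly)
  define N where "N = degree U + nat p"
  have "c = (\<Sum>i\<le>N. coeff ([:c:] * chipoly chi) i * wt i)"
    by (subst wt_sum_chipoly) (auto simp: N_def)
  also have "\<dots> = (\<Sum>i\<le>N. coeff (xp * U) i * wt i + of_nat l * (coeff V i * wt i))"
    unfolding eq by (simp add: algebra_simps)
  also have "\<dots> = of_nat l * (\<Sum>i\<le>N. coeff V i * wt i)"
    using wt_sum_xp[of U N] by (simp add: sum.distrib sum_distrib_left N_def)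
  finally have "c = of_nat l * (\<Sum>i\<le>N. coeff V i * wt i)" .
  then show ?thesis unfolding c_def e_def by (metis dvd_triv_left)
qed

end

section \<open>The symbol of a rational prime other than 3\<close>

lemma eis_dvd_iff: "of_nat l dvd (x::eis) \<longleftrightarrow> int l dvd ec x \<and> int l dvd eo x"
proof
  assume "of_nat l dvd x"
  then show "int l dvd ec x \<and> int l dvd eo x" by (auto elim!: dvdE)
next
  assume "int l dvd ec x \<and> int l dvd eo x"
  then obtain a b where "ec x = int l * a" "eo x = int l * b" by (auto elim!: dvdE)
  then have "x = of_nat l * Eis a b" by (simp add: eis_eq_iff)
  then show "of_nat l dvd x" by simp
qed

lemma eis_dvd_of_int_mult:
  assumes "prime (l::nat)" "of_nat l dvd of_int n * (x::eis)" "\<not> int l dvd n"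
  shows "of_nat l dvd x"
  using assms unfolding eis_dvd_iff
  by (auto simp: prime_dvd_mult_iff)

text \<open>The symbol is defined on all of \<open>\<int>[\<omega>]\<close> by the condition that \<open>reciprocity\<close> imposes on
  \<open>chi l\<close>: for \<open>x = - J\<close>, the base \<open>x * x * econj x\<close> is \<open>- p * J\<close>.\<close>

definition resym_cond :: "nat \<Rightarrow> eis \<Rightarrow> eis \<Rightarrow> bool" where
  "resym_cond l x z \<longleftrightarrow> z \<in> {1, omega, omega ^ 2} \<and> of_nat l dvd (x * x * econj x) ^ ((l ^ 2 - 1) div 3) - z"

definition resym :: "nat \<Rightarrow> eis \<Rightarrow> eis" where
  "resym l x = (if int l dvd enorm x then 0 else THE z. resym_cond l x z)"

text \<open>Two distinct cube roots of unity differ by an element of norm 3, which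
  \<open>l ^ 2\<close> does not divide.\<close>

lemma resym_cond_unique:
  assumes "prime l" "l \<noteq> 3" "resym_cond l x z" "resym_cond l x z'"
  shows "z = z'"
proof (rule ccontr)
  assume "z \<noteq> z'"
  have "of_nat l dvd z - z'"
    using dvd_diff[of "of_nat l" "(x * x * econj x) ^ ((l ^ 2 - 1) div 3) - z'" "(x * x * econj x) ^ ((l ^ 2 - 1) div 3) - z"] assms
    by (simp add: resym_cond_def)
  then have "enorm (of_nat l) dvd enorm (z - z')" by (rule enorm_dvd)
  moreover have "enorm (z - z') = 3"
    using assms(3,4) \<open>z \<noteq> z'\<close> by (auto simp: resym_cond_def enorm_def omega_sq)
  ultimately have "int l ^ 2 dvd 3" by simp
  then have "int (l ^ 2) dvd int 3" by simp
  then have "l ^ 2 dvd 3" by (simp only: of_nat_dvd_iff)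
  then have "l dvd 3" by (metis dvd_trans dvd_triv_left power2_eq_square)
  then show False using assms primes_dvd_imp_eq[of l 3] by simp
qed

text \<open>Frobenius is applied to \<open>ec x + eo x * omega\<close>, with
  \<open>omega ^ (l ^ 2) = omega\<close>; split and inert \<open>l\<close> are treated
  alike.\<close>

lemma fermat_sq_eis:
  assumes "prime l" "l \<noteq> 3"
  shows "of_nat l dvd (x::eis) ^ (l ^ 2) - x"
proof -
  define A B where "A = ec x" and "B = eo x"
  have x: "x = of_int A + of_int B * omega"
    by (simp add: A_def B_def eis_eq_iff eis_sel_mult)
  define g :: "nat \<Rightarrow> eis" where "g i = (if i = 0 then of_int A else of_int B * omega)" for i
  have "(\<Sum>i<2. g i) = x" unfolding x by (simp add: numeral_2_eq_2 g_def)
  then obtain c where c: "x ^ (l ^ 2) = (\<Sum>i<2. g i ^ (l ^ 2)) + of_nat l * c"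
    using frobenius_sum_sq[OF assms(1), of "{..<2::nat}" g] by auto
  have w: "omega ^ (l ^ 2) = omega"
    using omega_power_mod[of "l ^ 2"] sq_mod_3[OF assms] by simp
  have g2: "(\<Sum>i<2. g i ^ n) = of_int (A ^ n) + of_int (B ^ n) * omega ^ n" for n
    by (simp add: numeral_2_eq_2 g_def power_mult_distrib)
  have "x ^ (l ^ 2) - x = (of_int (A ^ (l ^ 2)) + of_int (B ^ (l ^ 2)) * omega + of_nat l * c) - (of_int A + of_int B * omega)"
    unfolding c g2 w by (simp only: x[symmetric])
  then have e: "x ^ (l ^ 2) - x = of_int (A ^ (l ^ 2) - A) + of_int (B ^ (l ^ 2) - B) * omega + of_nat l * c"
    by (simp add: algebra_simps)
  have f: "int l dvd a ^ (l ^ 2) - a" for a :: int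
  proof -
    have "int l dvd b ^ l - b" for b :: int
    proof (cases "int l dvd b")
      case True
      then show ?thesis using assms prime_gt_0_nat[of l] by (intro dvd_diff dvd_trans[OF True dvd_power]) auto
    next
      case False
      define n where "n = nat (b mod int l)"
      have l0: "int l > 0" using assms prime_gt_0_nat by simp
      have n: "int n = b mod int l" using l0 by (simp add: n_def)
      have "\<not> l dvd n"
      proof
        assume "l dvd n"
        then have "int l dvd int n" by simp
        then show False using False l0 unfolding n by (simp add: dvd_mod_iff)
      qed
      then have "[n ^ (l - 1) = 1] (mod l)" using assms fermat_theorem by blast
      then have "[n * n ^ (l - 1) = n * 1] (mod l)" by (rule cong_scalar_left)
      moreover have "n * n ^ (l - 1) = n ^ l" using l0 by (metis Suc_pred' of_nat_0_less_iff power_Suc)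
      ultimately have "[n ^ l = n] (mod l)" by simp
      then have "[int (n ^ l) = int n] (mod int l)" by (simp only: cong_int_iff)
      then have "[(b mod int l) ^ l = b mod int l] (mod int l)" by (simp add: n)
      then have "[b ^ l = b] (mod int l)" by (simp add: unique_euclidean_semiring_class.cong_def power_mod)
      then show ?thesis by (simp add: cong_iff_dvd_diff)
    qed
    from dvd_add[OF this[of "a ^ l"] this[of a]] show ?thesis
      by (simp add: power2_eq_square power_mult)
  qed
  have "of_nat l dvd (of_int (A ^ (l ^ 2) - A) :: eis)" "of_nat l dvd (of_int (B ^ (l ^ 2) - B) :: eis)"
    unfolding eis_dvd_iff eis_sel_of_int using f by simp_all
  then show ?thesis unfolding e by (intro dvd_add dvd_mult2) auto
qed

text \<open>Modulo \<open>l\<close> one has \<open>y ^ 3 = 1\<close> and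
  \<open>y * econj y = 1\<close>. For inert \<open>l\<close> the residue ring is a field and the
  first equation leaves only powers of \<open>omega\<close>; for split \<open>l\<close> it is a
  product of two fields that may have nine cube roots of unity, and the second equation, as
  conjugation swaps the factors, selects the powers of \<open>omega\<close>. The proof handles both
  cases in coordinates.\<close>

lemma resym_cond_exists:
  assumes "prime l" "l \<noteq> 3" "\<not> int l dvd enorm x"
  shows "\<exists>z. resym_cond l x z"
proof -
  define e where "e = (l ^ 2 - 1) div 3"
  define y where "y = (x * x * econj x) ^ e"
  have le: "l ^ 2 = 1 + 3 * e" unfolding e_def using sq_mod_3[OF assms(1,2)] by simp
  have f: "of_nat l dvd t ^ (3 * e) - 1" if "enorm t = enorm x \<or> enorm t = enorm x ^ 2" for t
  proof -
    have "\<not> int l dvd enorm t" using assms that prime_dvd_power by (metis prime_nat_int_transfer)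
    have "of_nat l dvd t * (t ^ (3 * e) - 1)"
      using fermat_sq_eis[OF assms(1,2), of t] unfolding le by (simp add: algebra_simps)
    then have "of_nat l dvd econj t * (t * (t ^ (3 * e) - 1))" by (rule dvd_mult)
    also have "econj t * (t * (t ^ (3 * e) - 1)) = of_int (enorm t) * (t ^ (3 * e) - 1)"
      by (simp add: mult_econj[symmetric] algebra_simps)
    finally show ?thesis using eis_dvd_of_int_mult[OF assms(1)] \<open>\<not> int l dvd enorm t\<close> by blast
  qed
  have mul1: "of_nat l dvd a * b - 1" if "of_nat l dvd a - 1" "of_nat l dvd b - 1" for a b :: eis
  proof -
    have "a * b - 1 = a * (b - 1) + (a - 1)" by (simp add: algebra_simps)
    then show ?thesis using that by (metis dvd_add dvd_mult)
  qed
  have fx: "of_nat l dvd x ^ (3 * e) - 1" "of_nat l dvd econj x ^ (3 * e) - 1" by (rule f, simp)+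
  have y3: "of_nat l dvd y ^ 3 - 1"
  proof -
    have "y ^ 3 = x ^ (3 * e) * x ^ (3 * e) * econj x ^ (3 * e)"
      by (simp add: y_def power_mult_distrib power_mult[symmetric] mult.commute)
    then show ?thesis using fx mul1 by metis
  qed
  have yy: "of_nat l dvd y * econj y - 1"
  proof -
    have "y * econj y = (x * econj x) ^ (3 * e)"
      by (simp add: y_def power_mult power_mult_distrib[symmetric]) (simp add: power3_eq_cube algebra_simps)
    also have "\<dots> = of_int (enorm x) ^ (3 * e)" by (simp add: mult_econj)
    finally show ?thesis using f[of "of_int (enorm x)"] by simp
  qed
  define c d where "c = ec y" and "d = eo y"
  \<comment> \<open>Modulo \<open>l\<close> the conjugate of \<open>y\<close> is
    \<open>y ^ 2\<close>, so the integer \<open>1 + y + econj y\<close> annihilates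
    \<open>y - 1\<close>. Either \<open>y\<close> is 1 or this integer vanishes modulo
    \<open>l\<close>.\<close>
  have t: "of_int (1 + 2 * c - d) = 1 + y + econj y" by (simp add: eis_eq_iff c_def d_def)
  have "of_int (1 + 2 * c - d) * (y - 1) = (y ^ 3 - 1) + (y - 1) * (econj y - y * y)"
    unfolding t by (simp add: power3_eq_cube algebra_simps)
  moreover have "of_nat l dvd econj y - y * y"
  proof -
    have "econj y - y * y = y * y * (y * econj y - 1) - econj y * (y ^ 3 - 1)"
      by (simp add: power3_eq_cube algebra_simps)
    then show ?thesis using y3 yy by (metis dvd_diff dvd_mult)
  qed
  ultimately have "of_nat l dvd of_int (1 + 2 * c - d) * (y - 1)"
    using y3 by (metis dvd_add dvd_mult)
  then consider "of_nat l dvd y - 1" | "int l dvd 1 + 2 * c - d"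
    using eis_dvd_of_int_mult[OF assms(1)] by blast
  then show ?thesis
  proof cases
    case 1
    then show ?thesis by (intro exI[of _ 1]) (simp add: resym_cond_def y_def e_def)
  next
    case 2
    have "of_nat l dvd (of_int (enorm y) - 1 :: eis)" using yy by (simp add: mult_econj)
    then have "int l dvd enorm y - 1" by (simp add: eis_dvd_iff)
    \<comment> \<open>With \<open>d = 1 + 2 * c\<close> modulo \<open>l\<close> the norm condition
      becomes \<open>3 * c * (c + 1) = 0\<close>: here \<open>c = 0\<close> gives
      \<open>omega\<close> and \<open>c = - 1\<close> gives \<open>omega ^ 2\<close>.\<close>
    moreover have "enorm y - 1 = 3 * (c * (c + 1)) - (1 + 2 * c - d) * (c + d + 1)"
      by (simp add: enorm_def c_def d_def power2_eq_square algebra_simps)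
    ultimately have "int l dvd 3 * (c * (c + 1))"
      using 2 by (metis dvd_add_left_iff dvd_mult2 diff_add_cancel dvd_diff_left_iff)
    moreover have "\<not> int l dvd 3"
    proof
      assume "int l dvd 3"
      then have "l dvd 3" by (metis of_nat_dvd_iff of_nat_numeral)
      then show False using assms primes_dvd_imp_eq[of l 3] by simp
    qed
    ultimately have "int l dvd c \<or> int l dvd c + 1"
      using assms(1) by (metis prime_dvd_mult_iff prime_nat_int_transfer)
    then show ?thesis
    proof
      assume c: "int l dvd c"
      then have "int l dvd d - 1" using 2 by (metis add_diff_eq diff_diff_eq2 dvd_diff_commute dvd_mult add.commute diff_add_eq dvd_add_left_iff)
      then have "of_nat l dvd y - omega" using c by (simp add: eis_dvd_iff c_def d_def)
      then show ?thesis by (intro exI[of _ omega]) (simp add: resym_cond_def y_def e_def)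
    next
      assume c: "int l dvd c + 1"
      have "d + 1 = 2 * (c + 1) - (1 + 2 * c - d)" by simp
      then have "int l dvd d + 1" using 2 c by (metis dvd_diff dvd_mult)
      then have "of_nat l dvd y - omega ^ 2" using c by (simp add: eis_dvd_iff c_def d_def omega_sq)
      then show ?thesis by (intro exI[of _ "omega ^ 2"]) (simp add: resym_cond_def y_def e_def)
    qed
  qed
qed

lemma resym_eqI:
  assumes "prime l" "l \<noteq> 3" "\<not> int l dvd enorm x" "resym_cond l x z"
  shows "resym l x = z"
  unfolding resym_def using assms resym_cond_unique[OF assms(1,2)] by (auto intro!: the_equality)

lemma resym_cond_resym:
  assumes "prime l" "l \<noteq> 3" "\<not> int l dvd enorm x"
  shows "resym_cond l x (resym l x)"
  using resym_cond_exists[OF assms] resym_eqI[OF assms] by blast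

lemma mu3_cube: "z \<in> {1, omega, omega ^ 2} \<Longrightarrow> z ^ 3 = 1"
  using omega_power_mod[of 6] by auto

lemma resym_cube:
  assumes "prime l" "l \<noteq> 3"
  shows "resym l x = 0 \<or> resym l x ^ 3 = 1"
proof (cases "int l dvd enorm x")
  case False
  then show ?thesis using resym_cond_resym[OF assms False] mu3_cube unfolding resym_cond_def by blast
qed (simp add: resym_def)

lemma resym_mult:
  assumes "prime l" "l \<noteq> 3"
  shows "resym l (x * y) = resym l x * resym l y"
proof (cases "int l dvd enorm x \<or> int l dvd enorm y")
  case True
  then show ?thesis by (auto simp: resym_def enorm_mult)
next
  case False
  define e where "e = (l ^ 2 - 1) div 3"
  have n: "\<not> int l dvd enorm (x * y)"
    using False assms(1) by (simp add: enorm_mult prime_dvd_mult_iff)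
  define u v where "u = (x * x * econj x) ^ e" and "v = (y * y * econj y) ^ e"
  have c: "resym_cond l x (resym l x)" "resym_cond l y (resym l y)"
    using False resym_cond_resym[OF assms] by auto
  have d: "of_nat l dvd u - resym l x" "of_nat l dvd v - resym l y"
    using c unfolding resym_cond_def u_def v_def e_def by auto
  have "u * v - resym l x * resym l y = u * (v - resym l y) + resym l y * (u - resym l x)"
    by (simp add: algebra_simps)
  then have "of_nat l dvd u * v - resym l x * resym l y" using d by simp
  moreover have "u * v = (x * y * (x * y) * econj (x * y)) ^ e"
  proof -
    have "u * v = ((x * x * econj x) * (y * y * econj y)) ^ e"
      by (simp only: u_def v_def power_mult_distrib)
    also have "(x * x * econj x) * (y * y * econj y) = x * y * (x * y) * econj (x * y)"
      by (simp add: algebra_simps)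
    finally show ?thesis .
  qed
  moreover have "resym l x * resym l y \<in> {1, omega, omega ^ 2}"
  proof -
    have "(resym l x * resym l y) ^ 3 = 1"
      using mu3_cube c unfolding resym_cond_def by (simp add: power_mult_distrib)
    then show ?thesis using eis_cube_root_unity by blast
  qed
  ultimately have "resym_cond l (x * y) (resym l x * resym l y)"
    unfolding resym_cond_def e_def by simp
  then show ?thesis by (rule resym_eqI[OF assms n])
qed

text \<open>Periodicity is visible from the defining congruence; together with
  \<open>resym_J\<close> it is cubic reciprocity for rational primes.\<close>

lemma resym_cong:
  assumes "of_nat l dvd x - y"
  shows "resym l x = resym l y"
proof -
  have cb: "of_nat l dvd econj x - econj y"
  proof -
    obtain c where "x - y = of_nat l * c" using assms unfolding dvd_def by blast
    then have "econj (x - y) = econj (of_nat l * c)" by simp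
    then show ?thesis by simp
  qed
  have m: "of_nat l dvd a * b - a' * b'" if "of_nat l dvd a - a'" "of_nat l dvd b - b'" for a b a' b' :: eis
  proof -
    have "a * b - a' * b' = a * (b - b') + b' * (a - a')" by (simp add: algebra_simps)
    then show ?thesis using that by simp
  qed
  have "of_nat l dvd (of_int (enorm x) - of_int (enorm y) :: eis)"
    unfolding mult_econj[symmetric] using m assms cb by blast
  then have "int l dvd enorm x - enorm y" by (simp add: eis_dvd_iff)
  then have "[enorm x = enorm y] (mod int l)" by (simp add: cong_iff_dvd_diff)
  then have n: "int l dvd enorm x \<longleftrightarrow> int l dvd enorm y" by (rule cong_dvd_iff)
  define e where "e = (l ^ 2 - 1) div 3"
  define u v where "u = (x * x * econj x) ^ e" and "v = (y * y * econj y) ^ e"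
  have "a - b dvd a ^ k - b ^ k" for a b :: eis and k
    by (simp add: power_diff_sumr2)
  moreover have "of_nat l dvd (x * x * econj x) - (y * y * econj y)" using m assms cb by blast
  ultimately have d: "of_nat l dvd u - v" unfolding u_def v_def using dvd_trans by blast
  have "of_nat l dvd u - z \<longleftrightarrow> of_nat l dvd v - z" for z
  proof -
    have "u - z = (u - v) + (v - z)" by simp
    then show ?thesis using d by (metis dvd_add_right_iff)
  qed
  then have "resym_cond l x = resym_cond l y"
    unfolding resym_cond_def fun_eq_iff u_def v_def e_def by blast
  then show ?thesis unfolding resym_def n by simp
qed

text \<open>The sign in \<open>- J\<close> has no effect on \<open>reciprocity\<close>: for odd
  \<open>l\<close> the exponent \<open>(l ^ 2 - 1) / 3\<close> is even, and for \<open>l = 2\<close>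
  signs do not matter modulo \<open>l\<close>.\<close>

lemma (in cubic_char) resym_J:
  assumes l: "prime (l::nat)" "l \<noteq> 3" "\<not> p dvd int l"
  shows "resym l (- J) = chi (int l)"
proof (rule resym_eqI[OF l(1,2)])
  have "\<not> int l dvd p"
    using l prime_p primes_dvd_imp_eq[of "int l" p] by auto
  then show "\<not> int l dvd enorm (- J)" by (simp add: enorm_J)
  have "of_nat l dvd (of_int p * - J) ^ ((l ^ 2 - 1) div 3) - chi (int l)"
  proof -
    have *: "(of_int p * - J) ^ k - chi (int l) = ((-1) ^ k - 1) * (of_int p * J) ^ k + ((of_int p * J) ^ k - chi (int l))" for k
      by (simp add: power_minus[of "of_int p * J"] algebra_simps)
    have "of_nat l dvd ((-1) ^ ((l ^ 2 - 1) div 3) - 1 :: eis)"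
    proof (cases "l = 2")
      case True then show ?thesis by simp
    next
      case False
      then have "odd l" using l(1) primes_dvd_imp_eq[of 2 l] by auto
      then have "odd (l ^ 2)" by simp
      then have "even ((l ^ 2 - 1) div 3)" using sq_mod_3[OF l(1,2)] by presburger
      then show ?thesis by simp
    qed
    then show ?thesis unfolding * using reciprocity[OF l] by simp
  qed
  moreover have JJ: "(- J) * (- J) * econj (- J) = of_int p * - J"
    unfolding J_norm[symmetric] by (simp add: algebra_simps)
  moreover have "chi (int l) \<in> {1, omega, omega ^ 2}" using chi_values[OF l(3)] by auto
  ultimately show "resym_cond l (- J) (chi (int l))" unfolding resym_cond_def JJ by blast
qed

section \<open>The symbol of 3 and of composite numbers\<close>

text \<open>The formula is read off from \<open>chi_3\<close>. It depends on \<open>x\<close> modulo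
  9, which is where the factor 9 of the modulus comes from.\<close>

definition sym3 :: "eis \<Rightarrow> eis" where "sym3 x = omega ^ nat ((eo x div 3) mod 3)"

definition sym :: "nat \<Rightarrow> eis \<Rightarrow> eis" where "sym l x = (if l = 3 then sym3 x else resym l x)"

lemma sym3_mult:
  assumes "prim x" "prim y"
  shows "sym3 (x * y) = sym3 x * sym3 y"
proof -
  from assms obtain u v where uv: "x = 1 + 3 * u" "y = 1 + 3 * v" by (auto simp: prim_alt)
  have "x * y = 1 + 3 * (u + v + 3 * (u * v))" unfolding uv by (simp add: algebra_simps)
  then have "eo (x * y) = 3 * (eo u + eo v + 3 * eo (u * v))" by simp
  then have "eo (x * y) div 3 = eo u + eo v + 3 * eo (u * v)" by simp
  then have e: "eo (x * y) div 3 mod 3 = (eo u mod 3 + eo v mod 3) mod 3" by presburger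
  have e2: "eo x div 3 = eo u" "eo y div 3 = eo v" by (simp_all add: uv)
  have "eo u mod 3 \<in> {0, 1, 2}" "eo v mod 3 \<in> {0, 1, 2}" by auto
  then have "nat ((eo u mod 3 + eo v mod 3) mod 3) mod 3 = (nat (eo u mod 3) + nat (eo v mod 3)) mod 3"
    by auto
  then show ?thesis unfolding sym3_def e e2 power_add[symmetric] omega_power_eq_iff .
qed

lemma sym_mult: assumes "prime l" "prim x" "prim y" shows "sym l (x * y) = sym l x * sym l y"
  using assms sym3_mult resym_mult by (simp add: sym_def)

lemma sym_cube: assumes "prime l" shows "sym l x = 0 \<or> sym l x ^ 3 = 1"
  using resym_cube[OF assms] by (auto simp: sym_def sym3_def power_mult[symmetric] mult.commute[of _ 3]) (simp add: power_mult)

lemma sym_cong: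
  assumes "of_nat (9 * l) dvd x - y"
  shows "sym l x = sym l y"
proof (cases "l = 3")
  case True
  obtain c where "x - y = of_nat (9 * l) * c" using assms unfolding dvd_def by blast
  then have "eo x - eo y = eo (of_nat (9 * l) * c)" by (metis eis_sel(8))
  then have "eo x = eo y + 27 * eo c" unfolding eis_sel_of_int_mult using True by simp
  then have "eo x = eo y + (9 * eo c) * 3" by simp
  then have "eo x div 3 = eo y div 3 + (3 * eo c) * 3" by simp
  then have "eo x div 3 mod 3 = eo y div 3 mod 3" by (metis mod_mult_self1)
  then show ?thesis using True by (simp add: sym_def sym3_def)
next
  case False
  have "of_nat l dvd x - y" using assms by (metis dvd_trans dvd_triv_right of_nat_mult)
  then show ?thesis using False resym_cong by (simp add: sym_def)
qed

lemma (in cubic_char) sym_J: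
  assumes "prime (l::nat)" "\<not> p dvd int l"
  shows "sym l (- J) = chi (int l)"
  using resym_J[OF assms(1) _ assms(2)] chi_3 by (simp add: sym_def sym3_def)

text \<open>The cubic residue symbol of \<open>a\<close> modulo \<open>x\<close> in the sense of
  \<open>csym_J\<close>, but defined through residues of \<open>x\<close> at the primes of
  \<open>a\<close>; so it is multiplicative and periodic in \<open>x\<close> without further
  reciprocity laws.\<close>

definition csym :: "nat \<Rightarrow> eis \<Rightarrow> eis" where
  "csym a x = (\<Prod>l\<in>prime_factors a. sym l x ^ multiplicity l a)"

lemma csym_mult: assumes "prim x" "prim y" shows "csym a (x * y) = csym a x * csym a y"
  unfolding csym_def prod.distrib[symmetric]
  by (intro prod.cong refl) (simp add: sym_mult assms power_mult_distrib in_prime_factors_iff)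

lemma csym_cube: "csym a x = 0 \<or> csym a x ^ 3 = 1"
proof (cases "\<exists>l\<in>prime_factors a. sym l x = 0")
  case True
  then obtain l where l: "l \<in> prime_factors a" "sym l x = 0" by blast
  then have "sym l x ^ multiplicity l a = 0" by (auto simp: prime_factors_multiplicity)
  then have "csym a x = 0"
    unfolding csym_def using l by (intro prod_zero) auto
  then show ?thesis ..
next
  case False
  have "csym a x ^ 3 = (\<Prod>l\<in>prime_factors a. (sym l x ^ multiplicity l a) ^ 3)"
    unfolding csym_def by (rule prod_power_distrib)
  also have "\<dots> = (\<Prod>l\<in>prime_factors a. (sym l x ^ 3) ^ multiplicity l a)"
    by (simp add: power_mult[symmetric] mult.commute)
  also have "\<dots> = (\<Prod>l\<in>prime_factors a. 1)"
  proof (rule prod.cong)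
    fix l assume l: "l \<in> prime_factors a"
    then have "prime l" by (simp add: in_prime_factors_iff)
    then have "sym l x ^ 3 = 1" using False l sym_cube by blast
    then show "(sym l x ^ 3) ^ multiplicity l a = 1" by simp
  qed simp
  finally show ?thesis by simp
qed

lemma csym_cong:
  assumes "of_nat (9 * a) dvd x - y" "a > 0"
  shows "csym a x = csym a y"
  unfolding csym_def
proof (intro prod.cong refl arg_cong2[where f = "(^)"] sym_cong)
  fix l assume "l \<in> prime_factors a"
  then have "9 * l dvd 9 * a" by (simp add: in_prime_factors_iff)
  then show "of_nat (9 * l) dvd x - y" using assms dvd_trans of_nat_dvd_mono by blast
qed

lemma csym_1 [simp]: "csym a 1 = 1"
proof -
  have "csym a 1 * csym a 1 = csym a 1" using csym_mult[of 1 1 a] by simp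
  moreover have "sym l 1 \<noteq> 0" if "prime l" for l
  proof (cases "l = 3")
    case False
    have "\<not> int l dvd enorm 1" using that by auto
    from resym_cond_resym[OF that False this] show ?thesis using False
      by (auto simp: sym_def resym_cond_def)
  qed (simp add: sym_def sym3_def)
  then have "csym a 1 \<noteq> 0" unfolding csym_def by (auto simp: in_prime_factors_iff)
  ultimately show ?thesis by simp
qed

lemma (in cubic_char) csym_J:
  assumes "\<not> p dvd int a" "a > 0"
  shows "csym a (- J) = chi (int a)"
proof -
  have pr: "chi (\<Prod>v\<in>A. g v) = (\<Prod>v\<in>A. chi (g v))" for A and g :: "nat \<Rightarrow> int"
    by (induction A rule: infinite_finite_induct) (auto simp: chi_mult)
  have "csym a (- J) = (\<Prod>l\<in>prime_factors a. chi (int l) ^ multiplicity l a)"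
    unfolding csym_def
  proof (intro prod.cong refl arg_cong2[where f = "(^)"] sym_J)
    fix l assume l: "l \<in> prime_factors a"
    then show "prime l" by (simp add: in_prime_factors_iff)
    have "int l dvd int a" using l by (simp add: in_prime_factors_iff)
    then show "\<not> p dvd int l" using assms dvd_trans by blast
  qed
  also have "\<dots> = chi (\<Prod>l\<in>prime_factors a. int l ^ multiplicity l a)"
    by (simp add: pr chi_power)
  also have "(\<Prod>l\<in>prime_factors a. int l ^ multiplicity l a) = int a"
  proof -
    have "(\<Prod>l\<in>prime_factors a. l ^ multiplicity l a) = a"
      using prod_prime_factors[of a] assms(2) by simp
    then have "int (\<Prod>l\<in>prime_factors a. l ^ multiplicity l a) = int a" by (rule arg_cong)
    then show ?thesis by (simp only: of_nat_prod of_nat_power)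
  qed
  finally show ?thesis .
qed

section \<open>Primary primes as Jacobi sums\<close>

text \<open>Both \<open>x * econj x\<close> and \<open>J * econj J\<close> are \<open>p\<close>, so
  the prime element \<open>x\<close> divides \<open>J\<close> or its conjugate. As \<open>x\<close>,
  \<open>- J\<close> and the conjugate of \<open>- J\<close> are primary of the same norm, the
  quotient is \<open>- 1\<close>. Passing to the conjugate character settles the second
  case.\<close>

lemma prim_prime_is_J:
  assumes "prim x" "prime (enorm x)"
  obtains chi where "cubic_char (enorm x) chi" "x = - cubic_char.J (enorm x) chi"
proof -
  define p where "p = enorm x"
  have "p mod 3 = 1" using enorm_prim_mod_3[OF assms(1)] by (simp add: p_def)
  then obtain chi where chi: "cubic_char p chi"
    using ex_cubic_char assms p_def by blast
  interpret cubic_char p chi by (rule chi)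
  have irr: "prime_elem x"
  proof -
    have "irreducible x"
    proof (rule irreducibleI)
      show "x \<noteq> 0" using prim_nonzero assms by blast
      show "\<not> x dvd 1" using assms by (auto simp: eis_unit_iff)
      fix a b assume "x = a * b"
      then have "enorm x = enorm a * enorm b" by (simp add: enorm_mult)
      then have "enorm a dvd 1 \<or> enorm b dvd 1"
        using assms(2) by (metis irreducible_def prime_elem_imp_irreducible prime_imp_prime_elem)
      then have "enorm a = 1 \<or> enorm b = 1"
        using enorm_nonneg[of a] enorm_nonneg[of b] by auto
      then show "a dvd 1 \<or> b dvd 1" by (simp add: eis_unit_iff)
    qed
    then show ?thesis by (simp add: irreducible_imp_prime_elem)
  qed
  have "x dvd x * econj x" by simp
  also have "x * econj x = of_int p" by (simp only: mult_econj p_def)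
  also have "\<dots> = J * econj J" by (rule J_norm[symmetric])
  finally have "x dvd J \<or> x dvd econj J" using irr prime_elem_dvd_mult_iff by blast
  moreover have "x = - K" if "x dvd K" "enorm K = p" "prim (- K)" for K
  proof -
    obtain u where u: "K = x * u" using \<open>x dvd K\<close> unfolding dvd_def by blast
    have "p = p * enorm u" using that(2) unfolding u by (simp add: enorm_mult p_def)
    then have "enorm u = 1" using p_gt_1 by simp
    moreover have "prim (- u)" using prim_cancel[OF assms(1), of "- u"] that u by simp
    ultimately have "- u = 1" by (intro prim_unit) simp_all
    then have "u = -1" by (metis minus_minus)
    then show ?thesis using u by simp
  qed
  ultimately have "x = - J \<or> x = - cubic_char.J p bar"
    using cubic_char.prim_minus_J[OF cubic_char_bar] prim_minus_J enorm_J cubic_char.enorm_J[OF cubic_char_bar] J_bar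
    by metis
  then show thesis using that[of chi] that[of bar] chi cubic_char_bar unfolding p_def by blast
qed

section \<open>Twisted lattice sums\<close>

lemma finite_enorm_le: "finite {x. enorm x \<le> n}"
proof -
  have "x \<in> (\<lambda>(a, b). Eis a b) ` ({-2 * n..2 * n} \<times> {-2 * n..2 * n})" if "enorm x \<le> n" for x
  proof -
    have sq: "\<bar>t\<bar> \<le> t ^ 2" for t :: int
      using mult_left_mono[of 1 "\<bar>t\<bar>" "\<bar>t\<bar>"] by (cases "t = 0") (auto simp: power2_eq_square)
    have "4 * enorm x = (2 * eo x - ec x) ^ 2 + 3 * ec x ^ 2"
      by (simp add: enorm_def power2_eq_square algebra_simps)
    then have "3 * ec x ^ 2 \<le> 4 * n" "3 * eo x ^ 2 \<le> 4 * n"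
      using that enorm_4[of x] zero_le_power2[of "2 * eo x - ec x"] zero_le_power2[of "2 * ec x - eo x"] by linarith+
    then have "\<bar>ec x\<bar> \<le> 2 * n" "\<bar>eo x\<bar> \<le> 2 * n"
      using sq[of "ec x"] sq[of "eo x"] by linarith+
    then show ?thesis by (intro image_eqI[of _ _ "(ec x, eo x)"]) auto
  qed
  then have "{x. enorm x \<le> n} \<subseteq> (\<lambda>(a, b). Eis a b) ` ({-2 * n..2 * n} \<times> {-2 * n..2 * n})" by blast
  then show ?thesis by (rule finite_subset) simp
qed

lemma norm_toc_le_iff: "r \<ge> 0 \<Longrightarrow> norm (toc x) \<le> sqrt r \<longleftrightarrow> real_of_int (enorm x) \<le> r"
  by (simp add: norm_toc)

lemma finite_disc: "finite {x. norm (toc x) \<le> r}"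
proof -
  have "enorm x \<le> \<lceil>r ^ 2\<rceil>" if "norm (toc x) \<le> r" for x
  proof -
    have "real_of_int (enorm x) \<le> r ^ 2"
      using power_mono[OF that norm_ge_zero, of 2] by (simp add: norm_toc_sq)
    then show ?thesis by linarith
  qed
  then show ?thesis by (intro finite_subset[OF _ finite_enorm_le[of "\<lceil>r ^ 2\<rceil>"]]) auto
qed

lemma finite_disc_shift: "finite {x. norm (toc x + d) \<le> r}"
proof (rule finite_subset[OF _ finite_disc[of "r + norm d"]], rule subsetI)
  fix x assume "x \<in> {x. norm (toc x + d) \<le> r}"
  then show "x \<in> {x. norm (toc x) \<le> r + norm d}"
    using norm_triangle_ineq4[of "toc x + d" d] by simp
qed

text \<open>Lattice points have distance at least 1, so the discs of radius 1/2 about them are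
  disjoint; they lie in an annulus widened by 1/2 on both sides, and areas are compared.\<close>

lemma card_annulus:
  assumes "A \<ge> 0" "w \<ge> 0"
  shows "real (card {x. A \<le> norm (toc x) \<and> norm (toc x) \<le> A + w}) \<le> 4 * (w + 1) * (2 * A + w + 1)"
proof -
  define S where "S = {x. A \<le> norm (toc x) \<and> norm (toc x) \<le> A + w}"
  have fin: "finite S" unfolding S_def by (rule finite_subset[OF _ finite_disc[of "A + w"]]) auto
  define q where "q = max 0 (A - 1/2)"
  define V where "V = unit_ball_vol (real DIM(complex))"
  have V: "V > 0" unfolding V_def by (rule unit_ball_vol_pos) simp
  have dist: "1 \<le> norm (toc x - toc y)" if "x \<noteq> y" for x y
  proof -
    have "1 \<le> enorm (x - y)" using that by (intro enorm_ge_1) auto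
    then have "1 \<le> sqrt (real_of_int (enorm (x - y)))" by simp
    then show ?thesis by (simp add: norm_toc[symmetric])
  qed
  have disj: "disjoint_family_on (\<lambda>x. ball (toc x) (1/2)) S"
    unfolding disjoint_family_on_def
  proof (intro ballI impI)
    fix x y assume "x \<in> S" "y \<in> S" "x \<noteq> y"
    then have "1 \<le> dist (toc x) (toc y)" using dist by (simp add: dist_norm)
    then show "ball (toc x) (1/2) \<inter> ball (toc y) (1/2) = {}"
      by (intro disjoint_ballI) simp
  qed
  have sub: "(\<Union>x\<in>S. ball (toc x) (1/2)) \<subseteq> cball 0 (A + w + 1/2) - ball 0 q"
  proof (rule subsetI)
    fix z assume "z \<in> (\<Union>x\<in>S. ball (toc x) (1/2))"
    then obtain x where x: "x \<in> S" "norm (toc x - z) < 1/2" by (auto simp: dist_norm)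
    have "norm z \<le> norm (toc x) + norm (toc x - z)" using norm_triangle_ineq4[of "toc x" "toc x - z"] by simp
    moreover have "norm (toc x) \<le> norm z + norm (toc x - z)" using norm_triangle_ineq[of z "toc x - z"] by simp
    ultimately have "norm z \<le> A + w + 1/2" "A - 1/2 \<le> norm z"
      using x unfolding S_def mem_Collect_eq by linarith+
    moreover from this have "q \<le> norm z" unfolding q_def by simp
    ultimately show "z \<in> cball 0 (A + w + 1/2) - ball 0 q" by auto
  qed
  have q: "q \<ge> 0" "q \<le> A + w + 1/2" using assms by (auto simp: q_def)
  have fm: "X \<in> fmeasurable lborel" if "bounded X" "X \<in> sets borel" for X :: "complex set"
    using that emeasure_bounded_finite[of X] by (simp add: fmeasurable_def)
  have nt: "emeasure lborel (ball c (1/2)) \<noteq> \<infinity>" for c :: complex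
    using emeasure_bounded_finite[of "ball c (1/2)"] by simp
  have "real (card S) * (V * (1/2) ^ 2) = (\<Sum>x\<in>S. measure lborel (ball (toc x) (1/2)))"
    by (simp add: content_ball V_def)
  also have "\<dots> = measure lborel (\<Union>x\<in>S. ball (toc x) (1/2))"
    using fin disj by (intro measure_finite_Union[symmetric]) (auto simp: nt[unfolded infinity_ennreal_def])
  also have "\<dots> \<le> measure lborel (cball 0 (A + w + 1/2) - ball (0::complex) q)"
    using sub by (intro measure_mono_fmeasurable) (auto intro!: fmeasurable.Diff sets.finite_UN fin fm)
  also have "\<dots> = measure lborel (cball 0 (A + w + 1/2) :: complex set) - measure lborel (ball (0::complex) q)"
    using q by (intro measurable_measure_Diff fm) auto
  also have "\<dots> = V * ((A + w + 1/2) ^ 2 - q ^ 2)"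
    using q assms by (simp add: content_ball content_cball V_def algebra_simps)
  finally have "V * real (card S) \<le> V * (4 * ((A + w + 1/2) ^ 2 - q ^ 2))"
    by (simp add: power2_eq_square algebra_simps)
  then have "real (card S) \<le> 4 * ((A + w + 1/2) ^ 2 - q ^ 2)" using V by simp
  also have "(A + w + 1/2) ^ 2 - q ^ 2 \<le> (w + 1) * (2 * A + w + 1)"
  proof (cases "A \<ge> 1/2")
    case True
    then have "(A + w + 1/2) ^ 2 - q ^ 2 = (w + 1) * (2 * A + w)"
      by (simp add: q_def power2_eq_square algebra_simps)
    then show ?thesis using assms by simp
  next
    case False
    then have "(A + w + 1/2) ^ 2 - q ^ 2 \<le> (w + 1) ^ 2"
      using assms by (simp add: q_def power_mono)
    also have "\<dots> \<le> (w + 1) * (2 * A + w + 1)"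
      unfolding power2_eq_square using assms by (intro mult_left_mono) auto
    finally show ?thesis .
  qed
  finally show ?thesis unfolding S_def by (simp only: mult.assoc)
qed

text \<open>An annulus between the radii \<open>m\<close> and \<open>m + 1\<close> has at most
  \<open>32 * m\<close> points, each of weight at most \<open>1 / m\<close>.\<close>

lemma sum_inverse_disc:
  assumes "r \<ge> 0"
  shows "(\<Sum>x | x \<noteq> 0 \<and> norm (toc x) \<le> r. 1 / norm (toc x)) \<le> 32 * r"
proof -
  define S where "S = {x. x \<noteq> 0 \<and> norm (toc x) \<le> r}"
  define L where "L m = {x. real m \<le> norm (toc x) \<and> norm (toc x) \<le> real m + 1}" for m :: nat
  have finL: "finite (L m)" for m unfolding L_def by (rule finite_subset[OF _ finite_disc[of "real m + 1"]]) auto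
  have ge1: "norm (toc x) \<ge> 1" if "x \<noteq> 0" for x
    using enorm_ge_1[OF that] by (simp add: norm_toc)
  define fl where "fl x = nat \<lfloor>norm (toc x)\<rfloor>" for x
  have fl: "fl x \<in> {1..nat \<lfloor>r\<rfloor>}" "x \<in> L (fl x)" if "x \<in> S" for x
  proof -
    have "norm (toc x) \<ge> 1" "norm (toc x) \<le> r" using that ge1 by (auto simp: S_def)
    then show "fl x \<in> {1..nat \<lfloor>r\<rfloor>}" "x \<in> L (fl x)"
      unfolding fl_def L_def by (auto simp: le_nat_iff floor_mono intro!: nat_mono)
  qed
  have finS: "finite S" unfolding S_def by (rule finite_subset[OF _ finite_disc[of r]]) auto
  have "(\<Sum>x\<in>S. 1 / norm (toc x)) = (\<Sum>m\<in>{1..nat \<lfloor>r\<rfloor>}. \<Sum>x | x \<in> S \<and> fl x = m. 1 / norm (toc x))"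
    using fl finS by (intro sum.group[symmetric]) auto
  also have "\<dots> \<le> (\<Sum>m\<in>{1..nat \<lfloor>r\<rfloor>}. \<Sum>x\<in>L m. 1 / norm (toc x))"
    using fl finL by (intro sum_mono sum_mono2) auto
  also have "\<dots> \<le> (\<Sum>m\<in>{1..nat \<lfloor>r\<rfloor>}. 32)"
  proof (rule sum_mono)
    fix m assume "m \<in> {1..nat \<lfloor>r\<rfloor>}"
    then have m: "real m \<ge> 1" by simp
    have "(\<Sum>x\<in>L m. 1 / norm (toc x)) \<le> (\<Sum>x\<in>L m. 1 / real m)"
      using m by (intro sum_mono frac_le) (auto simp: L_def)
    also have "\<dots> = real (card (L m)) / real m" by simp
    also have "real (card (L m)) \<le> 16 * (real m + 1)"
      using card_annulus[of "real m" 1] by (simp add: L_def)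
    also have "16 * (real m + 1) \<le> 32 * real m" using m by simp
    finally show "(\<Sum>x\<in>L m. 1 / norm (toc x)) \<le> 32" using m by (simp add: divide_right_mono)
  qed
  also have "\<dots> \<le> 32 * r" using assms by (simp add: of_nat_floor)
  finally show ?thesis by (simp add: S_def)
qed

section \<open>Shifted lattice sums\<close>

lemma norm_sgn_le_1: "norm (sgn (z::complex)) \<le> 1"
  by (simp add: norm_sgn)

lemma norm_sgn_shift:
  fixes z d :: complex
  assumes "z \<noteq> 0"
  shows "norm (sgn (z + d) - sgn z) \<le> 2 * norm d / norm z"
proof (cases "z + d = 0")
  case True
  then have "norm d = norm z" by (metis add_eq_0_iff norm_minus_cancel)
  then show ?thesis using True assms by (simp add: norm_sgn)
next
  case False
  have "sgn (z + d) - sgn z = sgn (z + d) * of_real ((norm z - norm (z + d)) / norm z) + d / of_real (norm z)"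
    using assms False by (simp add: sgn_eq field_simps)
  then have "norm (sgn (z + d) - sgn z) \<le> norm (sgn (z + d) * of_real ((norm z - norm (z + d)) / norm z)) + norm (d / of_real (norm z))"
    by (metis norm_triangle_ineq)
  also have "\<dots> = \<bar>norm z - norm (z + d)\<bar> / norm z + norm d / norm z"
    using False by (simp add: norm_mult norm_divide norm_sgn del: of_real_diff of_real_divide)
  also have "\<bar>norm z - norm (z + d)\<bar> \<le> norm d"
    using norm_triangle_ineq3[of z "z + d"] by simp
  finally show ?thesis using assms by (simp add: divide_right_mono add_divide_distrib[symmetric])
qed

text \<open>The shift \<open>d\<close> encodes a residue class: the class of \<open>v\<close> modulo
  \<open>s\<close>, divided by \<open>s\<close>, is the lattice shifted by \<open>v / s\<close>
  (\<open>sum_coset\<close>).\<close>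

definition dsum :: "nat \<Rightarrow> complex \<Rightarrow> real \<Rightarrow> complex" where
  "dsum k d r = (\<Sum>x | norm (toc x + d) \<le> r. sgn (toc x + d) ^ k)"

text \<open>The two index sets differ by \<open>O(r + 1)\<close> points near the circle. At a common
  point \<open>x\<close> the directions, and hence their \<open>k\<close>-th powers, differ by
  \<open>O(1 / |x|)\<close>, which adds up to \<open>O(r)\<close>; the point \<open>x = 0\<close> is
  estimated separately.\<close>

lemma dsum_shift:
  fixes D :: real
  assumes "D \<ge> 0"
  shows "\<exists>C\<ge>0. \<forall>d r. norm d \<le> D \<longrightarrow> r \<ge> 0 \<longrightarrow> norm (dsum k d r - dsum k 0 r) \<le> C * (r + 1)"
proof -
  define C where "C = 4 * (2 * D + 1) * (2 * D + 2) + 2 + 64 * D * real k"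
  have C0: "C \<ge> 0" using assms by (simp add: C_def)
  have "norm (dsum k d r - dsum k 0 r) \<le> C * (r + 1)" if d: "norm d \<le> D" and r: "r \<ge> 0" for d r
  proof -
    define X where "X = {x. norm (toc x + d) \<le> r}"
    define Y where "Y = {x. norm (toc x) \<le> r}"
    define f where "f x = sgn (toc x + d) ^ k" for x
    define g where "g x = sgn (toc x) ^ k" for x
    have fin: "finite X" "finite Y" unfolding X_def Y_def by (rule finite_disc_shift finite_disc)+
    have f1: "norm (f x) \<le> 1" for x unfolding f_def norm_power by (intro power_le_one norm_sgn_le_1) simp
    have g1: "norm (g x) \<le> 1" for x unfolding g_def norm_power by (intro power_le_one norm_sgn_le_1) simp
    have "dsum k d r = sum f (X \<inter> Y) + sum f (X - Y)"
      unfolding dsum_def X_def[symmetric] f_def[symmetric] using fin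
      by (metis sum.Int_Diff)
    moreover have "dsum k 0 r = sum g (X \<inter> Y) + sum g (Y - X)"
      unfolding dsum_def using fin
      by (simp add: Y_def[symmetric] g_def[symmetric]) (metis sum.Int_Diff Int_commute)
    ultimately have "dsum k d r - dsum k 0 r = (\<Sum>x\<in>X \<inter> Y. f x - g x) + sum f (X - Y) - sum g (Y - X)"
      by (simp add: sum_subtractf)
    also have "norm \<dots> \<le> norm (\<Sum>x\<in>X \<inter> Y. f x - g x) + norm (sum f (X - Y)) + norm (sum g (Y - X))"
      by (meson norm_triangle_ineq norm_triangle_ineq4 order_trans add_mono order_refl)
    also have "norm (sum f (X - Y)) \<le> real (card (X - Y))"
      using sum_norm_bound[of "X - Y" f 1] f1 by simp
    also have "norm (sum g (Y - X)) \<le> real (card (Y - X))"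
      using sum_norm_bound[of "Y - X" g 1] g1 by simp
    also have "norm (\<Sum>x\<in>X \<inter> Y. f x - g x) \<le> 2 + 64 * D * real k * r"
    proof -
      have "norm (\<Sum>x\<in>X \<inter> Y. f x - g x) \<le> (\<Sum>x\<in>X \<inter> Y. norm (f x - g x))" by (rule norm_sum)
      also have "\<dots> \<le> (\<Sum>x\<in>insert 0 {x. x \<noteq> 0 \<and> norm (toc x) \<le> r}. norm (f x - g x))"
        using fin(2) by (intro sum_mono2) (auto simp: Y_def intro: finite_subset[OF _ fin(2)])
      also have "\<dots> = norm (f 0 - g 0) + (\<Sum>x | x \<noteq> 0 \<and> norm (toc x) \<le> r. norm (f x - g x))"
        using fin(2) by (subst sum.insert) (auto simp: Y_def intro: finite_subset[OF _ fin(2)])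
      also have "norm (f 0 - g 0) \<le> 2"
        using norm_triangle_ineq4[of "f 0" "g 0"] f1[of 0] g1[of 0] by linarith
      also have "(\<Sum>x | x \<noteq> 0 \<and> norm (toc x) \<le> r. norm (f x - g x))
          \<le> (\<Sum>x | x \<noteq> 0 \<and> norm (toc x) \<le> r. 2 * D * real k * (1 / norm (toc x)))"
      proof (rule sum_mono)
        fix x assume "x \<in> {x. x \<noteq> 0 \<and> norm (toc x) \<le> r}"
        then have x: "toc x \<noteq> 0" by simp
        have "norm (f x - g x) \<le> real k * norm (sgn (toc x + d) - sgn (toc x))"
          unfolding f_def g_def by (intro norm_power_diff norm_sgn_le_1)
        also have "\<dots> \<le> real k * (2 * norm d / norm (toc x))"
          by (intro mult_left_mono norm_sgn_shift x) simp
        also have "\<dots> \<le> real k * (2 * D / norm (toc x))"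
          using d by (intro mult_left_mono divide_right_mono) auto
        finally show "norm (f x - g x) \<le> 2 * D * real k * (1 / norm (toc x))" by (simp add: mult_ac)
      qed
      also have "\<dots> = 2 * D * real k * (\<Sum>x | x \<noteq> 0 \<and> norm (toc x) \<le> r. 1 / norm (toc x))"
        by (rule sum_distrib_left[symmetric])
      also have "\<dots> \<le> 2 * D * real k * (32 * r)"
        using assms r by (intro mult_left_mono sum_inverse_disc) auto
      finally show ?thesis by (simp add: mult_ac)
    qed
    also have "(2 + 64 * D * real k * r) + real (card (X - Y)) + real (card (Y - X)) = 2 + 64 * D * real k * r + real (card ((X - Y) \<union> (Y - X)))"
      using fin by (subst card_Un_disjoint) auto
    also have "real (card ((X - Y) \<union> (Y - X))) \<le> 4 * (2 * D + 1) * (2 * D + 2) * (r + 1)"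
    proof -
      define A where "A = max 0 (r - D)"
      have A: "A \<ge> 0" by (simp add: A_def)
      have "(X - Y) \<union> (Y - X) \<subseteq> {x. A \<le> norm (toc x) \<and> norm (toc x) \<le> A + 2 * D}"
      proof
        fix x assume "x \<in> (X - Y) \<union> (Y - X)"
        moreover have "norm (toc x + d) \<le> norm (toc x) + D" using norm_triangle_ineq[of "toc x" d] d by linarith
        moreover have "norm (toc x) \<le> norm (toc x + d) + D" using norm_triangle_ineq4[of "toc x + d" d] d by simp
        ultimately show "x \<in> {x. A \<le> norm (toc x) \<and> norm (toc x) \<le> A + 2 * D}"
          using assms by (auto simp: X_def Y_def A_def)
      qed
      then have "real (card ((X - Y) \<union> (Y - X))) \<le> real (card {x. A \<le> norm (toc x) \<and> norm (toc x) \<le> A + 2 * D})"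
        unfolding of_nat_le_iff by (intro card_mono finite_subset[OF _ finite_disc[of "A + 2 * D"]]) auto
      also have "\<dots> \<le> 4 * (2 * D + 1) * (2 * A + 2 * D + 1)"
        using card_annulus[of A "2 * D"] assms A by simp
      also have "\<dots> \<le> 4 * (2 * D + 1) * ((2 * D + 2) * (r + 1))"
      proof (intro mult_left_mono)
        have "A \<le> r" using assms r by (simp add: A_def)
        moreover have "0 \<le> D * r" using assms r by simp
        ultimately show "2 * A + 2 * D + 1 \<le> (2 * D + 2) * (r + 1)" by (simp add: algebra_simps)
      qed (use assms in auto)
      finally show ?thesis by (simp add: mult_ac)
    qed
    also have "2 + 64 * D * real k * r + 4 * (2 * D + 1) * (2 * D + 2) * (r + 1) \<le> C * (r + 1)"
      unfolding C_def using assms r by (simp add: algebra_simps)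
    finally show ?thesis by simp
  qed
  then show ?thesis using C0 by blast
qed

lemma sum_coset:
  assumes "s \<noteq> 0"
  shows "(\<Sum>x | s dvd x - v \<and> norm (toc x) \<le> r. sgn (toc x) ^ k) =
    sgn (toc s) ^ k * dsum k (toc v / toc s) (r / norm (toc s))"
proof -
  have s: "toc s \<noteq> 0" "norm (toc s) > 0" using assms by simp_all
  have eq: "toc (s * y + v) = toc s * (toc y + toc v / toc s)" for y
    using s by (simp add: field_simps)
  have "(\<Sum>x | s dvd x - v \<and> norm (toc x) \<le> r. sgn (toc x) ^ k) =
    (\<Sum>y | norm (toc y + toc v / toc s) \<le> r / norm (toc s). sgn (toc (s * y + v)) ^ k)"
  proof (rule sum.reindex_bij_witness[of _ "\<lambda>y. s * y + v" "\<lambda>x. (x - v) div s"])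
    fix x assume "x \<in> {x. s dvd x - v \<and> norm (toc x) \<le> r}"
    then have x: "s dvd x - v" "norm (toc x) \<le> r" by auto
    show e: "s * ((x - v) div s) + v = x" using x by simp
    show "(x - v) div s \<in> {y. norm (toc y + toc v / toc s) \<le> r / norm (toc s)}"
    proof -
      have "norm (toc s) * norm (toc ((x - v) div s) + toc v / toc s) = norm (toc x)"
        by (metis eq e norm_mult)
      then have "norm (toc s) * norm (toc ((x - v) div s) + toc v / toc s) \<le> r" using x(2) by simp
      then show ?thesis using s(2) by (simp only: mem_Collect_eq pos_le_divide_eq mult.commute)
    qed
    show "sgn (toc (s * ((x - v) div s) + v)) ^ k = sgn (toc x) ^ k" unfolding e ..
  next
    fix y assume "y \<in> {y. norm (toc y + toc v / toc s) \<le> r / norm (toc s)}"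
    then have y: "norm (toc y + toc v / toc s) \<le> r / norm (toc s)" by simp
    show "(s * y + v - v) div s = y" using assms by simp
    have "norm (toc (s * y + v)) \<le> r" unfolding eq norm_mult using y s by (simp add: field_simps)
    then show "s * y + v \<in> {x. s dvd x - v \<and> norm (toc x) \<le> r}" by simp
  qed
  also have "\<dots> = sgn (toc s) ^ k * dsum k (toc v / toc s) (r / norm (toc s))"
    unfolding eq dsum_def by (simp add: sgn_mult power_mult_distrib sum_distrib_left)
  finally show ?thesis .
qed

section \<open>Residue systems and cancellation\<close>

definition complete_residues :: "eis \<Rightarrow> eis set \<Rightarrow> bool" where
  "complete_residues s V \<longleftrightarrow> finite V \<and> (\<forall>x. \<exists>!v. v \<in> V \<and> s dvd x - v)"

lemma sum_residues:
  fixes f :: "eis \<Rightarrow> complex"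
  assumes "complete_residues s V" "finite X"
  shows "sum f X = (\<Sum>v\<in>V. \<Sum>x | x \<in> X \<and> s dvd x - v. f x)"
proof -
  have "(\<Sum>v\<in>V. \<Sum>x | x \<in> X \<and> s dvd x - v. f x) = (\<Sum>x\<in>(\<Union>v\<in>V. {x \<in> X. s dvd x - v}). f x)"
  proof (rule sum.UNION_disjoint[symmetric])
    show "finite V" "\<forall>i\<in>V. finite {x \<in> X. s dvd x - i}" using assms by (auto simp: complete_residues_def)
    have "i = j" if "i \<in> V" "j \<in> V" "s dvd x - i" "s dvd x - j" for i j x
      using assms(1) that unfolding complete_residues_def by blast
    then show "\<forall>i\<in>V. \<forall>j\<in>V. i \<noteq> j \<longrightarrow> {x \<in> X. s dvd x - i} \<inter> {x \<in> X. s dvd x - j} = {}"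
      by blast
  qed
  also have "(\<Union>v\<in>V. {x \<in> X. s dvd x - v}) = X"
    using assms unfolding complete_residues_def by auto
  finally show ?thesis by simp
qed

lemma complete_residues_nat:
  assumes "m > 0"
  shows "complete_residues (of_nat m) ((\<lambda>(a, b). Eis a b) ` ({0..<int m} \<times> {0..<int m}))"
  unfolding complete_residues_def
proof (intro conjI allI)
  fix x
  show "\<exists>!v. v \<in> (\<lambda>(a, b). Eis a b) ` ({0..<int m} \<times> {0..<int m}) \<and> of_nat m dvd x - v"
  proof (rule ex1I[of _ "Eis (ec x mod int m) (eo x mod int m)"])
    show "Eis (ec x mod int m) (eo x mod int m) \<in> (\<lambda>(a, b). Eis a b) ` ({0..<int m} \<times> {0..<int m})
      \<and> of_nat m dvd x - Eis (ec x mod int m) (eo x mod int m)"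
      using assms by (auto simp: eis_dvd_iff mod_eq_dvd_iff[symmetric])
  next
    fix v assume v: "v \<in> (\<lambda>(a, b). Eis a b) ` ({0..<int m} \<times> {0..<int m}) \<and> of_nat m dvd x - v"
    then have "ec x mod int m = ec v mod int m" "eo x mod int m = eo v mod int m"
      by (simp_all add: eis_dvd_iff mod_eq_dvd_iff)
    then show "v = Eis (ec x mod int m) (eo x mod int m)" using v by (auto simp: eis_eq_iff)
  qed
qed simp

text \<open>A prime above the split prime 7. It and its conjugate have the same norm but different
  directions, even after the twelfth power (\<open>sgn_lam_power\<close>).\<close>

definition lam :: eis where "lam = Eis 3 1"

lemma enorm_lam: "enorm lam = 7" by (simp add: lam_def enorm_def)

lemma lam_dvd_of_int: "lam dvd of_int j \<longleftrightarrow> 7 dvd j"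
proof
  assume "lam dvd of_int j"
  then have "enorm lam dvd enorm (of_int j)" by (rule enorm_dvd)
  then have "7 dvd j ^ 2" by (simp add: enorm_lam)
  moreover have "prime (7::int)" by simp
  ultimately show "7 dvd j" using prime_dvd_power by blast
next
  assume "7 dvd j"
  then obtain i where "j = 7 * i" unfolding dvd_def by blast
  then have "of_int j = lam * (econj lam * of_int i)"
    by (simp add: mult.assoc[symmetric] mult_econj enorm_lam)
  then show "lam dvd of_int j" by (metis dvd_triv_left)
qed

lemma complete_residues_lam: "complete_residues lam (of_int ` {0..<7})"
  unfolding complete_residues_def
proof (intro conjI allI)
  fix x
  define j where "j = (ec x - 3 * eo x) mod 7"
  have "x - of_int (ec x - 3 * eo x) = lam * of_int (eo x)"
    by (simp add: eis_eq_iff eis_sel_mult lam_def)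
  then have 1: "lam dvd x - of_int (ec x - 3 * eo x)" by simp
  have iff: "lam dvd x - of_int i \<longleftrightarrow> 7 dvd (ec x - 3 * eo x) - i" for i
  proof -
    have "x - of_int i = (x - of_int (ec x - 3 * eo x)) + of_int ((ec x - 3 * eo x) - i)" by simp
    then show ?thesis using 1 lam_dvd_of_int by (metis dvd_add_right_iff)
  qed
  show "\<exists>!v. v \<in> of_int ` {0..<7} \<and> lam dvd x - v"
  proof (rule ex1I[of _ "of_int j"])
    show "of_int j \<in> of_int ` {0..<7} \<and> lam dvd x - of_int j"
      unfolding iff by (simp add: j_def mod_eq_dvd_iff[symmetric])
  next
    fix v assume v: "v \<in> of_int ` {0..<7} \<and> lam dvd x - v"
    then obtain i where i: "v = of_int i" "0 \<le> i" "i < 7" by auto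
    then have "7 dvd (ec x - 3 * eo x) - i" using v iff by simp
    then have "j = i mod 7" by (simp add: j_def mod_eq_dvd_iff)
    then show "v = of_int j" using i by simp
  qed
qed simp

lemma econj_dvd_iff: "econj s dvd x \<longleftrightarrow> s dvd econj x"
  by (metis dvd_def econj_simps(6,7))

lemma complete_residues_econj_lam: "complete_residues (econj lam) (of_int ` {0..<7})"
proof -
  have "econj lam dvd x - v \<longleftrightarrow> lam dvd econj x - v" if "v \<in> of_int ` {0..<7}" for x v
    using that by (auto simp: econj_dvd_iff)
  then show ?thesis
    using complete_residues_lam unfolding complete_residues_def
    by (metis (no_types, lifting))
qed

text \<open>Every class modulo \<open>s\<close>, divided by \<open>s\<close>, is a shifted lattice
  in the disc of radius \<open>r / |s|\<close>, and by \<open>dsum_shift\<close> the shifts change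
  the sum by \<open>O(r + 1)\<close> only.\<close>

lemma dsum_residues:
  assumes "complete_residues s V" "s \<noteq> 0"
  shows "\<exists>C\<ge>0. \<forall>r\<ge>0. norm (dsum k 0 r - of_nat (card V) * sgn (toc s) ^ k * dsum k 0 (r / norm (toc s))) \<le> C * (r + 1)"
proof -
  have finV: "finite V" using assms by (simp add: complete_residues_def)
  have s: "norm (toc s) \<ge> 1" using enorm_ge_1[OF assms(2)] by (simp add: norm_toc)
  define D where "D = Max (insert 0 ((\<lambda>v. norm (toc v / toc s)) ` V))"
  have D: "D \<ge> 0" "\<And>v. v \<in> V \<Longrightarrow> norm (toc v / toc s) \<le> D"
    unfolding D_def using finV by (auto intro!: Max_ge)
  obtain C where C: "C \<ge> 0" "\<And>d r. norm d \<le> D \<Longrightarrow> r \<ge> 0 \<Longrightarrow> norm (dsum k d r - dsum k 0 r) \<le> C * (r + 1)"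
    using dsum_shift[OF D(1), of k] by blast
  have "norm (dsum k 0 r - of_nat (card V) * sgn (toc s) ^ k * dsum k 0 (r / norm (toc s))) \<le> real (card V) * C * (r + 1)"
    if r: "r \<ge> 0" for r
  proof -
    define q where "q = r / norm (toc s)"
    have "q \<le> r / 1" unfolding q_def using r s by (intro frac_le) auto
    then have q: "q \<ge> 0" "q \<le> r" using r by (auto simp: q_def)
    have "dsum k 0 r = (\<Sum>v\<in>V. \<Sum>x | x \<in> {x. norm (toc x) \<le> r} \<and> s dvd x - v. sgn (toc x) ^ k)"
      unfolding dsum_def using sum_residues[OF assms(1) finite_disc[of r]] by simp
    also have "\<dots> = (\<Sum>v\<in>V. sgn (toc s) ^ k * dsum k (toc v / toc s) q)"
      unfolding q_def sum_coset[OF assms(2), symmetric] by (simp add: conj_commute)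
    finally have "dsum k 0 r - of_nat (card V) * sgn (toc s) ^ k * dsum k 0 q
       = (\<Sum>v\<in>V. sgn (toc s) ^ k * (dsum k (toc v / toc s) q - dsum k 0 q))"
      by (simp add: right_diff_distrib sum_subtractf mult.assoc)
    also have "norm \<dots> \<le> (\<Sum>v\<in>V. norm (sgn (toc s) ^ k * (dsum k (toc v / toc s) q - dsum k 0 q)))" by (rule norm_sum)
    also have "\<dots> \<le> (\<Sum>v\<in>V. 1 * (C * (r + 1)))"
    proof (rule sum_mono)
      fix v assume v: "v \<in> V"
      have "norm (dsum k (toc v / toc s) q - dsum k 0 q) \<le> C * (q + 1)" using C(2) D(2)[OF v] q by blast
      also have "\<dots> \<le> C * (r + 1)" using q C(1) by (intro mult_left_mono) auto
      finally show "norm (sgn (toc s) ^ k * (dsum k (toc v / toc s) q - dsum k 0 q)) \<le> 1 * (C * (r + 1))"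
        unfolding norm_mult norm_power using C(1) r by (intro mult_mono power_le_one norm_sgn_le_1) auto
    qed
    finally show ?thesis by (simp add: q_def)
  qed
  moreover have "real (card V) * C \<ge> 0" using C(1) by simp
  ultimately show ?thesis by blast
qed

text \<open>Raising to the power \<open>12 / k\<close> reduces all cases to one exact computation of
  \<open>lam ^ 12\<close>.\<close>

lemma sgn_lam_power:
  assumes "k dvd 12" "k > 0"
  shows "sgn (toc lam) ^ k \<noteq> sgn (toc (econj lam)) ^ k"
proof
  assume eq: "sgn (toc lam) ^ k = sgn (toc (econj lam)) ^ k"
  obtain j where j: "12 = k * j" using assms unfolding dvd_def by blast
  have n: "norm (toc lam) = sqrt 7" "norm (toc (econj lam)) = sqrt 7" by (simp_all add: norm_toc enorm_lam)
  have "sgn (toc lam) ^ 12 = sgn (toc (econj lam)) ^ 12"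
    unfolding j power_mult eq ..
  then have "toc lam ^ 12 = toc (econj lam) ^ 12"
    unfolding sgn_eq power_divide n by (simp del: toc_econj)
  then have "lam ^ 12 = econj lam ^ 12" by (metis toc_power toc_inj)
  then have "eo (lam ^ 12) = eo (econj lam ^ 12)" by simp
  moreover have "lam ^ 12 = ((lam * lam * lam) * (lam * lam * lam)) * ((lam * lam * lam) * (lam * lam * lam))"
    "econj lam ^ 12 = ((econj lam * econj lam * econj lam) * (econj lam * econj lam * econj lam)) * ((econj lam * econj lam * econj lam) * (econj lam * econj lam * econj lam))"
    by (simp_all add: eval_nat_numeral mult.assoc)
  ultimately show False by (simp add: eis_sel_mult lam_def)
qed

text \<open>Residue classes modulo \<open>lam\<close> and modulo \<open>econj lam\<close> both reduce the sum over a disc to the sum over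
  the disc scaled by \<open>1 / sqrt 7\<close>, but with different rotation factors; hence the latter is small.\<close>

lemma dsum_bound:
  assumes "k dvd 12" "k > 0"
  shows "\<exists>C\<ge>0. \<forall>r\<ge>0. norm (dsum k 0 r) \<le> C * (r + 1)"
proof -
  have l0: "lam \<noteq> 0" "econj lam \<noteq> 0" by (simp_all add: eis_eq_iff lam_def)
  have n: "norm (toc lam) = sqrt 7" "norm (toc (econj lam)) = sqrt 7" by (simp_all add: norm_toc enorm_lam)
  have cV: "card ((of_int :: int \<Rightarrow> eis) ` {0..<7}) = 7" by (subst card_image) (auto intro: inj_onI)
  define a b where "a = sgn (toc lam) ^ k" and "b = sgn (toc (econj lam)) ^ k"
  have ab: "norm (a - b) > 0" using sgn_lam_power[OF assms] by (simp add: a_def b_def)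
  obtain C1 where C1: "C1 \<ge> 0" "\<And>r. r \<ge> 0 \<Longrightarrow> norm (dsum k 0 r - 7 * a * dsum k 0 (r / sqrt 7)) \<le> C1 * (r + 1)"
    using dsum_residues[OF complete_residues_lam l0(1), of k] unfolding cV n a_def by auto
  obtain C2 where C2: "C2 \<ge> 0" "\<And>r. r \<ge> 0 \<Longrightarrow> norm (dsum k 0 r - 7 * b * dsum k 0 (r / sqrt 7)) \<le> C2 * (r + 1)"
    using dsum_residues[OF complete_residues_econj_lam l0(2), of k] unfolding cV n b_def by auto
  define C where "C = (C1 + C2) * sqrt 7 / (7 * norm (a - b))"
  have s7: "sqrt 7 \<ge> 1" by simp
  have "norm (dsum k 0 r) \<le> C * (r + 1)" if r: "r \<ge> 0" for r
  proof -
    \<comment> \<open>Starting from the larger radius \<open>R\<close> makes the scaled disc in both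
      estimates the one of radius \<open>r\<close>.\<close>
    define R where "R = r * sqrt 7"
    have R: "R \<ge> 0" "R / sqrt 7 = r" using r by (simp_all add: R_def)
    have "(dsum k 0 R - 7 * b * dsum k 0 r) - (dsum k 0 R - 7 * a * dsum k 0 r) = 7 * (a - b) * dsum k 0 r"
      by (simp add: algebra_simps)
    then have "7 * norm (a - b) * norm (dsum k 0 r) = norm ((dsum k 0 R - 7 * b * dsum k 0 r) - (dsum k 0 R - 7 * a * dsum k 0 r))"
      by (simp only: norm_mult norm_numeral)
    also have "\<dots> \<le> C2 * (R + 1) + C1 * (R + 1)"
      using C1(2)[OF R(1)] C2(2)[OF R(1)] norm_triangle_ineq4 unfolding R(2) by (meson add_mono order_trans)
    also have "\<dots> = (C1 + C2) * (R + 1)" by (simp add: algebra_simps)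
    also have "\<dots> \<le> (C1 + C2) * (sqrt 7 * (r + 1))"
      using C1(1) C2(1) s7 by (intro mult_left_mono) (simp_all add: R_def algebra_simps)
    finally show ?thesis using ab by (simp add: C_def field_simps)
  qed
  moreover have "C \<ge> 0" using C1(1) C2(1) by (simp add: C_def)
  ultimately show ?thesis by blast
qed

lemma prim_cong: assumes "3 dvd x - y" shows "prim x = prim y"
proof -
  have "(3::eis) = of_nat 3" by simp
  then have "int 3 dvd ec x - ec y" "int 3 dvd eo x - eo y" using assms eis_dvd_iff[of 3 "x - y"] by simp_all
  then show ?thesis unfolding prim_def by (simp add: mod_eq_dvd_iff[symmetric])
qed

text \<open>On each residue class modulo \<open>m\<close> both \<open>c\<close> and
  \<open>prim\<close> are constant, and the class contributes a shifted \<open>dsum\<close>. All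
  cancellation comes from the direction \<open>sgn (toc x) ^ k\<close>, so of \<open>c\<close> only
  its periodicity enters.\<close>

theorem twisted_lattice_sum:
  fixes c :: "eis \<Rightarrow> complex"
  assumes k: "k dvd 12" "k > 0" and m: "m > 0" "3 dvd m"
    and per: "\<And>x y. of_nat m dvd x - y \<Longrightarrow> c x = c y"
  shows "\<exists>C\<ge>0. \<forall>r\<ge>1. norm (\<Sum>x | prim x \<and> real_of_int (enorm x) \<le> r. c x * sgn (toc x) ^ k) \<le> C * sqrt r"
proof -
  define s :: eis where "s = of_nat m"
  have s0: "s \<noteq> 0" using m by (simp add: s_def)
  have s1: "norm (toc s) \<ge> 1" using m by (simp add: s_def)
  obtain V where V: "complete_residues s V" using complete_residues_nat[OF m(1)] s_def by blast
  have finV: "finite V" using V by (simp add: complete_residues_def)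
  have d3: "3 dvd s"
  proof -
    have "(of_nat 3 :: eis) dvd of_nat m" using m by (intro of_nat_dvd_mono)
    then show ?thesis by (simp add: s_def)
  qed
  define D where "D = Max (insert 0 ((\<lambda>v. norm (toc v / toc s)) ` V))"
  have D: "D \<ge> 0" "\<And>v. v \<in> V \<Longrightarrow> norm (toc v / toc s) \<le> D"
    unfolding D_def using finV by (auto intro!: Max_ge)
  obtain C1 where C1: "C1 \<ge> 0" "\<And>d r. norm d \<le> D \<Longrightarrow> r \<ge> 0 \<Longrightarrow> norm (dsum k d r - dsum k 0 r) \<le> C1 * (r + 1)"
    using dsum_shift[OF D(1), of k] by blast
  obtain C2 where C2: "C2 \<ge> 0" "\<And>r. r \<ge> 0 \<Longrightarrow> norm (dsum k 0 r) \<le> C2 * (r + 1)"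
    using dsum_bound[OF k] by blast
  define C where "C = (\<Sum>v\<in>V. norm (c v)) * (C1 + C2) * 2"
  have "norm (\<Sum>x | prim x \<and> real_of_int (enorm x) \<le> r. c x * sgn (toc x) ^ k) \<le> C * sqrt r" if r: "r \<ge> 1" for r
  proof -
    have set: "{x. prim x \<and> real_of_int (enorm x) \<le> r} = {x. prim x \<and> norm (toc x) \<le> sqrt r}"
      using r by (auto simp: norm_toc_le_iff)
    have fin: "finite {x. prim x \<and> norm (toc x) \<le> sqrt r}" by (rule finite_subset[OF _ finite_disc[of "sqrt r"]]) auto
    have "(\<Sum>x | prim x \<and> norm (toc x) \<le> sqrt r. c x * sgn (toc x) ^ k)
      = (\<Sum>v\<in>V. \<Sum>x | x \<in> {x. prim x \<and> norm (toc x) \<le> sqrt r} \<and> s dvd x - v. c x * sgn (toc x) ^ k)"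
      by (rule sum_residues[OF V fin])
    also have "\<dots> = (\<Sum>v\<in>V. (if prim v then c v else 0) * (\<Sum>x | s dvd x - v \<and> norm (toc x) \<le> sqrt r. sgn (toc x) ^ k))"
    proof (rule sum.cong)
      fix v
      have p: "prim x \<longleftrightarrow> prim v" if "s dvd x - v" for x
        using prim_cong[of x v] dvd_trans[OF d3 that] by simp
      show "(\<Sum>x | x \<in> {x. prim x \<and> norm (toc x) \<le> sqrt r} \<and> s dvd x - v. c x * sgn (toc x) ^ k)
        = (if prim v then c v else 0) * (\<Sum>x | s dvd x - v \<and> norm (toc x) \<le> sqrt r. sgn (toc x) ^ k)"
      proof (cases "prim v")
        case True
        then have eq: "{x. x \<in> {x. prim x \<and> norm (toc x) \<le> sqrt r} \<and> s dvd x - v} = {x. s dvd x - v \<and> norm (toc x) \<le> sqrt r}"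
          using p by blast
        have "c x = c v" if "s dvd x - v" for x using that unfolding s_def by (rule per)
        note cv = this
        have "(\<Sum>x | x \<in> {x. prim x \<and> norm (toc x) \<le> sqrt r} \<and> s dvd x - v. c x * sgn (toc x) ^ k)
          = (\<Sum>x | s dvd x - v \<and> norm (toc x) \<le> sqrt r. c v * sgn (toc x) ^ k)"
        proof (rule sum.cong[OF eq])
          fix x assume "x \<in> {x. s dvd x - v \<and> norm (toc x) \<le> sqrt r}"
          then have "s dvd x - v" by simp
          then show "c x * sgn (toc x) ^ k = c v * sgn (toc x) ^ k"
            using cv[of x] by (simp only:)
        qed
        then show ?thesis using True by (simp only: if_True sum_distrib_left mult.assoc)
      next
        case False
        then have e: "{x. x \<in> {x. prim x \<and> norm (toc x) \<le> sqrt r} \<and> s dvd x - v} = {}"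
          using p by blast
        show ?thesis using False unfolding e by simp
      qed
    qed simp
    also have "norm \<dots> \<le> (\<Sum>v\<in>V. norm ((if prim v then c v else 0) * (\<Sum>x | s dvd x - v \<and> norm (toc x) \<le> sqrt r. sgn (toc x) ^ k)))"
      by (rule norm_sum)
    also have "\<dots> \<le> (\<Sum>v\<in>V. norm (c v) * ((C1 + C2) * (2 * sqrt r)))"
    proof (rule sum_mono)
      fix v assume v: "v \<in> V"
      define q where "q = sqrt r / norm (toc s)"
      have "q \<le> sqrt r / 1" unfolding q_def using r s1 by (intro frac_le) auto
      then have q: "q \<ge> 0" "q \<le> sqrt r" using r by (auto simp: q_def)
      have "norm (dsum k (toc v / toc s) q) \<le> norm (dsum k (toc v / toc s) q - dsum k 0 q) + norm (dsum k 0 q)"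
        by (metis diff_add_cancel norm_triangle_ineq)
      also have "\<dots> \<le> C1 * (q + 1) + C2 * (q + 1)"
        using C1(2)[OF D(2)[OF v] q(1)] C2(2)[OF q(1)] by (rule add_mono)
      also have "\<dots> = (C1 + C2) * (q + 1)" by (simp add: algebra_simps)
      also have "\<dots> \<le> (C1 + C2) * (2 * sqrt r)"
      proof (intro mult_left_mono)
        have "1 \<le> sqrt r" using r by simp
        then show "q + 1 \<le> 2 * sqrt r" using q by linarith
      qed (use C1(1) C2(1) in auto)
      finally have b: "norm (dsum k (toc v / toc s) q) \<le> (C1 + C2) * (2 * sqrt r)" .
      have "norm (\<Sum>x | s dvd x - v \<and> norm (toc x) \<le> sqrt r. sgn (toc x) ^ k) \<le> 1 * norm (dsum k (toc v / toc s) q)"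
        unfolding sum_coset[OF s0] norm_mult norm_power q_def by (intro mult_right_mono power_le_one norm_sgn_le_1) auto
      also note b
      finally have b2: "norm (\<Sum>x | s dvd x - v \<and> norm (toc x) \<le> sqrt r. sgn (toc x) ^ k) \<le> (C1 + C2) * (2 * sqrt r)"
        by simp
      show "norm ((if prim v then c v else 0) * (\<Sum>x | s dvd x - v \<and> norm (toc x) \<le> sqrt r. sgn (toc x) ^ k)) \<le> norm (c v) * ((C1 + C2) * (2 * sqrt r))"
        unfolding norm_mult by (intro mult_mono b2) auto
    qed
    also have "\<dots> = C * sqrt r" unfolding sum_distrib_right[symmetric] by (simp add: C_def)
    finally show ?thesis unfolding set .
  qed
  moreover have "C \<ge> 0" using C1(1) C2(1) by (simp add: C_def sum_nonneg)
  ultimately show ?thesis by blast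
qed

section \<open>Counting primary elements\<close>

lemma dsum_0: "dsum 0 0 r = of_nat (card {x. norm (toc x) \<le> r})"
  by (simp add: dsum_def)

text \<open>The classes modulo \<open>m\<close> split the disc of radius \<open>m * r\<close> into
  \<open>m ^ 2\<close> shifted discs of radius \<open>r\<close>. The shifts stay below 2 for every
  \<open>m\<close>, so one constant serves all \<open>m\<close>.\<close>

lemma count_scaling:
  "\<exists>C\<ge>0. \<forall>m r. m > 0 \<longrightarrow> r \<ge> 0 \<longrightarrow>
     \<bar>real (card {x. norm (toc x) \<le> real m * r}) - real m ^ 2 * real (card {x. norm (toc x) \<le> r})\<bar> \<le> C * real m ^ 2 * (r + 1)"
proof -
  obtain C where C: "C \<ge> 0" "\<And>d r. norm d \<le> 2 \<Longrightarrow> r \<ge> 0 \<Longrightarrow> norm (dsum 0 d r - dsum 0 0 r) \<le> C * (r + 1)"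
    using dsum_shift[of 2 0] by auto
  have "\<bar>real (card {x. norm (toc x) \<le> real m * r}) - real m ^ 2 * real (card {x. norm (toc x) \<le> r})\<bar> \<le> C * real m ^ 2 * (r + 1)"
    if m: "m > 0" and r: "r \<ge> 0" for m r
  proof -
    define s :: eis where "s = of_nat m"
    have s0: "s \<noteq> 0" "norm (toc s) = real m" using m by (simp_all add: s_def)
    define V where "V = (\<lambda>(a, b). Eis a b) ` ({0..<int m} \<times> {0..<int m})"
    have V: "complete_residues s V" using complete_residues_nat[OF m] by (simp add: s_def V_def)
    have cV: "card V = m ^ 2"
      unfolding V_def by (subst card_image) (auto intro!: inj_onI simp: power2_eq_square)
    have Vn: "norm (toc v / toc s) \<le> 2" if "v \<in> V" for v
    proof -
      obtain a b where v: "v = Eis a b" "0 \<le> a" "a < int m" "0 \<le> b" "b < int m" using \<open>v \<in> V\<close> by (auto simp: V_def)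
      have "v = of_int a + of_int b * omega" by (simp add: v eis_eq_iff eis_sel_mult)
      then have "norm (toc v) \<le> norm (toc (of_int a)) + norm (toc (of_int b)) * norm (toc omega)"
        by (metis norm_mult norm_triangle_ineq toc_simps(3,6))
      also have "\<dots> \<le> 2 * real m" using v by (simp add: norm_toc)
      finally show ?thesis using m s0 by (simp add: norm_divide field_simps)
    qed
    have "(of_nat (card {x. norm (toc x) \<le> real m * r}) :: complex) = dsum 0 0 (real m * r)" by (simp add: dsum_0)
    also have "\<dots> = (\<Sum>v\<in>V. \<Sum>x | x \<in> {x. norm (toc x) \<le> real m * r} \<and> s dvd x - v. sgn (toc x) ^ 0)"
      unfolding dsum_def using sum_residues[OF V finite_disc[of "real m * r"], of "\<lambda>x. sgn (toc x) ^ 0"] by simp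
    also have "\<dots> = (\<Sum>v\<in>V. dsum 0 (toc v / toc s) r)"
    proof (rule sum.cong)
      fix v
      have "dsum 0 (toc v / toc s) r = (\<Sum>x | s dvd x - v \<and> norm (toc x) \<le> real m * r. sgn (toc x) ^ 0)"
        using sum_coset[OF s0(1), where v = v and r = "real m * r" and k = 0] m by (simp only: s0(2) power_0) simp
      then show "(\<Sum>x | x \<in> {x. norm (toc x) \<le> real m * r} \<and> s dvd x - v. sgn (toc x) ^ 0) = dsum 0 (toc v / toc s) r"
        by (simp only: mem_Collect_eq conj_commute)
    qed simp
    finally have "(of_nat (card {x. norm (toc x) \<le> real m * r}) :: complex) - of_nat (m ^ 2) * of_nat (card {x. norm (toc x) \<le> r})
      = (\<Sum>v\<in>V. dsum 0 (toc v / toc s) r - dsum 0 0 r)"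
      by (simp add: sum_subtractf dsum_0 cV)
    also have "norm \<dots> \<le> (\<Sum>v\<in>V. norm (dsum 0 (toc v / toc s) r - dsum 0 0 r))" by (rule norm_sum)
    also have "\<dots> \<le> (\<Sum>v\<in>V. C * (r + 1))" using C(2)[OF Vn r] by (intro sum_mono) auto
    also have "\<dots> = C * real m ^ 2 * (r + 1)" by (simp add: cV)
    finally have "norm (complex_of_real (real (card {x. norm (toc x) \<le> real m * r}) - real m ^ 2 * real (card {x. norm (toc x) \<le> r}))) \<le> C * real m ^ 2 * (r + 1)"
      by simp
    then show ?thesis unfolding norm_of_real .
  qed
  then show ?thesis using C(1) by blast
qed

lemma count_lower: "real (card {x. norm (toc x) \<le> real n}) \<ge> real n ^ 2 / 4"
proof -
  define A where "A = {0..int n div 2}"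
  have "(\<lambda>(a, b). Eis a b) ` (A \<times> A) \<subseteq> {x. norm (toc x) \<le> real n}"
  proof
    fix x assume "x \<in> (\<lambda>(a, b). Eis a b) ` (A \<times> A)"
    then obtain a b where x: "x = Eis a b" "0 \<le> a" "2 * a \<le> int n" "0 \<le> b" "2 * b \<le> int n" by (auto simp: A_def)
    have "x = of_int a + of_int b * omega" by (simp add: x eis_eq_iff eis_sel_mult)
    then have "norm (toc x) \<le> norm (toc (of_int a)) + norm (toc (of_int b)) * norm (toc omega)"
      by (metis norm_mult norm_triangle_ineq toc_simps(3,6))
    also have "\<dots> = real_of_int (a + b)" using x by (simp add: norm_toc)
    also have "\<dots> \<le> real_of_int (int n)" unfolding of_int_le_iff using x by linarith
    finally show "x \<in> {x. norm (toc x) \<le> real n}" by simp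
  qed
  then have "card ((\<lambda>(a, b). Eis a b) ` (A \<times> A)) \<le> card {x. norm (toc x) \<le> real n}"
    by (intro card_mono finite_disc)
  moreover have "card ((\<lambda>(a, b). Eis a b) ` (A \<times> A)) = card A * card A"
    by (subst card_image) (auto intro!: inj_onI simp: card_cartesian_product)
  moreover have "real (card A) \<ge> real n / 2" unfolding A_def by simp
  then have "real n / 2 * (real n / 2) \<le> real (card A) * real (card A)" by (intro mult_mono) auto
  ultimately have "real n / 2 * (real n / 2) \<le> real (card {x. norm (toc x) \<le> real n})"
    by (metis of_nat_le_iff of_nat_mult order_trans)
  then show ?thesis by (simp add: power2_eq_square)
qed

text \<open>By \<open>count_scaling\<close> the ratios \<open>a n = T n / n ^ 2\<close> satisfy
  \<open>a (m * n) - a n = O(1 / n)\<close>. Comparing \<open>a m\<close> and \<open>a n\<close>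
  through \<open>a (m * n)\<close> shows that they form a Cauchy sequence; its limit is the density,
  positive by \<open>count_lower\<close>.\<close>

lemma count_asymptotic:
  "\<exists>c>0. \<exists>C\<ge>0. \<forall>r\<ge>1. \<bar>real (card {x. norm (toc x) \<le> r}) - c * r ^ 2\<bar> \<le> C * r"
proof -
  define T where "T r = real (card {x. norm (toc x) \<le> r})" for r
  obtain C where C: "C \<ge> 0" "\<And>m r. m > 0 \<Longrightarrow> r \<ge> 0 \<Longrightarrow> \<bar>T (real m * r) - real m ^ 2 * T r\<bar> \<le> C * real m ^ 2 * (r + 1)"
    using count_scaling unfolding T_def by blast
  define a where "a n = T (real n) / real n ^ 2" for n :: nat
  have step: "\<bar>a (m * n) - a n\<bar> \<le> 2 * C / real n" if "m > 0" "n > 0" for m n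
  proof -
    have mn: "real m ^ 2 * real n ^ 2 > 0" using that by simp
    have "a (m * n) - a n = (T (real m * real n) - real m ^ 2 * T (real n)) / (real m ^ 2 * real n ^ 2)"
      using that by (simp add: a_def field_simps power_mult_distrib)
    then have "\<bar>a (m * n) - a n\<bar> = \<bar>T (real m * real n) - real m ^ 2 * T (real n)\<bar> / (real m ^ 2 * real n ^ 2)"
      using mn by simp
    also have "\<dots> \<le> (C * real m ^ 2 * (real n + 1)) / (real m ^ 2 * real n ^ 2)"
      using C(2)[of m "real n"] that mn by (intro divide_right_mono) auto
    also have "\<dots> = C * (real n + 1) / real n ^ 2" using that by simp
    also have "\<dots> \<le> C * (2 * real n) / real n ^ 2"
      using that C(1) by (intro divide_right_mono mult_left_mono) auto
    also have "\<dots> = 2 * C / real n" using that by (simp add: power2_eq_square)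
    finally show ?thesis .
  qed
  have diff: "\<bar>a m - a n\<bar> \<le> 2 * C / real m + 2 * C / real n" if "m > 0" "n > 0" for m n
    using step[of n m] step[of m n] that by (simp add: mult.commute)
  have "Cauchy a"
  proof (rule metric_CauchyI)
    fix e :: real assume e: "e > 0"
    obtain M :: nat where M: "real M > (4 * C + 1) / e" using reals_Archimedean2 by blast
    have M0: "real M > 0" using M C(1) e by (smt (verit) divide_pos_pos)
    have "dist (a m) (a n) < e" if "m \<ge> M" "n \<ge> M" for m n
    proof -
      have mn: "m > 0" "n > 0" using that M0 by auto
      have "dist (a m) (a n) \<le> 2 * C / real m + 2 * C / real n" using diff[OF mn] by (simp add: dist_real_def)
      also have "\<dots> \<le> 2 * C / real M + 2 * C / real M"
        using that M0 C(1) by (intro add_mono divide_left_mono) auto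
      also have "\<dots> < e" using M M0 e C(1) by (simp add: field_simps)
      finally show ?thesis .
    qed
    then show "\<exists>M. \<forall>m\<ge>M. \<forall>n\<ge>M. dist (a m) (a n) < e" by blast
  qed
  then obtain c where c: "a \<longlonglongrightarrow> c" using Cauchy_convergent_iff convergent_def by blast
  have ac: "\<bar>c - a n\<bar> \<le> 2 * C / real n" if "n > 0" for n
  proof (rule LIMSEQ_le_const2)
    show "(\<lambda>m. \<bar>a (m * n) - a n\<bar>) \<longlonglongrightarrow> \<bar>c - a n\<bar>"
      using that by (intro tendsto_intros LIMSEQ_subseq_LIMSEQ[OF c, unfolded o_def]) (simp add: strict_mono_def)
    show "\<exists>N. \<forall>m\<ge>N. \<bar>a (m * n) - a n\<bar> \<le> 2 * C / real n" using step that by (intro exI[of _ 1]) auto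
  qed
  have "c \<ge> 1/4"
  proof (rule LIMSEQ_le_const[OF c])
    show "\<exists>N. \<forall>n\<ge>N. 1/4 \<le> a n"
      using count_lower by (intro exI[of _ 1]) (auto simp: a_def T_def field_simps)
  qed
  then have c0: "c > 0" by simp
  have Tn: "\<bar>T (real n) - c * real n ^ 2\<bar> \<le> 2 * C * real n" if "n > 0" for n
  proof -
    have "T (real n) - c * real n ^ 2 = (a n - c) * real n ^ 2" using that by (simp add: a_def field_simps)
    then have "\<bar>T (real n) - c * real n ^ 2\<bar> = \<bar>c - a n\<bar> * real n ^ 2" by (simp add: abs_mult abs_minus_commute)
    also have "\<dots> \<le> 2 * C / real n * real n ^ 2" using ac[OF that] by (intro mult_right_mono) auto
    also have "\<dots> = 2 * C * real n" using that by (simp add: power2_eq_square)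
    finally show ?thesis .
  qed
  have "\<bar>T r - c * r ^ 2\<bar> \<le> (4 * C + 3 * c) * r" if r: "r \<ge> 1" for r
  proof -
    define n where "n = nat \<lfloor>r\<rfloor>"
    have n: "n > 0" "real n \<le> r" "r < real n + 1" using r unfolding n_def by linarith+
    have mono: "T x \<le> T y" if "x \<le> y" for x y
      unfolding T_def of_nat_le_iff using that by (intro card_mono finite_disc) auto
    have sq: "real n ^ 2 \<le> r ^ 2" "r ^ 2 \<le> real (Suc n) ^ 2" using n by (intro power_mono; simp)+
    have "real (Suc n) ^ 2 - real n ^ 2 = 2 * real n + 1" by (simp add: power2_eq_square algebra_simps)
    then have d: "real (Suc n) ^ 2 - real n ^ 2 \<le> 3 * r" using n by linarith
    have u: "real (Suc n) ^ 2 \<le> r ^ 2 + 3 * r" "r ^ 2 - 3 * r \<le> real n ^ 2"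
      using d sq by linarith+
    have v: "real (Suc n) \<le> 2 * r" "real n \<le> 2 * r" using n r by simp_all
    have "T r \<le> T (real (Suc n))" using n by (intro mono) simp
    also have "\<dots> \<le> c * real (Suc n) ^ 2 + 2 * C * real (Suc n)" using Tn[of "Suc n"] by simp
    also have "\<dots> \<le> c * (r ^ 2 + 3 * r) + 2 * C * (2 * r)"
      using c0 C(1) by (intro add_mono mult_left_mono u v) auto
    finally have 1: "T r - c * r ^ 2 \<le> (4 * C + 3 * c) * r" by (simp add: algebra_simps)
    have "c * (r ^ 2 - 3 * r) - 2 * C * (2 * r) \<le> c * real n ^ 2 - 2 * C * real n"
      using c0 C(1) by (intro diff_mono mult_left_mono u v) auto
    also have "\<dots> \<le> T (real n)" using Tn[OF n(1)] by linarith
    also have "\<dots> \<le> T r" using n by (intro mono)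
    finally have "c * r ^ 2 - T r \<le> (4 * C + 3 * c) * r" by (simp add: algebra_simps)
    with 1 show ?thesis by linarith
  qed
  moreover have "4 * C + 3 * c \<ge> 0" using c0 C(1) by simp
  ultimately show ?thesis using c0 unfolding T_def by blast
qed

text \<open>Divided by 3, the primary elements are the lattice shifted by 1/3 in the disc of radius
  \<open>sqrt r / 3\<close>; the density is one ninth of that of all elements.\<close>

theorem prim_count:
  "\<exists>c>0. \<exists>C\<ge>0. \<forall>r\<ge>1. \<bar>real (card {x. prim x \<and> real_of_int (enorm x) \<le> r}) - c * r\<bar> \<le> C * sqrt r"
proof -
  obtain c C where c: "c > 0" "C \<ge> 0" "\<And>r. r \<ge> 1 \<Longrightarrow> \<bar>real (card {x. norm (toc x) \<le> r}) - c * r ^ 2\<bar> \<le> C * r"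
    using count_asymptotic by blast
  obtain C1 where C1: "C1 \<ge> 0" "\<And>d r. norm d \<le> 1/3 \<Longrightarrow> r \<ge> 0 \<Longrightarrow> norm (dsum 0 d r - dsum 0 0 r) \<le> C1 * (r + 1)"
    using dsum_shift[of "1/3" 0] by auto
  have C3: "\<bar>real (card {x. norm (toc x) \<le> r}) - c * r ^ 2\<bar> \<le> (C + c + real (card {x. norm (toc x) \<le> 1})) * (r + 1)" if "r \<ge> 0" for r
  proof (cases "r \<ge> 1")
    case True
    have "C * r \<le> (C + c + real (card {x. norm (toc x) \<le> 1})) * (r + 1)"
      using True c by (intro mult_mono) auto
    then show ?thesis using c(3)[OF True] by linarith
  next
    case False
    define t1 t2 where "t1 = real (card {x. norm (toc x) \<le> r})" and "t2 = real (card {x. norm (toc x) \<le> 1})"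
    have "card {x. norm (toc x) \<le> r} \<le> card {x. norm (toc x) \<le> 1}"
      using False by (intro card_mono finite_disc) auto
    then have t: "t1 \<le> t2" "0 \<le> t1" by (simp_all add: t1_def t2_def)
    have "0 \<le> c * r ^ 2" "c * r ^ 2 \<le> c * 1" using c that False by (auto intro!: mult_left_mono power_le_one)
    then have "\<bar>t1 - c * r ^ 2\<bar> \<le> C + c + t2" using t c(1,2) by linarith
    then have "\<bar>real (card {x. norm (toc x) \<le> r}) - c * r ^ 2\<bar> \<le> (C + c + real (card {x. norm (toc x) \<le> 1})) * 1"
      by (simp only: t1_def t2_def mult_1_right)
    also have "\<dots> \<le> (C + c + real (card {x. norm (toc x) \<le> 1})) * (r + 1)"
      using c that by (intro mult_left_mono) auto
    finally show ?thesis .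
  qed
  define K where "K = (C1 + (C + c + real (card {x. norm (toc x) \<le> 1}))) * 2"
  have "\<bar>real (card {x. prim x \<and> real_of_int (enorm x) \<le> r}) - c / 9 * r\<bar> \<le> K * sqrt r" if r: "r \<ge> 1" for r
  proof -
    define q where "q = sqrt r / 3"
    have q: "q \<ge> 0" using r by (simp add: q_def)
    have "{x. prim x \<and> real_of_int (enorm x) \<le> r} = {x. 3 dvd x - 1 \<and> norm (toc x) \<le> sqrt r}"
      using r by (auto simp: norm_toc_le_iff prim_alt dvd_def algebra_simps)
    then have "of_nat (card {x. prim x \<and> real_of_int (enorm x) \<le> r}) = (\<Sum>x | 3 dvd x - 1 \<and> norm (toc x) \<le> sqrt r. sgn (toc x) ^ 0)"
      by simp
    also have "\<dots> = dsum 0 (1/3) q" using sum_coset[where s = 3 and v = 1 and r = "sqrt r" and k = 0] by (simp add: q_def)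
    finally have 1: "of_nat (card {x. prim x \<and> real_of_int (enorm x) \<le> r}) = dsum 0 (1/3) q" .
    have "norm (dsum 0 (1/3) q - dsum 0 0 q) \<le> C1 * (q + 1)" using C1(2)[of "1/3" q] q by simp
    then have "norm (complex_of_real (real (card {x. prim x \<and> real_of_int (enorm x) \<le> r}) - real (card {x. norm (toc x) \<le> q}))) \<le> C1 * (q + 1)"
      by (simp add: 1[symmetric] dsum_0)
    then have "\<bar>real (card {x. prim x \<and> real_of_int (enorm x) \<le> r}) - real (card {x. norm (toc x) \<le> q})\<bar> \<le> C1 * (q + 1)"
      unfolding norm_of_real .
    moreover have "c * q ^ 2 = c / 9 * r" using r by (simp add: q_def power_divide)
    ultimately have "\<bar>real (card {x. prim x \<and> real_of_int (enorm x) \<le> r}) - c / 9 * r\<bar> \<le> C1 * (q + 1) + (C + c + real (card {x. norm (toc x) \<le> 1})) * (q + 1)"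
      using C3[OF q] by linarith
    also have "\<dots> = (C1 + (C + c + real (card {x. norm (toc x) \<le> 1}))) * (q + 1)" by (simp add: algebra_simps)
    also have "\<dots> \<le> (C1 + (C + c + real (card {x. norm (toc x) \<le> 1}))) * (2 * sqrt r)"
    proof (intro mult_left_mono)
      have "1 \<le> sqrt r" using r by simp
      then show "q + 1 \<le> 2 * sqrt r" unfolding q_def by linarith
    qed (use C1(1) c in auto)
    finally show ?thesis by (simp only: K_def mult.assoc)
  qed
  moreover have "K \<ge> 0" using C1(1) c by (simp add: K_def)
  moreover have "c / 9 > 0" using c by simp
  ultimately show ?thesis by blast
qed

section \<open>Mertens estimates for twisted characters\<close>

abbreviation prims :: "real \<Rightarrow> eis set" where "prims y \<equiv> {x. prim x \<and> real_of_int (enorm x) \<le> y}"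
abbreviation nm :: "eis \<Rightarrow> real" where "nm x \<equiv> real_of_int (enorm x)"

lemma finite_prims: "finite (prims y)"
proof (rule finite_subset[OF _ finite_enorm_le[of "\<lfloor>y\<rfloor>"]])
  show "prims y \<subseteq> {x. enorm x \<le> \<lfloor>y\<rfloor>}" by (auto simp: le_floor_iff)
qed

lemma nm_ge_1: "prim x \<Longrightarrow> nm x \<ge> 1"
  using enorm_ge_1[OF prim_nonzero] by simp

lemma nm_mult: "nm (x * y) = nm x * nm y" by (simp add: enorm_mult)

lemma prims_floor: "y \<ge> 0 \<Longrightarrow> prims y = prims (real (nat \<lfloor>y\<rfloor>))"
  by (auto simp: le_floor_iff)

lemma sum_prims_layers:
  fixes f :: "eis \<Rightarrow> 'a :: comm_monoid_add"
  shows "(\<Sum>x\<in>prims (real n). f x) = (\<Sum>k\<in>{1..n}. \<Sum>x | prim x \<and> enorm x = int k. f x)"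
proof -
  have "(\<Sum>x\<in>prims (real n). f x) = (\<Sum>k\<in>{1..n}. \<Sum>x | x \<in> prims (real n) \<and> nat (enorm x) = k. f x)"
  proof (rule sum.group[symmetric])
    show "(\<lambda>x. nat (enorm x)) ` prims (real n) \<subseteq> {1..n}"
    proof (rule image_subsetI)
      fix x assume x: "x \<in> prims (real n)"
      then have "real_of_int (enorm x) \<le> real_of_int (int n)" by simp
      then have "enorm x \<le> int n" unfolding of_int_le_iff .
      moreover have "enorm x \<ge> 1" using x enorm_ge_1[OF prim_nonzero] by blast
      ultimately show "nat (enorm x) \<in> {1..n}" by auto
    qed
  qed (simp_all add: finite_prims)
  also have "\<dots> = (\<Sum>k\<in>{1..n}. \<Sum>x | prim x \<and> enorm x = int k. f x)"
  proof (rule sum.cong)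
    fix k assume k: "k \<in> {1..n}"
    have "x \<in> prims (real n) \<and> nat (enorm x) = k \<longleftrightarrow> prim x \<and> enorm x = int k" for x
      using k by auto
    then show "(\<Sum>x | x \<in> prims (real n) \<and> nat (enorm x) = k. f x) = (\<Sum>x | prim x \<and> enorm x = int k. f x)" by simp
  qed simp
  finally show ?thesis .
qed

section \<open>Partial summation with power-saving errors\<close>

text \<open>By the mean value theorem; the sum of \<open>k powr (-5/4)\<close> is thereby majorized
  by a telescoping one.\<close>

lemma powr_quarter_step:
  assumes "n \<ge> 1"
  shows "real (Suc n) powr (-5/4) \<le> 4 * (real n powr (-1/4) - real (Suc n) powr (-1/4))"
proof -
  have "\<exists>z. real n < z \<and> z < real (Suc n) \<and>
    real (Suc n) powr (-1/4) - real n powr (-1/4) = (real (Suc n) - real n) * (-1/4 * z powr (-1/4 - 1))"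
    using assms by (intro MVT2) (auto intro!: derivative_eq_intros)
  then obtain z where z: "real n < z" "z < real (Suc n)"
    "real (Suc n) powr (-1/4) - real n powr (-1/4) = -1/4 * z powr (-5/4)" by auto
  have "real (Suc n) powr (-5/4) \<le> z powr (-5/4)"
    using z assms by (intro powr_mono2') auto
  then show ?thesis using z(3) by simp
qed

lemma quarter_limit:
  fixes s :: "nat \<Rightarrow> complex"
  assumes K: "K \<ge> 0" and s: "\<And>n. n \<ge> 1 \<Longrightarrow> norm (s (Suc n) - s n) \<le> K * real (Suc n) powr (-5/4)"
  shows "\<exists>L. \<forall>n\<ge>1. norm (s n - L) \<le> 4 * K * real n powr (-1/4)"
proof -
  have d: "norm (s m - s n) \<le> 4 * K * (real n powr (-1/4) - real m powr (-1/4))" if "n \<le> m" "n \<ge> 1" for m n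
    using that(1)
  proof (induction m rule: dec_induct)
    case (step m)
    have "norm (s (Suc m) - s n) \<le> norm (s (Suc m) - s m) + norm (s m - s n)"
      by (metis norm_diff_triangle_ineq add.commute diff_add_cancel diff_diff_eq2 norm_triangle_ineq add_diff_eq)
    also have "\<dots> \<le> K * (4 * (real m powr (-1/4) - real (Suc m) powr (-1/4))) + 4 * K * (real n powr (-1/4) - real m powr (-1/4))"
      using step that K powr_quarter_step[of m] s[of m]
      by (intro add_mono) (auto intro: order_trans mult_left_mono)
    finally show ?case by (simp add: algebra_simps)
  qed simp
  have lim0: "(\<lambda>n. 4 * K * real n powr (-1/4)) \<longlonglongrightarrow> 0" by real_asymp
  have "Cauchy s"
  proof (rule metric_CauchyI)
    fix e :: real assume "e > 0"
    then obtain M where M: "\<And>n. n \<ge> M \<Longrightarrow> 4 * K * real n powr (-1/4) < e"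
      using order_tendstoD(2)[OF lim0] unfolding eventually_sequentially by blast
    have le: "dist (s m) (s n) < e" if "n \<le> m" "n \<ge> max M 1" for m n
    proof -
      have "dist (s m) (s n) \<le> 4 * K * (real n powr (-1/4) - real m powr (-1/4))" using d[of n m] that by (simp add: dist_norm)
      also have "\<dots> \<le> 4 * K * real n powr (-1/4)" using K by (intro mult_left_mono) auto
      also have "\<dots> < e" using M that by simp
      finally show ?thesis .
    qed
    have "dist (s m) (s n) < e" if "m \<ge> max M 1" "n \<ge> max M 1" for m n
      using le[of n m] le[of m n] that by (cases "n \<le> m") (auto simp: dist_commute)
    then show "\<exists>M. \<forall>m\<ge>M. \<forall>n\<ge>M. dist (s m) (s n) < e" by blast
  qed
  then obtain L where L: "s \<longlonglongrightarrow> L" using Cauchy_convergent_iff convergent_def by blast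
  have "norm (s n - L) \<le> 4 * K * real n powr (-1/4)" if n: "n \<ge> 1" for n
  proof (rule LIMSEQ_le_const2)
    show "(\<lambda>m. norm (s n - s m)) \<longlonglongrightarrow> norm (s n - L)" by (intro tendsto_intros L)
    have "norm (s n - s m) \<le> 4 * K * real n powr (-1/4)" if "m \<ge> n" for m
    proof -
      have "norm (s n - s m) \<le> 4 * K * (real n powr (-1/4) - real m powr (-1/4))" using d[OF that n] by (simp add: norm_minus_commute)
      also have "\<dots> \<le> 4 * K * real n powr (-1/4)" using K by (intro mult_left_mono) auto
      finally show ?thesis .
    qed
    then show "\<exists>N. \<forall>m\<ge>N. norm (s n - s m) \<le> 4 * K * real n powr (-1/4)" by blast
  qed
  then show ?thesis by blast
qed

text \<open>Partial summation. The decay -3/4 and -7/4, instead of -1 and -2, leaves room for the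
  logarithm in \<open>ln k / k\<close>, at the price of the error
  \<open>n powr (-1/4)\<close>.\<close>

lemma abel_quarter:
  fixes a :: "nat \<Rightarrow> complex" and h :: "nat \<Rightarrow> real"
  assumes C: "C \<ge> 0" "\<And>n. n \<ge> 1 \<Longrightarrow> norm (\<Sum>k=1..n. a k) \<le> C * real n powr (1/2)"
    and D: "D \<ge> 0" "\<And>k. k \<ge> 1 \<Longrightarrow> \<bar>h k\<bar> \<le> D * real k powr (-3/4)"
      "\<And>k. k \<ge> 1 \<Longrightarrow> \<bar>h k - h (Suc k)\<bar> \<le> D * real k powr (-7/4)"
  shows "\<exists>L K. K \<ge> 0 \<and> (\<forall>n\<ge>1. norm ((\<Sum>k=1..n. a k * h k) - L) \<le> K * real n powr (-1/4))"
proof -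
  define E where "E n = (\<Sum>k=1..n. a k)" for n
  define s where "s n = (\<Sum>k=1..n. a k * h k) - E n * h (Suc n)" for n
  have "norm (s (Suc n) - s n) \<le> (C * D) * real (Suc n) powr (-5/4)" if "n \<ge> 1" for n
  proof -
    have "s (Suc n) - s n = E (Suc n) * of_real (h (Suc n) - h (Suc (Suc n)))"
      by (simp add: s_def E_def algebra_simps)
    then have "norm (s (Suc n) - s n) = norm (E (Suc n)) * \<bar>h (Suc n) - h (Suc (Suc n))\<bar>"
      by (simp add: norm_mult del: of_real_diff)
    also have "\<dots> \<le> (C * real (Suc n) powr (1/2)) * (D * real (Suc n) powr (-7/4))"
    proof (intro mult_mono)
      show "norm (E (Suc n)) \<le> C * real (Suc n) powr (1/2)" unfolding E_def by (rule C(2)) simp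
      show "\<bar>h (Suc n) - h (Suc (Suc n))\<bar> \<le> D * real (Suc n) powr (-7/4)" by (rule D(3)) simp
    qed (use C(1) in simp_all)
    also have "\<dots> = (C * D) * (real (Suc n) powr (1/2) * real (Suc n) powr (-7/4))" by simp
    also have "real (Suc n) powr (1/2) * real (Suc n) powr (-7/4) = real (Suc n) powr (-5/4)"
      by (simp add: powr_add[symmetric])
    finally show ?thesis .
  qed
  then obtain L where L: "\<And>n. n \<ge> 1 \<Longrightarrow> norm (s n - L) \<le> 4 * (C * D) * real n powr (-1/4)"
    using quarter_limit[of "C * D" s] C D by auto
  have "norm ((\<Sum>k=1..n. a k * h k) - L) \<le> (5 * C * D) * real n powr (-1/4)" if n: "n \<ge> 1" for n
  proof -
    have "(\<Sum>k=1..n. a k * h k) - L = (s n - L) + E n * h (Suc n)" by (simp add: s_def)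
    then have "norm ((\<Sum>k=1..n. a k * h k) - L) \<le> norm (s n - L) + norm (E n * h (Suc n))"
      by (simp only: norm_triangle_ineq)
    also have "norm (E n * h (Suc n)) = norm (E n) * \<bar>h (Suc n)\<bar>" by (simp add: norm_mult)
    also have "norm (E n) * \<bar>h (Suc n)\<bar> \<le> (C * real n powr (1/2)) * (D * real n powr (-3/4))"
    proof (intro mult_mono)
      have "\<bar>h (Suc n)\<bar> \<le> D * real (Suc n) powr (-3/4)" by (rule D(2)) simp
      also have "\<dots> \<le> D * real n powr (-3/4)" using n D(1) by (intro mult_left_mono powr_mono2') auto
      finally show "\<bar>h (Suc n)\<bar> \<le> D * real n powr (-3/4)" .
      show "norm (E n) \<le> C * real n powr (1/2)" unfolding E_def by (rule C(2)) (rule n)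
    qed (use C(1) in simp_all)
    also have "\<dots> = (C * D) * (real n powr (1/2) * real n powr (-3/4))" by simp
    also have "real n powr (1/2) * real n powr (-3/4) = real n powr (-1/4)" by (simp add: powr_add[symmetric])
    finally show ?thesis using L[OF n] by (simp add: algebra_simps)
  qed
  moreover have "5 * C * D \<ge> 0" using C D by simp
  ultimately show ?thesis by blast
qed

lemma ln_quarter: assumes "(x::real) \<ge> 1" shows "ln x \<le> 4 * x powr (1/4)"
  using ln_powr_bound[of x "1/4"] assms by simp

lemma inverse_weight:
  assumes "k \<ge> 1"
  shows "\<bar>1 / real k\<bar> \<le> 1 * real k powr (-3/4)" "\<bar>1 / real k - 1 / real (Suc k)\<bar> \<le> 1 * real k powr (-7/4)"
proof -
  have k: "real k \<ge> 1" using assms by simp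
  have "real k powr (-1) \<le> real k powr (-3/4)" using k by (intro powr_mono) auto
  then show "\<bar>1 / real k\<bar> \<le> 1 * real k powr (-3/4)" using k by (simp add: powr_minus_divide)
  have "1 / real k - 1 / real (Suc k) = 1 / (real k * real (Suc k))" using k by (simp add: field_simps)
  then have "\<bar>1 / real k - 1 / real (Suc k)\<bar> \<le> 1 / (real k * real k)"
    using k by (simp add: frac_le mult_left_mono)
  also have "\<dots> = real k powr (-2)" using k by (simp add: powr_minus_divide power2_eq_square)
  also have "\<dots> \<le> real k powr (-7/4)" using k by (intro powr_mono) auto
  finally show "\<bar>1 / real k - 1 / real (Suc k)\<bar> \<le> 1 * real k powr (-7/4)" by simp
qed

lemma ln_weight:
  assumes "k \<ge> 1"
  shows "\<bar>ln (real k) / real k\<bar> \<le> 5 * real k powr (-3/4)"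
    "\<bar>ln (real k) / real k - ln (real (Suc k)) / real (Suc k)\<bar> \<le> 5 * real k powr (-7/4)"
proof -
  have k: "real k \<ge> 1" using assms by simp
  have ln: "0 \<le> ln (real k)" "ln (real k) \<le> 4 * real k powr (1/4)" using k ln_quarter by auto
  have pk: "real k powr (-1) = 1 / real k" "real k powr (-2) = 1 / (real k * real k)"
    using k by (simp_all add: powr_minus_divide power2_eq_square)
  have "\<bar>ln (real k) / real k\<bar> = ln (real k) * real k powr (-1)" unfolding pk using ln(1) by simp
  also have "\<dots> \<le> (4 * real k powr (1/4)) * real k powr (-1)" using ln by (intro mult_right_mono) auto
  also have "\<dots> = 4 * real k powr (-3/4)" by (simp only: mult.assoc powr_add[symmetric]) simp
  also have "\<dots> \<le> 5 * real k powr (-3/4)" by simp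
  finally show "\<bar>ln (real k) / real k\<bar> \<le> 5 * real k powr (-3/4)" .
  define d where "d = ln (real (Suc k)) - ln (real k)"
  have d: "0 \<le> d" "d \<le> 1 / real k"
  proof -
    show "0 \<le> d" using k by (simp add: d_def)
    have "1 + 1 / real k = real (Suc k) / real k" using k by (simp add: field_simps)
    then have "ln (1 + 1 / real k) = ln (real (Suc k) / real k)" by (rule arg_cong)
    also have "\<dots> = d" unfolding d_def using k by (intro ln_divide_pos) auto
    finally have "d = ln (1 + 1 / real k)" ..
    also have "\<dots> \<le> 1 / real k" using k by (intro ln_add_one_self_le_self) auto
    finally show "d \<le> 1 / real k" .
  qed
  have r: "1 / real k - 1 / real (Suc k) = 1 / (real k * real (Suc k))" using k by (simp add: field_simps)
  have "ln (real k) / real k - ln (real (Suc k)) / real (Suc k) = ln (real k) * (1 / real k - 1 / real (Suc k)) - d / real (Suc k)"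
    by (simp only: d_def diff_divide_distrib right_diff_distrib times_divide_eq_right mult_1_right)
  also have "\<dots> = ln (real k) / (real k * real (Suc k)) - d / real (Suc k)"
    unfolding r by (simp only: times_divide_eq_right mult_1_right)
  also have "\<bar>\<dots>\<bar> \<le> ln (real k) / (real k * real (Suc k)) + d / real (Suc k)"
    using ln d by (simp add: abs_le_iff)
  also have "\<dots> \<le> ln (real k) / (real k * real k) + (1 / real k) / real k"
    using ln d k by (intro add_mono frac_le mult_left_mono) auto
  also have "\<dots> = (ln (real k) + 1) * real k powr (-2)" unfolding pk by (simp add: add_divide_distrib)
  also have "\<dots> \<le> (5 * real k powr (1/4)) * real k powr (-2)"
  proof (intro mult_right_mono)
    have "1 \<le> real k powr (1/4)" using k by (simp add: ge_one_powr_ge_zero)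
    then show "ln (real k) + 1 \<le> 5 * real k powr (1/4)" using ln by linarith
  qed simp
  also have "\<dots> = 5 * real k powr (-7/4)" by (simp add: powr_add[symmetric])
  finally show "\<bar>ln (real k) / real k - ln (real (Suc k)) / real (Suc k)\<bar> \<le> 5 * real k powr (-7/4)" .
qed

lemma log_step:
  assumes "n \<ge> 1"
  defines "t \<equiv> 1 / real (Suc n)" and "d \<equiv> ln (real (Suc n)) - ln (real n)"
  shows "\<bar>t - d\<bar> \<le> 2 * t ^ 2" "0 \<le> d" "d \<le> 2 * t"
proof -
  have t: "0 < t" "t \<le> 1/2" using assms by (auto simp: t_def field_simps)
  have "real n / real (Suc n) = 1 + (- t)" by (simp add: t_def field_simps)
  then have "ln (1 + (- t)) = ln (real n / real (Suc n))" by (rule arg_cong[OF sym])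
  also have "\<dots> = ln (real n) - ln (real (Suc n))" using assms(1) by (intro ln_divide_pos) auto
  finally have "d = - ln (1 + (- t))" by (simp add: d_def)
  then have "\<bar>t - d\<bar> = \<bar>ln (1 + (- t)) - (- t)\<bar>" by simp
  also have "\<dots> \<le> 2 * (- t) ^ 2" using t by (intro abs_ln_one_plus_x_minus_x_bound) auto
  finally show 1: "\<bar>t - d\<bar> \<le> 2 * t ^ 2" by simp
  show "0 \<le> d" using assms(1) by (simp add: d_def)
  have "t * t \<le> t * (1/2)" using t by (intro mult_left_mono) auto
  then have "2 * t ^ 2 \<le> t" by (simp add: power2_eq_square)
  then show "d \<le> 2 * t" using 1 by linarith
qed

lemma inverse_square_quarter: "(1 / real (Suc n)) ^ 2 \<le> real (Suc n) powr (-7/4)"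
proof -
  have "(1 / real (Suc n)) ^ 2 = real (Suc n) powr (-2)" by (simp add: powr_minus_divide power_divide)
  also have "\<dots> \<le> real (Suc n) powr (-7/4)" by (intro powr_mono) auto
  finally show ?thesis .
qed

lemma harmonic_quarter:
  "\<exists>L K. K \<ge> 0 \<and> (\<forall>n\<ge>1. norm ((\<Sum>k=1..n. complex_of_real (1 / real k)) - of_real (ln (real n)) - L) \<le> K * real n powr (-1/4))"
proof -
  define s where "s n = (\<Sum>k=1..n. complex_of_real (1 / real k)) - of_real (ln (real n))" for n
  have "norm (s (Suc n) - s n) \<le> 2 * real (Suc n) powr (-5/4)" if "n \<ge> 1" for n
  proof -
    have "s (Suc n) - s n = of_real (1 / real (Suc n) - (ln (real (Suc n)) - ln (real n)))" by (simp add: s_def)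
    then have "norm (s (Suc n) - s n) = \<bar>1 / real (Suc n) - (ln (real (Suc n)) - ln (real n))\<bar>" by (simp only: norm_of_real)
    also have "\<dots> \<le> 2 * (1 / real (Suc n)) ^ 2" by (rule log_step(1)[OF that])
    also have "\<dots> \<le> 2 * real (Suc n) powr (-7/4)" using inverse_square_quarter[of n] by simp
    also have "\<dots> \<le> 2 * real (Suc n) powr (-5/4)" by (intro mult_left_mono powr_mono) auto
    finally show ?thesis .
  qed
  then obtain L where "\<forall>n\<ge>1. norm (s n - L) \<le> 4 * 2 * real n powr (-1/4)" using quarter_limit[of 2 s] by auto
  then show ?thesis unfolding s_def by (intro exI[of _ L] exI[of _ 8]) auto
qed

lemma log_harmonic_quarter:
  "\<exists>L K. K \<ge> 0 \<and> (\<forall>n\<ge>1. norm ((\<Sum>k=1..n. complex_of_real (ln (real k) / real k)) - of_real (ln (real n) ^ 2 / 2) - L) \<le> K * real n powr (-1/4))"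
proof -
  define s where "s n = (\<Sum>k=1..n. complex_of_real (ln (real k) / real k)) - of_real (ln (real n) ^ 2 / 2)" for n
  have "norm (s (Suc n) - s n) \<le> 10 * real (Suc n) powr (-5/4)" if n: "n \<ge> 1" for n
  proof -
    define t d u where "t = 1 / real (Suc n)" and "d = ln (real (Suc n)) - ln (real n)" and "u = ln (real (Suc n))"
    note ls = log_step[OF n, folded t_def d_def]
    have u: "0 \<le> u" "u \<le> 4 * real (Suc n) powr (1/4)" using ln_quarter[of "real (Suc n)"] by (simp_all add: u_def)
    have e: "ln (real n) = u - d" "ln (real (Suc n)) / real (Suc n) = u * t" by (simp_all add: u_def d_def t_def)
    have "s (Suc n) - s n = of_real (ln (real (Suc n)) / real (Suc n)) - (of_real (ln (real (Suc n)) ^ 2 / 2) - of_real (ln (real n) ^ 2 / 2))"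
      unfolding s_def by simp
    also have "\<dots> = of_real (u * t - (u ^ 2 / 2 - (u - d) ^ 2 / 2))"
      unfolding e by (simp only: u_def[symmetric] of_real_diff)
    also have "u * t - (u ^ 2 / 2 - (u - d) ^ 2 / 2) = u * (t - d) + d ^ 2 / 2"
      by (simp add: power2_eq_square field_simps)
    finally have "s (Suc n) - s n = of_real (u * (t - d) + d ^ 2 / 2)" .
    then have "norm (s (Suc n) - s n) = \<bar>u * (t - d) + d ^ 2 / 2\<bar>" by (simp only: norm_of_real)
    also have "\<dots> \<le> u * \<bar>t - d\<bar> + d ^ 2 / 2" using u abs_triangle_ineq[of "u * (t - d)" "d ^ 2 / 2"] by (simp add: abs_mult)
    also have "\<dots> \<le> u * (2 * t ^ 2) + (2 * t) ^ 2 / 2"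
      using ls u by (intro add_mono mult_left_mono divide_right_mono power_mono) auto
    also have "\<dots> = (2 * u + 2) * t ^ 2" by (simp add: power2_eq_square algebra_simps)
    also have "\<dots> \<le> (10 * real (Suc n) powr (1/4)) * t ^ 2"
    proof (intro mult_right_mono)
      have "1 \<le> real (Suc n) powr (1/4)" by (simp add: ge_one_powr_ge_zero)
      then show "2 * u + 2 \<le> 10 * real (Suc n) powr (1/4)" using u by linarith
    qed simp
    also have "t ^ 2 = real (Suc n) powr (-2)" by (simp add: t_def powr_minus_divide power_divide)
    also have "10 * real (Suc n) powr (1/4) * real (Suc n) powr (-2) = 10 * real (Suc n) powr (-7/4)"
      by (simp add: powr_add[symmetric])
    also have "\<dots> \<le> 10 * real (Suc n) powr (-5/4)" by (intro mult_left_mono powr_mono) auto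
    finally show ?thesis .
  qed
  then obtain L where "\<forall>n\<ge>1. norm (s n - L) \<le> 4 * 10 * real n powr (-1/4)" using quarter_limit[of 10 s] by auto
  then show ?thesis unfolding s_def by (intro exI[of _ L] exI[of _ 40]) auto
qed

lemma floor_log_bounds:
  assumes "y \<ge> 1"
  defines "n \<equiv> nat \<lfloor>y\<rfloor>"
  shows "n \<ge> 1" "real n powr (-1/4) \<le> 2 * y powr (-1/4)" "\<bar>ln y - ln (real n)\<bar> \<le> 2 * y powr (-1/4)"
    "\<bar>ln y ^ 2 - ln (real n) ^ 2\<bar> \<le> 16 * y powr (-1/4)"
proof -
  have n: "n \<ge> 1" "real n \<le> y" "y < real n + 1" using assms(1) unfolding n_def by linarith+
  show "n \<ge> 1" by (rule n(1))
  have y2: "y / 2 \<le> real n" using n by linarith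
  have "real n powr (-1/4) \<le> (y / 2) powr (-1/4)" using y2 assms(1) by (intro powr_mono2') auto
  also have "\<dots> = y powr (-1/4) * 2 powr (1/4)" using assms(1) by (simp add: powr_divide powr_minus field_simps)
  also have "\<dots> \<le> y powr (-1/4) * 2"
  proof (rule mult_left_mono)
    have "(2::real) powr (1/4) \<le> 2 powr 1" by (intro powr_mono) auto
    then show "(2::real) powr (1/4) \<le> 2" by simp
  qed simp
  finally show "real n powr (-1/4) \<le> 2 * y powr (-1/4)" by (simp only: mult.commute)
  have l0: "0 \<le> ln y - ln (real n)" using n by simp
  have "1 + (y - real n) / real n = y / real n" using n by (simp add: field_simps)
  then have "ln (1 + (y - real n) / real n) = ln (y / real n)" by (rule arg_cong)
  also have "\<dots> = ln y - ln (real n)" using n assms(1) by (intro ln_divide_pos) auto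
  finally have "ln y - ln (real n) = ln (1 + (y - real n) / real n)" ..
  also have "\<dots> \<le> (y - real n) / real n" using n by (intro ln_add_one_self_le_self) auto
  also have "\<dots> \<le> 1 / (y / 2)" using n y2 assms(1) by (intro frac_le) auto
  also have "\<dots> = 2 * y powr (-1)" using assms(1) by (simp add: powr_minus_divide)
  finally have l: "ln y - ln (real n) \<le> 2 * y powr (-1)" .
  also have "\<dots> \<le> 2 * y powr (-1/4)" using assms(1) by (intro mult_left_mono powr_mono) auto
  finally show "\<bar>ln y - ln (real n)\<bar> \<le> 2 * y powr (-1/4)" using l0 by simp
  have ly: "0 \<le> ln y" "ln y \<le> 4 * y powr (1/4)" "0 \<le> ln (real n)" "ln (real n) \<le> ln y" using n assms(1) ln_quarter by auto
  have "\<bar>ln y ^ 2 - ln (real n) ^ 2\<bar> = (ln y - ln (real n)) * (ln y + ln (real n))"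
    using l0 ly by (simp add: power2_eq_square algebra_simps abs_of_nonneg mult_mono)
  also have "\<dots> \<le> (2 * y powr (-1)) * (8 * y powr (1/4))" using l l0 ly by (intro mult_mono) auto
  also have "\<dots> = 16 * (y powr (-1) * y powr (1/4))"
  proof -
    have "(2 * p) * (8 * q) = 16 * (p * q)" for p q :: real by simp
    then show ?thesis .
  qed
  also have "y powr (-1) * y powr (1/4) = y powr (-3/4)" by (simp only: powr_add[symmetric]) simp
  also have "16 * y powr (-3/4) \<le> 16 * y powr (-1/4)" using assms(1) by (intro mult_left_mono powr_mono) auto
  finally show "\<bar>ln y ^ 2 - ln (real n) ^ 2\<bar> \<le> 16 * y powr (-1/4)" .
qed

section \<open>Convolution and Moebius inversion over primary elements\<close>

text \<open>The pairs \<open>(m, i)\<close> are sorted by the product \<open>b = m * e i\<close>.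
  The index set is kept abstract because it is used both for primary elements and for pairs of a
  prime and an exponent.\<close>

lemma prims_conv:
  fixes f :: "eis \<Rightarrow> 'i \<Rightarrow> complex" and e :: "'i \<Rightarrow> eis"
  assumes e: "\<And>i. i \<in> I \<Longrightarrow> prim (e i)" and fin: "\<And>y. finite {i \<in> I. nm (e i) \<le> y}"
  shows "(\<Sum>m\<in>prims x. \<Sum>i | i \<in> I \<and> nm (e i) \<le> x / nm m. f m i) =
    (\<Sum>b\<in>prims x. \<Sum>i | i \<in> I \<and> e i dvd b. f (b div e i) i)"
proof -
  have le: "nm (e i) \<le> nm b" if "prim b" "e i dvd b" "i \<in> I" for b i
  proof -
    obtain m where m: "b = e i * m" using \<open>e i dvd b\<close> unfolding dvd_def by blast
    have "prim m" using prim_cancel[of "e i" m] that e m by simp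
    have "nm (e i) * 1 \<le> nm (e i) * nm m"
      using nm_ge_1[OF \<open>prim m\<close>] nm_ge_1[OF e[OF that(3)]] by (intro mult_left_mono) linarith+
    then show ?thesis unfolding m nm_mult by simp
  qed
  have fin2: "finite {i. i \<in> I \<and> e i dvd b}" if "prim b" for b
    using le that by (intro finite_subset[OF _ fin[of "nm b"]]) auto
  have fin1: "finite {i. i \<in> I \<and> nm (e i) \<le> x / nm m}" for m using fin by simp
  have "(\<Sum>m\<in>prims x. \<Sum>i | i \<in> I \<and> nm (e i) \<le> x / nm m. f m i) =
     (\<Sum>(m, i)\<in>Sigma (prims x) (\<lambda>m. {i. i \<in> I \<and> nm (e i) \<le> x / nm m}). f m i)"
    by (rule sum.Sigma) (auto simp: finite_prims fin1)
  also have "\<dots> = (\<Sum>(b, i)\<in>Sigma (prims x) (\<lambda>b. {i. i \<in> I \<and> e i dvd b}). f (b div e i) i)"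
  proof (rule sum.reindex_bij_witness[of _ "\<lambda>(b, i). (b div e i, i)" "\<lambda>(m, i). (m * e i, i)"])
    fix a assume "a \<in> Sigma (prims x) (\<lambda>m. {i. i \<in> I \<and> nm (e i) \<le> x / nm m})"
    then obtain m i where a: "a = (m, i)" "prim m" "nm m \<le> x" "i \<in> I" "nm (e i) \<le> x / nm m" by auto
    have e0: "e i \<noteq> 0" using e[OF a(4)] prim_nonzero by blast
    show "(case case a of (m, i) \<Rightarrow> (m * e i, i) of (b, i) \<Rightarrow> (b div e i, i)) = a" using a e0 by simp
    have "nm (m * e i) \<le> x" unfolding nm_mult using a(5) nm_ge_1[OF a(2)] by (simp add: field_simps)
    then show "(case a of (m, i) \<Rightarrow> (m * e i, i)) \<in> Sigma (prims x) (\<lambda>b. {i. i \<in> I \<and> e i dvd b})"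
      using a e prim_mult by auto
    show "(case case a of (m, i) \<Rightarrow> (m * e i, i) of (b, i) \<Rightarrow> f (b div e i) i) = (case a of (m, i) \<Rightarrow> f m i)"
      using a e0 by simp
  next
    fix a assume "a \<in> Sigma (prims x) (\<lambda>b. {i. i \<in> I \<and> e i dvd b})"
    then obtain b i where a: "a = (b, i)" "prim b" "nm b \<le> x" "i \<in> I" "e i dvd b" by auto
    then obtain m where m: "b = e i * m" unfolding dvd_def by blast
    have e0: "e i \<noteq> 0" using e[OF a(4)] prim_nonzero by blast
    have pm: "prim m" using prim_cancel[of "e i" m] a e m by simp
    have dv: "b div e i = m" using m e0 by simp
    have nb: "nm b = nm (e i) * nm m" unfolding m by (rule nm_mult)
    have "1 * nm m \<le> nm (e i) * nm m"
      using nm_ge_1[OF e[OF a(4)]] nm_ge_1[OF pm] by (intro mult_right_mono) linarith+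
    then have "nm m \<le> x" using a(3) nb by simp
    moreover have "nm (e i) \<le> x / nm m" using nb a(3) nm_ge_1[OF pm] by (simp add: field_simps)
    ultimately show "(case a of (b, i) \<Rightarrow> (b div e i, i)) \<in> Sigma (prims x) (\<lambda>m. {i. i \<in> I \<and> nm (e i) \<le> x / nm m})"
      using a pm dv by auto
    show "(case case a of (b, i) \<Rightarrow> (b div e i, i) of (m, i) \<Rightarrow> (m * e i, i)) = a" using a by simp
  qed
  also have "\<dots> = (\<Sum>b\<in>prims x. \<Sum>i | i \<in> I \<and> e i dvd b. f (b div e i) i)"
    by (rule sum.Sigma[symmetric]) (auto simp: finite_prims fin2)
  finally show ?thesis .
qed

definition mu :: "eis \<Rightarrow> real" where
  "mu b = (if \<forall>q. prime q \<longrightarrow> multiplicity q b \<le> 1 then (-1) ^ card (prime_factors b) else 0)"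

lemma abs_mu: "\<bar>mu b\<bar> \<le> 1" by (simp add: mu_def power_abs)

lemma mu_mult_prime:
  assumes "prime q" "\<not> q dvd d" "d \<noteq> 0"
  shows "mu (q * d) = - mu d"
proof -
  have m: "multiplicity p (q * d) = multiplicity p q + multiplicity p d" if "prime p" for p
    using that assms by (intro prime_elem_multiplicity_mult_distrib) auto
  have mq: "multiplicity p q = (if p = q then 1 else 0)" if "prime p" for p
    using that assms by (simp add: prime_multiplicity_other multiplicity_self prime_elem_not_unit)
  have md: "multiplicity q d = 0" using assms by (simp add: not_dvd_imp_multiplicity_0)
  have all: "(\<forall>p. prime p \<longrightarrow> multiplicity p (q * d) \<le> 1) \<longleftrightarrow> (\<forall>p. prime p \<longrightarrow> multiplicity p d \<le> 1)"
    using m mq md by (metis add.right_neutral add_0 le_refl add_cancel_left_left le_add2 le_trans)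
  have pf: "prime_factors (q * d) = insert q (prime_factors d)"
    using assms by (subst prime_factors_product) (auto simp: prime_prime_factors)
  have "q \<notin> prime_factors d" using assms by (auto simp: in_prime_factors_iff)
  then have "card (prime_factors (q * d)) = Suc (card (prime_factors d))" unfolding pf by simp
  then show ?thesis unfolding mu_def all by simp
qed

lemma finite_prim_dvd: assumes "prim b" shows "finite {d. prim d \<and> d dvd b}"
proof (rule finite_subset[OF _ finite_enorm_le[of "enorm b"]], rule subsetI)
  fix d assume d: "d \<in> {d. prim d \<and> d dvd b}"
  have "enorm b \<ge> 1" using enorm_ge_1[OF prim_nonzero[OF assms]] .
  then show "d \<in> {x. enorm x \<le> enorm b}" using enorm_dvd[of d b] d zdvd_imp_le by auto
qed

text \<open>Fix a prime \<open>q\<close> dividing \<open>b\<close>. Divisors divisible by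
  \<open>q ^ 2\<close> contribute 0, and the others pair off as \<open>d\<close> and
  \<open>q * d\<close> with opposite signs.\<close>

lemma sum_mu:
  assumes "prim b"
  shows "(\<Sum>d | prim d \<and> d dvd b. mu d) = (if b = 1 then 1 else 0)"
proof (cases "b = 1")
  case True
  have "{d. prim d \<and> d dvd 1} = {1}"
    using prim_unit eis_unit_iff by auto
  then show ?thesis using True by (simp add: mu_def)
next
  case False
  have b0: "b \<noteq> 0" using prim_nonzero assms by blast
  have "\<not> b dvd 1" using False assms prim_unit eis_unit_iff by blast
  then obtain q where q: "prime q" "q dvd b" using prime_divisor_exists[OF b0] by blast
  have pq: "prim q" using prim_of_dvd[OF assms q(2)] q(1) by simp
  have q0: "q \<noteq> 0" using q(1) by auto
  define X where "X = {d. prim d \<and> d dvd b \<and> \<not> q dvd d}"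
  define Y where "Y = {d. prim d \<and> d dvd b \<and> q dvd d}"
  define Y' where "Y' = {d \<in> Y. \<not> q dvd (d div q)}"
  have fin: "finite X" "finite Y" using finite_prim_dvd[OF assms] by (auto simp: X_def Y_def elim: finite_subset[rotated])
  have "{d. prim d \<and> d dvd b} = X \<union> Y" "X \<inter> Y = {}" by (auto simp: X_def Y_def)
  then have 1: "(\<Sum>d | prim d \<and> d dvd b. mu d) = sum mu X + sum mu Y" using fin by (simp add: sum.union_disjoint)
  have "sum mu Y = sum mu Y'"
  proof (rule sum.mono_neutral_right[OF fin(2)])
    show "Y' \<subseteq> Y" by (auto simp: Y'_def)
    show "\<forall>d\<in>Y - Y'. mu d = 0"
    proof
      fix d assume d: "d \<in> Y - Y'"
      then have "q dvd d div q" "q dvd d" "d \<noteq> 0" using prim_nonzero by (auto simp: Y_def Y'_def)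
      then have "q ^ 2 dvd d" using q0 by (metis dvd_div_mult_self mult_dvd_mono dvd_refl power2_eq_square)
      then have "multiplicity q d \<ge> 2" using \<open>d \<noteq> 0\<close> q(1) by (intro multiplicity_geI) (auto simp: prime_elem_not_unit)
      then show "mu d = 0" using q(1) unfolding mu_def by (metis not_less_eq_eq numeral_2_eq_2 One_nat_def)
    qed
  qed
  also have "sum mu Y' = (\<Sum>d\<in>X. mu (q * d))"
  proof (rule sum.reindex_bij_witness[of _ "\<lambda>d. q * d" "\<lambda>d. d div q"])
    fix d assume d: "d \<in> Y'"
    then obtain c where c: "d = q * c" unfolding Y'_def Y_def dvd_def by blast
    have "prim c" using prim_cancel[OF pq] d c by (simp add: Y'_def Y_def)
    then show "d div q \<in> X" using d c q0 by (auto simp: X_def Y'_def Y_def intro: dvd_trans)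
    show "q * (d div q) = d" "mu (q * (d div q)) = mu d" using c q0 by simp_all
  next
    fix d assume d: "d \<in> X"
    have "q * d dvd b"
    proof -
      obtain c where c: "b = d * c" using d unfolding X_def dvd_def by blast
      have "q dvd c" using q c d prime_dvd_mult_iff[of q d c] by (auto simp: X_def)
      then show ?thesis using c by (simp add: mult.commute mult_dvd_mono)
    qed
    then show "q * d \<in> Y'" using d q0 prim_mult pq by (auto simp: X_def Y'_def Y_def)
    show "q * d div q = d" using q0 by simp
  qed
  also have "\<dots> = (\<Sum>d\<in>X. - mu d)"
    using q prim_nonzero by (intro sum.cong refl mu_mult_prime) (auto simp: X_def)
  finally show ?thesis using 1 False by (simp add: sum_negf)
qed

text \<open>Collecting the double sum by \<open>b = d * m\<close> leaves the factor
  \<open>sum_mu\<close>, which keeps only \<open>b = 1\<close>.\<close>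

lemma moebius_inversion:
  fixes w :: "eis \<Rightarrow> complex" and F :: "real \<Rightarrow> complex"
  assumes w: "\<And>a b. prim a \<Longrightarrow> prim b \<Longrightarrow> w (a * b) = w a * w b" "w 1 = 1" and x: "x \<ge> 1"
  shows "F x = (\<Sum>d\<in>prims x. of_real (mu d) * w d * (\<Sum>m\<in>prims (x / nm d). w m * F (x / nm d / nm m)))"
proof -
  have fin: "finite {i \<in> {d. prim d}. nm i \<le> y}" for y using finite_prims[of y] by simp
  have "(\<Sum>d\<in>prims x. of_real (mu d) * w d * (\<Sum>m\<in>prims (x / nm d). w m * F (x / nm d / nm m)))
    = (\<Sum>d\<in>prims x. \<Sum>m | m \<in> {d. prim d} \<and> nm m \<le> x / nm d. of_real (mu d) * w d * (w m * F (x / nm d / nm m)))"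
    by (simp add: sum_distrib_left)
  also have "\<dots> = (\<Sum>b\<in>prims x. \<Sum>m | m \<in> {d. prim d} \<and> m dvd b. of_real (mu (b div m)) * w (b div m) * (w m * F (x / nm (b div m) / nm m)))"
    by (rule prims_conv[where e = "\<lambda>m. m"]) (use fin in auto)
  also have "\<dots> = (\<Sum>b\<in>prims x. w b * F (x / nm b) * of_real (\<Sum>d | prim d \<and> d dvd b. mu d))"
  proof (rule sum.cong)
    fix b assume b: "b \<in> prims x"
    have "(\<Sum>m | m \<in> {d. prim d} \<and> m dvd b. of_real (mu (b div m)) * w (b div m) * (w m * F (x / nm (b div m) / nm m)))
      = (\<Sum>m | prim m \<and> m dvd b. w b * F (x / nm b) * of_real (mu (b div m)))"
    proof (rule sum.cong)
      fix m assume "m \<in> {m. prim m \<and> m dvd b}"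
      then have m: "prim m" "m dvd b" by auto
      obtain c where c: "b = m * c" using m(2) unfolding dvd_def by blast
      have pc: "prim c" using prim_cancel[OF m(1)] c b by simp
      have dv: "b div m = c" using c prim_nonzero[OF m(1)] by simp
      show "of_real (mu (b div m)) * w (b div m) * (w m * F (x / nm (b div m) / nm m)) = w b * F (x / nm b) * of_real (mu (b div m))"
        unfolding dv unfolding c w(1)[OF m(1) pc] nm_mult by (simp add: mult_ac)
    qed auto
    also have "\<dots> = w b * F (x / nm b) * of_real (\<Sum>m | prim m \<and> m dvd b. mu (b div m))"
      by (simp add: sum_distrib_left)
    also have "(\<Sum>m | prim m \<and> m dvd b. mu (b div m)) = (\<Sum>d | prim d \<and> d dvd b. mu d)"
    proof (rule sum.reindex_bij_witness[of _ "\<lambda>d. b div d" "\<lambda>m. b div m"])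
      fix m assume "m \<in> {m. prim m \<and> m dvd b}"
      then have m: "prim m" "m dvd b" by auto
      obtain c where c: "b = m * c" using m(2) unfolding dvd_def by blast
      have pc: "prim c" using prim_cancel[OF m(1)] c b by simp
      have n0: "m \<noteq> 0" "c \<noteq> 0" using m pc prim_nonzero by blast+
      show "b div (b div m) = m" "b div m \<in> {m. prim m \<and> m dvd b}" "mu (b div m) = mu (b div m)"
        using c n0 pc by (simp_all add: mult.commute)
      then show "b div (b div m) = m" "b div m \<in> {m. prim m \<and> m dvd b}" by -
    qed
    finally show "(\<Sum>m | m \<in> {d. prim d} \<and> m dvd b. of_real (mu (b div m)) * w (b div m) * (w m * F (x / nm (b div m) / nm m)))
      = w b * F (x / nm b) * of_real (\<Sum>d | prim d \<and> d dvd b. mu d)" .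
  qed simp
  also have "\<dots> = (\<Sum>b\<in>prims x. if b = 1 then F x else 0)"
    by (intro sum.cong refl) (auto simp: sum_mu w(2))
  also have "\<dots> = F x" using x finite_prims[of x] by simp
  finally show ?thesis ..
qed

section \<open>Power sums of norms\<close>

text \<open>The dyadic block above \<open>2 ^ j\<close> has \<open>O(2 ^ j)\<close> primary
  elements. The recursion serves all \<open>s > 0\<close>: its geometric series is dominated by the
  last term for \<open>s < 1\<close> and converges for \<open>s > 1\<close>.\<close>

lemma prims_powr_dyadic:
  "\<exists>K0\<ge>0. \<forall>s>0. (\<Sum>d\<in>prims 1. nm d powr (- s)) \<le> K0 \<and>
     (\<forall>j. (\<Sum>d\<in>prims (2 ^ Suc j). nm d powr (- s)) \<le> (\<Sum>d\<in>prims (2 ^ j). nm d powr (- s)) + 2 * K0 * (2 powr (1 - s)) ^ j)"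
proof -
  obtain c C where c: "c > 0" "C \<ge> 0" "\<And>r. r \<ge> 1 \<Longrightarrow> \<bar>real (card (prims r)) - c * r\<bar> \<le> C * sqrt r"
    using prim_count by blast
  define K0 where "K0 = c + C"
  have K0: "K0 \<ge> 0" using c by (simp add: K0_def)
  have count: "real (card (prims r)) \<le> K0 * r" if "r \<ge> 1" for r
  proof -
    have "r * 1 \<le> r * r" using that by (intro mult_left_mono) auto
    then have "sqrt r \<le> r" using that by (intro real_le_lsqrt) (auto simp: power2_eq_square)
    then have "C * sqrt r \<le> C * r" using c by (intro mult_left_mono)
    then show ?thesis using c(3)[OF that] by (simp add: K0_def algebra_simps)
  qed
  have "(\<Sum>d\<in>prims 1. nm d powr (- s)) \<le> K0 \<and>
     (\<forall>j. (\<Sum>d\<in>prims (2 ^ Suc j). nm d powr (- s)) \<le> (\<Sum>d\<in>prims (2 ^ j). nm d powr (- s)) + 2 * K0 * (2 powr (1 - s)) ^ j)"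
    if s: "s > 0" for s
  proof -
    define q where "q = 2 powr (1 - s)"
    define f where "f x = (\<Sum>d\<in>prims x. nm d powr (- s))" for x
  have step: "f (2 ^ Suc j) \<le> f (2 ^ j) + 2 * K0 * q ^ j" for j
  proof -
    define Z :: real where "Z = 2 ^ j"
    have Z: "Z \<ge> 1" "2 ^ Suc j = 2 * Z" by (simp_all add: Z_def)
    define X where "X = {d. prim d \<and> Z < nm d \<and> nm d \<le> 2 * Z}"
    have finX: "finite X" unfolding X_def by (rule finite_subset[OF _ finite_prims[of "2 * Z"]]) auto
    have "prims (2 * Z) = prims Z \<union> X" using Z(1) by (auto simp: X_def)
    moreover have "prims Z \<inter> X = {}" by (auto simp: X_def)
    ultimately have "f (2 * Z) = f Z + (\<Sum>d\<in>X. nm d powr (- s))"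
      unfolding f_def using finite_prims finX by (simp add: sum.union_disjoint)
    also have "(\<Sum>d\<in>X. nm d powr (- s)) \<le> (\<Sum>d\<in>X. Z powr (- s))"
      using s Z(1) by (intro sum_mono powr_mono2') (auto simp: X_def)
    also have "\<dots> = real (card X) * Z powr (- s)" by simp
    also have "\<dots> \<le> (K0 * (2 * Z)) * Z powr (- s)"
    proof (intro mult_right_mono)
      have "card X \<le> card (prims (2 * Z))"
        by (intro card_mono finite_prims) (auto simp: X_def)
      then have "real (card X) \<le> real (card (prims (2 * Z)))" by simp
      then show "real (card X) \<le> K0 * (2 * Z)"
        using count[of "2 * Z"] Z(1) by linarith
    qed simp
    also have "\<dots> = 2 * K0 * (Z powr 1 * Z powr (- s))" using Z(1) by simp
    also have "Z powr 1 * Z powr (- s) = Z powr (1 - s)" by (simp only: powr_add[symmetric]) simp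
    also have "Z powr (1 - s) = q ^ j"
      by (simp add: Z_def q_def powr_realpow[symmetric] powr_powr mult.commute)
    finally show ?thesis unfolding Z(2) by (simp add: Z_def)
  qed
  have f1: "f 1 \<le> K0"
  proof -
    have "f 1 \<le> (\<Sum>d\<in>prims 1. 1)"
      unfolding f_def using nm_ge_1 s by (intro sum_mono) (auto simp: powr_minus_divide divide_le_eq_1 ge_one_powr_ge_zero)
    also have "\<dots> \<le> K0" using count[of 1] by simp
    finally show ?thesis .
  qed
    then show ?thesis using step unfolding f_def q_def by blast
  qed
  then show ?thesis using K0 by blast
qed

lemma prims_powr_sum:
  assumes s: "0 < s" "s < 1"
  shows "\<exists>K\<ge>0. \<forall>x\<ge>1. (\<Sum>d\<in>prims x. nm d powr (- s)) \<le> K * x powr (1 - s)"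
proof -
  define q where "q = 2 powr (1 - s)"
  have q1: "q > 1" using s by (simp add: q_def gr_one_powr)
  define f where "f x = (\<Sum>d\<in>prims x. nm d powr (- s))" for x
  obtain K0 where K0: "K0 \<ge> 0" and f1: "f 1 \<le> K0" and step: "\<And>j. f (2 ^ Suc j) \<le> f (2 ^ j) + 2 * K0 * q ^ j"
    using prims_powr_dyadic s unfolding f_def q_def by blast
  have fj: "f (2 ^ j) \<le> (K0 + 2 * K0 / (q - 1)) * q ^ j" for j
  proof (induction j)
    case 0
    have "0 \<le> 2 * K0 / (q - 1)" using K0 q1 by simp
    then show ?case using f1 by simp
  next
    case (Suc j)
    have "f (2 ^ Suc j) \<le> (K0 + 2 * K0 / (q - 1)) * q ^ j + 2 * K0 * q ^ j" using step[of j] Suc.IH by linarith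
    also have "\<dots> = (K0 + 2 * K0 + 2 * K0 / (q - 1)) * q ^ j" by (simp add: algebra_simps)
    also have "\<dots> \<le> (K0 * q + (2 * K0 + 2 * K0 / (q - 1))) * q ^ j"
    proof (intro mult_right_mono)
      have "K0 * 1 \<le> K0 * q" using K0 q1 by (intro mult_left_mono) auto
      then show "K0 + 2 * K0 + 2 * K0 / (q - 1) \<le> K0 * q + (2 * K0 + 2 * K0 / (q - 1))" by simp
    qed (use q1 in auto)
    also have "2 * K0 + 2 * K0 / (q - 1) = 2 * K0 / (q - 1) * q" using q1 by (simp add: field_simps)
    finally show ?case by (simp add: algebra_simps)
  qed
  define K where "K = (K0 + 2 * K0 / (q - 1)) * q"
  have "f x \<le> K * x powr (1 - s)" if x: "x \<ge> 1" for x
  proof -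
    define j where "j = nat \<lfloor>log 2 x\<rfloor>"
    have lx: "log 2 x \<ge> 0" using x by simp
    have j: "real j \<le> log 2 x" "log 2 x < real (Suc j)" using lx unfolding j_def by linarith+
    have xj: "2 ^ j \<le> x" "x \<le> 2 ^ Suc j"
    proof -
      have "2 powr real j \<le> 2 powr (log 2 x)" "2 powr (log 2 x) \<le> 2 powr real (Suc j)" using j by (intro powr_mono; simp)+
      then show "2 ^ j \<le> x" "x \<le> 2 ^ Suc j" using x by (simp_all add: powr_realpow del: of_nat_Suc)
    qed
    have "f x \<le> f (2 ^ Suc j)" unfolding f_def using xj by (intro sum_mono2 finite_prims) auto
    also have "\<dots> \<le> (K0 + 2 * K0 / (q - 1)) * q ^ Suc j" by (rule fj)
    also have "\<dots> = K * q ^ j" by (simp add: K_def)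
    also have "\<dots> \<le> K * x powr (1 - s)"
    proof (intro mult_left_mono)
      have "q ^ j = (2 ^ j) powr (1 - s)" by (simp add: q_def powr_realpow[symmetric] powr_powr mult.commute)
      also have "\<dots> \<le> x powr (1 - s)" using xj s by (intro powr_mono2) auto
      finally show "q ^ j \<le> x powr (1 - s)" .
    qed (use K0 q1 in \<open>simp add: K_def\<close>)
    finally show ?thesis .
  qed
  moreover have "K \<ge> 0" using K0 q1 by (simp add: K_def)
  ultimately show ?thesis unfolding f_def by blast
qed

lemma prims_powr_sum_bounded:
  assumes s: "s > 1"
  shows "\<exists>K\<ge>0. \<forall>x. (\<Sum>d\<in>prims x. nm d powr (- s)) \<le> K"
proof -
  define q where "q = 2 powr (1 - s)"
  have q1: "0 < q" "q < 1" using s by (simp_all add: q_def powr_less_one)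
  define f where "f x = (\<Sum>d\<in>prims x. nm d powr (- s))" for x
  have s0: "s > 0" using s by simp
  obtain K0 where K0: "K0 \<ge> 0" and f1: "f 1 \<le> K0" and step: "\<And>j. f (2 ^ Suc j) \<le> f (2 ^ j) + 2 * K0 * q ^ j"
    using prims_powr_dyadic s0 unfolding f_def q_def by blast
  have fj: "f (2 ^ j) \<le> K0 + 2 * K0 * ((1 - q ^ j) / (1 - q))" for j
  proof (induction j)
    case (Suc j)
    have "(1 - q ^ j) / (1 - q) + q ^ j = (1 - q ^ Suc j) / (1 - q)" using q1 by (simp add: field_simps)
    then have "2 * K0 * ((1 - q ^ j) / (1 - q)) + 2 * K0 * q ^ j = 2 * K0 * ((1 - q ^ Suc j) / (1 - q))"
      by (metis distrib_left)
    then show ?case using step[of j] Suc.IH by linarith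
  qed (use f1 in simp)
  define K where "K = K0 + 2 * K0 * (1 / (1 - q))"
  have "f x \<le> K" for x
  proof -
    obtain j where j: "x < 2 ^ j" using real_arch_pow[of 2 x] by auto
    define Z :: real where "Z = 2 ^ j"
    have "f x \<le> f Z" unfolding f_def using j by (intro sum_mono2 finite_prims) (auto simp: Z_def[symmetric])
    also have "f Z \<le> K0 + 2 * K0 * ((1 - q ^ j) / (1 - q))" unfolding Z_def by (rule fj)
    also have "\<dots> \<le> K" unfolding K_def using K0 q1 by (intro add_left_mono mult_left_mono divide_right_mono) auto
    finally show ?thesis .
  qed
  moreover have "K \<ge> 0" using K0 q1 by (simp add: K_def)
  ultimately show ?thesis unfolding f_def by blast
qed

section \<open>L-series at 1 and Mertens sums\<close>

text \<open>A completely multiplicative function on primary elements with mean value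
  \<open>c\<close> and square-root error; \<open>c = 0\<close> covers the Hecke characters, and the
  constant function 1 has \<open>c > 0\<close>.\<close>

locale twist =
  fixes psi :: "eis \<Rightarrow> complex" and c C :: real
  assumes psi_mult: "\<And>x y. prim x \<Longrightarrow> prim y \<Longrightarrow> psi (x * y) = psi x * psi y"
    and psi_1: "psi 1 = 1"
    and psi_norm: "\<And>x. prim x \<Longrightarrow> psi x = 0 \<or> norm (psi x) = 1"
    and c_nonneg: "c \<ge> 0" and C_nonneg: "C \<ge> 0"
    and psi_sum: "\<And>r. r \<ge> 1 \<Longrightarrow> norm ((\<Sum>x\<in>prims r. psi x) - of_real (c * r)) \<le> C * sqrt r"
begin

lemma psi_le_1: "prim x \<Longrightarrow> norm (psi x) \<le> 1" using psi_norm[of x] by auto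

text \<open>\<open>P\<close> and \<open>A\<close> are the partial sums of the L-series at 1 and of
  minus its derivative there.\<close>

definition P :: "real \<Rightarrow> complex" where "P y = (\<Sum>x\<in>prims y. psi x / of_real (nm x))"
definition A :: "real \<Rightarrow> complex" where "A y = (\<Sum>x\<in>prims y. psi x / of_real (nm x) * of_real (ln (nm x)))"

text \<open>\<open>abel_quarter\<close> is applied to the layers of equal norm minus their mean
  \<open>c\<close>. The mean part contributes \<open>c\<close> times the sum of \<open>h\<close>,
  whose main term \<open>g\<close> and constant \<open>LA\<close> are assumptions.\<close>

lemma weighted_asymp:
  assumes D: "D \<ge> 0" "\<And>k. k \<ge> 1 \<Longrightarrow> \<bar>h (real k)\<bar> \<le> D * real k powr (-3/4)"
      "\<And>k. k \<ge> 1 \<Longrightarrow> \<bar>h (real k) - h (real (Suc k))\<bar> \<le> D * real k powr (-7/4)"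
    and g: "KA \<ge> 0" "\<And>n. n \<ge> 1 \<Longrightarrow> norm ((\<Sum>k=1..n. complex_of_real (h (real k))) - of_real (g (real n)) - LA) \<le> KA * real n powr (-1/4)"
    and g2: "KB \<ge> 0" "\<And>y. y \<ge> 1 \<Longrightarrow> \<bar>g y - g (real (nat \<lfloor>y\<rfloor>))\<bar> \<le> KB * y powr (-1/4)"
  shows "\<exists>L K. K \<ge> 0 \<and> (\<forall>y\<ge>1. norm ((\<Sum>x\<in>prims y. psi x * of_real (h (nm x))) - of_real (c * g y) - L) \<le> K * y powr (-1/4))"
proof -
  define a where "a k = (\<Sum>x | prim x \<and> enorm x = int k. psi x)" for k
  have "norm (\<Sum>k=1..n. a k - of_real c) \<le> C * real n powr (1/2)" if n: "n \<ge> 1" for n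
  proof -
    have "(\<Sum>k=1..n. a k - of_real c) = (\<Sum>x\<in>prims (real n). psi x) - of_real (c * real n)"
      unfolding sum_prims_layers a_def by (simp add: sum_subtractf)
    then show ?thesis using psi_sum[of "real n"] n by (simp add: powr_half_sqrt)
  qed
  then obtain L K where LK: "K \<ge> 0" "\<And>n. n \<ge> 1 \<Longrightarrow> norm ((\<Sum>k=1..n. (a k - of_real c) * of_real (h (real k))) - L) \<le> K * real n powr (-1/4)"
    using abel_quarter[of C "\<lambda>k. a k - of_real c" D "\<lambda>k. h (real k)"] C_nonneg D by blast
  define L' where "L' = L + of_real c * LA"
  define K' where "K' = 2 * (K + c * KA) + c * KB"
  have "norm ((\<Sum>x\<in>prims y. psi x * of_real (h (nm x))) - of_real (c * g y) - L') \<le> K' * y powr (-1/4)" if y: "y \<ge> 1" for y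
  proof -
    define n where "n = nat \<lfloor>y\<rfloor>"
    note fl = floor_log_bounds[OF y, folded n_def]
    have "(\<Sum>x\<in>prims y. psi x * of_real (h (nm x))) = (\<Sum>x\<in>prims (real n). psi x * of_real (h (nm x)))"
      using prims_floor[of y] y by (simp add: n_def)
    also have "\<dots> = (\<Sum>k=1..n. \<Sum>x | prim x \<and> enorm x = int k. psi x * of_real (h (nm x)))"
      by (rule sum_prims_layers)
    also have "\<dots> = (\<Sum>k=1..n. a k * of_real (h (real k)))"
      unfolding a_def sum_distrib_right by (intro sum.cong refl) auto
    also have "\<dots> = (\<Sum>k=1..n. (a k - of_real c) * of_real (h (real k))) + of_real c * (\<Sum>k=1..n. of_real (h (real k)))"
      by (simp add: sum_distrib_left sum.distrib[symmetric] algebra_simps)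
    finally have "(\<Sum>x\<in>prims y. psi x * of_real (h (nm x))) - of_real (c * g y) - L'
      = ((\<Sum>k=1..n. (a k - of_real c) * of_real (h (real k))) - L)
        + of_real c * ((\<Sum>k=1..n. of_real (h (real k))) - of_real (g (real n)) - LA)
        - of_real (c * (g y - g (real n)))"
      by (simp add: L'_def algebra_simps)
    also have "norm \<dots> \<le> norm ((\<Sum>k=1..n. (a k - of_real c) * of_real (h (real k))) - L)
        + norm (of_real c * ((\<Sum>k=1..n. of_real (h (real k))) - of_real (g (real n)) - LA))
        + norm (complex_of_real (c * (g y - g (real n))))"
      by (intro order_trans[OF norm_triangle_ineq4] add_mono norm_triangle_ineq order_refl)
    also have "\<dots> \<le> K * real n powr (-1/4) + c * (KA * real n powr (-1/4)) + c * (KB * y powr (-1/4))"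
    proof (intro add_mono)
      show "norm (of_real c * ((\<Sum>k=1..n. complex_of_real (h (real k))) - of_real (g (real n)) - LA)) \<le> c * (KA * real n powr (-1/4))"
        unfolding norm_mult using g(2)[OF fl(1)] c_nonneg by (simp add: mult_left_mono)
      show "norm (complex_of_real (c * (g y - g (real n)))) \<le> c * (KB * y powr (-1/4))"
        unfolding norm_of_real abs_mult using g2(2)[OF y] c_nonneg by (simp add: mult_left_mono n_def)
    qed (rule LK(2)[OF fl(1)])
    also have "\<dots> = (K + c * KA) * real n powr (-1/4) + c * KB * y powr (-1/4)" by (simp add: algebra_simps)
    also have "\<dots> \<le> (K + c * KA) * (2 * y powr (-1/4)) + c * KB * y powr (-1/4)"
      using fl(2) LK(1) g(1) g2(1) c_nonneg by (intro add_mono mult_left_mono) auto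
    also have "\<dots> = K' * y powr (-1/4)" by (simp add: K'_def algebra_simps)
    finally show ?thesis .
  qed
  moreover have "K' \<ge> 0" using LK(1) g g2 c_nonneg by (simp add: K'_def)
  ultimately show ?thesis by blast
qed

lemma P_asymp: "\<exists>L K. K \<ge> 0 \<and> (\<forall>y\<ge>1. norm (P y - of_real (c * ln y) - L) \<le> K * y powr (-1/4))"
proof -
  obtain L0 K0 where K0: "K0 \<ge> 0" "\<And>n. n \<ge> 1 \<Longrightarrow> norm ((\<Sum>k=1..n. complex_of_real (1 / real k)) - of_real (ln (real n)) - L0) \<le> K0 * real n powr (-1/4)"
    using harmonic_quarter by blast
  have "\<exists>L K. K \<ge> 0 \<and> (\<forall>y\<ge>1. norm ((\<Sum>x\<in>prims y. psi x * of_real (1 / nm x)) - of_real (c * ln y) - L) \<le> K * y powr (-1/4))"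
  proof (rule weighted_asymp[where D = 1 and KA = K0 and LA = L0 and KB = 2])
    fix y :: real assume "y \<ge> 1"
    then show "\<bar>ln y - ln (real (nat \<lfloor>y\<rfloor>))\<bar> \<le> 2 * y powr (-1/4)" by (rule floor_log_bounds(3))
  qed (use inverse_weight K0 in auto)
  then show ?thesis by (simp add: P_def)
qed

lemma A_asymp: "\<exists>L K. K \<ge> 0 \<and> (\<forall>y\<ge>1. norm (A y - of_real (c * (ln y ^ 2 / 2)) - L) \<le> K * y powr (-1/4))"
proof -
  obtain L0 K0 where K0: "K0 \<ge> 0" "\<And>n. n \<ge> 1 \<Longrightarrow> norm ((\<Sum>k=1..n. complex_of_real (ln (real k) / real k)) - of_real (ln (real n) ^ 2 / 2) - L0) \<le> K0 * real n powr (-1/4)"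
    using log_harmonic_quarter by blast
  have "\<exists>L K. K \<ge> 0 \<and> (\<forall>y\<ge>1. norm ((\<Sum>x\<in>prims y. psi x * of_real (ln (nm x) / nm x)) - of_real (c * (ln y ^ 2 / 2)) - L) \<le> K * y powr (-1/4))"
  proof (rule weighted_asymp[where D = 5 and KA = K0 and LA = L0 and KB = 8])
    fix y :: real assume "y \<ge> 1"
    from floor_log_bounds(4)[OF this]
    show "\<bar>ln y ^ 2 / 2 - ln (real (nat \<lfloor>y\<rfloor>)) ^ 2 / 2\<bar> \<le> 8 * y powr (-1/4)" by linarith
  qed (use ln_weight K0 in auto)
  then show ?thesis by (simp add: A_def)
qed

definition IQ :: "(eis \<times> nat) set" where "IQ = {(q, k). prime q \<and> prim q \<and> k \<ge> 1}"
text \<open>The partial sum of \<open>- L' / L\<close> at 1; a prime power is kept as the pair of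
  its prime and exponent, which gives access to the von Mangoldt weight.\<close>

definition S :: "real \<Rightarrow> complex" where
  "S x = (\<Sum>i | i \<in> IQ \<and> nm (fst i ^ snd i) \<le> x. psi (fst i ^ snd i) / of_real (nm (fst i ^ snd i)) * of_real (ln (nm (fst i))))"

end

lemma prime_nm_ge_2: assumes "prime q" "prim q" shows "nm q \<ge> 2"
proof -
  have "enorm q \<noteq> 1" using assms prim_unit by fastforce
  moreover have "enorm q \<ge> 1" using enorm_ge_1[OF prim_nonzero[OF assms(2)]] .
  ultimately have "enorm q \<ge> 2" by linarith
  then show ?thesis by linarith
qed

lemma prim_power: "prim x \<Longrightarrow> prim (x ^ n)"
  by (induction n) (auto simp: prim_mult)

lemma finite_prime_powers: "finite {i. i \<in> {(q, k). prime q \<and> prim q \<and> k \<ge> 1} \<and> nm (fst i ^ snd i) \<le> y}"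
proof (rule finite_subset[of _ "prims y \<times> {..nat \<lceil>y\<rceil>}"])
  show "{i. i \<in> {(q, k). prime q \<and> prim q \<and> k \<ge> 1} \<and> nm (fst i ^ snd i) \<le> y} \<subseteq> prims y \<times> {..nat \<lceil>y\<rceil>}"
  proof
    fix i assume i: "i \<in> {i. i \<in> {(q, k). prime q \<and> prim q \<and> k \<ge> 1} \<and> nm (fst i ^ snd i) \<le> y}"
    obtain q k where ik: "i = (q, k)" by force
    have q: "prime q" "prim q" "k \<ge> 1" "nm q ^ k \<le> y" using i unfolding ik by (simp_all add: enorm_power)
    have n2: "nm q \<ge> 2" by (rule prime_nm_ge_2) fact+
    have "nm q ^ 1 \<le> nm q ^ k" using q n2 by (intro power_increasing) auto
    then have "nm q ^ 1 \<le> y" using q(4) by (rule order_trans)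
    then have "nm q \<le> y" by (simp only: power_one_right)
    have "real k < 2 ^ k" by (metis of_nat_less_two_power)
    also have "(2::real) ^ k \<le> nm q ^ k" using n2 by (intro power_mono) auto
    finally have "real k < y" using q by linarith
    then have "k \<le> nat \<lceil>y\<rceil>" by linarith
    then show "i \<in> prims y \<times> {..nat \<lceil>y\<rceil>}" using ik q \<open>nm q \<le> y\<close> by simp
  qed
qed (simp add: finite_prims)

text \<open>The logarithm as the convolution of 1 with the von Mangoldt function. No unit enters,
  because \<open>b\<close> and the product of its prime powers are associated and both
  primary.\<close>

lemma ln_nm_sum:
  assumes "prim b"
  shows "(\<Sum>i | i \<in> {(q, k). prime q \<and> prim q \<and> k \<ge> 1} \<and> fst i ^ snd i dvd b. ln (nm (fst i))) = ln (nm b)"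
proof -
  have b0: "b \<noteq> 0" using assms prim_nonzero by blast
  have pr: "prime q" "prim q" "q dvd b" if "q \<in> prime_factors b" for q
    using that prim_of_dvd[OF assms, of q] by (auto simp: in_prime_factors_iff)
  have set: "{i. i \<in> {(q, k). prime q \<and> prim q \<and> k \<ge> 1} \<and> fst i ^ snd i dvd b} = Sigma (prime_factors b) (\<lambda>q. {1..multiplicity q b})"
  proof (intro equalityI subsetI)
    fix i assume "i \<in> {i. i \<in> {(q, k). prime q \<and> prim q \<and> k \<ge> 1} \<and> fst i ^ snd i dvd b}"
    then obtain q k where i: "i = (q, k)" "prime q" "k \<ge> 1" "q ^ k dvd b" by auto
    have "q ^ 1 dvd q ^ k" using i by (intro le_imp_power_dvd)
    then have "q dvd b" using i dvd_trans by auto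
    moreover have "k \<le> multiplicity q b" using i b0 by (intro multiplicity_geI) (auto simp: prime_elem_not_unit)
    ultimately show "i \<in> Sigma (prime_factors b) (\<lambda>q. {1..multiplicity q b})" using i b0 by (auto simp: in_prime_factors_iff)
  next
    fix i assume "i \<in> Sigma (prime_factors b) (\<lambda>q. {1..multiplicity q b})"
    then show "i \<in> {i. i \<in> {(q, k). prime q \<and> prim q \<and> k \<ge> 1} \<and> fst i ^ snd i dvd b}"
      using pr by (auto intro: multiplicity_dvd')
  qed
  have "(\<Sum>i | i \<in> {(q, k). prime q \<and> prim q \<and> k \<ge> 1} \<and> fst i ^ snd i dvd b. ln (nm (fst i)))
    = (\<Sum>q\<in>prime_factors b. \<Sum>k\<in>{1..multiplicity q b}. ln (nm q))"
    unfolding set by (subst sum.Sigma) (auto simp: case_prod_beta)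
  also have "\<dots> = (\<Sum>q\<in>prime_factors b. ln (nm q ^ multiplicity q b))"
  proof (intro sum.cong refl)
    fix q assume "q \<in> prime_factors b"
    then have "nm q \<ge> 2" using pr prime_nm_ge_2 by blast
    then show "(\<Sum>k\<in>{1..multiplicity q b}. ln (nm q)) = ln (nm q ^ multiplicity q b)" by (simp add: ln_realpow)
  qed
  also have "\<dots> = ln (\<Prod>q\<in>prime_factors b. nm q ^ multiplicity q b)"
  proof -
    have "nm q ^ multiplicity q b > 0" if "q \<in> prime_factors b" for q
      using prime_nm_ge_2[of q] pr[OF that] by simp
    then show ?thesis by (subst ln_prod) auto
  qed
  also have "(\<Prod>q\<in>prime_factors b. nm q ^ multiplicity q b) = nm (\<Prod>q\<in>prime_factors b. q ^ multiplicity q b)"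
  proof -
    have "nm (prod f X) = (\<Prod>x\<in>X. nm (f x))" for f :: "eis \<Rightarrow> eis" and X
      by (induction X rule: infinite_finite_induct) (auto simp: enorm_mult)
    then show ?thesis by (simp add: enorm_power)
  qed
  also have "(\<Prod>q\<in>prime_factors b. q ^ multiplicity q b) = b"
  proof -
    define r where "r = (\<Prod>q\<in>prime_factors b. q ^ multiplicity q b)"
    have "r = prod_mset (prime_factorization b)"
      unfolding r_def prod_mset_multiplicity
      by (intro prod.cong refl) (simp add: count_prime_factorization_prime in_prime_factors_iff)
    then have "normalize r = b"
      using prod_mset_prime_factorization_weak[OF b0] normalize_prim[OF assms] by simp
    moreover have "prim (prod f X)" if "\<And>x. x \<in> X \<Longrightarrow> prim (f x)" for f :: "eis \<Rightarrow> eis" and X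
      using that by (induction X rule: infinite_finite_induct) (auto simp: prim_mult)
    from this[of "prime_factors b" "\<lambda>q. q ^ multiplicity q b"] have "prim r"
      unfolding r_def using pr(2) prim_power by simp
    ultimately show ?thesis using normalize_prim[of r] by (simp add: r_def)
  qed
  finally show ?thesis .
qed

context twist
begin

text \<open>For partial sums this is the identity of \<open>L * (- L' / L)\<close> with
  \<open>- L'\<close>.\<close>

lemma S_conv: "(\<Sum>m\<in>prims y. psi m / of_real (nm m) * S (y / nm m)) = A y"
proof -
  have "(\<Sum>m\<in>prims y. psi m / of_real (nm m) * S (y / nm m))
    = (\<Sum>m\<in>prims y. \<Sum>i | i \<in> IQ \<and> nm (fst i ^ snd i) \<le> y / nm m.
        psi m / of_real (nm m) * (psi (fst i ^ snd i) / of_real (nm (fst i ^ snd i)) * of_real (ln (nm (fst i)))))"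
    by (simp add: S_def sum_distrib_left)
  also have "\<dots> = (\<Sum>b\<in>prims y. \<Sum>i | i \<in> IQ \<and> fst i ^ snd i dvd b.
        psi (b div fst i ^ snd i) / of_real (nm (b div fst i ^ snd i)) * (psi (fst i ^ snd i) / of_real (nm (fst i ^ snd i)) * of_real (ln (nm (fst i)))))"
    by (rule prims_conv) (use finite_prime_powers prim_power in \<open>auto simp: IQ_def\<close>)
  also have "\<dots> = (\<Sum>b\<in>prims y. psi b / of_real (nm b) * of_real (\<Sum>i | i \<in> IQ \<and> fst i ^ snd i dvd b. ln (nm (fst i))))"
  proof (rule sum.cong)
    fix b assume b: "b \<in> prims y"
    have "psi (b div fst i ^ snd i) / of_real (nm (b div fst i ^ snd i)) * (psi (fst i ^ snd i) / of_real (nm (fst i ^ snd i)) * of_real (ln (nm (fst i))))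
      = psi b / of_real (nm b) * of_real (ln (nm (fst i)))" if "i \<in> {i. i \<in> IQ \<and> fst i ^ snd i dvd b}" for i
    proof -
      define e where "e = fst i ^ snd i"
      have e: "prim e" "e dvd b" using that prim_power by (auto simp: e_def IQ_def)
      obtain m where m: "b = e * m" using e(2) unfolding dvd_def by blast
      have pm: "prim m" using prim_cancel[OF e(1)] m b by simp
      have "b div e = m" using m prim_nonzero[OF e(1)] by simp
      then show ?thesis
        unfolding e_def[symmetric] by (simp add: m psi_mult[OF e(1) pm] enorm_mult mult_ac)
    qed
    then show "(\<Sum>i | i \<in> IQ \<and> fst i ^ snd i dvd b. psi (b div fst i ^ snd i) / of_real (nm (b div fst i ^ snd i)) * (psi (fst i ^ snd i) / of_real (nm (fst i ^ snd i)) * of_real (ln (nm (fst i)))))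
      = psi b / of_real (nm b) * of_real (\<Sum>i | i \<in> IQ \<and> fst i ^ snd i dvd b. ln (nm (fst i)))"
      unfolding of_real_sum sum_distrib_left by (intro sum.cong refl) blast
  qed simp
  also have "\<dots> = A y"
    unfolding A_def
  proof (rule sum.cong)
    fix b assume "b \<in> prims y"
    then have "prim b" by simp
    then show "psi b / of_real (nm b) * of_real (\<Sum>i | i \<in> IQ \<and> fst i ^ snd i dvd b. ln (nm (fst i))) = psi b / of_real (nm b) * of_real (ln (nm b))"
      unfolding IQ_def by (simp only: ln_nm_sum)
  qed simp
  finally show ?thesis .
qed

text \<open>\<open>S\<close> minus its expected main term, where \<open>e\<close> is the order of
  the L-series at 1: 1 for a zero, 0 for a nonzero value, -1 for the pole of the trivial
  character.\<close>

definition F :: "real \<Rightarrow> real \<Rightarrow> complex \<Rightarrow> complex" where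
  "F e x k = S x + of_real (e * ln x) - k"

lemma F_conv:
  "(\<Sum>m\<in>prims y. psi m / of_real (nm m) * F e (y / nm m) k) = A y + of_real e * (of_real (ln y) * P y - A y) - k * P y" if "y > 0"
proof -
  have "(\<Sum>m\<in>prims y. psi m / of_real (nm m) * F e (y / nm m) k) =
    (\<Sum>m\<in>prims y. psi m / of_real (nm m) * S (y / nm m) + of_real e * (of_real (ln y) * (psi m / of_real (nm m)) - psi m / of_real (nm m) * of_real (ln (nm m))) - k * (psi m / of_real (nm m)))"
  proof (rule sum.cong)
    fix m assume "m \<in> prims y"
    then have "nm m \<ge> 1" using nm_ge_1 by blast
    then have l: "ln (y / nm m) = ln y - ln (nm m)" using that by (intro ln_divide_pos) auto
    show "psi m / of_real (nm m) * F e (y / nm m) k = psi m / of_real (nm m) * S (y / nm m) + of_real e * (of_real (ln y) * (psi m / of_real (nm m)) - psi m / of_real (nm m) * of_real (ln (nm m))) - k * (psi m / of_real (nm m))"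
    proof -
      have "w * (s + z * (a - b) - t) = w * s + z * (a * w - w * b) - t * w" for w s z a b t :: complex
        by (simp add: algebra_simps)
      then show ?thesis unfolding F_def l of_real_mult of_real_diff .
    qed
  qed simp
  also have "\<dots> = A y + of_real e * (of_real (ln y) * P y - A y) - k * P y"
    by (simp only: sum_subtractf sum.distrib sum_distrib_left[symmetric] S_conv P_def A_def)
  finally show ?thesis .
qed

text \<open>Moebius inversion recovers \<open>F\<close> from its convolution with
  \<open>psi / nm\<close>. If that convolution approaches a constant \<open>gz\<close> with a
  power-saving error, the errors summed over \<open>d\<close> stay bounded, since
  \<open>nm d powr (-7/8)\<close> sums to \<open>O(x powr (1/8))\<close>; the constant meets the
  Moebius sum that \<open>M\<close> controls.\<close>

lemma F_bound:
  assumes G: "K \<ge> 0" "\<And>y. y \<ge> 1 \<Longrightarrow> norm (A y + of_real e * (of_real (ln y) * P y - A y) - k * P y - gz) \<le> K * y powr (-1/8)"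
    and M: "M \<ge> 0" "\<And>x. x \<ge> 1 \<Longrightarrow> norm (gz * (\<Sum>d\<in>prims x. of_real (mu d) * (psi d / of_real (nm d)))) \<le> M"
  shows "\<exists>B. \<forall>x\<ge>1. norm (F e x k) \<le> B"
proof -
  obtain K1 where K1: "K1 \<ge> 0" "\<And>x. x \<ge> 1 \<Longrightarrow> (\<Sum>d\<in>prims x. nm d powr (-(7/8))) \<le> K1 * x powr (1 - 7/8)"
    using prims_powr_sum[of "7/8"] by auto
  have "norm (F e x k) \<le> K * K1 + M" if x: "x \<ge> 1" for x
  proof -
    define w where "w d = psi d / of_real (nm d)" for d
    have w: "w (a * b) = w a * w b" if "prim a" "prim b" for a b
      by (simp add: w_def psi_mult[OF that] enorm_mult)
    have w1: "w 1 = 1" by (simp add: w_def psi_1)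
    define G where "G y = A y + of_real e * (of_real (ln y) * P y - A y) - k * P y" for y
    have xd: "x / nm d \<ge> 1" if "d \<in> prims x" for d using that nm_ge_1[of d] x by (auto simp: field_simps)
    have "F e x k = (\<Sum>d\<in>prims x. of_real (mu d) * w d * (\<Sum>m\<in>prims (x / nm d). w m * F e (x / nm d / nm m) k))"
      by (rule moebius_inversion[where F = "\<lambda>x. F e x k"]) (use w w1 x in auto)
    also have "\<dots> = (\<Sum>d\<in>prims x. of_real (mu d) * w d * G (x / nm d))"
    proof (intro sum.cong refl)
      fix d assume "d \<in> prims x"
      then have "x / nm d > 0" using xd by fastforce
      from F_conv[OF this, of e k]
      show "of_real (mu d) * w d * (\<Sum>m\<in>prims (x / nm d). w m * F e (x / nm d / nm m) k) = of_real (mu d) * w d * G (x / nm d)"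
        by (simp only: w_def G_def)
    qed
    also have "\<dots> = (\<Sum>d\<in>prims x. of_real (mu d) * w d * (G (x / nm d) - gz)) + gz * (\<Sum>d\<in>prims x. of_real (mu d) * w d)"
      by (simp add: sum_distrib_left sum.distrib[symmetric] algebra_simps)
    finally have "norm (F e x k) \<le> norm (\<Sum>d\<in>prims x. of_real (mu d) * w d * (G (x / nm d) - gz)) + norm (gz * (\<Sum>d\<in>prims x. of_real (mu d) * w d))"
      by (simp only: norm_triangle_ineq)
    also have "norm (\<Sum>d\<in>prims x. of_real (mu d) * w d * (G (x / nm d) - gz)) \<le> (\<Sum>d\<in>prims x. norm (of_real (mu d) * w d * (G (x / nm d) - gz)))"
      by (rule norm_sum)
    also have "\<dots> \<le> (\<Sum>d\<in>prims x. K * x powr (-1/8) * nm d powr (-(7/8)))"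
    proof (rule sum_mono)
      fix d assume d: "d \<in> prims x"
      then have n1: "nm d \<ge> 1" using nm_ge_1 by blast
      have nw: "norm (w d) \<le> 1 / nm d" using psi_le_1[of d] d n1 by (simp add: w_def norm_divide divide_right_mono)
      have "norm (of_real (mu d) * w d * (G (x / nm d) - gz)) = \<bar>mu d\<bar> * norm (w d) * norm (G (x / nm d) - gz)"
        by (simp add: norm_mult)
      also have "\<dots> \<le> 1 * (1 / nm d) * (K * (x / nm d) powr (-1/8))"
        using abs_mu[of d] nw G(2)[OF xd[OF d]] G(1) n1 unfolding G_def by (intro mult_mono) auto
      also have "(x / nm d) powr (-1/8) = x powr (-1/8) * nm d powr (1/8)"
        using x n1 by (simp add: powr_divide powr_minus field_simps)
      also have "1 * (1 / nm d) * (K * (x powr (-1/8) * nm d powr (1/8))) = K * x powr (-1/8) * (nm d powr (1/8) * nm d powr (-1))"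
        using n1 by (simp add: powr_minus_divide)
      also have "nm d powr (1/8) * nm d powr (-1) = nm d powr (-(7/8))" by (simp only: powr_add[symmetric]) simp
      finally show "norm (of_real (mu d) * w d * (G (x / nm d) - gz)) \<le> K * x powr (-1/8) * nm d powr (-(7/8))" .
    qed
    also have "\<dots> = K * x powr (-1/8) * (\<Sum>d\<in>prims x. nm d powr (-(7/8)))" by (rule sum_distrib_left[symmetric])
    also have "\<dots> \<le> K * x powr (-1/8) * (K1 * x powr (1 - 7/8))"
      using K1(2)[OF x] G(1) by (intro mult_left_mono) auto
    also have "\<dots> = K * K1 * (x powr (-1/8) * x powr (1 - 7/8))" by simp
    also have "x powr (-1/8) * x powr (1 - 7/8) = 1" using x by (simp add: powr_add[symmetric])
    finally show ?thesis using M(2)[OF x] by (simp add: w_def)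
  qed
  then show ?thesis by blast
qed

lemma powr_quarter_eighth: "y \<ge> 1 \<Longrightarrow> y powr (-1/4) \<le> y powr (-1/8)" for y :: real
  by (intro powr_mono) auto

lemma ln_powr_quarter: "y \<ge> 1 \<Longrightarrow> ln y * y powr (-1/4) \<le> 8 * y powr (-1/8)" for y :: real
proof -
  assume y: "y \<ge> 1"
  have "ln y \<le> 8 * y powr (1/8)" using ln_powr_bound[of y "1/8"] y by simp
  then have "ln y * y powr (-1/4) \<le> 8 * y powr (1/8) * y powr (-1/4)" by (intro mult_right_mono) auto
  also have "\<dots> = 8 * y powr (-1/8)" by (simp only: mult.assoc powr_add[symmetric]) simp
  finally show ?thesis .
qed

text \<open>The second alternative corresponds to a zero of the L-series of \<open>psi\<close> at 1.\<close>

theorem mertens_dichotomy: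
  assumes c0: "c = 0"
  shows "(\<exists>B. \<forall>x\<ge>1. norm (S x) \<le> B) \<or> (\<exists>B. \<forall>x\<ge>1. norm (S x + of_real (ln x)) \<le> B)"
proof -
  obtain L K where LK: "K \<ge> 0" "\<And>y. y \<ge> 1 \<Longrightarrow> norm (P y - L) \<le> K * y powr (-1/4)"
    using P_asymp unfolding c0 by auto
  obtain L1 K1 where LK1: "K1 \<ge> 0" "\<And>y. y \<ge> 1 \<Longrightarrow> norm (A y - L1) \<le> K1 * y powr (-1/4)"
    using A_asymp unfolding c0 by auto
  show ?thesis
  proof (cases "L = 0")
    case True
    \<comment> \<open>With \<open>e = 1\<close> and \<open>k = 0\<close> the terms
      \<open>A y\<close> cancel, and \<open>ln y * P y\<close> tends to 0 because the limit
      \<open>L\<close> of \<open>P\<close> is 0.\<close>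
    have "norm (A y + of_real 1 * (of_real (ln y) * P y - A y) - 0 * P y - 0) \<le> (8 * K) * y powr (-1/8)" if y: "y \<ge> 1" for y
    proof -
      have "norm (A y + of_real 1 * (of_real (ln y) * P y - A y) - 0 * P y - 0) = ln y * norm (P y)"
        using y by (simp add: norm_mult)
      also have "\<dots> \<le> ln y * (K * y powr (-1/4))" using LK(2)[OF y] True y by (intro mult_left_mono) auto
      also have "\<dots> = K * (ln y * y powr (-1/4))" by simp
      also have "\<dots> \<le> K * (8 * y powr (-1/8))" using LK(1) ln_powr_quarter[OF y] by (intro mult_left_mono)
      finally show ?thesis by simp
    qed
    then have "\<exists>B. \<forall>x\<ge>1. norm (F 1 x 0) \<le> B"
      using LK(1) by (intro F_bound[where K = "8 * K" and gz = 0 and M = 0]) auto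
    then show ?thesis by (simp add: F_def)
  next
    case False
    \<comment> \<open>The value of \<open>- L' / L\<close> at 1: it makes
      \<open>A y - k * P y\<close> tend to 0.\<close>
    define k where "k = L1 / L"
    have "norm (A y + of_real 0 * (of_real (ln y) * P y - A y) - k * P y - 0) \<le> (K1 + norm k * K) * y powr (-1/8)" if y: "y \<ge> 1" for y
    proof -
      have "A y + of_real 0 * (of_real (ln y) * P y - A y) - k * P y - 0 = (A y - L1) - k * (P y - L)"
        using False by (simp add: k_def algebra_simps)
      also have "norm \<dots> \<le> norm (A y - L1) + norm k * norm (P y - L)"
        by (metis norm_triangle_ineq4 norm_mult)
      also have "\<dots> \<le> K1 * y powr (-1/4) + norm k * (K * y powr (-1/4))"
        using LK(2)[OF y] LK1(2)[OF y] by (intro add_mono mult_left_mono) auto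
      also have "\<dots> = (K1 + norm k * K) * y powr (-1/4)" by (simp add: algebra_simps)
      also have "\<dots> \<le> (K1 + norm k * K) * y powr (-1/8)"
        using LK(1) LK1(1) powr_quarter_eighth[OF y] by (intro mult_left_mono) auto
      finally show ?thesis .
    qed
    then have "\<exists>B. \<forall>x\<ge>1. norm (F 0 x k) \<le> B"
      using LK(1) LK1(1) by (intro F_bound[where K = "K1 + norm k * K" and gz = 0 and M = 0]) auto
    then obtain B where B: "\<And>x. x \<ge> 1 \<Longrightarrow> norm (S x - k) \<le> B" by (auto simp: F_def)
    have "norm (S x) \<le> B + norm k" if "x \<ge> 1" for x
      using B[OF that] norm_triangle_ineq[of "S x - k" k] by simp
    then show ?thesis by blast
  qed
qed

end

text \<open>The inversion formula for the constant 1, in which the number of primary elements up to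
  \<open>x / nm d\<close> is replaced by \<open>c * x / nm d\<close> with square-root error.\<close>

lemma sum_mu_over_norm_bounded: "\<exists>M\<ge>0. \<forall>x\<ge>1. \<bar>\<Sum>d\<in>prims x. mu d / nm d\<bar> \<le> M"
proof -
  obtain c C where c: "c > 0" "C \<ge> 0" "\<And>r. r \<ge> 1 \<Longrightarrow> \<bar>real (card (prims r)) - c * r\<bar> \<le> C * sqrt r"
    using prim_count by blast
  obtain K where K: "K \<ge> 0" "\<And>x. x \<ge> 1 \<Longrightarrow> (\<Sum>d\<in>prims x. nm d powr (-(1/2))) \<le> K * x powr (1 - 1/2)"
    using prims_powr_sum[of "1/2"] by auto
  have "\<bar>\<Sum>d\<in>prims x. mu d / nm d\<bar> \<le> (1 + C * K) / c" if x: "x \<ge> 1" for x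
  proof -
    have xd: "x / nm d \<ge> 1" if "d \<in> prims x" for d using that nm_ge_1[of d] x by (auto simp: field_simps)
    have "(1::complex) = (\<Sum>d\<in>prims x. of_real (mu d) * 1 * (\<Sum>m\<in>prims (x / nm d). 1 * 1))"
      by (rule moebius_inversion[where w = "\<lambda>_. 1" and F = "\<lambda>_. 1"]) (use x in auto)
    also have "\<dots> = of_real (\<Sum>d\<in>prims x. mu d * real (card (prims (x / nm d))))" by simp
    finally have "complex_of_real 1 = of_real (\<Sum>d\<in>prims x. mu d * real (card (prims (x / nm d))))" by simp
    then have one: "1 = (\<Sum>d\<in>prims x. mu d * real (card (prims (x / nm d))))" unfolding of_real_eq_iff .
    define R where "R = (\<Sum>d\<in>prims x. mu d * (real (card (prims (x / nm d))) - c * (x / nm d)))"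
    have "c * x * (\<Sum>d\<in>prims x. mu d / nm d) = 1 - R"
      unfolding R_def one by (simp add: sum_subtractf right_diff_distrib sum_distrib_left mult_ac)
    moreover have "\<bar>R\<bar> \<le> C * K * x"
    proof -
      have "\<bar>R\<bar> \<le> (\<Sum>d\<in>prims x. \<bar>mu d * (real (card (prims (x / nm d))) - c * (x / nm d))\<bar>)" unfolding R_def by (rule sum_abs)
      also have "\<dots> \<le> (\<Sum>d\<in>prims x. C * sqrt x * nm d powr (-(1/2)))"
      proof (rule sum_mono)
        fix d assume d: "d \<in> prims x"
        then have n1: "nm d \<ge> 1" using nm_ge_1 by blast
        have "\<bar>mu d * (real (card (prims (x / nm d))) - c * (x / nm d))\<bar> \<le> 1 * (C * sqrt (x / nm d))"
          unfolding abs_mult using abs_mu c(3)[OF xd[OF d]] by (intro mult_mono) auto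
        also have "sqrt (x / nm d) = sqrt x * nm d powr (-(1/2))"
          using n1 by (simp add: real_sqrt_divide powr_minus_divide powr_half_sqrt)
        finally show "\<bar>mu d * (real (card (prims (x / nm d))) - c * (x / nm d))\<bar> \<le> C * sqrt x * nm d powr (-(1/2))" by simp
      qed
      also have "\<dots> = C * sqrt x * (\<Sum>d\<in>prims x. nm d powr (-(1/2)))" by (rule sum_distrib_left[symmetric])
      also have "\<dots> \<le> C * sqrt x * (K * x powr (1 - 1/2))" using K(2)[OF x] c x by (intro mult_left_mono) auto
      also have "\<dots> = C * K * (sqrt x * sqrt x)" using x by (simp add: powr_half_sqrt)
      finally show ?thesis using x by simp
    qed
    ultimately have "\<bar>c * x * (\<Sum>d\<in>prims x. mu d / nm d)\<bar> \<le> 1 + C * K * x" by linarith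
    also have "\<dots> \<le> (1 + C * K) * x" using x by (simp add: algebra_simps)
    finally have "(c * x) * \<bar>\<Sum>d\<in>prims x. mu d / nm d\<bar> \<le> (1 + C * K) * x"
      using c x by (simp add: abs_mult)
    then have "(c * \<bar>\<Sum>d\<in>prims x. mu d / nm d\<bar>) * x \<le> (1 + C * K) * x" by (simp add: mult_ac)
    then have "c * \<bar>\<Sum>d\<in>prims x. mu d / nm d\<bar> \<le> 1 + C * K" using x by simp
    then show ?thesis using c by (simp add: field_simps)
  qed
  moreover have "(1 + C * K) / c \<ge> 0" using c K by simp
  ultimately show ?thesis by blast
qed

theorem mertens_principal:
  assumes "twist (\<lambda>_. 1) c C" "c > 0"
  shows "\<exists>B. \<forall>x\<ge>1. norm (twist.S (\<lambda>_. 1) x - of_real (ln x)) \<le> B"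
proof -
  interpret twist "\<lambda>_. 1" c C by fact
  obtain L K where LK: "K \<ge> 0" "\<And>y. y \<ge> 1 \<Longrightarrow> norm (P y - of_real (c * ln y) - L) \<le> K * y powr (-1/4)"
    using P_asymp by auto
  obtain L1 K1 where LK1: "K1 \<ge> 0" "\<And>y. y \<ge> 1 \<Longrightarrow> norm (A y - of_real (c * (ln y ^ 2 / 2)) - L1) \<le> K1 * y powr (-1/4)"
    using A_asymp by auto
  \<comment> \<open>For \<open>e = - 1\<close> the convolution is
    \<open>2 * A y - ln y * P y - k * P y\<close>. The squares of \<open>ln y\<close> cancel, this
    \<open>k\<close> cancels the terms linear in \<open>ln y\<close>, and \<open>g0\<close> is the
    constant that remains.\<close>
  define k where "k = - L / of_real c"
  define g0 where "g0 = 2 * L1 - k * L"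
  have "norm (A y + of_real (-1) * (of_real (ln y) * P y - A y) - k * P y - g0) \<le> (2 * K1 + 8 * K + norm k * K) * y powr (-1/8)" if y: "y \<ge> 1" for y
  proof -
    define u where "u = A y - of_real (c * (ln y ^ 2 / 2)) - L1"
    define v where "v = P y - of_real (c * ln y) - L"
    have kc: "k * of_real c = - L" using assms(2) by (simp add: k_def)
    have AP: "A y = u + of_real (c * (ln y ^ 2 / 2)) + L1" "P y = v + of_real (c * ln y) + L" by (simp_all add: u_def v_def)
    have "A y + of_real (-1) * (of_real (ln y) * P y - A y) - k * P y - g0 = 2 * u - of_real (ln y) * v - k * v - of_real (ln y) * (L + k * of_real c)"
      unfolding AP g0_def by (simp add: power2_eq_square algebra_simps)
    also have "\<dots> = 2 * u - of_real (ln y) * v - k * v" by (simp add: kc)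
    also have "norm \<dots> \<le> norm (2 * u) + norm (of_real (ln y) * v) + norm (k * v)"
      by (intro order_trans[OF norm_triangle_ineq4] add_mono order_refl)
    also have "\<dots> = 2 * norm u + ln y * norm v + norm k * norm v" using y by (simp add: norm_mult)
    also have "\<dots> \<le> 2 * (K1 * y powr (-1/4)) + ln y * (K * y powr (-1/4)) + norm k * (K * y powr (-1/4))"
      using LK(2)[OF y] LK1(2)[OF y] y unfolding u_def v_def by (intro add_mono mult_left_mono) auto
    also have "\<dots> = (2 * K1 + norm k * K) * y powr (-1/4) + K * (ln y * y powr (-1/4))" by (simp add: algebra_simps)
    also have "\<dots> \<le> (2 * K1 + norm k * K) * y powr (-1/8) + K * (8 * y powr (-1/8))"
      using LK(1) LK1(1) powr_quarter_eighth[OF y] ln_powr_quarter[OF y] by (intro add_mono mult_left_mono) auto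
    finally show ?thesis by (simp add: algebra_simps)
  qed
  moreover obtain M where M: "M \<ge> 0" "\<And>x. x \<ge> 1 \<Longrightarrow> \<bar>\<Sum>d\<in>prims x. mu d / nm d\<bar> \<le> M"
    using sum_mu_over_norm_bounded by blast
  have "norm (g0 * (\<Sum>d\<in>prims x. of_real (mu d) * (1 / of_real (nm d)))) \<le> norm g0 * M" if x: "x \<ge> 1" for x
  proof -
    have "(\<Sum>d\<in>prims x. of_real (mu d) * (1 / of_real (nm d))) = complex_of_real (\<Sum>d\<in>prims x. mu d / nm d)" by simp
    then have "norm (\<Sum>d\<in>prims x. of_real (mu d) * (1 / complex_of_real (nm d))) = \<bar>\<Sum>d\<in>prims x. mu d / nm d\<bar>" by (simp only: norm_of_real)
    then show ?thesis unfolding norm_mult using M(2)[OF x] by (simp add: mult_left_mono)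
  qed
  ultimately have "\<exists>B. \<forall>x\<ge>1. norm (F (-1) x k) \<le> B"
    using LK(1) LK1(1) M(1) by (intro F_bound[where K = "2 * K1 + 8 * K + norm k * K" and gz = g0 and M = "norm g0 * M"]) auto
  then obtain B where B: "\<And>x. x \<ge> 1 \<Longrightarrow> norm (S x - of_real (ln x) - k) \<le> B" by (auto simp: F_def)
  have "norm (S x - of_real (ln x)) \<le> B + norm k" if "x \<ge> 1" for x
    using B[OF that] norm_triangle_ineq[of "S x - of_real (ln x) - k" k] by simp
  then show ?thesis by blast
qed

section \<open>Primes with a negative bias of the local density\<close>

text \<open>\<open>tw a 1 1\<close> is the \<psi> of the local density, and \<open>tw a 0 6\<close>
  is its sixth power wherever the symbol does not vanish. The two exponents make the family closed
  under squaring, which excluding a zero at 1 relies on.\<close>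

definition tw :: "nat \<Rightarrow> nat \<Rightarrow> nat \<Rightarrow> eis \<Rightarrow> complex" where
  "tw a j k x = cnj (toc (csym a x)) ^ j * sgn (toc x) ^ k"

lemma norm_csym: "norm (toc (csym a x)) = 0 \<or> norm (toc (csym a x)) = 1"
proof (cases "csym a x = 0")
  case False
  then have "csym a x ^ 3 = 1" using csym_cube by blast
  then have "norm (toc (csym a x)) ^ 3 = 1" by (metis norm_one norm_power toc_power toc_simps(2))
  then show ?thesis using power_eq_imp_eq_base[of "norm (toc (csym a x))" 3 1] by simp
qed simp

lemma norm_sgn_toc: "x \<noteq> 0 \<Longrightarrow> norm (sgn (toc x)) = 1"
  by (simp add: norm_sgn)

lemma twist_tw:
  assumes a: "a > 0" and k: "k dvd 12" "k > 0"
  shows "\<exists>C. twist (tw a j k) 0 C"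
proof -
  define cc where "cc x = cnj (toc (csym a x)) ^ j" for x
  have per: "cc x = cc y" if "of_nat (9 * a) dvd x - y" for x y
    using csym_cong[OF that a] by (simp add: cc_def)
  obtain C where C: "C \<ge> 0" "\<And>r. r \<ge> 1 \<Longrightarrow> norm (\<Sum>x\<in>prims r. cc x * sgn (toc x) ^ k) \<le> C * sqrt r"
    using twisted_lattice_sum[OF k, of "9 * a" cc] a per by auto
  have "twist (tw a j k) 0 C"
  proof
    fix x y assume xy: "prim x" "prim y"
    show "tw a j k (x * y) = tw a j k x * tw a j k y"
      by (simp add: tw_def csym_mult[OF xy] sgn_mult power_mult_distrib)
  next
    show "tw a j k 1 = 1" by (simp add: tw_def)
    show "tw a j k x = 0 \<or> norm (tw a j k x) = 1" if "prim x" for x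
    proof (cases "csym a x = 0 \<and> j > 0")
      case False
      then have "norm (cnj (toc (csym a x)) ^ j) = 1" using norm_csym[of a x] by (auto simp: norm_power)
      then show ?thesis using norm_sgn_toc[OF prim_nonzero[OF that]] by (simp add: tw_def norm_mult norm_power)
    qed (simp add: tw_def power_0_left)
    show "norm ((\<Sum>x\<in>prims r. tw a j k x) - of_real (0 * r)) \<le> C * sqrt r" if "r \<ge> 1" for r
      using C(2)[OF that] by (simp add: tw_def cc_def)
  qed (use C in auto)
  then show ?thesis ..
qed

lemma tw_sq: "tw a j k x ^ 2 = tw a (2 * j) (2 * k) x"
  by (simp add: tw_def power_mult_distrib power_mult[symmetric] mult.commute)

lemma twist_one: "\<exists>c C. c > 0 \<and> twist (\<lambda>_. 1) c C"
proof -
  obtain c C where c: "c > 0" "C \<ge> 0" "\<And>r. r \<ge> 1 \<Longrightarrow> \<bar>real (card (prims r)) - c * r\<bar> \<le> C * sqrt r"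
    using prim_count by blast
  have "twist (\<lambda>_. 1) c C"
  proof
    fix r :: real assume r: "r \<ge> 1"
    have "norm (complex_of_real (real (card (prims r)) - c * r)) \<le> C * sqrt r"
      unfolding norm_of_real by (rule c(3)[OF r])
    then show "norm ((\<Sum>x\<in>prims r. 1) - complex_of_real (c * r)) \<le> C * sqrt r" by simp
  qed (use c in auto)
  then show ?thesis using c by blast
qed

section \<open>Sums over prime powers and nonvanishing at 1\<close>

text \<open>The index set of \<open>S\<close> outside the locale, so that sums for different
  characters can be combined term by term.\<close>

definition ppow :: "real \<Rightarrow> (eis \<times> nat) set" where
  "ppow x = {i. i \<in> {(q, k). prime q \<and> prim q \<and> k \<ge> 1} \<and> nm (fst i ^ snd i) \<le> x}"

definition pw :: "eis \<times> nat \<Rightarrow> real" where "pw i = ln (nm (fst i)) / nm (fst i ^ snd i)"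

definition pe :: "eis \<times> nat \<Rightarrow> eis" where "pe i = fst i ^ snd i"

lemma finite_ppow: "finite (ppow x)" unfolding ppow_def by (rule finite_prime_powers)

lemma pw_nonneg: "i \<in> ppow x \<Longrightarrow> pw i \<ge> 0"
  unfolding ppow_def pw_def using prime_nm_ge_2 prim_power nm_ge_1
  by (auto intro!: divide_nonneg_nonneg)

lemma prim_pe: "i \<in> ppow x \<Longrightarrow> prim (pe i)"
  by (auto simp: ppow_def pe_def prim_power)

lemma twist_S: assumes "twist psi c C" shows "twist.S psi x = (\<Sum>i\<in>ppow x. of_real (pw i) * psi (pe i))"
  unfolding twist.S_def[OF assms] twist.IQ_def[OF assms] ppow_def pw_def pe_def
  by (intro sum.cong refl) simp

lemma mertens_ppow: "\<exists>B. \<forall>x\<ge>1. \<bar>(\<Sum>i\<in>ppow x. pw i) - ln x\<bar> \<le> B"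
proof -
  obtain c C where t: "c > 0" "twist (\<lambda>_. 1) c C" using twist_one by blast
  obtain B where B: "\<And>x. x \<ge> 1 \<Longrightarrow> norm (twist.S (\<lambda>_. 1) x - of_real (ln x)) \<le> B"
    using mertens_principal[OF t(2,1)] by blast
  have "\<bar>(\<Sum>i\<in>ppow x. pw i) - ln x\<bar> \<le> B" if "x \<ge> 1" for x
  proof -
    have "twist.S (\<lambda>_. 1) x - of_real (ln x) = of_real ((\<Sum>i\<in>ppow x. pw i) - ln x)"
      unfolding twist_S[OF t(2)] by simp
    then show ?thesis using B[OF that] by (metis norm_of_real)
  qed
  then show ?thesis by blast
qed

text \<open>On the unit circle the expression is \<open>2 * (1 + Re z) ^ 2\<close>;
  \<open>z = 0\<close> occurs where the symbol vanishes.\<close>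

lemma trig_341: assumes "z = 0 \<or> norm z = 1" shows "3 + 4 * Re z + Re (z ^ 2) \<ge> 0"
  using assms
proof
  assume "norm z = 1"
  then have "Re z ^ 2 + Im z ^ 2 = 1" by (metis cmod_power2 power_one)
  then have "3 + 4 * Re z + Re (z ^ 2) = 2 * (1 + Re z) ^ 2"
    by (simp add: power2_eq_square algebra_simps)
  then show ?thesis by simp
qed simp

text \<open>If the sum for \<open>psi\<close> were \<open>- ln x + O(1)\<close>, then
  \<open>trig_341\<close> would give \<open>3 * ln x - 4 * ln x + Re (S2 x)\<close> bounded below.
  Both alternatives of the dichotomy for \<open>psi ^ 2\<close> bound \<open>Re (S2 x)\<close> from
  above, so \<open>ln x\<close> would be bounded.\<close>

lemma twisted_mertens_bounded:
  assumes t: "twist psi 0 C" "twist (\<lambda>x. psi x ^ 2) 0 C'"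
  shows "\<exists>B. \<forall>x\<ge>1. norm (\<Sum>i\<in>ppow x. of_real (pw i) * psi (pe i)) \<le> B"
proof -
  obtain B0 where B0: "\<And>x. x \<ge> 1 \<Longrightarrow> \<bar>(\<Sum>i\<in>ppow x. pw i) - ln x\<bar> \<le> B0" using mertens_ppow by blast
  define S1 where "S1 x = (\<Sum>i\<in>ppow x. of_real (pw i) * psi (pe i))" for x
  define S2 where "S2 x = (\<Sum>i\<in>ppow x. of_real (pw i) * psi (pe i) ^ 2)" for x
  have d1: "(\<exists>B. \<forall>x\<ge>1. norm (S1 x) \<le> B) \<or> (\<exists>B. \<forall>x\<ge>1. norm (S1 x + of_real (ln x)) \<le> B)"
    using twist.mertens_dichotomy[OF t(1)] unfolding twist_S[OF t(1)] S1_def by blast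
  have d2: "(\<exists>B. \<forall>x\<ge>1. norm (S2 x) \<le> B) \<or> (\<exists>B. \<forall>x\<ge>1. norm (S2 x + of_real (ln x)) \<le> B)"
    using twist.mertens_dichotomy[OF t(2)] unfolding twist_S[OF t(2)] S2_def by blast
  obtain B2 where B2: "\<And>x. x \<ge> 1 \<Longrightarrow> Re (S2 x) \<le> B2"
  proof -
    from d2 show thesis
    proof (elim disjE exE)
      fix B assume B: "\<forall>x\<ge>1. norm (S2 x) \<le> B"
      show thesis by (rule that[of B]) (use B complex_Re_le_cmod order_trans in blast)
    next
      fix B assume B: "\<forall>x\<ge>1. norm (S2 x + of_real (ln x)) \<le> B"
      show thesis
      proof (rule that[of B])
        fix x :: real assume x: "x \<ge> 1"
        have "Re (S2 x) + ln x \<le> B" using B x complex_Re_le_cmod[of "S2 x + of_real (ln x)"] by fastforce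
        moreover have "ln x \<ge> 0" using x by simp
        ultimately show "Re (S2 x) \<le> B" by linarith
      qed
    qed
  qed
  have "\<not> (\<exists>B. \<forall>x\<ge>1. norm (S1 x + of_real (ln x)) \<le> B)"
  proof
    assume "\<exists>B. \<forall>x\<ge>1. norm (S1 x + of_real (ln x)) \<le> B"
    then obtain B1 where B1: "\<And>x. x \<ge> 1 \<Longrightarrow> norm (S1 x + of_real (ln x)) \<le> B1" by blast
    have "ln x \<le> 3 * B0 + 4 * B1 + B2" if x: "x \<ge> 1" for x
    proof -
      have "Re (S1 x) + ln x \<le> B1" using B1[OF x] complex_Re_le_cmod[of "S1 x + of_real (ln x)"] by simp
      moreover have "(\<Sum>i\<in>ppow x. pw i) \<le> ln x + B0" using B0[OF x] by linarith
      moreover have "0 \<le> (\<Sum>i\<in>ppow x. pw i * (3 + 4 * Re (psi (pe i)) + Re (psi (pe i) ^ 2)))"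
        using pw_nonneg trig_341 twist.psi_norm[OF t(1)] prim_pe by (intro sum_nonneg mult_nonneg_nonneg) blast+
      moreover have "(\<Sum>i\<in>ppow x. pw i * (3 + 4 * Re (psi (pe i)) + Re (psi (pe i) ^ 2)))
        = 3 * (\<Sum>i\<in>ppow x. pw i) + 4 * Re (S1 x) + Re (S2 x)"
        unfolding S1_def S2_def Re_sum
        by (simp add: sum.distrib[symmetric] sum_distrib_left algebra_simps del: Re_power2)
      ultimately show ?thesis using B2[OF x] by linarith
    qed
    from this[of "exp (\<bar>3 * B0 + 4 * B1 + B2\<bar> + 1)"] show False by simp
  qed
  then show ?thesis using d1 unfolding S1_def by blast
qed

section \<open>Higher powers and inert primes\<close>

text \<open>The prime \<open>q\<close> divides its own norm, hence a rational prime factor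
  \<open>r\<close> of it, so that the norm divides \<open>r ^ 2\<close>.\<close>

lemma rational_prime_below:
  assumes "prime q" "prim q" "\<not> prime (enorm q)"
  obtains r :: nat where "prime r" "nm q = real r ^ 2" "q dvd of_nat r"
proof -
  define n where "n = nat (enorm q)"
  have n: "enorm q = int n" by (simp add: n_def)
  have n2: "n \<ge> 2" using prime_nm_ge_2[OF assms(1,2)] by (simp add: n)
  have "q dvd of_nat n" using mult_econj[of q] n by (metis dvd_triv_left of_int_of_nat_eq)
  moreover have "of_nat n = (\<Prod>p\<in>#prime_factorization n. (of_nat p :: eis))"
  proof -
    have "(of_nat (\<Prod>p\<in>#A. p) :: eis) = (\<Prod>p\<in>#A. of_nat p)" for A :: "nat multiset"
      by (induction A) auto
    moreover have "of_nat n = (of_nat (\<Prod>p\<in>#prime_factorization n. p) :: eis)"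
      using n2 by (simp add: prod_mset_prime_factorization_nat)
    ultimately show ?thesis by simp
  qed
  ultimately have "q dvd (\<Prod>p\<in>#prime_factorization n. (of_nat p :: eis))" by simp
  then obtain r where r: "r \<in># prime_factorization n" "q dvd of_nat r"
    using assms(1) by (auto simp: prime_dvd_prod_mset_iff)
  have pr: "prime r" using r(1) by auto
  have "enorm q dvd enorm (of_nat r)" using r(2) by (rule enorm_dvd)
  then have "int n dvd int r ^ 2" by (simp add: n)
  then have "n dvd r ^ 2" by (metis of_nat_dvd_iff of_nat_power)
  then obtain i where i: "i \<le> 2" "n = r ^ i" using divides_primepow_nat[OF pr] by blast
  have "i \<noteq> 0"
  proof
    assume "i = 0"
    then have "n = 1" using i by simp
    then show False using n2 by simp
  qed
  moreover have "i \<noteq> 1" using i pr assms(3) n by auto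
  ultimately have "i = 2" using i by linarith
  then have "nm q = real r ^ 2" using i n by simp
  then show thesis using that pr r(2) by blast
qed

lemma prim_primes_eqI:
  assumes "prime q" "prime q'" "q dvd q'"
  shows "q = (q' :: eis)"
  using assms primes_dvd_imp_eq by blast

lemma quarter_sum: "(\<Sum>k=1..n. real k powr (-5/4)) \<le> 5"
proof -
  have "(\<Sum>k=1..n. real k powr (-5/4)) \<le> 5 - 4 * real n powr (-1/4)" if "n \<ge> 1"
    using that
  proof (induction n rule: dec_induct)
    case (step n)
    then show ?case using powr_quarter_step[of n] by simp
  qed simp
  moreover have "4 * real n powr (-1/4) \<ge> 0" by simp
  ultimately have "(\<Sum>k=1..n. real k powr (-5/4)) \<le> 5" if "n \<ge> 1" using that by linarith
  then show ?thesis by (cases "n = 0") auto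
qed

definition deg1 :: "eis \<times> nat \<Rightarrow> bool" where "deg1 i \<longleftrightarrow> snd i = 1 \<and> prime (enorm (fst i))"

text \<open>Higher powers contribute at most a sum over \<open>ln (nm q) / nm q ^ 2\<close>, and
  primes of non-prime norm one over \<open>ln r / r ^ 2\<close>; both converge.\<close>

lemma not_deg1_bounded: "\<exists>B. \<forall>x. (\<Sum>i | i \<in> ppow x \<and> \<not> deg1 i. pw i) \<le> B"
proof -
  obtain K where K: "K \<ge> 0" "\<And>x. (\<Sum>d\<in>prims x. nm d powr (-(7/4))) \<le> K"
    using prims_powr_sum_bounded[of "7/4"] by auto
  have "(\<Sum>i | i \<in> ppow x \<and> \<not> deg1 i. pw i) \<le> 8 * K + 40" for x
  proof -
    define X where "X = {i \<in> ppow x. snd i \<ge> 2}"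
    define Y where "Y = {i \<in> ppow x. snd i = 1 \<and> \<not> prime (enorm (fst i))}"
    have fin: "finite X" "finite Y" using finite_ppow[of x] by (auto simp: X_def Y_def)
    have un: "{i. i \<in> ppow x \<and> \<not> deg1 i} = X \<union> Y" "X \<inter> Y = {}"
      by (auto simp: X_def Y_def deg1_def ppow_def)
    have X: "sum pw X \<le> 8 * K"
    proof -
      define N where "N = nat \<lceil>x\<rceil> + 2"
      have sub: "X \<subseteq> prims x \<times> {2..N}"
      proof
        fix i assume i: "i \<in> X"
        obtain q k where ik: "i = (q, k)" by force
        have q: "prime q" "prim q" "k \<ge> 2" "nm q ^ k \<le> x" using i unfolding ik X_def ppow_def by (simp_all add: enorm_power)
        have n2: "nm q \<ge> 2" by (rule prime_nm_ge_2) fact+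
        have "nm q ^ 1 \<le> nm q ^ k" using q n2 by (intro power_increasing) auto
        then have "nm q ^ 1 \<le> x" using q(4) by (rule order_trans)
        then have 1: "nm q \<le> x" by (simp only: power_one_right)
        have "real k < 2 ^ k" by (metis of_nat_less_two_power)
        also have "(2::real) ^ k \<le> nm q ^ k" using n2 by (intro power_mono) auto
        finally have "real k < x" using q by linarith
        then have "k \<le> N" unfolding N_def by linarith
        then show "i \<in> prims x \<times> {2..N}" using ik q 1 by simp
      qed
      have "sum pw X = (\<Sum>i\<in>X. if prime (fst i) then pw i else 0)"
        by (intro sum.cong refl) (auto simp: X_def ppow_def)
      also have "\<dots> \<le> (\<Sum>i\<in>prims x \<times> {2..N}. if prime (fst i) then pw i else 0)"
        using sub prime_nm_ge_2 prim_power nm_ge_1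
        by (intro sum_mono2) (auto simp: finite_prims pw_def intro!: divide_nonneg_nonneg)
      also have "\<dots> = (\<Sum>q\<in>prims x. \<Sum>k\<in>{2..N}. if prime q then pw (q, k) else 0)"
        unfolding sum.cartesian_product by (intro sum.cong refl) auto
      also have "\<dots> \<le> (\<Sum>q\<in>prims x. 8 * nm q powr (-(7/4)))"
      proof (rule sum_mono)
        fix q assume q: "q \<in> prims x"
        show "(\<Sum>k\<in>{2..N}. if prime q then pw (q, k) else 0) \<le> 8 * nm q powr (-(7/4))"
        proof (cases "prime q")
          case True
          define t where "t = 1 / nm q"
          have n2: "nm q \<ge> 2" using True q prime_nm_ge_2 by blast
          have t: "0 < t" "t \<le> 1/2" using n2 by (auto simp: t_def field_simps)
          have l: "0 \<le> ln (nm q)" "ln (nm q) \<le> 4 * nm q powr (1/4)" using n2 ln_quarter[of "nm q"] by auto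
          have "(\<Sum>k\<in>{2..N}. if prime q then pw (q, k) else 0) = (\<Sum>k\<in>{2..N}. ln (nm q) * t ^ k)"
            using True by (simp add: pw_def t_def power_divide enorm_power)
          also have "\<dots> = ln (nm q) * (\<Sum>k\<in>{2..N}. t ^ k)" by (rule sum_distrib_left[symmetric])
          also have "(\<Sum>k\<in>{2..N}. t ^ k) = t ^ 2 * (\<Sum>k<N - 1. t ^ k)"
            unfolding sum_distrib_left
          proof (rule sum.reindex_bij_witness[of _ "\<lambda>k. k + 2" "\<lambda>k. k - 2"])
            fix k assume "k \<in> {2..N}"
            then have "2 + (k - 2) = k" "k \<le> N" by auto
            then show "t ^ 2 * t ^ (k - 2) = t ^ k" "k - 2 + 2 = k" "k - 2 \<in> {..<N - 1}"
              by (simp_all only: power_add[symmetric]) (auto simp: N_def)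
          qed (auto simp: N_def)
          also have "(\<Sum>k<N - 1. t ^ k) \<le> 2"
          proof -
            have "(\<Sum>k<N - 1. t ^ k) = (1 - t ^ (N - 1)) / (1 - t)" using t by (intro sum_gp_strict[THEN trans]) auto
            also have "\<dots> \<le> 1 / (1/2)" using t by (intro frac_le) auto
            finally show ?thesis by simp
          qed
          then have "ln (nm q) * (t ^ 2 * (\<Sum>k<N - 1. t ^ k)) \<le> (4 * nm q powr (1/4)) * (t ^ 2 * 2)"
            using l t by (intro mult_mono mult_left_mono) (auto intro!: mult_nonneg_nonneg sum_nonneg)
          also have "t ^ 2 = nm q powr (-2)" using n2 by (simp add: t_def powr_minus_divide power_divide)
          also have "(4 * nm q powr (1/4)) * (nm q powr (-2) * 2) = 8 * (nm q powr (1/4) * nm q powr (-2))" by simp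
          also have "nm q powr (1/4) * nm q powr (-2) = nm q powr (-(7/4))" by (simp only: powr_add[symmetric]) simp
          finally show ?thesis by simp
        qed simp
      qed
      also have "\<dots> \<le> 8 * K" using K(2)[of x] by (simp add: sum_distrib_left[symmetric])
      finally show ?thesis .
    qed
    have Y: "sum pw Y \<le> 40"
    proof -
      have "\<exists>r::nat. prime r \<and> nm (fst i) = real r ^ 2 \<and> fst i dvd of_nat r" if "i \<in> Y" for i
        using that rational_prime_below[of "fst i"] by (force simp: Y_def ppow_def)
      then obtain R where R: "\<And>i. i \<in> Y \<Longrightarrow> prime (R i) \<and> nm (fst i) = real (R i) ^ 2 \<and> fst i dvd of_nat (R i)" by metis
      have assoc: "of_nat (R i) dvd fst i" if "i \<in> Y" for i
      proof -
        obtain u where u: "of_nat (R i) = fst i * u" using R[OF \<open>i \<in> Y\<close>] unfolding dvd_def by blast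
        have "nm (of_nat (R i)) = nm (fst i) * nm u" unfolding u by (rule nm_mult)
        moreover have "nm (of_nat (R i)) = nm (fst i)" using R[OF that] by simp
        ultimately have "nm (fst i) * nm u = nm (fst i) * 1" by simp
        moreover have "nm (fst i) \<noteq> 0" using R[OF that] prime_gt_0_nat[of "R i"] by simp
        ultimately have "nm u = 1" by (simp only: mult_cancel_left) blast
        then have "enorm u = 1" by simp
        then have "of_nat (R i) * econj u = fst i" unfolding u by (simp add: mult.assoc mult_econj)
        then show ?thesis by (metis dvd_triv_left)
      qed
      \<comment> \<open>Each such prime is associated to the rational prime \<open>R i\<close>, so
        \<open>R\<close> determines it and the sum can be taken over rational integers.\<close>
      have inj: "inj_on R Y"
      proof (rule inj_onI)
        fix i j assume ij: "i \<in> Y" "j \<in> Y" "R i = R j"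
        have "fst i dvd of_nat (R i)" using R ij by blast
        also have "of_nat (R i) dvd fst j" using assoc[OF ij(2)] ij(3) by simp
        finally have "fst i dvd fst j" .
        then have "fst i = fst j" using ij by (intro prim_primes_eqI) (auto simp: Y_def ppow_def)
        then show "i = j" using ij by (auto simp: Y_def prod_eq_iff)
      qed
      define N where "N = Max (insert 1 (R ` Y))"
      have RN: "R i \<in> {1..N}" if "i \<in> Y" for i
        using that fin(2) R[OF that] prime_gt_0_nat[of "R i"] unfolding N_def by (auto intro!: Max_ge)
      have "sum pw Y \<le> (\<Sum>i\<in>Y. 8 * real (R i) powr (-5/4))"
      proof (rule sum_mono)
        fix i assume i: "i \<in> Y"
        have r2: "real (R i) \<ge> 1" using R[OF i] prime_gt_0_nat[of "R i"] by simp
        have "pw i = ln (real (R i) ^ 2) / real (R i) ^ 2" using i R[OF i] by (simp add: pw_def Y_def)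
        also have "\<dots> = 2 * ln (real (R i)) * real (R i) powr (-2)" using r2 by (simp add: ln_realpow powr_minus_divide)
        also have "\<dots> \<le> 2 * (4 * real (R i) powr (1/4)) * real (R i) powr (-2)"
          using ln_quarter[OF r2] by (intro mult_right_mono mult_left_mono) auto
        also have "\<dots> = 8 * (real (R i) powr (1/4) * real (R i) powr (-2))" by simp
        also have "real (R i) powr (1/4) * real (R i) powr (-2) = real (R i) powr (-7/4)" by (simp only: powr_add[symmetric]) simp
        also have "8 * real (R i) powr (-7/4) \<le> 8 * real (R i) powr (-5/4)" using r2 by (intro mult_left_mono powr_mono) auto
        finally show "pw i \<le> 8 * real (R i) powr (-5/4)" .
      qed
      also have "\<dots> = (\<Sum>r\<in>R ` Y. 8 * real r powr (-5/4))" using inj by (simp add: sum.reindex)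
      also have "\<dots> \<le> (\<Sum>r\<in>{1..N}. 8 * real r powr (-5/4))" using RN by (intro sum_mono2) auto
      also have "\<dots> \<le> 40" using quarter_sum[of N] by (simp add: sum_distrib_left[symmetric])
      finally show ?thesis .
    qed
    show ?thesis unfolding un(1) using X Y fin un(2) by (simp add: sum.union_disjoint)
  qed
  then show ?thesis by blast
qed

text \<open>With \<open>z = e^(i t)\<close> this reads
  \<open>1 + cos (6 t) + 18 cos t \<le> 36 max 0 (cos t)\<close>, and \<open>1 + cos (6 t) = 2 cos (3 t)^2\<close>.\<close>

lemma trig_majorant:
  assumes "norm z = 1"
  shows "1 + Re (z ^ 6) + 18 * Re z \<le> 36 * max 0 (Re z)" "-18 \<le> 1 + Re (z ^ 6) + 18 * Re z"
proof -
  define x y where "x = Re z" and "y = Im z"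
  have xy: "x ^ 2 + y ^ 2 = 1" using assms unfolding x_def y_def by (metis cmod_power2 power_one)
  then have y2: "y * y = 1 - x * x" by (simp add: power2_eq_square)
  have z3: "Re (z ^ 3) = x * (4 * x ^ 2 - 3)"
  proof -
    have "Re (z ^ 3) = x * x * x - 3 * x * (y * y)"
      by (simp add: power3_eq_cube x_def y_def algebra_simps)
    then show ?thesis unfolding y2 by (simp add: power2_eq_square algebra_simps)
  qed
  have n3: "norm (z ^ 3) = 1" using assms by (simp add: norm_power)
  have "Re (z ^ 3) ^ 2 + Im (z ^ 3) ^ 2 = 1" using n3 by (metis cmod_power2 power_one)
  moreover have "Re ((z ^ 3) ^ 2) = Re (z ^ 3) ^ 2 - Im (z ^ 3) ^ 2" by (rule Re_power2)
  moreover have "(z ^ 3) ^ 2 = z ^ 6" by (simp add: power_mult[symmetric])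
  ultimately have z6: "1 + Re (z ^ 6) = 2 * (x * (4 * x ^ 2 - 3)) ^ 2" unfolding z3 by simp
  have x1: "x ^ 2 \<le> 1" using xy zero_le_power2[of y] by linarith
  have xa: "\<bar>x\<bar> \<le> 1" using x1 by (simp add: abs_square_le_1)
  have "\<bar>4 * x ^ 2 - 3\<bar> \<le> 3" using x1 zero_le_power2[of x] by linarith
  then have "(4 * x ^ 2 - 3) ^ 2 \<le> 3 ^ 2" by (metis abs_le_square_iff abs_numeral)
  then have "x ^ 2 * (4 * x ^ 2 - 3) ^ 2 \<le> x ^ 2 * 9" by (intro mult_left_mono) auto
  then have "(x * (4 * x ^ 2 - 3)) ^ 2 \<le> 9 * x ^ 2" by (simp add: power_mult_distrib)
  moreover have "\<bar>x\<bar> * \<bar>x\<bar> \<le> \<bar>x\<bar>" using xa by (intro mult_left_le) auto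
  then have "x ^ 2 \<le> \<bar>x\<bar>" by (simp add: power2_eq_square)
  \<comment> \<open>Adding \<open>18 * x\<close> doubles the right side for \<open>x \<ge> 0\<close>
    and cancels it for \<open>x < 0\<close>; this fixes the weight 18 of
    \<open>Re z\<close>.\<close>
  ultimately have "1 + Re (z ^ 6) \<le> 18 * \<bar>x\<bar>" unfolding z6 by linarith
  then show "1 + Re (z ^ 6) + 18 * Re z \<le> 36 * max 0 (Re z)" unfolding x_def[symmetric] by (auto simp: max_def)
  have "1 + Re (z ^ 6) \<ge> 0" unfolding z6 by simp
  then show "-18 \<le> 1 + Re (z ^ 6) + 18 * Re z" using xa unfolding x_def[symmetric] by linarith
qed

section \<open>Local densities at primary primes\<close>

text \<open>The count \<open>nsol\<close> stated without a cubic character, in the form in which the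
  lattice point argument uses it.\<close>

definition msol :: "nat \<Rightarrow> nat \<Rightarrow> nat \<Rightarrow> nat \<Rightarrow> int \<Rightarrow> nat" where
  "msol p a1 a2 a3 m = card {(x, y, z). x \<in> {0..<int p} \<and> y \<in> {0..<int p} \<and> z \<in> {0..<int p} \<and>
     [int a1 * x ^ 3 + int a2 * y ^ 3 + int a3 * z ^ 3 = m] (mod int p)}"

text \<open>Write \<open>q = - J\<close> for a suitable character; \<open>csym_J\<close> identifies
  its value at \<open>a1 * a2 * a3\<close> with \<open>csym\<close>. The minus sign in
  \<open>- J\<close> becomes the minus sign before the bias.\<close>

lemma msol_prime:
  assumes q: "prim q" "enorm q = int p" "prime p" and a: "a1 > 0" "a2 > 0" "a3 > 0"
    and np: "\<not> p dvd a1" "\<not> p dvd a2" "\<not> p dvd a3"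
  shows "int p dvd m \<Longrightarrow> real (msol p a1 a2 a3 m) = real p ^ 2 - (real p - 1) * (2 * sqrt (real p) * Re (tw (a1 * a2 * a3) 1 1 q))"
    "\<not> int p dvd m \<Longrightarrow> real (msol p a1 a2 a3 m) \<le> real p ^ 2 + 8 * real p"
proof -
  define a where "a = a1 * a2 * a3"
  have pr: "prime (enorm q)" using q by simp
  obtain chi where chi: "cubic_char (int p) chi" "q = - cubic_char.J (int p) chi"
    using prim_prime_is_J[OF q(1) pr] unfolding q(2) by blast
  interpret cubic_char "int p" chi by (rule chi(1))
  have nd: "\<not> int p dvd int a1" "\<not> int p dvd int a2" "\<not> int p dvd int a3" using np by simp_all
  have ms: "msol p a1 a2 a3 m = nsol (int a1) (int a2) (int a3) m" for m
    by (simp add: msol_def nsol_def)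
  show "real (msol p a1 a2 a3 m) \<le> real p ^ 2 + 8 * real p" if "\<not> int p dvd m"
    using nsol_le[OF nd that] by (simp add: ms)
  have "\<not> p dvd a" using np q(3) by (simp add: a_def prime_dvd_mult_iff)
  then have "\<not> int p dvd int a" by simp
  moreover have "a > 0" using a by (simp add: a_def)
  ultimately have cs: "csym a q = chi (int a)" unfolding chi(2) by (rule csym_J)
  have tq: "toc q = of_real (sqrt (real p)) * sgn (toc q)"
  proof -
    have "toc q = of_real (norm (toc q)) * sgn (toc q)"
      using prim_nonzero[OF q(1)] by (simp add: sgn_eq)
    then show ?thesis by (simp add: norm_toc q(2))
  qed
  have "toc (bar (int a1 * int a2 * int a3) * J) = cnj (toc (csym a q)) * (- toc q)"
    unfolding cs bar_def by (simp add: chi(2) a_def)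
  also have "\<dots> = - of_real (sqrt (real p)) * tw a 1 1 q"
    by (subst tq) (simp add: tw_def)
  finally have "Re (toc (bar (int a1 * int a2 * int a3) * J)) = - sqrt (real p) * Re (tw a 1 1 q)"
    by simp
  then show "real (msol p a1 a2 a3 m) = real p ^ 2 - (real p - 1) * (2 * sqrt (real p) * Re (tw (a1 * a2 * a3) 1 1 q))"
    if "int p dvd m"
    using nsol_0[OF nd that] by (simp add: ms a_def)
qed

text \<open>A prime of norm \<open>p\<close> divides \<open>q * econj q\<close>, and the conjugate
  of a primary element is primary; so only \<open>q\<close> and \<open>econj q\<close>
  remain.\<close>

lemma card_primes_above:
  assumes "prime (p::nat)"
  shows "card {q. prim q \<and> prime q \<and> enorm q = int p} \<le> 2"
proof (cases "{q. prim q \<and> prime q \<and> enorm q = int p} = {}")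
  case True
  show ?thesis unfolding True by simp
next
  case False
  then obtain q where q: "prim q" "prime q" "enorm q = int p" by blast
  have pc: "prim (econj q)"
  proof -
    have "q - econj q = of_int (eo q) * (1 + 2 * omega)" by (simp add: eis_eq_iff eis_sel_mult)
    moreover have "3 dvd eo q" using q(1) by (simp add: prim_def dvd_eq_mod_eq_0)
    then obtain t where "eo q = 3 * t" unfolding dvd_def by blast
    ultimately have "q - econj q = 3 * (of_int t * (1 + 2 * omega))" by (simp add: mult.assoc)
    then have "3 dvd q - econj q" by simp
    then show ?thesis using prim_cong q(1) by blast
  qed
  have "{q. prim q \<and> prime q \<and> enorm q = int p} \<subseteq> {q, econj q}"
  proof
    fix r assume "r \<in> {q. prim q \<and> prime q \<and> enorm q = int p}"
    then have r: "prim r" "prime r" "enorm r = int p" by auto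
    have "r dvd q * econj q" using mult_econj[of r] r(3) q(3) mult_econj[of q] by (metis dvd_triv_left)
    then have "r dvd q \<or> r dvd econj q" using r(2) prime_dvd_mult_iff by blast
    then show "r \<in> {q, econj q}"
    proof
      assume "r dvd q"
      then show ?thesis using prim_primes_eqI[OF r(2) q(2)] by simp
    next
      assume "r dvd econj q"
      then obtain u where u: "econj q = r * u" unfolding dvd_def by blast
      have "enorm (econj q) = enorm r * enorm u" unfolding u by (rule enorm_mult)
      then have "enorm u = 1" using r(3) q(3) assms prime_gt_0_nat by simp
      moreover have "prim u" using prim_cancel[OF r(1)] pc u by simp
      ultimately have "u = 1" by (intro prim_unit)
      then show ?thesis using u by simp
    qed
  qed
  then have "card {q. prim q \<and> prime q \<and> enorm q = int p} \<le> card {q, econj q}" by (intro card_mono) auto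
  also have "\<dots> \<le> 2" by (simp add: card_insert_if)
  finally show ?thesis .
qed

section \<open>The window of biased primes\<close>

text \<open>The weights \<open>g i\<close> are 1 plus two characters with bounded Mertens sums, so
  over a long window \<open>pw i * g i\<close> sums to at least 1 on primes of degree one. The
  constant is \<open>144 = 36 * 2 * 2\<close>: the majorant, the two primes above each
  \<open>p\<close>, and \<open>ln p \<le> 2 * ln y\<close>.\<close>

theorem prime_window:
  assumes a: "a1 > 0" "a2 > 0" "a3 > (0::nat)"
  shows "\<exists>Cw>1. \<exists>y0\<ge>1. \<forall>y\<ge>y0. \<exists>P \<delta>. finite P \<and>
    (\<forall>p\<in>P. prime (p::nat) \<and> y < real p \<and> real p \<le> Cw * y \<and> 0 \<le> \<delta> p \<and> \<delta> p \<le> (1::real) \<and>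
      (\<forall>m. int p dvd m \<longrightarrow> real (msol p a1 a2 a3 m) \<le> real p ^ 2 * (1 - \<delta> p)) \<and>
      (\<forall>m. \<not> int p dvd m \<longrightarrow> real (msol p a1 a2 a3 m) \<le> real p ^ 2 + 8 * real p)) \<and>
    sqrt y / (144 * ln y) \<le> sum \<delta> P"
proof -
  define a where "a = a1 * a2 * a3"
  have a0: "a > 0" using a by (simp add: a_def)
  define psi where "psi = tw a 1 1"
  define xi where "xi = tw a 0 6"
  obtain C1 C2 C3 C4 where tws: "twist psi 0 C1" "twist (\<lambda>x. psi x ^ 2) 0 C2" "twist xi 0 C3" "twist (\<lambda>x. xi x ^ 2) 0 C4"
    using twist_tw[OF a0, of 1 1] twist_tw[OF a0, of 2 2] twist_tw[OF a0, of 6 0] twist_tw[OF a0, of 12 0]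
    unfolding psi_def xi_def tw_sq by auto
  obtain B1 where B1: "\<And>x. x \<ge> 1 \<Longrightarrow> norm (\<Sum>i\<in>ppow x. of_real (pw i) * psi (pe i)) \<le> B1"
    using twisted_mertens_bounded[OF tws(1,2)] by blast
  obtain B2 where B2: "\<And>x. x \<ge> 1 \<Longrightarrow> norm (\<Sum>i\<in>ppow x. of_real (pw i) * xi (pe i)) \<le> B2"
    using twisted_mertens_bounded[OF tws(3,4)] by blast
  obtain B0 where B0: "\<And>x. x \<ge> 1 \<Longrightarrow> \<bar>(\<Sum>i\<in>ppow x. pw i) - ln x\<bar> \<le> B0" using mertens_ppow by blast
  obtain D where D: "\<And>x. (\<Sum>i | i \<in> ppow x \<and> \<not> deg1 i. pw i) \<le> D" using not_deg1_bounded by blast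
  have D0: "D \<ge> 0"
    using D[of 0] sum_nonneg[of "{i. i \<in> ppow 0 \<and> \<not> deg1 i}" pw] pw_nonneg by fastforce
  define g where "g i = 1 + Re (xi (pe i)) + 18 * Re (psi (pe i))" for i
  define V where "V x = (\<Sum>i\<in>ppow x. pw i * g i)" for x
  define B where "B = B0 + B2 + 18 * B1"
  have V: "\<bar>V x - ln x\<bar> \<le> B" if "x \<ge> 1" for x
  proof -
    have "V x = (\<Sum>i\<in>ppow x. pw i) + Re (\<Sum>i\<in>ppow x. of_real (pw i) * xi (pe i)) + 18 * Re (\<Sum>i\<in>ppow x. of_real (pw i) * psi (pe i))"
      unfolding V_def g_def Re_sum by (simp add: sum.distrib[symmetric] sum_distrib_left algebra_simps)
    moreover have "\<bar>Re (\<Sum>i\<in>ppow x. of_real (pw i) * xi (pe i))\<bar> \<le> B2" using abs_Re_le_cmod B2[OF that] by (rule order_trans)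
    moreover have "\<bar>Re (\<Sum>i\<in>ppow x. of_real (pw i) * psi (pe i))\<bar> \<le> B1" using abs_Re_le_cmod B1[OF that] by (rule order_trans)
    ultimately show ?thesis using B0[OF that] unfolding B_def by linarith
  qed
  have B_pos: "B \<ge> 0" using V[of 1] by (metis abs_ge_zero order_trans order_refl)
  have g20: "\<bar>g i\<bar> \<le> 20" if "i \<in> ppow x" for i x
  proof -
    have "\<bar>Re (xi (pe i))\<bar> \<le> 1" "\<bar>Re (psi (pe i))\<bar> \<le> 1"
      using abs_Re_le_cmod order_trans twist.psi_le_1[OF tws(3) prim_pe[OF that]] twist.psi_le_1[OF tws(1) prim_pe[OF that]] by blast+
    then show ?thesis unfolding g_def by linarith
  qed
  \<comment> \<open>\<open>ln Cw\<close> pays for the error \<open>B\<close> at both ends of the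
    window and for the terms that are not of degree one, where \<open>g\<close> is at most
    \<open>1 + 1 + 18 = 20\<close>; 1 is left over.\<close>
  define Cw where "Cw = exp (2 * B + 20 * D + 1)"
  have Cw: "Cw > 1" using B_pos D0 by (simp add: Cw_def)
  \<comment> \<open>\<open>y > a\<close> keeps all primes of the window prime to the coefficients,
    and \<open>y \<ge> Cw\<close> gives \<open>ln (Cw * y) \<le> 2 * ln y\<close>.\<close>
  define y0 where "y0 = max (real a + 2) Cw"
  have y0: "y0 \<ge> 1" by (simp add: y0_def)
  have main: "\<exists>P \<delta>. finite P \<and>
    (\<forall>p\<in>P. prime (p::nat) \<and> y < real p \<and> real p \<le> Cw * y \<and> 0 \<le> \<delta> p \<and> \<delta> p \<le> (1::real) \<and>
      (\<forall>m. int p dvd m \<longrightarrow> real (msol p a1 a2 a3 m) \<le> real p ^ 2 * (1 - \<delta> p)) \<and>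
      (\<forall>m. \<not> int p dvd m \<longrightarrow> real (msol p a1 a2 a3 m) \<le> real p ^ 2 + 8 * real p)) \<and>
    sqrt y / (144 * ln y) \<le> sum \<delta> P" if y: "y \<ge> y0" for y
  proof -
    have ya: "y > real a" "y \<ge> 2" "y \<ge> Cw" using y by (auto simp: y0_def)
    have y1: "y \<ge> 1" "Cw * y \<ge> 1" "y \<le> Cw * y"
    proof -
      show "y \<ge> 1" using ya by simp
      have "1 * y \<le> Cw * y" using Cw ya by (intro mult_right_mono) auto
      then show "y \<le> Cw * y" "Cw * y \<ge> 1" using ya by linarith+
    qed
    define W where "W = ppow (Cw * y) - ppow y"
    have finW: "finite W" using finite_ppow by (simp add: W_def)
    have sub: "ppow y \<subseteq> ppow (Cw * y)" using y1(3) by (auto simp: ppow_def)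
    have "ln (Cw * y) - ln y = 2 * B + 20 * D + 1"
      using ya Cw by (simp add: ln_mult Cw_def)
    then have "20 * D + 1 \<le> V (Cw * y) - V y" using V[OF y1(1)] V[OF y1(2)] by linarith
    also have "V (Cw * y) - V y = (\<Sum>i\<in>W. pw i * g i)"
      unfolding V_def W_def using sum.subset_diff[OF sub finite_ppow, of "\<lambda>i. pw i * g i"] by simp
    also have "\<dots> = (\<Sum>i | i \<in> W \<and> deg1 i. pw i * g i) + (\<Sum>i | i \<in> W \<and> \<not> deg1 i. pw i * g i)"
    proof -
      have "W = {i. i \<in> W \<and> deg1 i} \<union> {i. i \<in> W \<and> \<not> deg1 i}" by blast
      then show ?thesis using finW by (subst sum.union_disjoint[symmetric]) auto
    qed
    also have "(\<Sum>i | i \<in> W \<and> \<not> deg1 i. pw i * g i) \<le> 20 * D"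
    proof -
      have "(\<Sum>i | i \<in> W \<and> \<not> deg1 i. pw i * g i) \<le> (\<Sum>i | i \<in> W \<and> \<not> deg1 i. pw i * 20)"
      proof (rule sum_mono)
        fix i assume "i \<in> {i. i \<in> W \<and> \<not> deg1 i}"
        then have i: "i \<in> ppow (Cw * y)" by (simp add: W_def)
        show "pw i * g i \<le> pw i * 20" using g20[OF i] pw_nonneg[OF i] by (intro mult_left_mono) auto
      qed
      also have "\<dots> \<le> (\<Sum>i | i \<in> ppow (Cw * y) \<and> \<not> deg1 i. pw i * 20)"
        using finite_ppow pw_nonneg by (intro sum_mono2) (auto simp: W_def)
      also have "\<dots> \<le> 20 * D" using D[of "Cw * y"] by (simp add: sum_distrib_right[symmetric])
      finally show ?thesis .
    qed
    finally have low: "1 \<le> (\<Sum>i | i \<in> W \<and> deg1 i. pw i * g i)" by linarith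
    define W1 where "W1 = {i. i \<in> W \<and> deg1 i}"
    have finW1: "finite W1" using finW by (simp add: W1_def)
    define np where "np i = nat (enorm (fst i))" for i :: "eis \<times> nat"
    \<comment> \<open>\<open>Re (psi q)\<close> expressed through the solution count, hence a
      function of \<open>p\<close> alone: both primes above \<open>p\<close> share this
      value.\<close>
    define rho where "rho p = (real p ^ 2 - real (msol p a1 a2 a3 0)) / ((real p - 1) * (2 * sqrt (real p)))" for p :: nat
    have W1: "prim (fst i)" "prime (fst i)" "prime (np i)" "enorm (fst i) = int (np i)" "snd i = 1" "y < real (np i)" "real (np i) \<le> Cw * y"
      "\<not> np i dvd a1" "\<not> np i dvd a2" "\<not> np i dvd a3" "pe i = fst i" "pw i = ln (real (np i)) / real (np i)"
      if "i \<in> W1" for i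
    proof -
      show 1: "prim (fst i)" "prime (fst i)" "snd i = 1" using that by (auto simp: W1_def W_def ppow_def deg1_def)
      have e: "enorm (fst i) \<ge> 0" by simp
      then show 2: "enorm (fst i) = int (np i)" by (simp add: np_def)
      have "prime (enorm (fst i))" using that by (simp add: W1_def deg1_def)
      then show "prime (np i)" unfolding 2 by simp
      show "y < real (np i)" "real (np i) \<le> Cw * y" using that 1 2 by (auto simp: W1_def W_def ppow_def)
      then have "np i > a" using ya by linarith
      then have nd: "\<not> np i dvd a" using a0 by (auto dest: dvd_imp_le)
      then show "\<not> np i dvd a1" "\<not> np i dvd a2" "\<not> np i dvd a3" by (auto simp: a_def)
      show "pe i = fst i" "pw i = ln (real (np i)) / real (np i)" using 1 2 by (simp_all add: pe_def pw_def)
    qed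
    have rho: "Re (psi (fst i)) = rho (np i)" if "i \<in> W1" for i
    proof -
      note w = W1[OF that]
      have "real (msol (np i) a1 a2 a3 0) = real (np i) ^ 2 - (real (np i) - 1) * (2 * sqrt (real (np i)) * Re (psi (fst i)))"
        unfolding psi_def a_def by (rule msol_prime(1)) (use w a in auto)
      moreover have "real (np i) > 1" using prime_gt_1_nat[OF w(3)] by simp
      ultimately show ?thesis by (simp add: rho_def)
    qed
    have norm1: "norm (psi (fst i)) = 1" "xi (fst i) = psi (fst i) ^ 6" if "i \<in> W1" for i
    proof -
      note w = W1[OF that]
      have "prime (enorm (fst i))" using w by simp
      then obtain chi where chi: "cubic_char (enorm (fst i)) chi" "fst i = - cubic_char.J (enorm (fst i)) chi"
        using prim_prime_is_J[OF w(1)] by blast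
      have nd: "\<not> enorm (fst i) dvd int a" using w by (simp add: a_def prime_dvd_mult_iff)
      have "csym a (fst i) = chi (int a)"
        using cubic_char.csym_J[OF chi(1) nd a0] chi(2) by simp
      then have c3: "csym a (fst i) ^ 3 = 1" using cubic_char.chi_cube[OF chi(1) nd] by simp
      then have "csym a (fst i) \<noteq> 0" by auto
      then have nc: "norm (toc (csym a (fst i))) = 1" using norm_csym[of a "fst i"] by auto
      show "norm (psi (fst i)) = 1"
        using nc norm_sgn_toc[OF prim_nonzero[OF w(1)]] by (simp add: psi_def tw_def norm_mult)
      have "cnj (toc (csym a (fst i))) ^ 6 = cnj (toc ((csym a (fst i) ^ 3) ^ 2))"
        by (simp add: power_mult[symmetric])
      then have "cnj (toc (csym a (fst i))) ^ 6 = 1" unfolding c3 by simp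
      then show "xi (fst i) = psi (fst i) ^ 6" by (simp add: psi_def xi_def tw_def power_mult_distrib)
    qed
    define P where "P = {p \<in> np ` W1. rho p > 0}"
    \<comment> \<open>Half of the leading bias \<open>2 * rho p / sqrt p\<close>; the other half
      absorbs the factor \<open>(p - 1) / p\<close>, which is at least 1/2.\<close>
    define \<delta> where "\<delta> p = rho p / sqrt (real p)" for p
    have finP: "finite P" using finW1 by (simp add: P_def)
    have "1 \<le> (\<Sum>i\<in>W1. pw i * g i)" using low by (simp add: W1_def)
    also have "\<dots> \<le> (\<Sum>i\<in>W1. 36 * (ln (real (np i)) / real (np i) * max 0 (rho (np i))))"
    proof (rule sum_mono)
      fix i assume i: "i \<in> W1"
      have "g i \<le> 36 * max 0 (Re (psi (fst i)))"
        unfolding g_def W1(11)[OF i] norm1(2)[OF i] by (rule trig_majorant(1)[OF norm1(1)[OF i]])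
      then have "g i \<le> 36 * max 0 (rho (np i))" unfolding rho[OF i] .
      moreover have "pw i \<ge> 0" using i pw_nonneg[of i "Cw * y"] by (simp add: W1_def W_def)
      ultimately have "pw i * g i \<le> pw i * (36 * max 0 (rho (np i)))" by (intro mult_left_mono)
      then show "pw i * g i \<le> 36 * (ln (real (np i)) / real (np i) * max 0 (rho (np i)))"
        unfolding W1(12)[OF i] by (simp add: mult_ac)
    qed
    also have "\<dots> = 36 * (\<Sum>i\<in>W1. ln (real (np i)) / real (np i) * max 0 (rho (np i)))" by (rule sum_distrib_left[symmetric])
    also have "(\<Sum>i\<in>W1. ln (real (np i)) / real (np i) * max 0 (rho (np i)))
      = (\<Sum>p\<in>np ` W1. \<Sum>i | i \<in> W1 \<and> np i = p. ln (real (np i)) / real (np i) * max 0 (rho (np i)))"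
      using finW1 by (intro sum.group[symmetric]) auto
    also have "\<dots> \<le> (\<Sum>p\<in>np ` W1. 2 * (ln (real p) / real p * max 0 (rho p)))"
    proof (rule sum_mono)
      fix p assume "p \<in> np ` W1"
      then obtain j where j: "j \<in> W1" "p = np j" by blast
      have pp: "prime p" using W1(3)[OF j(1)] j(2) by simp
      have p1: "real p > 1" using prime_gt_1_nat[OF pp] by simp
      have "(\<Sum>i | i \<in> W1 \<and> np i = p. ln (real (np i)) / real (np i) * max 0 (rho (np i)))
        = real (card {i. i \<in> W1 \<and> np i = p}) * (ln (real p) / real p * max 0 (rho p))" by simp
      also have "\<dots> \<le> 2 * (ln (real p) / real p * max 0 (rho p))"
      proof (rule mult_right_mono)
        have "card {i. i \<in> W1 \<and> np i = p} = card (fst ` {i. i \<in> W1 \<and> np i = p})"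
          using W1(5) by (intro card_image[symmetric] inj_onI) (auto simp: prod_eq_iff)
        also have "\<dots> \<le> card {q. prim q \<and> prime q \<and> enorm q = int p}"
        proof (rule card_mono)
          show "finite {q. prim q \<and> prime q \<and> enorm q = int p}" by (rule finite_subset[OF _ finite_enorm_le[of "int p"]]) auto
          show "fst ` {i. i \<in> W1 \<and> np i = p} \<subseteq> {q. prim q \<and> prime q \<and> enorm q = int p}" using W1 by auto
        qed
        also have "\<dots> \<le> 2" by (rule card_primes_above[OF pp])
        finally show "real (card {i. i \<in> W1 \<and> np i = p}) \<le> 2" by simp
      qed (use p1 in auto)
      finally show "(\<Sum>i | i \<in> W1 \<and> np i = p. ln (real (np i)) / real (np i) * max 0 (rho (np i))) \<le> 2 * (ln (real p) / real p * max 0 (rho p))" .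
    qed
    also have "\<dots> = (\<Sum>p\<in>P. 2 * (ln (real p) / real p * rho p))"
      using finW1 by (intro sum.mono_neutral_cong_right) (auto simp: P_def)
    also have "\<dots> \<le> (\<Sum>p\<in>P. 4 * ln y / sqrt y * \<delta> p)"
    proof (rule sum_mono)
      fix p assume p: "p \<in> P"
      then obtain j where j: "j \<in> W1" "p = np j" by (auto simp: P_def)
      have py: "y < real p" "real p \<le> Cw * y" using W1(6,7)[OF j(1)] j(2) by simp_all
      have r0: "rho p > 0" using p by (simp add: P_def)
      have "ln (real p) \<le> ln (Cw * y)" using py ya by simp
      also have "\<dots> = ln Cw + ln y" using Cw ya by (simp add: ln_mult)
      also have "\<dots> \<le> ln y + ln y" using Cw ya by simp
      finally have l: "ln (real p) \<le> 2 * ln y" by simp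
      have sp: "sqrt y \<le> sqrt (real p)" "sqrt y > 0" using py ya by auto
      have "2 * (ln (real p) / real p * rho p) = 2 * ln (real p) / sqrt (real p) * \<delta> p"
        using py ya by (simp add: \<delta>_def)
      also have "\<dots> \<le> 2 * (2 * ln y) / sqrt y * \<delta> p"
        using l sp r0 ya py by (intro mult_right_mono frac_le) (auto simp: \<delta>_def)
      finally show "2 * (ln (real p) / real p * rho p) \<le> 4 * ln y / sqrt y * \<delta> p" by simp
    qed
    also have "\<dots> = 4 * ln y / sqrt y * sum \<delta> P" by (rule sum_distrib_left[symmetric])
    finally have "1 \<le> 36 * (4 * ln y / sqrt y * sum \<delta> P)" by simp
    then have s: "sqrt y / (144 * ln y) \<le> sum \<delta> P"
      using ya by (simp add: field_simps)
    have "prime p \<and> y < real p \<and> real p \<le> Cw * y \<and> 0 \<le> \<delta> p \<and> \<delta> p \<le> 1 \<and>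
      (\<forall>m. int p dvd m \<longrightarrow> real (msol p a1 a2 a3 m) \<le> real p ^ 2 * (1 - \<delta> p)) \<and>
      (\<forall>m. \<not> int p dvd m \<longrightarrow> real (msol p a1 a2 a3 m) \<le> real p ^ 2 + 8 * real p)" if p: "p \<in> P" for p
    proof -
      obtain j where j: "j \<in> W1" "p = np j" using p by (auto simp: P_def)
      note w = W1[OF j(1), folded j(2)]
      have p2: "real p \<ge> 2" using prime_ge_2_nat[OF w(3)] by simp
      have sp: "sqrt (real p) \<ge> 1" "sqrt (real p) * sqrt (real p) = real p" using p2 by auto
      have r: "0 < rho p" using p by (simp add: P_def)
      have r1: "rho p \<le> 1" using rho[OF j(1)] abs_Re_le_cmod[of "psi (fst j)"] norm1(1)[OF j(1)] j(2) by simp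
      have "rho p \<le> sqrt (real p)" using r1 sp(1) by linarith
      then have "\<delta> p \<le> 1" unfolding \<delta>_def using p2 by (simp add: divide_le_eq_1)
      moreover have "0 \<le> \<delta> p" using r by (simp add: \<delta>_def)
      moreover have "real (msol p a1 a2 a3 m) \<le> real p ^ 2 * (1 - \<delta> p)" if "int p dvd m" for m
      proof -
        have "real (msol p a1 a2 a3 m) = real p ^ 2 - (real p - 1) * (2 * sqrt (real p) * rho p)"
          using msol_prime(1)[OF w(1) w(4) w(3) a w(8-10) that] rho[OF j(1)] j(2) by (simp add: psi_def a_def)
        also have "\<dots> \<le> real p ^ 2 - (real p / 2) * (2 * sqrt (real p) * rho p)"
          using p2 r by (intro diff_mono order_refl mult_right_mono) auto
        also have "\<dots> = real p ^ 2 * (1 - \<delta> p)"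
        proof -
          have "real p ^ 2 * \<delta> p = real p * (sqrt (real p) * sqrt (real p)) * (rho p / sqrt (real p))"
            unfolding sp(2) by (simp add: \<delta>_def power2_eq_square)
          also have "\<dots> = real p * sqrt (real p) * rho p"
          proof -
            have "A * (t * t) * (r / t) = A * t * r" if "t \<noteq> 0" for A t r :: real using that by simp
            note * = this
            show ?thesis by (rule *) (use p2 in simp)
          qed
          finally show ?thesis by (simp add: algebra_simps)
        qed
        finally show ?thesis .
      qed
      moreover have "real (msol p a1 a2 a3 m) \<le> real p ^ 2 + 8 * real p" if "\<not> int p dvd m" for m
        by (rule msol_prime(2)[OF w(1) w(4) w(3) a w(8-10) that])
      ultimately show ?thesis using w by blast
    qed
    then show ?thesis using finP s by blast
  qed
  then show ?thesis using Cw y0 by blast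
qed

section \<open>Gaps\<close>

lemma prod_primes_dvd:
  assumes "finite S" "\<And>p. p \<in> S \<Longrightarrow> prime (p::nat)" "\<And>p. p \<in> S \<Longrightarrow> p dvd n"
  shows "\<Prod>S dvd n"
  using assms
proof (induction S rule: finite_induct)
  case (insert p S)
  have "coprime p (\<Prod>S)"
  proof (rule prod_coprime_right)
    fix q assume "q \<in> S"
    then have "prime p" "prime q" "p \<noteq> q" using insert.hyps(2) insert.prems(1) by auto
    then show "coprime p q" by (rule primes_coprime)
  qed
  then show ?case using insert by (simp add: divides_mult)
qed simp

text \<open>Chebyshev's argument along powers of 2: the product of the primes above \<open>m\<close>
  and up to \<open>2 * m\<close> divides the central binomial coefficient, which is at most
  \<open>4 ^ m\<close>.\<close>

lemma prod_primes_dyadic: "\<Prod>{p::nat. prime p \<and> p \<le> 2 ^ k} \<le> 4 ^ (2 ^ k)"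
proof (induction k)
  case 0
  have "{p::nat. prime p \<and> p \<le> 2 ^ 0} = {}" by (auto dest: prime_ge_2_nat)
  then have "\<Prod>{p::nat. prime p \<and> p \<le> 2 ^ 0} = 1" by (simp only: prod.empty)
  then show ?case by simp
next
  case (Suc k)
  define m :: nat where "m = 2 ^ k"
  define S where "S = {p::nat. prime p \<and> m < p \<and> p \<le> 2 * m}"
  have fin: "finite S" unfolding S_def by simp
  have dv: "p dvd (2 * m choose m)" if "p \<in> S" for p
  proof -
    have p: "prime p" "m < p" "p \<le> 2 * m" using that by (auto simp: S_def)
    have "p dvd fact (2 * m)" using p by (simp add: prime_dvd_fact_iff)
    also have "fact (2 * m) = fact m * fact m * (2 * m choose m)"
      using binomial_fact_lemma[of m "2 * m"] by (simp add: mult_2)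
    finally have "p dvd fact m * fact m * (2 * m choose m)" .
    moreover have "\<not> p dvd fact m" using p by (simp add: prime_dvd_fact_iff)
    ultimately show ?thesis using p(1) prime_dvd_mult_iff by blast
  qed
  have "\<Prod>S dvd (2 * m choose m)" using fin dv by (intro prod_primes_dvd) (auto simp: S_def)
  then have "\<Prod>S \<le> (2 * m choose m)" by (intro dvd_imp_le) auto
  also have "\<dots> \<le> 2 ^ (2 * m)" by (rule binomial_le_pow2)
  also have "\<dots> = 4 ^ m" by (simp add: power_mult)
  finally have S: "\<Prod>S \<le> 4 ^ m" .
  have "{p::nat. prime p \<and> p \<le> 2 ^ Suc k} = {p. prime p \<and> p \<le> 2 ^ k} \<union> S" by (auto simp: S_def m_def)
  moreover have "{p. prime p \<and> p \<le> 2 ^ k} \<inter> S = {}" by (auto simp: S_def m_def)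
  ultimately have "\<Prod>{p::nat. prime p \<and> p \<le> 2 ^ Suc k} = \<Prod>{p. prime p \<and> p \<le> 2 ^ k} * \<Prod>S"
    using fin by (simp add: prod.union_disjoint)
  also have "\<dots> \<le> 4 ^ m * 4 ^ m" using Suc.IH S by (intro mult_mono) (auto simp: m_def)
  also have "\<dots> = 4 ^ (2 ^ Suc k)" by (simp add: power_add[symmetric] m_def mult_2)
  finally show ?case .
qed

text \<open>With a power of 2 such that \<open>m \<le> x \<le> 2 * m\<close>, the dyadic bound is
  \<open>16 ^ m\<close>, and \<open>16 \<le> (13/8) ^ 6 \<le> exp 3\<close>.\<close>

lemma prod_primes_le:
  assumes "finite P" "\<And>p. p \<in> P \<Longrightarrow> prime (p::nat) \<and> real p \<le> x" "x \<ge> 1"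
  shows "real (\<Prod>P) \<le> exp (3 * x)"
proof -
  define j where "j = nat \<lfloor>log 2 x\<rfloor>"
  have lx: "log 2 x \<ge> 0" using assms by simp
  have j: "real j \<le> log 2 x" "log 2 x < real (Suc j)" using lx unfolding j_def by linarith+
  have xj: "2 ^ j \<le> x" "x \<le> 2 ^ Suc j"
  proof -
    have "2 powr real j \<le> 2 powr (log 2 x)" "2 powr (log 2 x) \<le> 2 powr real (Suc j)" using j by (intro powr_mono; simp)+
    then show "2 ^ j \<le> x" "x \<le> 2 ^ Suc j" using assms(3) by (simp_all add: powr_realpow del: of_nat_Suc)
  qed
  define m :: nat where "m = 2 ^ j"
  have m: "real m \<le> x" "x \<le> real (2 * m)" using xj by (simp_all add: m_def)
  have "P \<subseteq> {p. prime p \<and> p \<le> 2 ^ Suc j}"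
  proof
    fix p assume "p \<in> P"
    then have "prime p" "real p \<le> real (2 * m)" using assms(2) m(2) order_trans by blast+
    then show "p \<in> {p. prime p \<and> p \<le> 2 ^ Suc j}" unfolding of_nat_le_iff by (simp add: m_def)
  qed
  then have "\<Prod>P dvd \<Prod>{p. prime p \<and> p \<le> 2 ^ Suc j}" by (intro prod_dvd_prod_subset) auto
  moreover have "\<Prod>{p::nat. prime p \<and> p \<le> 2 ^ Suc j} > 0" by (intro prod_pos) (auto simp: prime_gt_0_nat)
  ultimately have "\<Prod>P \<le> \<Prod>{p. prime p \<and> p \<le> 2 ^ Suc j}" by (intro dvd_imp_le)
  also have "\<dots> \<le> 4 ^ (2 ^ Suc j)" by (rule prod_primes_dyadic)
  also have "\<dots> = 16 ^ m" by (simp add: m_def power_mult)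
  finally have "real (\<Prod>P) \<le> real (16 ^ m)" by (simp only: of_nat_le_iff)
  also have "\<dots> = 16 ^ m" by simp
  also have "\<dots> \<le> exp 3 ^ m"
  proof (intro power_mono)
    have "1 + 1 / 2 + (1 / 2) ^ 2 / 2 \<le> exp (1 / 2 :: real)" by (rule exp_lower_Taylor_quadratic) simp
    then have "(13 / 8 :: real) \<le> exp (1 / 2)" by (simp add: power2_eq_square)
    then have "(13 / 8 :: real) ^ 6 \<le> exp (1 / 2) ^ 6" by (intro power_mono) auto
    also have "exp (1 / 2 :: real) ^ 6 = exp 3" by (simp add: exp_of_nat_mult[symmetric])
    finally show "(16 :: real) \<le> exp 3" by (simp add: power_divide)
  qed simp
  also have "\<dots> = exp (3 * real m)" by (simp add: exp_of_nat_mult[symmetric] mult.commute)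
  also have "\<dots> \<le> exp (3 * x)" using m by simp
  finally show ?thesis .
qed

section \<open>Grouping the primes\<close>

text \<open>The first partial sum that reaches \<open>T\<close> overshoots by at most one weight,
  and weights are at most 1.\<close>

lemma subset_sum_between:
  fixes \<delta> :: "'a \<Rightarrow> real"
  assumes "finite P" "\<And>p. p \<in> P \<Longrightarrow> 0 \<le> \<delta> p \<and> \<delta> p \<le> 1" "T \<ge> 0" "sum \<delta> P \<ge> T"
  shows "\<exists>A\<subseteq>P. T \<le> sum \<delta> A \<and> sum \<delta> A \<le> T + 1"
  using assms
proof (induction P rule: finite_induct)
  case empty
  then show ?case by auto
next
  case (insert p P)
  show ?case
  proof (cases "sum \<delta> P \<ge> T")
    case True
    then obtain A where "A \<subseteq> P" "T \<le> sum \<delta> A" "sum \<delta> A \<le> T + 1" using insert by blast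
    then show ?thesis by blast
  next
    case False
    have "\<delta> p \<le> 1" using insert.prems(1) by simp
    then have "sum \<delta> (insert p P) \<le> T + 1" using False insert.hyps by simp
    then show ?thesis using insert by blast
  qed
qed

text \<open>Sets are split off one at a time, and each uses up at most \<open>T + 1\<close> of the
  total.\<close>

lemma partition_sums:
  fixes \<delta> :: "'a \<Rightarrow> real"
  assumes "finite P" "\<And>p. p \<in> P \<Longrightarrow> 0 \<le> \<delta> p \<and> \<delta> p \<le> 1" "T \<ge> 0" "sum \<delta> P \<ge> real K * (T + 1)"
  shows "\<exists>A. (\<forall>i<K. A i \<subseteq> P \<and> T \<le> sum \<delta> (A i)) \<and> (\<forall>i<K. \<forall>j<K. i \<noteq> j \<longrightarrow> A i \<inter> A j = {})"
  using assms
proof (induction K arbitrary: P)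
  case (Suc K)
  have "0 \<le> real K * (T + 1)" using Suc.prems by simp
  moreover have "real (Suc K) * (T + 1) = real K * (T + 1) + (T + 1)" by (simp add: algebra_simps)
  ultimately have "sum \<delta> P \<ge> T" using Suc.prems(4) by linarith
  then obtain X where X: "X \<subseteq> P" "T \<le> sum \<delta> X" "sum \<delta> X \<le> T + 1"
    using subset_sum_between[of P \<delta> T] Suc.prems by blast
  have "sum \<delta> (P - X) = sum \<delta> P - sum \<delta> X" using X(1) Suc.prems(1) by (simp add: sum_diff)
  then have "sum \<delta> (P - X) \<ge> real K * (T + 1)"
    using X(3) Suc.prems(4) \<open>real (Suc K) * (T + 1) = real K * (T + 1) + (T + 1)\<close> by linarith
  then obtain A where A: "\<And>i. i < K \<Longrightarrow> A i \<subseteq> P - X \<and> T \<le> sum \<delta> (A i)" "\<And>i j. i < K \<Longrightarrow> j < K \<Longrightarrow> i \<noteq> j \<Longrightarrow> A i \<inter> A j = {}"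
    using Suc.IH[of "P - X"] Suc.prems by (metis DiffD1 finite_Diff)
  define A' where "A' = A(K := X)"
  have "A' i \<subseteq> P \<and> T \<le> sum \<delta> (A' i)" if "i < Suc K" for i
    using that A(1)[of i] X by (auto simp: A'_def less_Suc_eq)
  moreover have "A' i \<inter> A' j = {}" if "i < Suc K" "j < Suc K" "i \<noteq> j" for i j
    using that A(1)[of i] A(1)[of j] A(2)[of i j] by (auto simp: A'_def less_Suc_eq)
  ultimately show ?case by blast
qed simp

section \<open>Counting lattice points\<close>

definition solQ :: "nat \<Rightarrow> nat \<Rightarrow> nat \<Rightarrow> nat \<Rightarrow> nat \<Rightarrow> (nat \<times> nat \<times> nat) set" where
  "solQ Q a1 a2 a3 s = {(x, y, z). x < Q \<and> y < Q \<and> z < Q \<and> [diag_cubic a1 a2 a3 x y z = s] (mod Q)}"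

lemma finite_solQ: "finite (solQ Q a1 a2 a3 s)"
  by (rule finite_subset[of _ "{..<Q} \<times> {..<Q} \<times> {..<Q}"]) (auto simp: solQ_def)

text \<open>By the Chinese remainder theorem, reduction modulo all primes of \<open>P\<close> is
  injective on triples below the product, and it maps solutions to solutions.\<close>

lemma card_solQ_le:
  assumes "finite P" "\<And>p. p \<in> P \<Longrightarrow> prime p"
  shows "card (solQ (\<Prod>P) a1 a2 a3 s) \<le> (\<Prod>p\<in>P. msol p a1 a2 a3 (int s))"
proof -
  define Q where "Q = \<Prod>P"
  define X where "X p = {(x, y, z). x \<in> {0..<int p} \<and> y \<in> {0..<int p} \<and> z \<in> {0..<int p} \<and>
     [int a1 * x ^ 3 + int a2 * y ^ 3 + int a3 * z ^ 3 = int s] (mod int p)}" for p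
  have finX: "finite (X p)" for p
    by (rule finite_subset[of _ "{0..<int p} \<times> {0..<int p} \<times> {0..<int p}"]) (auto simp: X_def)
  define g where "g w = (\<lambda>p\<in>P. (int (fst w mod p), int (fst (snd w) mod p), int (snd (snd w) mod p)))" for w :: "nat \<times> nat \<times> nat"
  have sub: "g ` solQ Q a1 a2 a3 s \<subseteq> Pi\<^sub>E P X"
  proof
    fix u assume "u \<in> g ` solQ Q a1 a2 a3 s"
    then obtain x y z where w: "[diag_cubic a1 a2 a3 x y z = s] (mod Q)" "u = g (x, y, z)"
      by (auto simp: solQ_def)
    have "(int (x mod p), int (y mod p), int (z mod p)) \<in> X p" if p: "p \<in> P" for p
    proof -
      have p0: "p > 0" using assms(2)[OF p] prime_gt_0_nat by blast
      have "p dvd Q" unfolding Q_def using assms(1) p by (intro dvd_prodI)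
      then have "[diag_cubic a1 a2 a3 x y z = s] (mod p)" using w(1) cong_dvd_modulus_nat by blast
      moreover have "[a1 * (x mod p) ^ 3 + a2 * (y mod p) ^ 3 + a3 * (z mod p) ^ 3 = a1 * x ^ 3 + a2 * y ^ 3 + a3 * z ^ 3] (mod p)"
        by (intro cong_add cong_mult cong_pow cong_refl) (simp_all add: unique_euclidean_semiring_class.cong_def)
      ultimately have "[a1 * (x mod p) ^ 3 + a2 * (y mod p) ^ 3 + a3 * (z mod p) ^ 3 = s] (mod p)"
        unfolding diag_cubic_def using cong_trans by blast
      then have "[int (a1 * (x mod p) ^ 3 + a2 * (y mod p) ^ 3 + a3 * (z mod p) ^ 3) = int s] (mod int p)"
        by (simp only: cong_int_iff)
      then have "[int a1 * int (x mod p) ^ 3 + int a2 * int (y mod p) ^ 3 + int a3 * int (z mod p) ^ 3 = int s] (mod int p)"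
        by (simp only: of_nat_add of_nat_mult of_nat_power)
      then show ?thesis unfolding X_def using p0 by auto
    qed
    then show "u \<in> Pi\<^sub>E P X" using w(2) by (simp add: g_def)
  qed
  have inj: "inj_on g (solQ Q a1 a2 a3 s)"
  proof (rule inj_onI)
    fix v w assume vw: "v \<in> solQ Q a1 a2 a3 s" "w \<in> solQ Q a1 a2 a3 s" "g v = g w"
    obtain x y z where v: "v = (x, y, z)" "x < Q" "y < Q" "z < Q" using vw(1) by (auto simp: solQ_def)
    obtain x' y' z' where w: "w = (x', y', z')" "x' < Q" "y' < Q" "z' < Q" using vw(2) by (auto simp: solQ_def)
    have e: "x mod p = x' mod p" "y mod p = y' mod p" "z mod p = z' mod p" if "p \<in> P" for p
      using fun_cong[OF vw(3), of p] that by (simp_all add: g_def v w)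
    have crt: "a = b" if "\<And>p. p \<in> P \<Longrightarrow> a mod p = b mod p" "a < Q" "b < Q" for a b
    proof -
      have "[a = b] (mod \<Prod>P)"
      proof (rule coprime_cong_prod_nat)
        fix i j assume "i \<in> P" "j \<in> P" "i \<noteq> j"
        then show "coprime i j" using assms(2) primes_coprime by blast
      qed (use that in \<open>simp add: unique_euclidean_semiring_class.cong_def\<close>)
      then show ?thesis using that by (simp add: Q_def unique_euclidean_semiring_class.cong_def)
    qed
    have "x = x'" by (rule crt) (use e v w in auto)
    moreover have "y = y'" by (rule crt) (use e v w in auto)
    moreover have "z = z'" by (rule crt) (use e v w in auto)
    ultimately show "v = w" using v w by simp
  qed
  have "card (solQ Q a1 a2 a3 s) = card (g ` solQ Q a1 a2 a3 s)" by (rule card_image[OF inj, symmetric])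
  also have "\<dots> \<le> card (Pi\<^sub>E P X)" by (intro card_mono sub finite_PiE assms(1) finX)
  also have "\<dots> = (\<Prod>p\<in>P. msol p a1 a2 a3 (int s))"
    unfolding card_PiE[OF assms(1)] msol_def X_def ..
  finally show ?thesis unfolding Q_def .
qed

text \<open>A box of side \<open>Q * u\<close> consists of \<open>u ^ 3\<close> translates of a
  complete residue system.\<close>

lemma card_box_le:
  assumes "Q > 0"
  shows "card {(x, y, z). x < Q * u \<and> y < Q * u \<and> z < Q * u \<and> [diag_cubic a1 a2 a3 x y z = s] (mod Q)}
    \<le> card (solQ Q a1 a2 a3 s) * u ^ 3"
proof -
  define X where "X = {(x, y, z). x < Q * u \<and> y < Q * u \<and> z < Q * u \<and> [diag_cubic a1 a2 a3 x y z = s] (mod Q)}"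
  define g where "g w = ((fst w mod Q, fst (snd w) mod Q, snd (snd w) mod Q), (fst w div Q, fst (snd w) div Q, snd (snd w) div Q))" for w :: "nat \<times> nat \<times> nat"
  have inj: "inj_on g X"
  proof (rule inj_onI)
    fix v w assume "g v = g w"
    then have "fst v = fst w" "fst (snd v) = fst (snd w)" "snd (snd v) = snd (snd w)"
      by (auto simp: g_def) (metis div_mult_mod_eq)+
    then show "v = w" by (simp add: prod_eq_iff)
  qed
  have "g ` X \<subseteq> solQ Q a1 a2 a3 s \<times> ({..<u} \<times> {..<u} \<times> {..<u})"
  proof
    fix t assume "t \<in> g ` X"
    then obtain x y z where w: "x < Q * u" "y < Q * u" "z < Q * u" "[diag_cubic a1 a2 a3 x y z = s] (mod Q)" "t = g (x, y, z)"
      by (auto simp: X_def)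
    have "[a1 * (x mod Q) ^ 3 + a2 * (y mod Q) ^ 3 + a3 * (z mod Q) ^ 3 = a1 * x ^ 3 + a2 * y ^ 3 + a3 * z ^ 3] (mod Q)"
      by (intro cong_add cong_mult cong_pow cong_refl) (simp_all add: unique_euclidean_semiring_class.cong_def)
    then have "[diag_cubic a1 a2 a3 (x mod Q) (y mod Q) (z mod Q) = s] (mod Q)"
      using w(4) cong_trans unfolding diag_cubic_def by blast
    then show "t \<in> solQ Q a1 a2 a3 s \<times> ({..<u} \<times> {..<u} \<times> {..<u})"
      using w assms by (auto simp: g_def solQ_def less_mult_imp_div_less mult.commute)
  qed
  then have "card (g ` X) \<le> card (solQ Q a1 a2 a3 s \<times> ({..<u} \<times> {..<u} \<times> {..<u}))"
    by (intro card_mono) (auto simp: finite_solQ)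
  also have "\<dots> = card (solQ Q a1 a2 a3 s) * u ^ 3" by (simp add: card_cartesian_product power3_eq_cube)
  finally have "card X \<le> card (solQ Q a1 a2 a3 s) * u ^ 3" by (simp only: card_image[OF inj])
  then show ?thesis unfolding X_def .
qed

text \<open>If every \<open>n < N div 2\<close> in the residue class of \<open>r\<close> modulo \<open>Q\<close> had a value among
  \<open>n + 1, \<dots>, n + K\<close>, then these values would come from too many lattice points of a box of volume
  at most \<open>8 N\<close>.\<close>

lemma gap_in_residue_class:
  fixes N K Q r :: nat and R :: real
  assumes a: "a1 > 0" "a2 > 0" "a3 > 0" and Q: "Q > 0" "Q ^ 3 \<le> N" "4 * Q < N" and r: "r < Q" and K: "2 * K < N" "K > 0"
    and R: "\<And>i. i \<in> {1..K} \<Longrightarrow> real (card (solQ Q a1 a2 a3 (r + i))) \<le> R"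
    and small: "real K * R * 32 \<le> real Q ^ 2"
  shows "\<exists>n. (\<forall>i\<in>{1..K}. n + i < N) \<and> is_gap (diag_cubic a1 a2 a3) n K"
proof (rule ccontr)
  assume no: "\<not> ?thesis"
  \<comment> \<open>The starting points \<open>r + Q * t\<close> with \<open>t < T\<close> lie below
    \<open>N / 2\<close>; as \<open>2 * K < N\<close>, adding at most \<open>K\<close> stays below
    \<open>N\<close>.\<close>
  define T where "T = N div (2 * Q)"
  have lt: "r + Q * t + i < N" if "t < T" "i \<in> {1..K}" for t i
  proof -
    have "r + Q * t < Q * (t + 1)" using r by simp
    also have "\<dots> \<le> Q * T" using that by (intro mult_le_mono2) simp
    finally have "2 * (r + Q * t) < 2 * Q * T" by simp
    also have "\<dots> \<le> N" unfolding T_def by simp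
    finally show ?thesis using K that by simp
  qed
  have "\<exists>i x y z. i \<in> {1..K} \<and> r + Q * t + i = diag_cubic a1 a2 a3 x y z" if "t < T" for t
    using no lt[OF that] unfolding is_gap_def is_value_of_def by blast
  then obtain I X Y Z where IX: "\<And>t. t < T \<Longrightarrow> I t \<in> {1..K} \<and> r + Q * t + I t = diag_cubic a1 a2 a3 (X t) (Y t) (Z t)" by metis
  \<comment> \<open>\<open>Q * u\<close> is the least multiple of \<open>Q\<close> whose cube
    reaches \<open>N\<close>. Since the coefficients are positive, a value below \<open>N\<close>
    has all its arguments below \<open>Q * u\<close>.\<close>
  define u where "u = (LEAST u. N \<le> (Q * u) ^ 3)"
  have "N \<le> (Q * N) ^ 3"
  proof -
    have "N ^ 1 \<le> N ^ 3" using Q by (intro power_increasing) auto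
    also have "\<dots> \<le> (Q * N) ^ 3" using Q by (intro power_mono) auto
    finally show ?thesis by simp
  qed
  then have u: "N \<le> (Q * u) ^ 3" unfolding u_def by (rule LeastI)
  have u2: "(Q * (u - 1)) ^ 3 < N"
  proof -
    have "u \<noteq> 0" using u Q by (intro notI) simp
    then have "\<not> N \<le> (Q * (u - 1)) ^ 3" using not_less_Least[of "u - 1" "\<lambda>u. N \<le> (Q * u) ^ 3", folded u_def] by simp
    then show ?thesis by (simp only: not_le)
  qed
  have "u \<noteq> 0" using u Q by (intro notI) simp
  \<comment> \<open>For \<open>u = 1\<close> this is \<open>Q ^ 3 \<le> N\<close>; otherwise
    \<open>u \<le> 2 * (u - 1)\<close>, and the cube for \<open>u - 1\<close> is below
    \<open>N\<close> by minimality.\<close>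
  have u3: "real Q ^ 3 * real u ^ 3 \<le> 8 * real N"
  proof (cases "u = 1")
    case True
    have "real (Q ^ 3) \<le> real N" using Q(2) by (simp only: of_nat_le_iff)
    then have "real Q ^ 3 \<le> real N" by simp
    then have "real Q ^ 3 \<le> 8 * real N" using of_nat_0_le_iff[of N, where ?'a = real] by linarith
    then show ?thesis using True by simp
  next
    case False
    then have "Q * u \<le> 2 * (Q * (u - 1))" using \<open>u \<noteq> 0\<close> by (cases u) auto
    then have "(Q * u) ^ 3 \<le> (2 * (Q * (u - 1))) ^ 3" by (intro power_mono) auto
    also have "\<dots> = 8 * (Q * (u - 1)) ^ 3" by (simp add: power_mult_distrib)
    also have "\<dots> \<le> 8 * N" using u2 by simp
    finally have "real ((Q * u) ^ 3) \<le> real (8 * N)" by (simp only: of_nat_le_iff)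
    then show ?thesis by (simp add: power_mult_distrib)
  qed
  define box where "box i = {(x, y, z). x < Q * u \<and> y < Q * u \<and> z < Q * u \<and> [diag_cubic a1 a2 a3 x y z = r + i] (mod Q)}" for i
  have finbox: "finite (box i)" for i
    by (rule finite_subset[of _ "{..<Q * u} \<times> {..<Q * u} \<times> {..<Q * u}"]) (auto simp: box_def)
  have inbox: "(X t, Y t, Z t) \<in> box (I t)" if t: "t < T" for t
  proof -
    have v: "diag_cubic a1 a2 a3 (X t) (Y t) (Z t) < (Q * u) ^ 3"
      using IX[OF t] lt[OF t, of "I t"] u by simp
    have "1 * X t ^ 3 \<le> a1 * X t ^ 3" "1 * Y t ^ 3 \<le> a2 * Y t ^ 3" "1 * Z t ^ 3 \<le> a3 * Z t ^ 3"
      using a by (intro mult_le_mono1; simp)+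
    then have "X t ^ 3 < (Q * u) ^ 3" "Y t ^ 3 < (Q * u) ^ 3" "Z t ^ 3 < (Q * u) ^ 3"
      using v unfolding diag_cubic_def by linarith+
    then have "X t < Q * u" "Y t < Q * u" "Z t < Q * u" by (auto dest: power_less_imp_less_base)
    moreover have "[diag_cubic a1 a2 a3 (X t) (Y t) (Z t) = r + I t] (mod Q)"
    proof -
      have "diag_cubic a1 a2 a3 (X t) (Y t) (Z t) = r + I t + Q * t" using IX[OF t] by simp
      then show ?thesis by (simp add: unique_euclidean_semiring_class.cong_def)
    qed
    ultimately show ?thesis by (simp add: box_def)
  qed
  have "inj_on (\<lambda>t. (I t, X t, Y t, Z t)) {..<T}"
  proof (rule inj_onI)
    fix s t assume st: "s \<in> {..<T}" "t \<in> {..<T}" "(I s, X s, Y s, Z s) = (I t, X t, Y t, Z t)"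
    then have "r + Q * s + I s = r + Q * t + I t" using IX[of s] IX[of t] by simp
    then show "s = t" using st Q by simp
  qed
  then have "T = card ((\<lambda>t. (I t, X t, Y t, Z t)) ` {..<T})" by (simp add: card_image)
  also have "\<dots> \<le> card (Sigma {1..K} box)"
    using inbox IX finbox by (intro card_mono) auto
  also have "\<dots> = (\<Sum>i\<in>{1..K}. card (box i))" using finbox by (intro card_SigmaI) auto
  finally have "real T \<le> (\<Sum>i\<in>{1..K}. real (card (box i)))" by (metis of_nat_le_iff of_nat_sum)
  also have "\<dots> \<le> (\<Sum>i\<in>{1..K}. R * real u ^ 3)"
  proof (rule sum_mono)
    fix i assume i: "i \<in> {1..K}"
    have "card (box i) \<le> card (solQ Q a1 a2 a3 (r + i)) * u ^ 3"
      unfolding box_def by (rule card_box_le[OF Q(1)])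
    then have "real (card (box i)) \<le> real (card (solQ Q a1 a2 a3 (r + i)) * u ^ 3)" by (simp only: of_nat_le_iff)
    also have "\<dots> = real (card (solQ Q a1 a2 a3 (r + i))) * real u ^ 3" by simp
    also have "\<dots> \<le> R * real u ^ 3" using R[OF i] by (intro mult_right_mono) auto
    finally show "real (card (box i)) \<le> R * real u ^ 3" .
  qed
  also have "\<dots> = real K * R * real u ^ 3" by simp
  finally have T1: "real T \<le> real K * R * real u ^ 3" .
  have q0: "real Q > 0" using Q by simp
  have "real T * 32 * real Q \<le> (real K * R * real u ^ 3) * 32 * real Q" using T1 by (intro mult_right_mono) auto
  also have "\<dots> = (real K * R * 32) * (real u ^ 3 * real Q)" by simp
  also have "\<dots> \<le> real Q ^ 2 * (real u ^ 3 * real Q)" using small by (intro mult_right_mono) auto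
  also have "\<dots> = real Q ^ 3 * real u ^ 3" by (simp add: power2_eq_square power3_eq_cube)
  also have "\<dots> \<le> 8 * real N" by (rule u3)
  finally have T2: "4 * (real T * real Q) \<le> real N" by (simp add: mult.commute)
  \<comment> \<open>\<open>T\<close> is rounded down, so \<open>N < 2 * Q * T + 2 * Q\<close>. With
    \<open>4 * T * Q \<le> N\<close> the right side is at most \<open>N / 2 + 2 * Q\<close>, which
    is below \<open>N\<close> because \<open>4 * Q < N\<close>.\<close>
  have "N < 2 * Q * (T + 1)" unfolding T_def using Q dividend_less_times_div[of "2 * Q" N] by simp
  then have "real N < real (2 * Q * (T + 1))" by (simp only: of_nat_less_iff)
  then have "real N < 2 * real Q * real T + 2 * real Q" by (simp add: algebra_simps)
  moreover have "4 * real Q < real N" using Q(3) by linarith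
  ultimately show False using T2 by (simp add: mult_ac)
qed

section \<open>Choice of the parameters\<close>

theorem theorem1p1:
  fixes a1 a2 a3 :: nat
  assumes "a1 > 0" and "a2 > 0" and "a3 > 0"
  shows "\<exists>\<kappa>::real. \<kappa> > 0 \<and>
    (\<forall>N K :: nat. real N > exp (exp 1) \<longrightarrow> K \<ge> 2 \<longrightarrow>
       real K < \<kappa> * (sqrt (ln (real N)) / (ln (ln (real N))) ^ 2) \<longrightarrow>
       (\<exists>n::nat. (\<forall>i\<in>{1..K}. n + i < N) \<and> is_gap (diag_cubic a1 a2 a3) n K))"
proof -
  obtain C y0 where C: "C > 1" "y0 \<ge> 1" and window: "\<And>y. y \<ge> y0 \<Longrightarrow> \<exists>P \<delta>. finite P \<and>
    (\<forall>p\<in>P. prime (p::nat) \<and> y < real p \<and> real p \<le> C * y \<and> 0 \<le> \<delta> p \<and> \<delta> p \<le> (1::real) \<and>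
      (\<forall>m. int p dvd m \<longrightarrow> real (msol p a1 a2 a3 m) \<le> real p ^ 2 * (1 - \<delta> p)) \<and>
      (\<forall>m. \<not> int p dvd m \<longrightarrow> real (msol p a1 a2 a3 m) \<le> real p ^ 2 + 8 * real p)) \<and>
    sqrt y / (144 * ln y) \<le> sum \<delta> P"
    using prime_window[OF assms] by blast
  \<comment> \<open>\<open>prod_primes_le\<close> gives \<open>Q \<le> exp (3 * C * y)\<close>; with
    \<open>y = L / D\<close> the cube is at most \<open>exp (L / 2)\<close>, the square root of
    \<open>N\<close>.\<close>
  define D where "D = 18 * C"
  \<comment> \<open>\<open>exp (8 * C)\<close> bounds the product of the factors
    \<open>1 + 8 / p\<close> over at most \<open>C * y\<close> primes above \<open>y\<close>; 32 is
    the constant in \<open>gap_in_residue_class\<close>.\<close>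
  define M where "M = 32 * exp (8 * C)"
  \<comment> \<open>The first bound provides \<open>K\<close> groups with sum at least
    \<open>T\<close>; the second admits no \<open>K \<ge> 2\<close> unless
    \<open>y \<ge> y0 + 20\<close>, so that small \<open>N\<close> are covered vacuously.\<close>
  define \<kappa> where "\<kappa> = min (1 / (144 * sqrt D * (ln M + 2))) (1 / sqrt (D * (y0 + 20)))"
  have D: "D > 1" using C by (simp add: D_def)
  have M1: "ln M \<ge> 0" using C by (simp add: M_def ln_mult)
  have \<kappa>: "\<kappa> > 0" "\<kappa> \<le> 1 / (144 * sqrt D * (ln M + 2))" "\<kappa> \<le> 1 / sqrt (D * (y0 + 20))"
    using D M1 C by (auto simp: \<kappa>_def)
  have "\<exists>n. (\<forall>i\<in>{1..K}. n + i < N) \<and> is_gap (diag_cubic a1 a2 a3) n K"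
    if N: "real N > exp (exp 1)" and K2: "K \<ge> 2" and KN: "real K < \<kappa> * (sqrt (ln (real N)) / (ln (ln (real N))) ^ 2)" for N K :: nat
  proof -
    define L where "L = ln (real N)"
    have N0: "real N > 0" using N exp_gt_zero less_trans by blast
    have Le: "L > exp 1" unfolding L_def using N N0 by (metis exp_gt_zero ln_exp ln_less_cancel_iff)
    have L0: "L > 0" using Le exp_gt_zero less_trans by blast
    have ll: "ln L > 1" using Le L0 by (metis exp_gt_zero ln_exp ln_less_cancel_iff)
    have expL: "exp L = real N" using N0 by (simp add: L_def)
    have K1: "real K < \<kappa> * (sqrt L / (ln L) ^ 2)" using KN by (simp add: L_def)
    have "sqrt L / (ln L) ^ 2 \<le> sqrt L / 1" using ll L0 by (intro frac_le) auto
    then have "\<kappa> * (sqrt L / (ln L) ^ 2) \<le> \<kappa> * sqrt L" using \<kappa>(1) by (intro mult_left_mono) auto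
    then have KL: "real K < \<kappa> * sqrt L" using K1 by linarith
    define y where "y = L / D"
    have sD: "sqrt (D * (y0 + 20)) \<ge> 1" using mult_mono[of 1 D 1 "y0 + 20"] D C by simp
    have Lb: "L \<ge> D * (y0 + 20)"
    proof -
      have "1 < \<kappa> * sqrt L" using KL K2 by linarith
      also have "\<dots> \<le> 1 / sqrt (D * (y0 + 20)) * sqrt L" using \<kappa>(3) L0 by (intro mult_right_mono) auto
      finally have "sqrt (D * (y0 + 20)) < sqrt L" using sD by (simp add: field_simps)
      then show ?thesis by simp
    qed
    have yb: "y \<ge> y0 + 20" using Lb D by (simp add: y_def field_simps)
    have "\<kappa> \<le> 1 / 1" using \<kappa>(3) sD by (meson frac_le order_refl order_trans zero_le_one zero_less_one)
    then have "\<kappa> * sqrt L \<le> 1 * sqrt L" using L0 by (intro mult_right_mono) auto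
    then have KsL: "real K < sqrt L" using KL by linarith
    obtain P \<delta> where W: "finite P \<and>
      (\<forall>p\<in>P. prime (p::nat) \<and> y < real p \<and> real p \<le> C * y \<and> 0 \<le> \<delta> p \<and> \<delta> p \<le> (1::real) \<and>
        (\<forall>m. int p dvd m \<longrightarrow> real (msol p a1 a2 a3 m) \<le> real p ^ 2 * (1 - \<delta> p)) \<and>
        (\<forall>m. \<not> int p dvd m \<longrightarrow> real (msol p a1 a2 a3 m) \<le> real p ^ 2 + 8 * real p)) \<and>
      sqrt y / (144 * ln y) \<le> sum \<delta> P"
      using window[of y] yb by fastforce
    have P: "finite P" "\<And>p. p \<in> P \<Longrightarrow> prime p" "\<And>p. p \<in> P \<Longrightarrow> y < real p" "\<And>p. p \<in> P \<Longrightarrow> real p \<le> C * y"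
        "\<And>p. p \<in> P \<Longrightarrow> 0 \<le> \<delta> p \<and> \<delta> p \<le> 1"
        "\<And>p m. p \<in> P \<Longrightarrow> int p dvd m \<Longrightarrow> real (msol p a1 a2 a3 m) \<le> real p ^ 2 * (1 - \<delta> p)"
        "\<And>p m. p \<in> P \<Longrightarrow> \<not> int p dvd m \<Longrightarrow> real (msol p a1 a2 a3 m) \<le> real p ^ 2 + 8 * real p"
        "sqrt y / (144 * ln y) \<le> sum \<delta> P"
      using W by blast+
    define T where "T = ln (M * real K)"
    have MK: "M * real K \<ge> 1" "M > 0"
    proof -
      have "exp (8 * C) \<ge> 1" using C by simp
      then have M1: "M \<ge> 1" unfolding M_def by linarith
      then show "M > 0" by simp
      show "M * real K \<ge> 1" using mult_mono[of 1 M 1 "real K"] M1 K2 by simp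
    qed
    have T0: "T \<ge> 0" using MK by (simp add: T_def)
    have total: "real K * (T + 1) \<le> sum \<delta> P"
    proof -
      \<comment> \<open>\<open>K < sqrt L\<close> turns the \<open>ln K\<close> inside
        \<open>T\<close> into a multiple of \<open>ln L\<close>. This is one of the two factors
        \<open>ln L\<close> in the bound for \<open>K\<close>; the other one comes from
        \<open>ln y\<close> in the window.\<close>
      have "ln (real K) \<le> ln (sqrt L)" using KsL K2 L0 by simp
      also have "\<dots> = ln L / 2" using L0 by (simp add: ln_sqrt)
      finally have "T + 1 \<le> ln L / 2 + ln M + 1" unfolding T_def using MK K2 by (simp add: ln_mult)
      also have "\<dots> \<le> (ln M + 2) * ln L"
        using ll M1 mult_left_mono[of 1 "ln L" "ln M"] by (simp add: algebra_simps)
      finally have T1: "T + 1 \<le> (ln M + 2) * ln L" .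
      have "real K * (T + 1) \<le> (\<kappa> * (sqrt L / (ln L) ^ 2)) * ((ln M + 2) * ln L)"
        using K1 T1 T0 \<kappa>(1) L0 by (intro mult_mono) auto
      also have "\<dots> = \<kappa> * ((ln M + 2) * sqrt L / ln L)" using ll by (simp add: power2_eq_square)
      also have "\<dots> \<le> 1 / (144 * sqrt D * (ln M + 2)) * ((ln M + 2) * sqrt L / ln L)"
        by (rule mult_right_mono[OF \<kappa>(2)], intro divide_nonneg_nonneg mult_nonneg_nonneg) (use M1 ll L0 in linarith, use L0 in simp, use ll in linarith)
      also have "\<dots> = sqrt y / (144 * ln L)" using M1 D by (simp add: y_def real_sqrt_divide)
      also have "\<dots> \<le> sqrt y / (144 * ln y)"
      proof -
        have "y \<le> L / 1" unfolding y_def using D L0 by (intro frac_le) auto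
        then have "ln y \<le> ln L" using yb C by simp
        moreover have "ln y > 0" using yb C by simp
        ultimately show ?thesis using yb C by (intro frac_le) auto
      qed
      also note P(8)
      finally show ?thesis .
    qed
    obtain A where A: "\<And>i. i < K \<Longrightarrow> A i \<subseteq> P \<and> T \<le> sum \<delta> (A i)" "\<And>i j. i < K \<Longrightarrow> j < K \<Longrightarrow> i \<noteq> j \<Longrightarrow> A i \<inter> A j = {}"
      using partition_sums[OF P(1,5) T0 total] by metis
    \<comment> \<open>\<open>col p\<close> is the shift for which \<open>r + col p\<close> is to be
      divisible by \<open>p\<close>: \<open>Suc i\<close> for the group \<open>A i\<close>, as
      shifts start at 1. Primes outside all groups get the default 1.\<close>
    define col where "col p = (if \<exists>i<K. p \<in> A i then Suc (SOME i. i < K \<and> p \<in> A i) else 1)" for p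
    have col: "col p = Suc i" if "i < K" "p \<in> A i" for p i
    proof -
      have "\<exists>i<K. p \<in> A i" using that by blast
      from someI_ex[OF this] have "(SOME i. i < K \<and> p \<in> A i) = i" using A(2)[of _ i] that by blast
      then show ?thesis using that by (auto simp: col_def)
    qed
    define Q where "Q = \<Prod>P"
    have Q0: "Q > 0" unfolding Q_def by (intro prod_pos) (auto simp: P(2) prime_gt_0_nat)
    \<comment> \<open>\<open>(p - 1) * col p\<close> represents \<open>- col p\<close> modulo
      \<open>p\<close> among the natural numbers.\<close>
    have "\<exists>r. \<forall>p\<in>P. [r = (p - 1) * col p] (mod p)"
      using P(1,2) by (intro chinese_remainder_nat) (auto intro: primes_coprime)
    then obtain r' where r': "\<And>p. p \<in> P \<Longrightarrow> [r' = (p - 1) * col p] (mod p)" by blast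
    define r where "r = r' mod Q"
    have rQ: "r < Q" using Q0 by (simp add: r_def)
    have rdiv: "p dvd r + Suc i" if "i < K" "p \<in> A i" for p i
    proof -
      have p: "p \<in> P" using A(1) that by blast
      have "p dvd Q" unfolding Q_def using P(1) p by (intro dvd_prodI)
      have "[r = r'] (mod Q)" by (simp add: r_def unique_euclidean_semiring_class.cong_def)
      then have "[r = r'] (mod p)" using \<open>p dvd Q\<close> cong_dvd_modulus_nat by blast
      then have "[r = (p - 1) * Suc i] (mod p)" using r'[OF p] col[OF that] cong_trans by metis
      then have "[r + Suc i = (p - 1) * Suc i + Suc i] (mod p)" by (intro cong_add cong_refl)
      also have "(p - 1) * Suc i + Suc i = p * Suc i"
        using prime_gt_0_nat[OF P(2)[OF p]] by (metis Suc_pred' add.commute mult_Suc Suc_diff_1)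
      finally show ?thesis by (simp add: cong_0_iff unique_euclidean_semiring_class.cong_def dvd_eq_mod_eq_0)
    qed
    have y0': "y > 0" using yb C by simp
    have cardP: "real (card P) \<le> C * y"
    proof -
      have "P \<subseteq> {1..nat \<lfloor>C * y\<rfloor>}"
      proof
        fix p assume p: "p \<in> P"
        then have "int p \<le> \<lfloor>C * y\<rfloor>" using P(4) by (simp add: le_floor_iff)
        moreover have "p \<ge> 1" using P(2)[OF p] prime_ge_1_nat by blast
        ultimately show "p \<in> {1..nat \<lfloor>C * y\<rfloor>}" by simp
      qed
      then have "card P \<le> nat \<lfloor>C * y\<rfloor>" using card_mono[of "{1..nat \<lfloor>C * y\<rfloor>}" P] by simp
      moreover have "C * y \<ge> 0" using C y0' by simp
      ultimately show ?thesis by linarith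
    qed
    have R: "real (card (solQ Q a1 a2 a3 (r + i))) \<le> real Q ^ 2 * exp (8 * C) / (M * real K)" if i: "i \<in> {1..K}" for i
    proof -
      obtain k where k: "i = Suc k" "k < K" using i by (cases i) auto
      define Ai where "Ai = A k"
      have Ai: "Ai \<subseteq> P" "T \<le> sum \<delta> Ai" using A(1)[OF k(2)] by (auto simp: Ai_def)
      have finA: "finite Ai" using Ai(1) P(1) finite_subset by blast
      have "real (card (solQ Q a1 a2 a3 (r + i))) \<le> real (\<Prod>p\<in>P. msol p a1 a2 a3 (int (r + i)))"
        unfolding of_nat_le_iff Q_def by (rule card_solQ_le[OF P(1,2)])
      also have "\<dots> = (\<Prod>p\<in>P. real (msol p a1 a2 a3 (int (r + i))))" by simp
      \<comment> \<open>A prime not dividing \<open>r + i\<close> costs at most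
        \<open>1 + 8 / p \<le> exp (8 / y)\<close>, and the primes of \<open>Ai\<close> gain
        \<open>exp (- \<delta> p)\<close>. Accidental divisibility by another prime does no harm, as
        \<open>1 - \<delta> p \<le> 1\<close>.\<close>
      also have "\<dots> \<le> (\<Prod>p\<in>P. real p ^ 2 * (exp (8 / y) * (if p \<in> Ai then exp (- \<delta> p) else 1)))"
      proof (intro prod_mono conjI)
        fix p assume p: "p \<in> P"
        have pp: "real p > 0" using prime_gt_0_nat[OF P(2)[OF p]] by simp
        have e1: "exp (8 / y) \<ge> 1" using y0' by simp
        show "real (msol p a1 a2 a3 (int (r + i))) \<le> real p ^ 2 * (exp (8 / y) * (if p \<in> Ai then exp (- \<delta> p) else 1))"
        proof (cases "int p dvd int (r + i)")
          case True
          have "real (msol p a1 a2 a3 (int (r + i))) \<le> real p ^ 2 * (1 - \<delta> p)" by (rule P(6)[OF p True])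
          also have "\<dots> \<le> real p ^ 2 * (if p \<in> Ai then exp (- \<delta> p) else 1)"
            using exp_ge_add_one_self[of "- \<delta> p"] P(5)[OF p] by (intro mult_left_mono) auto
          also have "\<dots> \<le> real p ^ 2 * (exp (8 / y) * (if p \<in> Ai then exp (- \<delta> p) else 1))"
            using e1 by (intro mult_left_mono) auto
          finally show ?thesis .
        next
          case False
          then have "p \<notin> Ai" using rdiv[OF k(2), of p] by (auto simp: Ai_def k(1) simp del: of_nat_add of_nat_Suc)
          have "real (msol p a1 a2 a3 (int (r + i))) \<le> real p ^ 2 + 8 * real p" by (rule P(7)[OF p False])
          also have "\<dots> = real p ^ 2 * (1 + 8 / real p)" using pp by (simp add: power2_eq_square field_simps)
          also have "\<dots> \<le> real p ^ 2 * exp (8 / y)"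
          proof (intro mult_left_mono)
            have "8 / real p \<le> 8 / y" using P(3)[OF p] y0' by (intro frac_le) auto
            then show "1 + 8 / real p \<le> exp (8 / y)" using exp_ge_add_one_self[of "8 / y"] by linarith
          qed simp
          finally show ?thesis using \<open>p \<notin> Ai\<close> by simp
        qed
      qed simp
      also have "\<dots> = real Q ^ 2 * (exp (8 / y) ^ card P * (\<Prod>p\<in>P. if p \<in> Ai then exp (- \<delta> p) else 1))"
        by (simp add: prod.distrib Q_def prod_power_distrib)
      also have "(\<Prod>p\<in>P. if p \<in> Ai then exp (- \<delta> p) else 1) = exp (- sum \<delta> Ai)"
      proof -
        have "(\<Prod>p\<in>P. if p \<in> Ai then exp (- \<delta> p) else 1) = (\<Prod>p\<in>Ai. exp (- \<delta> p))"
          using Ai(1) P(1) by (intro prod.mono_neutral_cong_right) auto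
        then show ?thesis using finA by (simp add: exp_sum[symmetric] sum_negf)
      qed
      also have "exp (8 / y) ^ card P = exp (real (card P) * (8 / y))" by (rule exp_of_nat_mult[symmetric])
      also have "real Q ^ 2 * (exp (real (card P) * (8 / y)) * exp (- sum \<delta> Ai)) \<le> real Q ^ 2 * (exp (8 * C) * exp (- T))"
      proof (intro mult_left_mono mult_mono)
        have "real (card P) * (8 / y) \<le> C * y * (8 / y)" using cardP y0' by (intro mult_right_mono) auto
        then show "exp (real (card P) * (8 / y)) \<le> exp (8 * C)" using y0' by simp
      qed (use Ai in auto)
      also have "exp (- T) = 1 / (M * real K)" unfolding T_def using MK by (simp add: exp_minus field_simps)
      finally show ?thesis by simp
    qed
    have Qb: "real Q ^ 3 \<le> exp (L / 2)"
    proof -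
      have Cy: "C * y \<ge> 1" using C yb mult_mono[of 1 C 1 y] by simp
      have "real Q \<le> exp (3 * (C * y))" unfolding Q_def
        by (rule prod_primes_le[OF P(1) _ Cy]) (use P(2,4) in auto)
      then have "real Q ^ 3 \<le> exp (3 * (C * y)) ^ 3" by (intro power_mono) auto
      also have "\<dots> = exp (9 * (C * y))" by (simp add: exp_of_nat_mult[symmetric])
      also have "9 * (C * y) = L / 2" using C by (simp add: y_def D_def)
      finally show ?thesis .
    qed
    have L20: "L \<ge> 20"
    proof -
      have "1 * 20 \<le> D * (y0 + 20)" using D C by (intro mult_mono) auto
      then show ?thesis using Lb by linarith
    qed
    have e2: "exp (L / 2) * exp (L / 2) = real N" using expL by (simp add: exp_add[symmetric])
    have eL: "exp (L / 2) \<ge> 1 + L / 2" by (rule exp_ge_add_one_self)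
    have eN: "exp (L / 2) * 11 \<le> real N" unfolding e2[symmetric] by (rule mult_left_mono) (use eL L20 in linarith, simp)
    have Q1: "real Q \<ge> 1" using Q0 by simp
    have "real Q \<le> real Q ^ 3" using Q1 by (intro self_le_power) auto
    then have QN: "real Q \<le> exp (L / 2)" using Qb by linarith
    show ?thesis
    proof (rule gap_in_residue_class[OF assms Q0 _ _ rQ])
      have "real Q ^ 3 \<le> real N" using Qb eN exp_ge_zero[of "L / 2"] by linarith
      then have "real (Q ^ 3) \<le> real N" by simp
      then show "Q ^ 3 \<le> N" by (simp only: of_nat_le_iff)
      have "real (4 * Q) < real N" using QN eN exp_gt_zero[of "L / 2"] unfolding of_nat_mult of_nat_numeral by linarith
      then show "4 * Q < N" by (simp only: of_nat_less_iff)
      have "sqrt L \<le> L" using L20 by (intro real_le_lsqrt) (auto simp: power2_eq_square)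
      then have "real K < 2 * exp (L / 2)" using KsL eL by linarith
      then have "real (2 * K) < real N" using eN exp_gt_zero[of "L / 2"] unfolding of_nat_mult of_nat_numeral by linarith
      then show "2 * K < N" by (simp only: of_nat_less_iff)
      show "K > 0" using K2 by simp
      show "real (card (solQ Q a1 a2 a3 (r + i))) \<le> real Q ^ 2 * exp (8 * C) / (M * real K)" if "i \<in> {1..K}" for i
        by (rule R[OF that])
      show "real K * (real Q ^ 2 * exp (8 * C) / (M * real K)) * 32 \<le> real Q ^ 2"
        using K2 by (simp add: M_def)
    qed
  qed
  then show ?thesis using \<kappa>(1) by blast
qed

end
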